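(* Let $\{\tilde Z^{(r)}\}_{r\in(0,1)}$ be the family of $J$-dimensional SRBMs with initial states $\tilde Z^{(r)}(0)$, drift vectors $\theta^{(r)}$, covariance matrix $\Gamma$ and reflection matrix $R$ described in the context. Suppose: (i) for all $r\in(0,1)$, $\theta^{(r)}=-R\delta^{(r)}$ with $\delta^{(r)}=[\gamma_1(r),\dots,\gamma_J(r)]'$; (ii) there is an $\mathbb R_+^J$-valued random vector $\tilde\xi$ with mutually independent components such that $\big(\gamma_1(r)\tilde Z_1^{(r)}(0),\dots,\gamma_J(r)\tilde Z_J^{(r)}(0)\big)\Longrightarrow\tilde\xi$ as $r\to0$, and for all $j=2,\dots,J$, $\gamma_{j-1}(r)\tilde Z_j^{(r)}(0)\to\infty$ in probability as $r\to0$. Then, as $r\to0$, $$\Big\{\big(\gamma_1(r)\tilde Z_1^{(r)}(t/\gamma_1^2(r)),\dots,\gamma_J(r)\tilde Z_J^{(r)}(t/\gamma_J^2(r))\big);\ t\ge0\Big\}\Longrightarrow\tilde Z^*,$$ where $\tilde Z^*$ is a $J$-dimensional diffusion process. Furthermore, all coordinate processes of $\tilde Z^*$ are mutually independent, and each coordinate process $\tilde Z_j^*$ is a one-dimensional SRBM with initial state $\tilde\xi_j$, drift $\tilde\theta_j=-(1-w_{jj})<0$ and variance $$\tilde\sigma_j^2=(u^{(j)})'\,\Gamma\,u^{(j)},\qquad u^{(j)}=(w_{1j},\dots,w_{j-1,j},1,0,\dots,0)',$$ where, for $i\le j$ in $\mathcal J$, $w_{ij}$ is defined by $$(w_{1j},\dots,w_{j-1,j})=-R_{j,[1:j-1]}R_{j-1}^{-1},\qquad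 w_{jj}=1-R_{jj}+R_{j,[1:j-1]}R_{j-1}^{-1}R_{[1:j-1],j}.$$ When $R=I-P'$ for a substochastic matrix $P$ with $I-P$ invertible, these $w_{ij}$, $1\le i\le j\le J$, coincide with those given by $$(w_{1j},\dots,w_{j-1,j})'=(I-P_{j-1})^{-1}P_{[1:j-1],j},\qquad w_{jj}=P_{jj}+P_{j,[1:j-1]}(I-P_{j-1})^{-1}P_{[1:j-1],j}.$$
   Context: $J\ge1$, $\mathcal J=\{1,\dots,J\}$. For a matrix $M$ and index sets $A,B$, $M_{A,B}$ is the submatrix with rows in $A$ and columns in $B$; $[\ell:k]=\{\ell,\dots,k\}$; $M_{A,k}=M_{A,\{k\}}$, $M_{k,B}=M_{\{k\},B}$, $M_k=M_{[1:k],[1:k]}$; terms with empty index sets are absent. Prime denotes transpose. Scale functions. $\gamma_1,\dots,\gamma_J:(0,1)\to(0,\infty)$ are strictly increasing, $\lim_{r\to0}\gamma_j(r)=0$, $\lim_{r\to0}\gamma_j(r)/\gamma_i(r)=0$ for $i<j$, and, for a fixed $\varepsilon\in(0,1)$, $\lim_{r\to0}\gamma_1(r)^{(2-\varepsilon)/(2+\varepsilon)}\sqrt{\log\log(1/\gamma_1(r))}\,\log\log(1/\gamma_J(r))=0$. Skorokhod map. A matrix $R$ is an $\mathcal M$-matrix if $R=sI-B$ with $s>0$, $B\ge0$ entrywise and spectral radius of $B$ less than $s$. For an $\mathcal M$-matrix $R\in\mathbb R^{d\times d}$ and a càdlàg path $x$ in $\mathbb R^d$ with $x(0)\in\mathbb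 R_+^d$, there is a unique pair $(z,y)=(\Phi(x;R),\Psi(x;R))$ of càdlàg $\mathbb R_+^d$-valued paths with $z=x+Ry$, each $y_j$ nondecreasing with $y_j(0)=0$, and $\int_0^\infty z_j\,dy_j=0$. When $d=1$, $z$ does not depend on the positive scalar $R$. SRBM family. $\Gamma$ is a positive definite $J\times J$ matrix with Cholesky decomposition $\Gamma=LL'$, $R$ is a $J\times J$ $\mathcal M$-matrix, $W$ is a $J$-dimensional standard Brownian motion; $\Gamma,R,W$ do not depend on $r$. For each $r\in(0,1)$, $\tilde Z^{(r)}(0)$ is an $\mathbb R_+^J$-valued random vector independent of $W$, $\tilde X^{(r)}(t)=\tilde Z^{(r)}(0)+\theta^{(r)}t+LW(t)$, $\tilde Y^{(r)}=\Psi(\tilde X^{(r)};R)$ and $\tilde Z^{(r)}=\Phi(\tilde X^{(r)};R)=\tilde X^{(r)}+R\tilde Y^{(r)}$. A one-dimensional SRBM with initial state $x$, drift $\theta$, variance $\sigma^2$ is $\Phi(X)$ with $X(t)=x+\theta t+\sigma W_0(t)$, $W_0$ a standard one-dimensional Brownian motion independent of $x$. $\Longrightarrow$ denotes weak convergence, for processes in the path space with the topology of uniform convergence on compact time intervals. *)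

theory Defs
  imports
    "HOL-Probability.Probability"
    "Jordan_Normal_Form.Spectral_Radius"
    "Jordan_Normal_Form.Gauss_Jordan_Elimination"
    "Jordan_Normal_Form.DL_Submatrix"
begin

unbundle no vec_syntax
hide_type (open) Finite_Cartesian_Product.vec
hide_const (open) Finite_Cartesian_Product.vec

text \<open>
  Vectors and matrices are those of \<open>Jordan_Normal_Form\<close>, so that the dimension is an ordinary
  natural number. Their indices start at 0: the coordinate set $\{1,\dots,J\}$ is \<open>{..<J}\<close>, and
  for the coordinate with 0-based index \<open>j\<close> (which is number $j+1$ when counting from 1) the
  preceding coordinates are exactly those in \<open>{..<j}\<close>.

  A path is a function on $[0,\infty)$, represented as an element of an extensional function space
  (fixed value \<open>undefined\<close> at negative times), so that equality of paths is equality of functions.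
\<close>

section \<open>Matrices\<close>

definition mat_inv :: "real mat \<Rightarrow> real mat" where
  "mat_inv A = the (mat_inverse A)"

definition M_matrix :: "nat \<Rightarrow> real mat \<Rightarrow> bool" where
  "M_matrix d R \<longleftrightarrow> R \<in> carrier_mat d d \<and>
     (\<exists>s B. s > 0 \<and> B \<in> carrier_mat d d \<and> (\<forall>i<d. \<forall>j<d. 0 \<le> B $$ (i, j)) \<and>
            spectral_radius (map_mat complex_of_real B) < s \<and>
            R = s \<cdot>\<^sub>m 1\<^sub>m d - B)"

definition positive_definite :: "nat \<Rightarrow> real mat \<Rightarrow> bool" where
  "positive_definite d A \<longleftrightarrow> A \<in> carrier_mat d d \<and> transpose_mat A = A \<and>
     (\<forall>v\<in>carrier_vec d. v \<noteq> 0\<^sub>v d \<longrightarrow> 0 < scalar_prod v (A *\<^sub>v v))"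

definition cholesky :: "nat \<Rightarrow> real mat \<Rightarrow> real mat \<Rightarrow> bool" where
  "cholesky d A L \<longleftrightarrow> L \<in> carrier_mat d d \<and> upper_triangular (transpose_mat L) \<and>
     (\<forall>i<d. 0 < L $$ (i, i)) \<and> A = L * transpose_mat L"

definition substochastic :: "nat \<Rightarrow> real mat \<Rightarrow> bool" where
  "substochastic d P \<longleftrightarrow> P \<in> carrier_mat d d \<and> (\<forall>i<d. \<forall>j<d. 0 \<le> P $$ (i, j)) \<and>
     (\<forall>i<d. (\<Sum>j<d. P $$ (i, j)) \<le> 1)"

text \<open>
  The coefficients $w_{ij}$, meaningful for $i \le j$. For \<open>j = 0\<close> the matrix products below
  have inner dimension 0 and contribute 0, so the terms with empty index sets are absent.
\<close>

definition w_coeff :: "real mat \<Rightarrow> nat \<Rightarrow> nat \<Rightarrow> real" where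
  "w_coeff R i j =
     (if i < j then (- (submatrix R {j} {..<j} * mat_inv (submatrix R {..<j} {..<j}))) $$ (0, i)
      else 1 - R $$ (j, j)
         + (submatrix R {j} {..<j} * mat_inv (submatrix R {..<j} {..<j})
              * submatrix R {..<j} {j}) $$ (0, 0))"

definition w_coeff_routing :: "real mat \<Rightarrow> nat \<Rightarrow> nat \<Rightarrow> real" where
  "w_coeff_routing P i j =
     (if i < j then (mat_inv (1\<^sub>m j - submatrix P {..<j} {..<j}) * submatrix P {..<j} {j}) $$ (i, 0)
      else P $$ (j, j)
         + (submatrix P {j} {..<j} * mat_inv (1\<^sub>m j - submatrix P {..<j} {..<j})
              * submatrix P {..<j} {j}) $$ (0, 0))"

definition u_vec :: "nat \<Rightarrow> real mat \<Rightarrow> nat \<Rightarrow> real vec" where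
  "u_vec J R j = Matrix.vec J (\<lambda>i. if i < j then w_coeff R i j else if i = j then 1 else 0)"


section \<open>State space and path space\<close>

definition borel_of :: "'a topology \<Rightarrow> 'a measure" where
  "borel_of T = sigma (topspace T) {U. openin T U}"

definition vec_topology :: "nat \<Rightarrow> real vec topology" where
  "vec_topology d = pullback_topology (carrier_vec d) (\<lambda>v. \<lambda>i\<in>{..<d}. v $ i)
                      (product_topology (\<lambda>_. euclideanreal) {..<d})"

definition cont_paths :: "nat \<Rightarrow> (real \<Rightarrow> real vec) set" where
  "cont_paths d = {x \<in> {0..} \<rightarrow>\<^sub>E carrier_vec d. \<forall>i<d. continuous_on {0..} (\<lambda>t. x t $ i)}"

text \<open>The topology of uniform convergence on compact time intervals.\<close>

definition path_topology :: "nat \<Rightarrow> (real \<Rightarrow> real vec) topology" where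
  "path_topology d = topology (\<lambda>U. U \<subseteq> cont_paths d \<and>
     (\<forall>x\<in>U. \<exists>T>0. \<exists>e>0. \<forall>y\<in>cont_paths d.
        (\<forall>t\<in>{0..T}. \<forall>i<d. \<bar>y t $ i - x t $ i\<bar> < e) \<longrightarrow> y \<in> U))"

lemma openin_path_topology:
  "openin (path_topology d) U \<longleftrightarrow> U \<subseteq> cont_paths d \<and>
     (\<forall>x\<in>U. \<exists>T>0. \<exists>e>0. \<forall>y\<in>cont_paths d.
        (\<forall>t\<in>{0..T}. \<forall>i<d. \<bar>y t $ i - x t $ i\<bar> < e) \<longrightarrow> y \<in> U)"
proof -
  let ?N = "\<lambda>x T e y. \<forall>t\<in>{0..T}. \<forall>i<d. \<bar>y t $ i - x t $ i\<bar> < (e::real)"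
  have "istopology (\<lambda>U. U \<subseteq> cont_paths d \<and>
          (\<forall>x\<in>U. \<exists>T>0. \<exists>e>0. \<forall>y\<in>cont_paths d. ?N x T e y \<longrightarrow> y \<in> U))"
    (is "istopology ?op")
  proof (unfold istopology_def, intro conjI allI impI)
    fix U V assume U: "?op U" and V: "?op V"
    show "U \<inter> V \<subseteq> cont_paths d" using U by blast
    show "\<forall>x\<in>U \<inter> V. \<exists>T>0. \<exists>e>0. \<forall>y\<in>cont_paths d. ?N x T e y \<longrightarrow> y \<in> U \<inter> V"
    proof
      fix x assume x: "x \<in> U \<inter> V"
      obtain S a where a: "S > 0" "a > 0" "\<And>y. y \<in> cont_paths d \<Longrightarrow> ?N x S a y \<Longrightarrow> y \<in> U"
        using U x by blast
      obtain T b where b: "T > 0" "b > 0" "\<And>y. y \<in> cont_paths d \<Longrightarrow> ?N x T b y \<Longrightarrow> y \<in> V"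
        using V x by blast
      have "y \<in> U \<inter> V" if y: "y \<in> cont_paths d" "?N x (max S T) (min a b) y" for y
      proof
        have "?N x S a y" "?N x T b y" using y(2) by auto
        with a(3)[OF y(1)] b(3)[OF y(1)] show "y \<in> U" "y \<in> V" by simp_all
      qed
      then show "\<exists>T>0. \<exists>e>0. \<forall>y\<in>cont_paths d. ?N x T e y \<longrightarrow> y \<in> U \<inter> V"
        using a(1,2) b(1,2) by (intro exI[of _ "max S T"] conjI exI[of _ "min a b"] ballI impI) simp_all
    qed
  next
    fix K assume K: "\<forall>U\<in>K. ?op U"
    show "\<Union>K \<subseteq> cont_paths d" using K by blast
    show "\<forall>x\<in>\<Union>K. \<exists>T>0. \<exists>e>0. \<forall>y\<in>cont_paths d. ?N x T e y \<longrightarrow> y \<in> \<Union>K"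
    proof
      fix x assume "x \<in> \<Union>K"
      then obtain U where U: "U \<in> K" "x \<in> U" by blast
      with K have "\<exists>T>0. \<exists>e>0. \<forall>y\<in>cont_paths d. ?N x T e y \<longrightarrow> y \<in> U" by simp
      moreover have "U \<subseteq> \<Union>K" using U(1) by (rule Union_upper)
      ultimately show "\<exists>T>0. \<exists>e>0. \<forall>y\<in>cont_paths d. ?N x T e y \<longrightarrow> y \<in> \<Union>K" by (meson subsetD)
    qed
  qed
  then show ?thesis unfolding path_topology_def by (simp add: topology_inverse')
qed

lemma topspace_path_topology: "topspace (path_topology d) = cont_paths d"
proof
  show "topspace (path_topology d) \<subseteq> cont_paths d"
    using openin_topspace[of "path_topology d"] unfolding openin_path_topology by blast
  have "openin (path_topology d) (cont_paths d)"
    unfolding openin_path_topology by (auto intro!: exI[of _ 1])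
  then show "cont_paths d \<subseteq> topspace (path_topology d)" by (rule openin_subset)
qed

lemma topspace_vec_topology: "topspace (vec_topology d) = carrier_vec d"
  by (auto simp: vec_topology_def topspace_pullback_topology)

abbreviation vec_borel :: "nat \<Rightarrow> real vec measure" where
  "vec_borel d \<equiv> borel_of (vec_topology d)"

abbreviation path_borel :: "nat \<Rightarrow> (real \<Rightarrow> real vec) measure" where
  "path_borel d \<equiv> borel_of (path_topology d)"

text \<open>One coordinate of a path, as a path of dimension 1.\<close>

definition coord_path :: "nat \<Rightarrow> (real \<Rightarrow> real vec) \<Rightarrow> real \<Rightarrow> real vec" where
  "coord_path j z = (\<lambda>t\<in>{0..}. Matrix.vec 1 (\<lambda>_. z t $ j))"


section \<open>Random elements and weak convergence\<close>

definition indep_elements ::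
  "'w measure \<Rightarrow> 'a measure \<Rightarrow> ('w \<Rightarrow> 'a) \<Rightarrow> 'b measure \<Rightarrow> ('w \<Rightarrow> 'b) \<Rightarrow> bool" where
  "indep_elements M S X T Y \<longleftrightarrow> X \<in> M \<rightarrow>\<^sub>M S \<and> Y \<in> M \<rightarrow>\<^sub>M T \<and>
     prob_space.indep_set M (sets (vimage_algebra (space M) X S)) (sets (vimage_algebra (space M) Y T))"

text \<open>
  Weak convergence, along the filter \<open>F\<close>, of the random elements \<open>X i\<close> on \<open>M\<close> to the random element
  \<open>Y\<close> on a possibly different probability space \<open>N\<close>.
\<close>

definition converges_weakly ::
  "'a topology \<Rightarrow> 'w measure \<Rightarrow> ('i \<Rightarrow> 'w \<Rightarrow> 'a) \<Rightarrow> 'v measure \<Rightarrow> ('v \<Rightarrow> 'a) \<Rightarrow> 'i filter \<Rightarrow> bool" where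
  "converges_weakly T M X N Y F \<longleftrightarrow>
     (\<forall>\<^sub>F i in F. X i \<in> M \<rightarrow>\<^sub>M borel_of T) \<and> Y \<in> N \<rightarrow>\<^sub>M borel_of T \<and>
     (\<forall>f. continuous_map T euclideanreal f \<and> (\<exists>B. \<forall>x\<in>topspace T. \<bar>f x\<bar> \<le> B) \<longrightarrow>
        ((\<lambda>i. \<integral>\<omega>. f (X i \<omega>) \<partial>M) \<longlongrightarrow> (\<integral>\<omega>. f (Y \<omega>) \<partial>N)) F)"


section \<open>The Skorokhod map\<close>

definition cadlag_paths :: "nat \<Rightarrow> (real \<Rightarrow> real vec) set" where
  "cadlag_paths d = {x \<in> {0..} \<rightarrow>\<^sub>E carrier_vec d. \<forall>i<d.
      (\<forall>t\<ge>0. continuous (at_right t) (\<lambda>s. x s $ i)) \<and>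
      (\<forall>t>0. \<exists>l. ((\<lambda>s. x s $ i) \<longlongrightarrow> l) (at_left t))}"

text \<open>
  \<open>y_i\<close> is extended to negative times by \<open>y_i(0) = 0\<close>; \<open>interval_measure\<close> is then the
  Lebesgue--Stieltjes measure \<open>dy_i\<close>, without atom at 0.
\<close>

definition skorokhod_solution ::
  "nat \<Rightarrow> real mat \<Rightarrow> (real \<Rightarrow> real vec) \<Rightarrow> (real \<Rightarrow> real vec) \<Rightarrow> (real \<Rightarrow> real vec) \<Rightarrow> bool" where
  "skorokhod_solution d R x z y \<longleftrightarrow>
     z \<in> cadlag_paths d \<and> y \<in> cadlag_paths d \<and>
     (\<forall>t\<ge>0. z t = x t + R *\<^sub>v y t) \<and>
     (\<forall>i<d. (\<forall>t\<ge>0. 0 \<le> z t $ i \<and> 0 \<le> y t $ i) \<and>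
            mono_on {0..} (\<lambda>t. y t $ i) \<and> y 0 $ i = 0 \<and>
            (\<integral>\<^sup>+t\<in>{0..}. ennreal (z t $ i) \<partial>interval_measure (\<lambda>t. y (max 0 t) $ i)) = 0)"

text \<open>\<open>\<Phi>(x; R)\<close> and \<open>\<Psi>(x; R)\<close>.\<close>

definition skorokhod_map ::
  "nat \<Rightarrow> real mat \<Rightarrow> (real \<Rightarrow> real vec) \<Rightarrow> (real \<Rightarrow> real vec) \<times> (real \<Rightarrow> real vec)" where
  "skorokhod_map d R x = (THE (z, y). skorokhod_solution d R x z y)"

definition reflected :: "nat \<Rightarrow> real mat \<Rightarrow> (real \<Rightarrow> real vec) \<Rightarrow> real \<Rightarrow> real vec" where
  "reflected d R x = fst (skorokhod_map d R x)"

definition regulator :: "nat \<Rightarrow> real mat \<Rightarrow> (real \<Rightarrow> real vec) \<Rightarrow> real \<Rightarrow> real vec" where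
  "regulator d R x = snd (skorokhod_map d R x)"


section \<open>Brownian motion, SRBM, diffusions\<close>

definition standard_BM :: "'w measure \<Rightarrow> nat \<Rightarrow> ('w \<Rightarrow> real \<Rightarrow> real vec) \<Rightarrow> bool" where
  "standard_BM M d W \<longleftrightarrow>
     W \<in> M \<rightarrow>\<^sub>M path_borel d \<and>
     (\<forall>\<omega>\<in>space M. W \<omega> 0 = 0\<^sub>v d) \<and>
     (\<forall>i<d. \<forall>s t. 0 \<le> s \<and> s < t \<longrightarrow>
        distributed M lborel (\<lambda>\<omega>. W \<omega> t $ i - W \<omega> s $ i) (normal_density 0 (sqrt (t - s)))) \<and>
     (\<forall>n. \<forall>\<tau>::nat \<Rightarrow> real. 0 \<le> \<tau> 0 \<and> (\<forall>k<n. \<tau> k < \<tau> (Suc k)) \<longrightarrow>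
        prob_space.indep_vars M (\<lambda>_. borel)
          (\<lambda>(i, k) \<omega>. W \<omega> (\<tau> (Suc k)) $ i - W \<omega> (\<tau> k) $ i) ({..<d} \<times> {..<n}))"

text \<open>
  In dimension 1 the reflected path does not depend on the positive reflection scalar, which is
  therefore taken to be 1.
\<close>

definition SRBM_1d ::
  "'w measure \<Rightarrow> ('w \<Rightarrow> real) \<Rightarrow> real \<Rightarrow> real \<Rightarrow> ('w \<Rightarrow> real \<Rightarrow> real vec) \<Rightarrow> bool" where
  "SRBM_1d M x \<theta> var Z \<longleftrightarrow> 0 < var \<and> (\<forall>\<omega>\<in>space M. 0 \<le> x \<omega>) \<and>
     (\<exists>W. standard_BM M 1 W \<and> indep_elements M borel x (path_borel 1) W \<and>
        (\<forall>\<omega>\<in>space M. Z \<omega> =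
           reflected 1 (1\<^sub>m 1) (\<lambda>t\<in>{0..}. Matrix.vec 1 (\<lambda>_. x \<omega> + \<theta> * t + sqrt var * (W \<omega> t $ 0)))))"

definition natural_filtration ::
  "'w measure \<Rightarrow> nat \<Rightarrow> ('w \<Rightarrow> real \<Rightarrow> real vec) \<Rightarrow> real \<Rightarrow> 'w measure" where
  "natural_filtration M d Z t =
     sigma (space M) {(\<lambda>\<omega>. Z \<omega> s) -` A \<inter> space M | s A. 0 \<le> s \<and> s \<le> t \<and> A \<in> sets (vec_borel d)}"

text \<open>
  A diffusion is a continuous (time-homogeneous) strong Markov process: for a kernel \<open>K\<close> from states
  to laws of paths and every finite stopping time \<open>T\<close>, \<open>K (Z(T))\<close> is a conditional law of
  \<open>Z(T + \<cdot>)\<close> given the past up to time \<open>T\<close>.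
\<close>

definition diffusion :: "'w measure \<Rightarrow> nat \<Rightarrow> ('w \<Rightarrow> real \<Rightarrow> real vec) \<Rightarrow> bool" where
  "diffusion M d Z \<longleftrightarrow> Z \<in> M \<rightarrow>\<^sub>M path_borel d \<and>
     (\<exists>K \<in> vec_borel d \<rightarrow>\<^sub>M prob_algebra (path_borel d).
        \<forall>T. stopping_time (natural_filtration M d Z) T \<and> (\<forall>\<omega>\<in>space M. 0 \<le> T \<omega>) \<longrightarrow>
          (\<forall>A \<in> sets (filtration.pre_sigma (space M) (natural_filtration M d Z) T).
           \<forall>B \<in> sets (path_borel d).
             measure M {\<omega>\<in>A. (\<lambda>t\<in>{0..}. Z \<omega> (T \<omega> + t)) \<in> B} =
             (LINT \<omega>:A|M. measure (K (Z \<omega> (T \<omega>))) B)))"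

end

theory Submission
  imports Defs
begin

text \<open>
  The rows of the block elimination of \<open>R\<close> combine the coordinates of the process so that the regulators of
  the first \<open>j\<close> coordinates cancel. On the time scale \<open>1 / \<gamma>\<^sub>j\<^sup>2\<close> and after multiplication by \<open>\<gamma>\<^sub>j\<close>, the
  coordinates before \<open>j\<close> vanish, because their drift \<open>\<gamma>\<^sub>i / \<gamma>\<^sub>j\<close> tends to infinity and beats the Brownian modulus
  of continuity, and the coordinates after \<open>j\<close> start too high to be reflected at all. Hence coordinate \<open>j\<close> is
  asymptotically a one-dimensional reflected path driven by \<open>(u\<^sup>j)' L W\<close>. Up to a small error near time 0, the
  driving motions on the separated time scales only use the increments of \<open>W\<close> over disjoint time blocks,
  so they become independent. Minimality of the regulator makes the reflection maps Lipschitz for uniform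
  convergence, which carries these approximations over to the weak limit.
\<close>

subsection \<open>Path space\<close>

text \<open>The Stieltjes integral in the definition of the Skorokhod problem is awkward when two
  solutions have to be compared, so the problem is recast in terms of order: a regulator is the
  least level that keeps its coordinate nonnegative. The only information kept about the reflection
  matrix is the sign of its off-diagonal entries and a positive vector \<open>v\<close> with
  \<open>R v > 0\<close>; this vector also serves every principal block and every Schur complement,
  and all constants come from it. No compactness argument on path space occurs. By Brownian scaling
  the law of \<open>lincomb_path d a c (W w)\<close> is the same for every \<open>c\<close>, so each
  uniform estimate is made once for a single Brownian motion and then holds for all
  \<open>r\<close>. The limit law is reached by replacing the rescaled noises by the coordinates of
  \<open>W\<close> itself: after truncation the two have exactly the same law, not merely close
  ones. Independence of \<open>Z0 r\<close> from \<open>W\<close> then allows the noise to be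
  integrated out, so that the assumed convergence of the initial states is applied to one bounded
  continuous function of the state.\<close>

lemma space_borel_of [simp]: "space (borel_of T) = topspace T"
  unfolding borel_of_def by (rule space_measure_of) (auto dest: openin_subset)

lemma sets_borel_of: "sets (borel_of T) = sigma_sets (topspace T) {U. openin T U}"
  unfolding borel_of_def by (rule sets_measure_of) (auto dest: openin_subset)

lemma borel_of_openin: "openin T U ==> U \<in> sets (borel_of T)"
  by (simp add: sets_borel_of sigma_sets.Basic)

lemma borel_of_closedin: "closedin T U ==> U \<in> sets (borel_of T)"
  using sets.compl_sets[OF borel_of_openin[of T "topspace T - U"]]
  by (simp add: closedin_def double_diff)

lemma measurable_borel_of_continuous_map:
  assumes "continuous_map T S f"
  shows "f \<in> borel_of T \<rightarrow>\<^sub>M borel_of S"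
  unfolding borel_of_def[of S]
proof (rule measurable_measure_of)
  show "{U. openin S U} \<subseteq> Pow (topspace S)" by (auto dest: openin_subset)
  show "f \<in> space (borel_of T) \<rightarrow> topspace S" using assms by (auto simp: continuous_map_def)
  fix U assume "U \<in> {U. openin S U}"
  then show "f -` U \<inter> space (borel_of T) \<in> sets (borel_of T)"
    using openin_continuous_map_preimage[OF assms, of U] borel_of_openin[of T]
    by (auto simp: vimage_def Int_def conj_commute)
qed

lemma borel_measurable_borel_of:
  assumes "continuous_map T euclideanreal f"
  shows "f \<in> borel_measurable (borel_of T)"
proof (rule borel_measurableI)
  fix S :: "real set" assume "open S"
  then show "f -` S \<inter> space (borel_of T) \<in> sets (borel_of T)"
    using openin_continuous_map_preimage[OF assms, of S] borel_of_openin[of T]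
    by (auto simp: vimage_def Int_def conj_commute)
qed

lemma cont_paths_carrier: "x \<in> cont_paths d ==> 0 <= t ==> x t \<in> carrier_vec d"
  by (auto simp: cont_paths_def PiE_def Pi_def)

lemma cont_paths_continuous: "x \<in> cont_paths d ==> i < d ==> continuous_on {0..} (\<lambda>t. x t $ i)"
  by (auto simp: cont_paths_def)

lemma cont_paths_undefined: "x \<in> cont_paths d ==> t < 0 ==> x t = undefined"
  by (auto simp: cont_paths_def PiE_def extensional_def)

lemma cont_paths_vecI:
  assumes "\<And>i. i < d ==> continuous_on {0..} (f i)"
  shows "(\<lambda>t\<in>{0..}. Matrix.vec d (\<lambda>i. f i t)) \<in> cont_paths d"
  unfolding cont_paths_def
proof (intro CollectI conjI allI impI)
  show "(\<lambda>t\<in>{0..}. Matrix.vec d (\<lambda>i. f i t)) \<in> {0..} \<rightarrow>\<^sub>E carrier_vec d" by auto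
  fix i assume "i < d"
  then show "continuous_on {0..} (\<lambda>t. (\<lambda>t\<in>{0..}. Matrix.vec d (\<lambda>i. f i t)) t $ i)"
    by (subst continuous_on_cong[OF refl, where g = "f i"]) (use assms in auto)
qed

lemma cont_paths_eqI:
  assumes "x \<in> cont_paths d" "y \<in> cont_paths d" "\<And>t i. 0 <= t ==> i < d ==> x t $ i = y t $ i"
  shows "x = y"
proof
  fix t show "x t = y t"
  proof (cases "0 <= t")
    case True
    then show ?thesis
      using cont_paths_carrier[OF assms(1) True] cont_paths_carrier[OF assms(2) True] assms(3)
      by (intro eq_vecI) auto
  next
    case False
    then show ?thesis
      using cont_paths_undefined[OF assms(1), of t] cont_paths_undefined[OF assms(2), of t] by simp
  qed
qed

text \<open>The inserted 0 covers the empty index set (\<open>T < 0\<close> or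
  \<open>d = 0\<close>), for which \<open>Sup\<close> would be unspecified. As \<open>T\<close>
  varies, these pseudometrics describe \<open>path_topology d\<close>; every quantitative estimate
  is stated for one of them.\<close>

definition path_dist :: "nat => real => (real => real vec) => (real => real vec) => real" where
  "path_dist d T x y = Sup (insert 0 {\<bar>x t $ i - y t $ i\<bar> | t i. t \<in> {0..T} \<and> i < d})"

lemma bdd_above_path_dist:
  assumes "x \<in> cont_paths d" "y \<in> cont_paths d"
  shows "bdd_above (insert 0 {\<bar>x t $ i - y t $ i\<bar> | t i. t \<in> {0..T} \<and> i < d})"
proof -
  have "bdd_above ((\<lambda>t. \<bar>x t $ i - y t $ i\<bar>) ` {0..T})" if "i < d" for i
  proof (intro bounded_imp_bdd_above compact_imp_bounded compact_continuous_image)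
    show "continuous_on {0..T} (\<lambda>t. \<bar>x t $ i - y t $ i\<bar>)"
      using assms that
      by (intro continuous_intros; elim continuous_on_subset[OF cont_paths_continuous]) auto
  qed simp
  then have "bdd_above (\<Union>i<d. (\<lambda>t. \<bar>x t $ i - y t $ i\<bar>) ` {0..T})" by simp
  moreover have "{\<bar>x t $ i - y t $ i\<bar> | t i. t \<in> {0..T} \<and> i < d}
      \<subseteq> (\<Union>i<d. (\<lambda>t. \<bar>x t $ i - y t $ i\<bar>) ` {0..T})" by blast
  ultimately have "bdd_above {\<bar>x t $ i - y t $ i\<bar> | t i. t \<in> {0..T} \<and> i < d}" by (rule bdd_above_mono)
  then show ?thesis by simp
qed

lemma path_dist_le_iff:
  assumes "x \<in> cont_paths d" "y \<in> cont_paths d" "0 <= e"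
  shows "path_dist d T x y <= e \<longleftrightarrow> (\<forall>t\<in>{0..T}. \<forall>i<d. \<bar>x t $ i - y t $ i\<bar> <= e)"
  unfolding path_dist_def
  by (subst cSup_le_iff[OF _ bdd_above_path_dist[OF assms(1,2)]]) (use assms(3) in "auto, blast")

lemma path_dist_nonneg:
  assumes "x \<in> cont_paths d" "y \<in> cont_paths d"
  shows "0 <= path_dist d T x y"
  unfolding path_dist_def by (rule cSup_upper[OF _ bdd_above_path_dist[OF assms]]) simp

lemma path_dist_upper:
  assumes "x \<in> cont_paths d" "y \<in> cont_paths d" "0 <= t" "t <= T" "i < d"
  shows "\<bar>x t $ i - y t $ i\<bar> <= path_dist d T x y"
  unfolding path_dist_def
  by (rule cSup_upper[OF _ bdd_above_path_dist[OF assms(1,2)]]) (use assms in auto)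

lemma path_dist_commute: "path_dist d T x y = path_dist d T y x"
  unfolding path_dist_def by (simp add: abs_minus_commute)

lemma path_dist_self: "x \<in> cont_paths d ==> path_dist d T x x = 0"
  using path_dist_le_iff[of x d x 0 T] path_dist_nonneg[of x d x T] by auto

lemma path_dist_leI:
  assumes "x \<in> cont_paths d" "y \<in> cont_paths d" "0 <= e"
    and "\<And>t i. 0 <= t ==> t <= T ==> i < d ==> \<bar>x t $ i - y t $ i\<bar> <= e"
  shows "path_dist d T x y <= e"
  using assms(4) by (subst path_dist_le_iff[OF assms(1-3)]) simp

lemma path_dist_triangle:
  assumes "x \<in> cont_paths d" "y \<in> cont_paths d" "z \<in> cont_paths d"
  shows "path_dist d T x z <= path_dist d T x y + path_dist d T y z"
proof (rule path_dist_leI[OF assms(1,3)])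
  show "0 <= path_dist d T x y + path_dist d T y z"
    by (intro add_nonneg_nonneg path_dist_nonneg assms)
  fix t i assume "0 <= t" "t <= T" "i < d"
  from path_dist_upper[OF assms(1,2) this] path_dist_upper[OF assms(2,3) this]
  show "\<bar>x t $ i - z t $ i\<bar> <= path_dist d T x y + path_dist d T y z" by linarith
qed

lemma path_dist_mono:
  assumes "x \<in> cont_paths d" "y \<in> cont_paths d" "S <= T"
  shows "path_dist d S x y <= path_dist d T x y"
  by (rule path_dist_leI[OF assms(1,2) path_dist_nonneg[OF assms(1,2)]]) (rule path_dist_upper, use assms in auto)

text \<open>One pseudometric suffices, since its balls are neighbourhoods in
  \<open>path_topology d\<close>. This is the usual route to continuity, and then to Borel
  measurability, of functionals of paths.\<close>

lemma continuous_map_path_topology_lipschitz: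
  fixes f :: "(real => real vec) => real"
  assumes lip: "\<And>x y. x \<in> cont_paths d ==> y \<in> cont_paths d ==> \<bar>f x - f y\<bar> <= C * path_dist d T x y"
  shows "continuous_map (path_topology d) euclideanreal f"
  unfolding continuous_map_def
proof (intro conjI allI impI)
  fix U :: "real set" assume "openin euclidean U"
  then have U: "open U" by simp
  show "openin (path_topology d) {x \<in> topspace (path_topology d). f x \<in> U}"
    unfolding openin_path_topology topspace_path_topology
  proof (intro conjI ballI)
    fix x assume "x \<in> {x \<in> cont_paths d. f x \<in> U}"
    then have x: "x \<in> cont_paths d" "f x \<in> U" by auto
    then obtain e where e: "e > 0" "\<And>y. \<bar>y - f x\<bar> < e ==> y \<in> U"
      using U by (auto simp: open_dist dist_real_def)
    show "\<exists>T>0. \<exists>e>0. \<forall>y\<in>cont_paths d. (\<forall>t\<in>{0..T}. \<forall>i<d. \<bar>y t $ i - x t $ i\<bar> < e)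
      --> y \<in> {x \<in> cont_paths d. f x \<in> U}"
    \<comment> \<open>\<open>max T 1\<close> because a basic neighbourhood needs a positive horizon;
      \<open>\<bar>C\<bar> + 1\<close> because \<open>C\<close> may be zero or negative.\<close>
    proof (rule exI[of _ "max T 1"], rule conjI, simp, rule exI[of _ "e / (\<bar>C\<bar> + 1)"], rule conjI, simp add: e(1),
        intro ballI impI)
      fix y assume y: "y \<in> cont_paths d"
        and "\<forall>t\<in>{0..max T 1}. \<forall>i<d. \<bar>y t $ i - x t $ i\<bar> < e / (\<bar>C\<bar> + 1)"
      then have "path_dist d T y x <= e / (\<bar>C\<bar> + 1)"
        using e(1) by (subst path_dist_le_iff[OF y x(1)]) (auto intro!: less_imp_le)
      then have "\<bar>C\<bar> * path_dist d T y x <= \<bar>C\<bar> * (e / (\<bar>C\<bar> + 1))"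
        by (rule mult_left_mono) simp
      also have "... < e" using e(1) by (simp add: field_simps)
      finally have "\<bar>f y - f x\<bar> < e"
        using lip[OF y x(1)] mult_right_mono[OF abs_ge_self[of C] path_dist_nonneg[OF y x(1), of T]] by linarith
      then show "y \<in> {x \<in> cont_paths d. f x \<in> U}" using e(2) y by simp
    qed
  qed auto
qed auto

lemma continuous_map_path_eval:
  assumes "0 <= t" "i < d"
  shows "continuous_map (path_topology d) euclideanreal (\<lambda>x. x t $ i)"
  by (rule continuous_map_path_topology_lipschitz[where C = 1 and T = t])
    (use path_dist_upper[where t = t and T = t and i = i] assms in auto)

lemma measurable_path_eval:
  "0 <= t ==> i < d ==> (\<lambda>x. x t $ i) \<in> borel_measurable (path_borel d)"
  by (intro borel_measurable_borel_of continuous_map_path_eval)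

section \<open>Separability of the path space and measurability by evaluations\<close>

lemma all_rat_le_iff:
  fixes f :: "real => real"
  assumes f: "continuous_on {0..} f" and T: "0 <= T"
  shows "(\<forall>t\<in>{0..T}. f t <= c) \<longleftrightarrow> (\<forall>q::rat\<in>{0<..<1}. f (of_rat q * T) <= c)"
proof (intro iffI ballI)
  fix q :: rat assume *: "\<forall>t\<in>{0..T}. f t <= c" "q \<in> {0<..<1}"
  then have "of_rat q * T <= 1 * T" using T by (intro mult_right_mono) auto
  then show "f (of_rat q * T) <= c" using * T by auto
next
  fix t assume H': "\<forall>q::rat\<in>{0<..<1}. f (of_rat q * T) <= c" and t: "t \<in> {0..T}"
  have H: "\<forall>q\<in>\<rat> \<inter> {0<..<1}. f (q * T) <= c" using H' by (auto elim!: Rats_cases)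
  let ?g = "\<lambda>s. f (s * T)"
  define s where "s = (if T = 0 then 0 else t / T)"
  have s: "s \<in> {0..1}" "s * T = t" using t T by (auto simp: s_def)
  have "closure (\<rat> \<inter> {0<..<1::real}) = closure {0<..<1}"
    using open_Int_closure_subset[of "{0<..<1::real}" "\<rat>"] closure_mono[of "\<rat> \<inter> {0<..<1::real}" "{0<..<1}"]
      closure_minimal[of "{0<..<1::real}" "closure ({0<..<1} \<inter> \<rat>)"]
    by (auto simp: Rats_closure_real Int_commute)
  then have cl: "closure (\<rat> \<inter> {0<..<1::real}) = {0..1}" by simp
  have "continuous_on {0..1} ?g"
    using T by (intro continuous_on_compose2[OF f] continuous_intros) auto
  then have "?g s <= c"
    using continuous_le_on_closure[of "\<rat> \<inter> {0<..<1}" ?g s c] H s(1) unfolding cl by auto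
  then show "f t <= c" using s by simp
qed

text \<open>Paths are sorted into countably many classes, by a mesh that controls their modulus of
  continuity and by their rounded values on that mesh. Choosing one representative of each nonempty
  class gives the dense set.\<close>

lemma countable_dense_paths:
  "\<exists>D. countable D \<and> D \<subseteq> cont_paths d \<and>
     (\<forall>x\<in>cont_paths d. \<forall>n m::nat. \<exists>c\<in>D. \<forall>t\<in>{0..real n}. \<forall>i<d. \<bar>x t $ i - c t $ i\<bar> < 1 / real (Suc m))"
proof -
  \<comment> \<open>\<open>mo\<close> says that the mesh \<open>1 / (N + 1)\<close> is fine enough
    for accuracy \<open>1 / (4 (m + 1))\<close> on \<open>[0, n]\<close>, and \<open>code\<close>
    lists the grid values rounded at that accuracy. Two members of one class differ by less than
    three such errors.\<close>
  define mo where "mo x n m N \<longleftrightarrow> (\<forall>s\<in>{0..real n}. \<forall>t\<in>{0..real n}. \<bar>s - t\<bar> <= 1 / real (Suc N) -->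
      (\<forall>i<d. \<bar>x s $ i - x t $ i\<bar> < 1 / (4 * real (Suc m))))" for x :: "real => real vec" and n m N :: nat
  define code where "code x n m N = map (\<lambda>(k, i). \<lfloor>4 * real (Suc m) * x (real k / real (Suc N)) $ i\<rfloor>)
      (List.product [0..<Suc (n * Suc N)] [0..<d])" for x :: "real => real vec" and n m N :: nat
  define P where "P x k \<longleftrightarrow> (case k of (n, m, N, l) => x \<in> cont_paths d \<and> mo x n m N \<and> code x n m N = l)" for x k
  define D where "D = (\<lambda>k. SOME x. P x k) ` {k. \<exists>x. P x k}"
  have "countable D" unfolding D_def by simp
  moreover have "D \<subseteq> cont_paths d"
  proof
    fix c assume "c \<in> D"
    then obtain k where "\<exists>x. P x k" "c = (SOME x. P x k)" unfolding D_def by blast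
    then have "P c k" by (metis someI_ex)
    then show "c \<in> cont_paths d" by (auto simp: P_def)
  qed
  moreover have "\<exists>c\<in>D. \<forall>t\<in>{0..real n}. \<forall>i<d. \<bar>x t $ i - c t $ i\<bar> < 1 / real (Suc m)"
    if x: "x \<in> cont_paths d" for x n m
  proof -
    have "\<exists>\<delta>>0. \<forall>s\<in>{0..real n}. \<forall>t\<in>{0..real n}. \<bar>s - t\<bar> < \<delta> --> \<bar>x s $ i - x t $ i\<bar> < 1 / (4 * real (Suc m))"
      if "i < d" for i
    proof -
      have "uniformly_continuous_on {0..real n} (\<lambda>t. x t $ i)"
        by (intro compact_uniformly_continuous continuous_on_subset[OF cont_paths_continuous[OF x that]]) auto
      moreover have "0 < 1 / (4 * real (Suc m))" by simp
      ultimately show ?thesis unfolding uniformly_continuous_on_def dist_real_def by (metis abs_minus_commute)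
    qed
    then obtain \<delta> where \<delta>: "\<And>i. i < d ==> \<delta> i > 0"
      "\<And>i s t. i < d ==> s \<in> {0..real n} ==> t \<in> {0..real n} ==> \<bar>s - t\<bar> < \<delta> i ==> \<bar>x s $ i - x t $ i\<bar> < 1 / (4 * real (Suc m))"
      by metis
    define \<delta>0 where "\<delta>0 = Min (insert 1 (\<delta> ` {..<d}))"
    have "\<delta>0 > 0" using \<delta>(1) by (auto simp: \<delta>0_def)
    have \<delta>0: "\<delta>0 <= \<delta> i" if "i < d" for i using that by (auto simp: \<delta>0_def)
    obtain N where N: "1 / real (Suc N) < \<delta>0" using \<open>\<delta>0 > 0\<close> nat_approx_posE by auto
    have mo: "mo x n m N" unfolding mo_def
      using N \<delta>0 \<delta>(2) by (meson le_less_trans less_le_trans)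
    define k where "k = (n, m, N, code x n m N)"
    define c where "c = (SOME x. P x k)"
    have "P x k" using x mo by (simp add: P_def k_def)
    then have "P c k" unfolding c_def by (rule someI[of "\<lambda>x. P x k"])
    moreover have "c \<in> D" using \<open>P x k\<close> unfolding D_def c_def by blast
    ultimately have "c \<in> D" "P c k" by blast+
    then have c: "mo c n m N" "code c n m N = code x n m N" by (auto simp: P_def k_def)
    have "\<bar>x t $ i - c t $ i\<bar> < 1 / real (Suc m)" if t: "t \<in> {0..real n}" and i: "i < d" for t i
    proof -
      define q where "q = nat \<lfloor>t * real (Suc N)\<rfloor>"
      have q: "real q <= t * real (Suc N)" "t * real (Suc N) < real q + 1"
        using t by (auto simp: q_def)
      have "t * real (Suc N) <= real n * real (Suc N)" using t by (intro mult_right_mono) auto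
      then have "real q <= real (n * Suc N)" using q(1) by (simp only: of_nat_mult)
      then have qn: "q <= n * Suc N" by linarith
      define s where "s = real q / real (Suc N)"
      have "s <= t" "t < s + 1 / real (Suc N)"
        using q by (simp_all add: s_def pos_divide_le_eq pos_less_divide_eq flip: add_divide_distrib)
      then have st: "s \<in> {0..real n}" "\<bar>s - t\<bar> <= 1 / real (Suc N)" using t by (auto simp: s_def)
      have "(q, i) \<in> set (List.product [0..<Suc (n * Suc N)] [0..<d])" using qn i by auto
      with c(2) have "\<lfloor>4 * real (Suc m) * c s $ i\<rfloor> = \<lfloor>4 * real (Suc m) * x s $ i\<rfloor>"
        unfolding code_def s_def map_eq_conv by (auto dest!: bspec[where x = "(q, i)"])
      then have "\<bar>4 * real (Suc m) * c s $ i - 4 * real (Suc m) * x s $ i\<bar> < 1" by linarith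
      then have c4: "4 * real (Suc m) * \<bar>c s $ i - x s $ i\<bar> < 1"
        by (simp add: abs_mult flip: right_diff_distrib)
      define a where "a = 1 / (4 * real (Suc m))"
      have "\<bar>c s $ i - x s $ i\<bar> < a" using c4 by (simp add: a_def pos_less_divide_eq mult.commute)
      moreover have "\<bar>x s $ i - x t $ i\<bar> < a" using mo st t i unfolding mo_def a_def by blast
      moreover have "\<bar>c s $ i - c t $ i\<bar> < a" using c(1) st t i unfolding mo_def a_def by blast
      moreover have "0 < a" by (simp add: a_def)
      ultimately have "\<bar>x t $ i - c t $ i\<bar> < 4 * a" by linarith
      also have "4 * a = 1 / real (Suc m)" by (simp add: a_def divide_simps)
      finally show ?thesis .
    qed
    with \<open>c \<in> D\<close> show ?thesis by blast
  qed
  ultimately show ?thesis by (intro exI[of _ D] conjI ballI allI)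
qed

text \<open>The path space is separable, so its Borel sets are generated by the evaluations.\<close>

lemma measurable_path_borelI:
  assumes f: "\<And>w. w \<in> space M ==> f w \<in> cont_paths d"
    and ev: "\<And>t i. 0 <= t ==> i < d ==> (\<lambda>w. f w t $ i) \<in> borel_measurable M"
  shows "f \<in> M \<rightarrow>\<^sub>M path_borel d"
  unfolding borel_of_def
proof (rule measurable_measure_of)
  show "{U. openin (path_topology d) U} \<subseteq> Pow (topspace (path_topology d))" by (auto dest: openin_subset)
  show "f \<in> space M \<rightarrow> topspace (path_topology d)" using f by (simp add: topspace_path_topology)
  fix U assume "U \<in> {U. openin (path_topology d) U}"
  then have U: "openin (path_topology d) U" by simp
  obtain D where D: "countable D" "D \<subseteq> cont_paths d"
    "\<And>x n m. x \<in> cont_paths d ==> \<exists>c\<in>D. \<forall>t\<in>{0..real n}. \<forall>i<d. \<bar>x t $ i - c t $ i\<bar> < 1 / real (Suc m)"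
    using countable_dense_paths[of d] by metis
  \<comment> \<open>Closed balls around the countable dense set, with horizon and radius indexed by
    natural numbers: an open set is the union of those it contains.\<close>
  define Bl where "Bl c n m = {y \<in> cont_paths d. \<forall>t\<in>{0..real n}. \<forall>i<d. \<bar>y t $ i - c t $ i\<bar> <= 1 / real (Suc m)}"
    for c n m
  have meas: "f -` Bl c n m \<inter> space M \<in> sets M" if c: "c \<in> D" for c n m
  proof -
    have cc: "c \<in> cont_paths d" using c D by blast
    \<comment> \<open>Testing only rational fractions of the horizon turns the ball into a countable
      intersection of conditions on evaluations.\<close>
    let ?Q = "{0<..<1::rat}"
    have eq: "(\<forall>t\<in>{0..real n}. \<bar>f w t $ i - c t $ i\<bar> <= 1 / real (Suc m)) \<longleftrightarrow>
        (\<forall>q\<in>?Q. \<bar>f w (of_rat q * real n) $ i - c (of_rat q * real n) $ i\<bar> <= 1 / real (Suc m))"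
      if "w \<in> space M" "i < d" for w i
      by (rule all_rat_le_iff)
        (intro continuous_intros cont_paths_continuous[OF f[OF that(1)] that(2)] cont_paths_continuous[OF cc that(2)], simp)
    have "f -` Bl c n m \<inter> space M = {w \<in> space M. \<forall>i\<in>{..<d}. \<forall>q\<in>?Q.
       \<bar>f w (of_rat q * real n) $ i - c (of_rat q * real n) $ i\<bar> <= 1 / real (Suc m)}"
    proof (rule Set.set_eqI)
      fix w
      show "w \<in> f -` Bl c n m \<inter> space M \<longleftrightarrow> w \<in> {w \<in> space M. \<forall>i\<in>{..<d}. \<forall>q\<in>?Q.
       \<bar>f w (of_rat q * real n) $ i - c (of_rat q * real n) $ i\<bar> <= 1 / real (Suc m)}"
        using eq[of w] f[of w] by (cases "w \<in> space M") (auto simp: Bl_def)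
    qed
    also have "... \<in> sets M"
    proof (rule sets.sets_Collect_finite_All)
      fix i assume "i \<in> {..<d}"
      then have i: "i < d" by simp
      have "Measurable.pred M (\<lambda>w. \<bar>f w (of_rat q * real n) $ i - c (of_rat q * real n) $ i\<bar> <= 1 / real (Suc m))"
        if "q \<in> ?Q" for q
      proof -
        have "(\<lambda>w. f w (of_rat q * real n) $ i) \<in> borel_measurable M" using that i by (intro ev) auto
        then show ?thesis unfolding pred_def
          by (intro borel_measurable_le borel_measurable_const borel_measurable_abs borel_measurable_diff)
      qed
      then have "Measurable.pred M (\<lambda>w. \<forall>q\<in>?Q. \<bar>f w (of_rat q * real n) $ i - c (of_rat q * real n) $ i\<bar> <= 1 / real (Suc m))"
        by (rule pred_intros_countable_bounded(3))
      then show "{w \<in> space M. \<forall>q\<in>?Q. \<bar>f w (of_rat q * real n) $ i - c (of_rat q * real n) $ i\<bar> <= 1 / real (Suc m)} \<in> sets M"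
        by (simp only: pred_def)
    qed simp
    finally show ?thesis .
  qed
  let ?K = "{(c, n, m). c \<in> D \<and> Bl c n m \<subseteq> U}"
  have "U \<subseteq> (\<Union>(c, n, m)\<in>?K. Bl c n m)"
  proof
    fix x assume xU: "x \<in> U"
    then have x: "x \<in> cont_paths d" using openin_subset[OF U] by (auto simp: topspace_path_topology)
    have "\<exists>T>0. \<exists>e>0. \<forall>y\<in>cont_paths d. (\<forall>t\<in>{0..T}. \<forall>i<d. \<bar>y t $ i - x t $ i\<bar> < e) --> y \<in> U"
      using U xU unfolding openin_path_topology by blast
    then obtain T e where Te: "T > 0" "e > 0"
      "\<And>y. y \<in> cont_paths d ==> \<forall>t\<in>{0..T}. \<forall>i<d. \<bar>y t $ i - x t $ i\<bar> < e ==> y \<in> U" by blast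
    obtain m where m: "1 / real (Suc m) < e / 2" using Te(2) nat_approx_posE[of "e/2"] by auto
    obtain n where n: "T <= real n" using real_arch_simple by blast
    obtain c where c: "c \<in> D" "\<And>t i. t \<in> {0..real n} ==> i < d ==> \<bar>x t $ i - c t $ i\<bar> < 1 / real (Suc m)"
      using D(3)[OF x, where n = n and m = m] by blast
    have "Bl c n m \<subseteq> U"
    proof
      fix y assume y: "y \<in> Bl c n m"
      have "\<bar>y t $ i - x t $ i\<bar> < e" if "t \<in> {0..T}" "i < d" for t i
      proof -
        have t: "t \<in> {0..real n}" using that n by auto
        then have "\<bar>y t $ i - c t $ i\<bar> <= 1 / real (Suc m)" using y that by (auto simp: Bl_def)
        with c(2)[OF t that(2)] m show ?thesis by linarith
      qed
      with y Te(3) show "y \<in> U" by (auto simp: Bl_def)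
    qed
    moreover have "x \<in> Bl c n m" using x c(2) by (auto simp: Bl_def intro: less_imp_le)
    ultimately show "x \<in> (\<Union>(c, n, m)\<in>?K. Bl c n m)" using c(1) by blast
  qed
  then have UU: "U = (\<Union>(c, n, m)\<in>?K. Bl c n m)" by auto
  have "?K \<subseteq> D \<times> UNIV" by auto
  then have "countable ?K" by (rule countable_subset) (intro countable_SIGMA D(1), auto)
  have "f -` (\<Union>(c, n, m)\<in>?K. Bl c n m) \<inter> space M = (\<Union>(c, n, m)\<in>?K. f -` Bl c n m \<inter> space M)"
    by blast
  also have "... \<in> sets M"
  proof (rule sets.countable_UN''[OF \<open>countable ?K\<close>])
    fix k assume "k \<in> ?K"
    then show "(case k of (c, n, m) => f -` Bl c n m \<inter> space M) \<in> sets M" using meas by auto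
  qed
  finally show "f -` U \<inter> space M \<in> sets M" by (simp only: UU[symmetric])
qed

lemma measurable_path_borel_cont_paths: "f \<in> M \<rightarrow>\<^sub>M path_borel d ==> x \<in> space M ==> f x \<in> cont_paths d"
  using measurable_space[of f M "path_borel d"] by (simp add: topspace_path_topology)

section \<open>The state space as the space of constant paths\<close>

lemma continuous_map_vec_component:
  assumes "i < d"
  shows "continuous_map (vec_topology d) euclideanreal (\<lambda>v. v $ i)"
proof -
  have "continuous_map (vec_topology d) euclideanreal ((\<lambda>f. f i) \<circ> (\<lambda>v. \<lambda>i\<in>{..<d}. v $ i))"
    unfolding vec_topology_def using assms
    by (intro continuous_map_pullback continuous_map_product_projection) auto
  then show ?thesis using assms by (simp add: comp_def)
qed

lemma openin_vec_box:
  "openin (vec_topology d) {v \<in> carrier_vec d. \<forall>i<d. \<bar>v $ i - u $ i\<bar> < e}"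
proof -
  have "{v \<in> carrier_vec d. \<forall>i<d. \<bar>v $ i - u $ i\<bar> < e} =
    topspace (vec_topology d) \<inter> (\<Inter>i<d. {v \<in> topspace (vec_topology d). v $ i \<in> {u $ i - e<..<u $ i + e}})"
    by (auto simp: topspace_vec_topology abs_less_iff) force+
  also have "openin (vec_topology d) ..."
  proof (cases "d = 0")
    case False
    then show ?thesis
      by (intro openin_Int openin_topspace openin_INT2 openin_continuous_map_preimage[where Y = euclideanreal] continuous_map_vec_component) auto
  qed simp
  finally show ?thesis .
qed

text \<open>Vectors are embedded as constant paths, with evaluation at time 0 as left inverse, so
  that measurability and continuity on the state space are inherited from the path space.\<close>

definition const_path :: "real vec => real => real vec" where
  "const_path v = (\<lambda>t\<in>{0..}. v)"

lemma const_path_cont_paths: "v \<in> carrier_vec d ==> const_path v \<in> cont_paths d"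
  by (auto simp: cont_paths_def const_path_def cong: continuous_on_cong_simp)

lemma continuous_map_const_path: "continuous_map (vec_topology d) (path_topology d) const_path"
  unfolding continuous_map_def
proof (intro conjI allI impI)
  show "const_path \<in> topspace (vec_topology d) \<rightarrow> topspace (path_topology d)"
    by (auto simp: topspace_vec_topology topspace_path_topology const_path_cont_paths)
  fix U assume U: "openin (path_topology d) U"
  show "openin (vec_topology d) {v \<in> topspace (vec_topology d). const_path v \<in> U}"
  proof (subst openin_subopen, intro ballI)
    fix u assume "u \<in> {v \<in> topspace (vec_topology d). const_path v \<in> U}"
    then have u: "u \<in> carrier_vec d" "const_path u \<in> U" by (auto simp: topspace_vec_topology)
    then have "\<exists>T>0. \<exists>e>0. \<forall>y\<in>cont_paths d. (\<forall>t\<in>{0..T}. \<forall>i<d. \<bar>y t $ i - const_path u t $ i\<bar> < e) --> y \<in> U"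
      using U unfolding openin_path_topology by blast
    then obtain T e where Te: "T > 0" "e > 0"
      "\<And>y. y \<in> cont_paths d ==> \<forall>t\<in>{0..T}. \<forall>i<d. \<bar>y t $ i - const_path u t $ i\<bar> < e ==> y \<in> U"
      by blast
    let ?V = "{v \<in> carrier_vec d. \<forall>i<d. \<bar>v $ i - u $ i\<bar> < e}"
    have "?V \<subseteq> {v \<in> topspace (vec_topology d). const_path v \<in> U}"
    proof (rule subsetI)
      fix v assume "v \<in> ?V"
      then show "v \<in> {v \<in> topspace (vec_topology d). const_path v \<in> U}"
        using Te(3)[OF const_path_cont_paths, of v] by (simp add: topspace_vec_topology const_path_def)
    qed
    moreover have "u \<in> ?V" using u Te(2) by simp
    ultimately show "\<exists>V. openin (vec_topology d) V \<and> u \<in> V \<and> V \<subseteq> {v \<in> topspace (vec_topology d). const_path v \<in> U}"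
      by (intro exI[of _ ?V] conjI openin_vec_box)
  qed
qed

lemma continuous_map_path_at:
  assumes t: "0 <= t"
  shows "continuous_map (path_topology d) (vec_topology d) (\<lambda>x. x t)"
  unfolding vec_topology_def
proof (rule continuous_map_pullback')
  show "continuous_map (path_topology d) (product_topology (\<lambda>_. euclideanreal) {..<d})
     ((\<lambda>v. \<lambda>i\<in>{..<d}. v $ i) \<circ> (\<lambda>x. x t))"
    using continuous_map_path_eval[OF t] by (auto simp: continuous_map_componentwise comp_def)
  show "topspace (path_topology d) \<subseteq> (\<lambda>x. x t) -` carrier_vec d"
    using cont_paths_carrier[OF _ t] by (auto simp: topspace_path_topology)
qed

lemma measurable_path_at: "0 <= t ==> (\<lambda>x. x t) \<in> path_borel d \<rightarrow>\<^sub>M vec_borel d"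
  by (intro measurable_borel_of_continuous_map continuous_map_path_at)

lemma measurable_vec_component: "i < d ==> (\<lambda>v. v $ i) \<in> borel_measurable (vec_borel d)"
  by (intro borel_measurable_borel_of continuous_map_vec_component)

lemma measurable_vec_borelI:
  assumes "\<And>x. x \<in> space M ==> f x \<in> carrier_vec d"
    and "\<And>i. i < d ==> (\<lambda>x. f x $ i) \<in> borel_measurable M"
  shows "f \<in> M \<rightarrow>\<^sub>M vec_borel d"
proof -
  have "(\<lambda>x. const_path (f x)) \<in> M \<rightarrow>\<^sub>M path_borel d"
    using assms by (intro measurable_path_borelI const_path_cont_paths) (simp_all add: const_path_def)
  from measurable_compose[OF this measurable_path_at[of 0]] show ?thesis by (simp add: const_path_def)
qed

lemma continuous_map_vec_lipschitz:
  fixes f :: "real vec => real"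
  assumes "\<And>u v e. u \<in> carrier_vec d ==> v \<in> carrier_vec d ==> 0 <= e ==> (\<And>i. i < d ==> \<bar>u $ i - v $ i\<bar> <= e) ==>
     \<bar>f u - f v\<bar> <= C * e"
  shows "continuous_map (vec_topology d) euclideanreal f"
proof -
  have "continuous_map (path_topology d) euclideanreal (\<lambda>x. f (x 0))"
    by (rule continuous_map_path_topology_lipschitz[where T = 0 and C = C])
      (auto intro!: assms cont_paths_carrier path_dist_nonneg path_dist_upper)
  from continuous_map_compose[OF continuous_map_const_path this] show ?thesis
    by (simp add: comp_def const_path_def)
qed

text \<open>For bounded continuous \<open>f\<close>, the infimal convolution \<open>x \<mapsto> inf\<^sub>y f y + n * path_dist d n x y\<close> is bounded,
  Lipschitz, below \<open>f\<close> and converges to \<open>f\<close> pointwise.\<close>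

lemma lipschitz_approx_below:
  fixes f :: "(real => real vec) => real"
  assumes f: "continuous_map (path_topology d) euclideanreal f" and B: "\<And>x. x \<in> cont_paths d ==> \<bar>f x\<bar> <= B"
  obtains g :: "nat => (real => real vec) => real"
  where "\<And>n x y. x \<in> cont_paths d ==> y \<in> cont_paths d ==> \<bar>g n x - g n y\<bar> <= real n * path_dist d (real n) x y"
    and "\<And>n x. x \<in> cont_paths d ==> \<bar>g n x\<bar> <= B" and "\<And>n x. x \<in> cont_paths d ==> g n x <= f x"
    and "\<And>x. x \<in> cont_paths d ==> (\<lambda>n. g n x) \<longlonglongrightarrow> f x"
proof -
  let ?P = "cont_paths d"
  let ?\<rho> = "\<lambda>n. path_dist d (real n)"
  define g where "g n x = (INF y\<in>?P. f y + real n * ?\<rho> n x y)" for n x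
  have ne: "?P \<noteq> {}" using const_path_cont_paths[of "0\<^sub>v d" d] by auto
  have lb: "- B <= f y + real n * ?\<rho> n x y" if "x \<in> ?P" "y \<in> ?P" for x y n
    using B[OF that(2)] mult_nonneg_nonneg[OF of_nat_0_le_iff path_dist_nonneg[OF that], of n "real n"] by linarith
  have bdd: "bdd_below ((\<lambda>y. f y + real n * ?\<rho> n x y) ` ?P)" if "x \<in> ?P" for x n
    using lb[OF that] by (intro bdd_belowI2)
  have le: "g n x <= f x" if "x \<in> ?P" for n x
    unfolding g_def by (rule cINF_lower2[OF bdd[OF that] that]) (simp add: path_dist_self[OF that])
  have low: "- B <= g n x" if "x \<in> ?P" for n x
    unfolding g_def by (rule cINF_greatest[OF ne lb[OF that]])
  have lip1: "g n x <= g n y + real n * ?\<rho> n x y" if "x \<in> ?P" "y \<in> ?P" for n x y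
  proof -
    have "g n x - real n * ?\<rho> n x y <= f z + real n * ?\<rho> n y z" if z: "z \<in> ?P" for z
    proof -
      have "g n x <= f z + real n * ?\<rho> n x z"
        unfolding g_def by (rule cINF_lower[OF bdd[OF \<open>x \<in> ?P\<close>] z])
      also have "... <= f z + real n * (?\<rho> n x y + ?\<rho> n y z)"
        using path_dist_triangle[OF \<open>x \<in> ?P\<close> \<open>y \<in> ?P\<close> z] by (intro add_left_mono mult_left_mono) simp_all
      finally show ?thesis by (simp add: algebra_simps)
    qed
    then have "g n x - real n * ?\<rho> n x y <= g n y"
      unfolding g_def[of n y] by (intro cINF_greatest[OF ne])
    then show ?thesis by simp
  qed
  show ?thesis
  proof
    show "\<bar>g n x - g n y\<bar> <= real n * ?\<rho> n x y" if "x \<in> ?P" "y \<in> ?P" for n x y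
      using lip1[OF that, of n] lip1[OF that(2,1), of n] by (simp add: path_dist_commute[of d _ y x])
    show "\<bar>g n x\<bar> <= B" if "x \<in> ?P" for n x
      using le[OF that, of n] low[OF that, of n] B[OF that] by linarith
    show "g n x <= f x" if "x \<in> ?P" for n x by (rule le[OF that])
    show "(\<lambda>n. g n x) \<longlonglongrightarrow> f x" if x: "x \<in> ?P" for x
    proof (rule LIMSEQ_I)
      fix r :: real assume r: "r > 0"
      have "openin (path_topology d) {y \<in> topspace (path_topology d). f y \<in> {f x - r / 2<..}}"
        by (rule openin_continuous_map_preimage[OF f]) simp
      moreover have "x \<in> {y \<in> topspace (path_topology d). f y \<in> {f x - r / 2<..}}"
        using x r by (simp add: topspace_path_topology)
      ultimately have "\<exists>T>0. \<exists>e>0. \<forall>y\<in>cont_paths d. (\<forall>t\<in>{0..T}. \<forall>i<d. \<bar>y t $ i - x t $ i\<bar> < e) -->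
         y \<in> {y \<in> topspace (path_topology d). f y \<in> {f x - r / 2<..}}"
        unfolding openin_path_topology by blast
      then obtain T e where Te: "T > 0" "e > 0"
        "\<And>y. y \<in> ?P ==> \<forall>t\<in>{0..T}. \<forall>i<d. \<bar>y t $ i - x t $ i\<bar> < e ==> f x - r / 2 < f y"
        by auto
      \<comment> \<open>For \<open>y\<close> at distance at least \<open>e\<close> the penalty is at
        least \<open>n * e >= 2 * B\<close>, the largest possible oscillation of \<open>f\<close>;
        for closer \<open>y\<close> the value \<open>f y\<close> is above \<open>f x - r / 2\<close>
        by continuity.\<close>
      obtain n0 where n0: "max T (2 * B / e + 1) <= real n0" using real_arch_simple by blast
      have "norm (g n x - f x) < r" if n: "n \<ge> n0" for n
      proof -
        have n': "T <= real n" "2 * B / e <= real n" using n0 n by linarith+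
        have "f x - r / 2 <= f y + real n * ?\<rho> n x y" if y: "y \<in> ?P" for y
        proof (cases "?\<rho> n x y < e")
          case True
          then have "f x - r / 2 < f y"
            using path_dist_upper[OF x y, where T = "real n"] n'(1)
            by (intro Te(3)[OF y]) (fastforce simp: abs_minus_commute)
          then show ?thesis using mult_nonneg_nonneg[OF of_nat_0_le_iff path_dist_nonneg[OF x y], of n "real n"] by linarith
        next
          case False
          have "2 * B <= real n * e" using n'(2) Te(2) by (simp add: field_simps)
          also have "... <= real n * ?\<rho> n x y" using False by (intro mult_left_mono) auto
          finally show ?thesis using B[OF x] B[OF y] r by linarith
        qed
        then have "f x - r / 2 <= g n x" unfolding g_def by (intro cINF_greatest[OF ne])
        then show ?thesis using le[OF x, of n] r by simp
      qed
      then show "\<exists>no. \<forall>n\<ge>no. norm (g n x - f x) < r" by blast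
    qed
  qed
qed

text \<open>Lipschitz minorants of a bounded continuous \<open>f\<close> bound its expectations from
  below in the limit, and the same for \<open>- f\<close> closes the gap. Afterwards only bounded
  Lipschitz tests have to be checked.\<close>

lemma converges_weakly_pathI:
  assumes M: "prob_space M" and N: "prob_space N"
    and X: "\<forall>\<^sub>F i in F. X i \<in> M \<rightarrow>\<^sub>M path_borel d" and Y: "Y \<in> N \<rightarrow>\<^sub>M path_borel d"
    and conv: "\<And>g T C B. (\<And>x y. x \<in> cont_paths d ==> y \<in> cont_paths d ==> \<bar>g x - g y\<bar> <= C * path_dist d T x y) ==>
       0 <= C ==> (\<And>x. x \<in> cont_paths d ==> \<bar>g x\<bar> <= B) ==>
       ((\<lambda>i. \<integral>p. g (X i p) \<partial>M) \<longlongrightarrow> (\<integral>p. g (Y p) \<partial>N)) F"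
  shows "converges_weakly (path_topology d) M X N Y F"
proof -
  interpret M: prob_space M by fact
  interpret N: prob_space N by fact
  have low: "\<forall>\<^sub>F i in F. (\<integral>p. f (Y p) \<partial>N) - e < (\<integral>p. f (X i p) \<partial>M)"
    if f: "continuous_map (path_topology d) euclideanreal f" and B: "\<And>x. x \<in> cont_paths d ==> \<bar>f x\<bar> <= B" and e: "e > 0"
    for f :: "(real => real vec) => real" and B e
  proof -
    obtain g where g: "\<And>n x y. x \<in> cont_paths d ==> y \<in> cont_paths d ==> \<bar>g n x - g n y\<bar> <= real n * path_dist d (real n) x y"
      "\<And>n x. x \<in> cont_paths d ==> \<bar>g n x\<bar> <= B" "\<And>n x. x \<in> cont_paths d ==> g n x <= f x"
      "\<And>x. x \<in> cont_paths d ==> (\<lambda>n. g n x) \<longlonglongrightarrow> f x"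
      using lipschitz_approx_below[OF f B] by blast
    have gm: "g n \<in> borel_measurable (path_borel d)" for n
      by (rule borel_measurable_borel_of, rule continuous_map_path_topology_lipschitz[OF g(1)])
    have fm: "f \<in> borel_measurable (path_borel d)" using f by (rule borel_measurable_borel_of)
    note YP = measurable_path_borel_cont_paths[OF Y]
    have "(\<lambda>n. \<integral>p. g n (Y p) \<partial>N) \<longlonglongrightarrow> (\<integral>p. f (Y p) \<partial>N)"
      by (rule integral_dominated_convergence[where w = "\<lambda>_. B"])
        (auto intro!: measurable_compose[OF Y] gm fm AE_I2 g YP)
    then have "\<forall>\<^sub>F n in sequentially. (\<integral>p. f (Y p) \<partial>N) - e / 2 < (\<integral>p. g n (Y p) \<partial>N)"
      using e by (intro order_tendstoD(1)) auto
    then obtain n where n: "(\<integral>p. f (Y p) \<partial>N) - e / 2 < (\<integral>p. g n (Y p) \<partial>N)"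
      by (auto simp: eventually_sequentially)
    have "((\<lambda>i. \<integral>p. g n (X i p) \<partial>M) \<longlongrightarrow> (\<integral>p. g n (Y p) \<partial>N)) F"
      by (rule conv[where C = "real n" and T = "real n" and B = B]) (use g in auto)
    then have "\<forall>\<^sub>F i in F. (\<integral>p. g n (Y p) \<partial>N) - e / 2 < (\<integral>p. g n (X i p) \<partial>M)"
      using e by (intro order_tendstoD(1)) auto
    then show ?thesis using X
    proof eventually_elim
      case (elim i)
      have "(\<integral>p. g n (X i p) \<partial>M) <= (\<integral>p. f (X i p) \<partial>M)"
        using measurable_path_borel_cont_paths[OF elim(2)]
        by (intro integral_mono M.integrable_const_bound[where B = B] measurable_compose[OF elim(2)] gm fm)
          (auto intro!: g B AE_I2)
      then show ?case using elim(1) n by linarith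
    qed
  qed
  show ?thesis unfolding converges_weakly_def
  proof (intro conjI X Y allI impI, elim conjE exE)
    fix f :: "(real => real vec) => real" and B
    assume f: "continuous_map (path_topology d) euclideanreal f" and "\<forall>x\<in>topspace (path_topology d). \<bar>f x\<bar> <= B"
    then have B: "\<bar>f x\<bar> <= B" if "x \<in> cont_paths d" for x using that by (auto simp: topspace_path_topology)
    have f': "continuous_map (path_topology d) euclideanreal (\<lambda>x. - f x)" using f by (intro continuous_intros)
    show "((\<lambda>i. \<integral>p. f (X i p) \<partial>M) \<longlongrightarrow> (\<integral>p. f (Y p) \<partial>N)) F"
    proof (rule tendstoI)
      fix e :: real assume e: "e > 0"
      have B': "\<bar>- f x\<bar> <= B" if "x \<in> cont_paths d" for x using B[OF that] by simp
      have "\<forall>\<^sub>F i in F. (\<integral>p. f (Y p) \<partial>N) - e < (\<integral>p. f (X i p) \<partial>M)" by (rule low[OF f B e])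
      moreover have "\<forall>\<^sub>F i in F. (\<integral>p. - f (Y p) \<partial>N) - e < (\<integral>p. - f (X i p) \<partial>M)" by (rule low[OF f' B' e])
      ultimately show "\<forall>\<^sub>F i in F. dist (\<integral>p. f (X i p) \<partial>M) (\<integral>p. f (Y p) \<partial>N) < e"
        by eventually_elim (simp add: dist_real_def abs_less_iff)
    qed
  qed
qed

subsection \<open>The Skorokhod problem for nonsingular M-matrices\<close>

text \<open>The semipositivity form of a nonsingular M-matrix. It passes to principal blocks and
  Schur complements with the same \<open>v\<close>, without any spectral argument.\<close>

locale nonsingular_M =
  fixes d :: nat and r :: "nat => nat => real" and v :: "nat => real"
  assumes offdiag: "\<And>i j. i < d ==> j < d ==> i \<noteq> j ==> r i j <= 0"
    and v_pos: "\<And>i. i < d ==> 0 < v i"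
    and rv_pos: "\<And>i. i < d ==> 0 < (\<Sum>j<d. r i j * v j)"
begin

lemma sum_split: "i < d ==> (\<Sum>k<d. f k :: real) = f i + (\<Sum>k\<in>{..<d} - {i}. f k)"
  by (intro sum.remove) auto

lemma off_nonpos: "i < d ==> k \<in> {..<d} - {i} ==> r i k <= 0"
  using offdiag[of i k] by auto

lemma off_mono:
  "i < d ==> (\<And>k. k < d ==> k \<noteq> i ==> a k <= b k) ==>
     (\<Sum>k\<in>{..<d} - {i}. r i k * b k) <= (\<Sum>k\<in>{..<d} - {i}. r i k * a k)"
  by (intro sum_mono mult_left_mono_neg off_nonpos) auto

lemma diag_pos:
  assumes "i < d"
  shows "0 < r i i"
proof -
  have "(\<Sum>k\<in>{..<d} - {i}. r i k * v k) <= 0"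
    using assms v_pos by (intro sum_nonpos mult_nonpos_nonneg off_nonpos) (auto intro: less_imp_le)
  then have "0 < r i i * v i" using rv_pos[OF assms] sum_split[OF assms, of "\<lambda>k. r i k * v k"] by linarith
  then show ?thesis using v_pos[OF assms] by (simp add: zero_less_mult_iff)
qed

text \<open>If \<open>r v >= \<beta>\<close> with \<open>\<beta>\<close> the minimum below, then
  \<open>v / \<beta>\<close> dominates the row sums of the inverse matrix; \<open>K\<close> is a
  crude common bound for them. The inserted 1 keeps \<open>Min\<close> defined for
  \<open>d = 0\<close>.\<close>

definition K :: real where
  "K = (\<Sum>i<d. v i) / Min (insert 1 ((\<lambda>i. \<Sum>j<d. r i j * v j) ` {..<d}))"

lemma K_nonneg: "0 <= K"
  unfolding K_def using v_pos rv_pos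
  by (intro divide_nonneg_nonneg sum_nonneg) (auto intro: less_imp_le)

text \<open>At the index \<open>k\<close> where \<open>m k / v k\<close> takes its maximal value
  \<open>q\<close>, the signs off the diagonal give \<open>(r m) k >= q * (r v) k\<close>, which
  bounds \<open>q\<close> by \<open>c / \<beta>\<close>. If \<open>q > 0\<close> then
  \<open>m k > 0\<close>, which is why the inequality is demanded only at indices with positive
  \<open>m\<close>.\<close>

lemma max_principle:
  assumes m: "\<And>i. i < d ==> 0 < m i ==> (\<Sum>j<d. r i j * m j) <= c" and c: "0 <= c" and i: "i < d"
  shows "m i <= K * c"
proof (cases "\<exists>k<d. 0 < m k")
  case False
  then have "m i <= 0" using i by (meson not_less)
  also have "0 <= K * c" using K_nonneg c by simp
  finally show ?thesis .
next
  case True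
  define \<beta> where "\<beta> = Min (insert 1 ((\<lambda>i. \<Sum>j<d. r i j * v j) ` {..<d}))"
  have \<beta>: "0 < \<beta>" unfolding \<beta>_def using rv_pos by auto
  have \<beta>le: "\<beta> <= (\<Sum>j<d. r k j * v j)" if "k < d" for k
    unfolding \<beta>_def using that by (intro Min_le) auto
  have ne: "(\<lambda>k. m k / v k) ` {..<d} \<noteq> {}" using i by auto
  define q where "q = Max ((\<lambda>k. m k / v k) ` {..<d})"
  have "q \<in> (\<lambda>k. m k / v k) ` {..<d}" unfolding q_def by (intro Max_in ne) auto
  then obtain k where k: "k < d" "q = m k / v k" by auto
  have q: "m j <= q * v j" if "j < d" for j
  proof -
    have "m j / v j <= q" unfolding q_def using that by (intro Max_ge) auto
    then show ?thesis using v_pos[OF that] by (simp add: field_simps)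
  qed
  have mk: "m k = q * v k" using k v_pos[OF k(1)] by simp
  have "0 < q"
  proof -
    obtain j where "j < d" "0 < m j" using True by blast
    then have "0 < q * v j" using q[of j] by linarith
    then show ?thesis using v_pos[OF \<open>j < d\<close>] by (simp add: zero_less_mult_iff)
  qed
  have "q * \<beta> <= q * (\<Sum>j<d. r k j * v j)"
    using \<open>0 < q\<close> k(1) by (intro mult_left_mono \<beta>le) auto
  also have "... = r k k * m k + (\<Sum>j\<in>{..<d} - {k}. r k j * (q * v j))"
    by (simp add: sum_split[OF k(1)] sum_distrib_left mk algebra_simps)
  also have "... <= r k k * m k + (\<Sum>j\<in>{..<d} - {k}. r k j * m j)"
    by (intro add_left_mono off_mono[OF k(1)] q)
  also have "... = (\<Sum>j<d. r k j * m j)" by (simp add: sum_split[OF k(1)])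
  also have "... <= c" using m[OF k(1)] mk \<open>0 < q\<close> v_pos[OF k(1)] by simp
  finally have "q <= c / \<beta>" using \<beta> by (simp add: pos_le_divide_eq)
  have "m i <= q * v i" by (rule q[OF i])
  also have "... <= (c / \<beta>) * (\<Sum>j<d. v j)"
  proof (rule mult_mono)
    show "v i <= (\<Sum>j<d. v j)" using i v_pos by (intro member_le_sum) (auto intro: less_imp_le)
  qed (use \<open>q <= c / \<beta>\<close> v_pos[OF i] \<beta> c in auto)
  also have "... = K * c" by (simp add: K_def \<beta>_def)
  finally show ?thesis .
qed

text \<open>The last condition is the minimality of the regulator \<open>y\<close>, in the form
  \<open>y\<^sub>i(t) \<le> sup\<^sub>s\<^sub>\<le>\<^sub>t (- (x\<^sub>i + \<Sum>\<^sub>k\<^sub>\<noteq>\<^sub>i r\<^sub>i\<^sub>k y\<^sub>k)(s))\<^sup>+ / r\<^sub>i\<^sub>i\<close>.\<close>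

definition regulated :: "real => (nat => real => real) => (nat => real => real) => bool" where
  "regulated T x y \<longleftrightarrow> (\<forall>i<d.
     (\<forall>t\<in>{0..T}. 0 <= y i t) \<and> (\<forall>t\<in>{0..T}. \<forall>s\<in>{0..t}. y i s <= y i t) \<and>
     (\<forall>t\<in>{0..T}. 0 <= x i t + (\<Sum>k<d. r i k * y k t)) \<and>
     (\<forall>t\<in>{0..T}. \<forall>c\<ge>0. (\<forall>s\<in>{0..t}. 0 <= x i s + (\<Sum>k\<in>{..<d} - {i}. r i k * y k s) + r i i * c) --> y i t <= c))"

lemma
  assumes "regulated T x y" "i < d"
  shows regulated_nonneg: "0 <= t ==> t <= T ==> 0 <= y i t"
    and regulated_mono: "0 <= s ==> s <= t ==> t <= T ==> y i s <= y i t"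
    and regulated_feasible: "0 <= t ==> t <= T ==> 0 <= x i t + (\<Sum>k<d. r i k * y k t)"
    and regulated_least: "0 <= t ==> t <= T ==> 0 <= c ==>
      (\<And>s. 0 <= s ==> s <= t ==> 0 <= x i s + (\<Sum>k\<in>{..<d} - {i}. r i k * y k s) + r i i * c) ==> y i t <= c"
  using assms unfolding regulated_def by auto

text \<open>For fixed \<open>k\<close>, the level \<open>y' k s\<close>, raised by \<open>e\<close>
  and by the weighted supremum distances of the other coordinates (divided by the diagonal entry),
  is admissible for \<open>y k\<close> on \<open>[0, s]\<close>. Leastness turns this into
  \<open>r m <= e\<close> for the vector \<open>m\<close> of supremum distances, and
  \<open>max_principle\<close> applies.\<close>

lemma regulated_lipschitz:
  assumes y: "regulated T x y" and y': "regulated T x' y'" and T: "0 <= T" and e: "0 <= e"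
    and x: "\<And>i s. i < d ==> 0 <= s ==> s <= T ==> \<bar>x i s - x' i s\<bar> <= e"
    and i: "i < d" and t: "0 <= t" "t <= T"
  shows "\<bar>y i t - y' i t\<bar> <= K * e"
proof -
  define m where "m k = (SUP s\<in>{0..T}. \<bar>y k s - y' k s\<bar>)" for k
  have ne: "{0..T} \<noteq> {}" using T by simp
  have m: "\<bar>y k s - y' k s\<bar> <= m k" if "k < d" "0 <= s" "s <= T" for k s
    unfolding m_def
  proof (rule cSUP_upper)
    show "bdd_above ((\<lambda>s. \<bar>y k s - y' k s\<bar>) ` {0..T})"
    proof (rule bdd_aboveI2)
      fix s assume s: "s \<in> {0..T}"
      then show "\<bar>y k s - y' k s\<bar> <= y k T + y' k T"
        using regulated_nonneg[OF y \<open>k < d\<close>, of s] regulated_mono[OF y \<open>k < d\<close>, of s T]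
          regulated_nonneg[OF y' \<open>k < d\<close>, of s] regulated_mono[OF y' \<open>k < d\<close>, of s T] by auto
    qed
  qed (use that in auto)
  \<comment> \<open>Stated for arbitrary pairs, as it is applied once in each order to bound the
    absolute value.\<close>
  have one: "r k k * (y k s - y' k s) <= e - (\<Sum>j\<in>{..<d} - {k}. r k j * m j)"
    if y: "regulated T x y" and y': "regulated T x' y'"
      and x: "\<And>i s. i < d ==> 0 <= s ==> s <= T ==> \<bar>x i s - x' i s\<bar> <= e"
      and m: "\<And>k s. k < d ==> 0 <= s ==> s <= T ==> \<bar>y k s - y' k s\<bar> <= m k"
      and k: "k < d" and s: "0 <= s" "s <= T" for x x' y y' k s
  proof -
    let ?b = "\<Sum>j\<in>{..<d} - {k}. r k j * m j"
    have m0: "0 <= m j" if "j < d" for j using m[OF that, of 0] T by linarith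
    have b: "?b <= 0" by (intro sum_nonpos mult_nonpos_nonneg off_nonpos k) (auto intro: m0)
    define c where "c = y' k s + (e - ?b) / r k k"
    have rk: "0 < r k k" by (rule diag_pos[OF k])
    have rc: "r k k * c = r k k * y' k s + (e - ?b)" using rk by (simp add: c_def distrib_left)
    have "y k s <= c"
    proof (rule regulated_least[OF y k s])
      show "0 <= c" unfolding c_def
        using regulated_nonneg[OF y' k s] e b rk by (intro add_nonneg_nonneg divide_nonneg_pos) auto
      fix u assume u: "0 <= u" "u <= s"
      then have uT: "u <= T" using s by simp
      have "0 <= x' k u + (\<Sum>j<d. r k j * y' j u)" by (rule regulated_feasible[OF y' k u(1) uT])
      also have "... = x' k u + r k k * y' k u + (\<Sum>j\<in>{..<d} - {k}. r k j * y' j u)"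
        by (simp add: sum_split[OF k])
      also have "... <= (x k u + e) + r k k * y' k s + (\<Sum>j\<in>{..<d} - {k}. r k j * (y j u - m j))"
      proof (intro add_mono mult_left_mono off_mono[OF k])
        show "x' k u <= x k u + e" using x[OF k u(1) uT] by linarith
        show "y' k u <= y' k s" by (rule regulated_mono[OF y' k u s(2)])
        show "y j u - m j <= y' j u" if "j < d" for j using m[OF that u(1) uT] by linarith
      qed (use rk in simp)
      also have "... = x k u + (\<Sum>j\<in>{..<d} - {k}. r k j * y j u) + r k k * c"
        using rc by (simp add: algebra_simps sum_subtractf)
      finally show "0 <= x k u + (\<Sum>j\<in>{..<d} - {k}. r k j * y j u) + r k k * c" .
    qed
    then have "r k k * y k s <= r k k * c" using rk by simp
    then show ?thesis unfolding rc by (simp add: algebra_simps)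
  qed
  have "m i <= K * e"
  proof (rule max_principle[OF _ e i])
    fix k assume k: "k < d"
    let ?b = "\<Sum>j\<in>{..<d} - {k}. r k j * m j"
    have rk: "0 < r k k" by (rule diag_pos[OF k])
    have "m k <= (e - ?b) / r k k" unfolding m_def[of k]
    proof (rule cSUP_least[OF ne])
      fix s assume s: "s \<in> {0..T}"
      have "r k k * (y k s - y' k s) <= e - ?b" by (rule one[OF y y' x m k]) (use s in auto)
      moreover have "r k k * (y' k s - y k s) <= e - ?b"
        by (rule one[OF y' y _ _ k]) (use s x m in "auto simp: abs_minus_commute")
      ultimately show "\<bar>y k s - y' k s\<bar> <= (e - ?b) / r k k"
        using rk by (auto simp: abs_le_iff pos_le_divide_eq mult.commute)
    qed
    then show "(\<Sum>j<d. r k j * m j) <= e"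
      using rk by (simp add: sum_split[OF k] pos_le_divide_eq mult.commute)
  qed
  with m[OF i t] show ?thesis by linarith
qed

lemma regulated_unique:
  assumes "regulated T x y" "regulated T x y'" "i < d" "0 <= t" "t <= T"
  shows "y i t = y' i t"
  using regulated_lipschitz[OF assms(1,2) _ order.refl _ assms(3-5)] assms by simp

text \<open>The argument of \<open>regulated_lipschitz\<close> for increments over
  \<open>[a, b]\<close>: up to time \<open>a\<close> the level \<open>y k a\<close> suffices, and
  later it has to be raised only by the oscillation of \<open>x\<close> and the increments of the
  other regulators.\<close>

lemma regulated_oscillation:
  assumes y: "regulated T x y" and ab: "0 <= a" "a <= b" "b <= T" and e: "0 <= e"
    and x: "\<And>i s. i < d ==> a <= s ==> s <= b ==> \<bar>x i s - x i a\<bar> <= e" and i: "i < d"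
  shows "y i b - y i a <= K * e"
proof (rule max_principle[OF _ e i, of "\<lambda>i. y i b - y i a"])
  fix k assume k: "k < d"
  define m where "m j = y j b - y j a" for j
  have rk: "0 < r k k" by (rule diag_pos[OF k])
  let ?b = "\<Sum>j\<in>{..<d} - {k}. r k j * m j"
  have m0: "0 <= m j" if "j < d" for j using regulated_mono[OF y that ab] by (simp add: m_def)
  have b: "?b <= 0" by (intro sum_nonpos mult_nonpos_nonneg off_nonpos k) (auto intro: m0)
  define c where "c = y k a + (e - ?b) / r k k"
  have rc: "r k k * c = r k k * y k a + (e - ?b)" using rk by (simp add: c_def distrib_left)
  have yc: "y k a <= c" using e b rk by (simp add: c_def)
  have "y k b <= c"
  proof (rule regulated_least[OF y k])
    show "0 <= b" "b <= T" using ab by auto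
    show "0 <= c" using yc regulated_nonneg[OF y k, of a] ab by simp
    fix s assume s: "0 <= s" "s <= b"
    show "0 <= x k s + (\<Sum>j\<in>{..<d} - {k}. r k j * y j s) + r k k * c"
    proof (cases "s <= a")
      case True
      have "0 <= x k s + (\<Sum>j<d. r k j * y j s)" using ab s by (intro regulated_feasible[OF y k]) auto
      also have "... = x k s + (\<Sum>j\<in>{..<d} - {k}. r k j * y j s) + r k k * y k s" by (simp add: sum_split[OF k])
      also have "... <= x k s + (\<Sum>j\<in>{..<d} - {k}. r k j * y j s) + r k k * c"
        using rk regulated_mono[OF y k, of s a] yc True s ab by (intro add_left_mono mult_left_mono) auto
      finally show ?thesis .
    next
      case False
      have "0 <= x k a + (\<Sum>j<d. r k j * y j a)" using ab by (intro regulated_feasible[OF y k]) auto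
      also have "... = x k a + r k k * y k a + (\<Sum>j\<in>{..<d} - {k}. r k j * y j a)" by (simp add: sum_split[OF k])
      also have "... <= (x k s + e) + r k k * y k a + (\<Sum>j\<in>{..<d} - {k}. r k j * (y j s - m j))"
      proof (intro add_mono off_mono[OF k] order.refl)
        show "x k a <= x k s + e" using x[OF k, of s] False s by auto
        show "y j s - m j <= y j a" if "j < d" for j
          using regulated_mono[OF y that, of s b] s ab by (simp add: m_def)
      qed
      also have "... = x k s + (\<Sum>j\<in>{..<d} - {k}. r k j * y j s) + r k k * c"
        using rc by (simp add: algebra_simps sum_subtractf)
      finally show ?thesis .
    qed
  qed
  then have "r k k * y k b <= r k k * c" using rk by simp
  then have "(\<Sum>j<d. r k j * m j) <= e" unfolding rc by (simp add: sum_split[OF k] m_def[of k] algebra_simps)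
  then show "(\<Sum>j<d. r k j * (y j b - y j a)) <= e" by (simp add: m_def)
qed

section \<open>Existence of the least regulator, continuity and complementarity\<close>

definition feasible :: "(nat => real => real) => (nat => real => real) set" where
  "feasible x = {y. \<forall>i<d. (\<forall>t\<ge>0. 0 <= y i t) \<and> (\<forall>s\<ge>0. \<forall>t\<ge>s. y i s <= y i t) \<and>
     (\<forall>t\<ge>0. 0 <= x i t + (\<Sum>k<d. r i k * y k t))}"

lemma
  assumes "y \<in> feasible x" "i < d"
  shows feasible_nonneg: "0 <= t ==> 0 <= y i t"
    and feasible_mono: "0 <= s ==> s <= t ==> y i s <= y i t"
    and feasible_feasible: "0 <= t ==> 0 <= x i t + (\<Sum>k<d. r i k * y k t)"
  using assms unfolding feasible_def by auto

definition least_reg :: "(nat => real => real) => nat => real => real" where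
  "least_reg x i t = (INF y\<in>feasible x. y i t)"

text \<open>Large multiples of \<open>v\<close> are feasible: with \<open>A\<close> the running
  maxima of the components of \<open>x\<close>, the multiple below pushes coordinate
  \<open>i\<close> up by at least \<open>A i t\<close>.\<close>

lemma feasible_nonempty:
  assumes x: "\<And>i. i < d ==> continuous_on {0..} (x i)"
  shows "feasible x \<noteq> {}"
proof -
  define \<beta> where "\<beta> = Min (insert 1 ((\<lambda>i. \<Sum>j<d. r i j * v j) ` {..<d}))"
  have \<beta>: "0 < \<beta>" unfolding \<beta>_def using rv_pos by auto
  have \<beta>le: "\<beta> <= (\<Sum>j<d. r k j * v j)" if "k < d" for k
    unfolding \<beta>_def using that by (intro Min_le) auto
  define A where "A i t = (SUP s\<in>{0..t}. \<bar>x i s\<bar>)" for i t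
  have bdd: "bdd_above ((\<lambda>s. \<bar>x i s\<bar>) ` {0..t})" if "i < d" for i t
    by (intro bounded_imp_bdd_above compact_imp_bounded compact_continuous_image continuous_intros
        continuous_on_subset[OF x[OF that]]) auto
  have A: "\<bar>x i t\<bar> <= A i t" if "i < d" "0 <= t" for i t
    unfolding A_def by (rule cSUP_upper[OF _ bdd]) (use that in auto)
  have Amono: "A i s <= A i t" if "i < d" "0 <= s" "s <= t" for i s t
    unfolding A_def by (rule cSUP_subset_mono[OF _ bdd]) (use that in auto)
  have A0: "0 <= A i t" if "i < d" "0 <= t" for i t using A[OF that] by linarith
  define y where "y i t = v i * ((\<Sum>k<d. A k t) / \<beta>)" for i t
  have "y \<in> feasible x" unfolding feasible_def
  proof (intro CollectI allI impI conjI)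
    fix i assume i: "i < d"
    show "0 <= y i t" if "0 <= t" for t unfolding y_def
      using that v_pos[OF i] \<beta> by (intro mult_nonneg_nonneg divide_nonneg_nonneg sum_nonneg A0) (auto intro: less_imp_le)
    show "y i s <= y i t" if "0 <= s" "s <= t" for s t unfolding y_def
      by (intro mult_left_mono divide_right_mono sum_mono Amono less_imp_le[OF \<beta>] less_imp_le[OF v_pos[OF i]])
        (use that in auto)
    show "0 <= x i t + (\<Sum>k<d. r i k * y k t)" if t: "0 <= t" for t
    proof -
      let ?S = "\<Sum>k<d. A k t"
      have S: "A i t <= ?S" using i t by (intro member_le_sum A0) auto
      have S0: "0 <= ?S" using t by (intro sum_nonneg A0) auto
      have "A i t <= \<beta> * (?S / \<beta>)" using \<beta> S by simp
      also have "... <= (\<Sum>k<d. r i k * v k) * (?S / \<beta>)"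
        using i S0 \<beta> by (intro mult_right_mono \<beta>le) auto
      also have "... = (\<Sum>k<d. r i k * y k t)" unfolding y_def sum_distrib_right by (simp only: mult.assoc)
      finally show ?thesis using A[OF i t] by linarith
    qed
  qed
  then show ?thesis by blast
qed

text \<open>Nonpositive off-diagonal entries make pointwise infima feasible: lowering the other
  regulators only helps coordinate \<open>i\<close>, and the resulting lower bound on
  \<open>y i t\<close> passes to the infimum.\<close>

lemma least_reg_feasible:
  assumes x: "\<And>i. i < d ==> continuous_on {0..} (x i)"
  shows "least_reg x \<in> feasible x"
proof -
  have ne: "feasible x \<noteq> {}" by (rule feasible_nonempty) (rule x)
  have bdd: "bdd_below ((\<lambda>y. y i t) ` feasible x)" if "i < d" "0 <= t" for i t
    using feasible_nonneg[OF _ that(1) that(2)] by (intro bdd_belowI2[where m = 0])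
  have low: "least_reg x i t <= y i t" if "y \<in> feasible x" "i < d" "0 <= t" for y i t
    unfolding least_reg_def by (rule cINF_lower[OF bdd[OF that(2,3)] that(1)])
  show ?thesis unfolding feasible_def
  proof (intro CollectI allI impI conjI)
    fix i assume i: "i < d"
    show "0 <= least_reg x i t" if "0 <= t" for t
      unfolding least_reg_def by (rule cINF_greatest[OF ne], rule feasible_nonneg[OF _ i that])
    show "least_reg x i s <= least_reg x i t" if "0 <= s" "s <= t" for s t
      unfolding least_reg_def[of x i t]
    proof (rule cINF_greatest[OF ne])
      fix y assume y: "y \<in> feasible x"
      show "least_reg x i s <= y i t" using low[OF y i that(1)] feasible_mono[OF y i that] by linarith
    qed
    show "0 <= x i t + (\<Sum>k<d. r i k * least_reg x k t)" if t: "0 <= t" for t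
    proof -
      let ?b = "\<Sum>k\<in>{..<d} - {i}. r i k * least_reg x k t"
      have "- (x i t + ?b) / r i i <= least_reg x i t"
        unfolding least_reg_def[of x i t]
      proof (rule cINF_greatest[OF ne])
        fix y assume y: "y \<in> feasible x"
        have "0 <= x i t + r i i * y i t + (\<Sum>k\<in>{..<d} - {i}. r i k * y k t)"
          using feasible_feasible[OF y i t] by (simp add: sum_split[OF i])
        also have "... <= x i t + r i i * y i t + ?b"
          by (intro add_left_mono off_mono[OF i] low[OF y _ t])
        finally show "- (x i t + ?b) / r i i <= y i t"
          using diag_pos[OF i] by (simp add: pos_divide_le_eq algebra_simps)
      qed
      then show ?thesis using diag_pos[OF i] by (simp add: sum_split[OF i] pos_divide_le_eq algebra_simps)
    qed
  qed
qed

text \<open>Capping coordinate \<open>i\<close> at an admissible level \<open>c\<close> up to time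
  \<open>t\<close> leaves a feasible regulator \<open>z\<close>, so the infimum is at most
  \<open>c\<close> at time \<open>t\<close>.\<close>

lemma regulated_least_reg:
  assumes x: "\<And>i. i < d ==> continuous_on {0..} (x i)"
  shows "regulated T x (least_reg x)"
  unfolding regulated_def
proof (intro allI impI conjI ballI)
  have L: "least_reg x \<in> feasible x" by (rule least_reg_feasible) (rule x)
  fix i assume i: "i < d"
  show "0 <= least_reg x i t" if "t \<in> {0..T}" for t using feasible_nonneg[OF L i] that by auto
  show "least_reg x i s <= least_reg x i t" if "s \<in> {0..t}" for s t using feasible_mono[OF L i] that by auto
  show "0 <= x i t + (\<Sum>k<d. r i k * least_reg x k t)" if "t \<in> {0..T}" for t
    using feasible_feasible[OF L i] that by auto
  fix t c assume t: "t \<in> {0..T}" and c: "0 <= c"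
    and H: "\<forall>s\<in>{0..t}. 0 <= x i s + (\<Sum>k\<in>{..<d} - {i}. r i k * least_reg x k s) + r i i * c"
  define z where "z k s = (if k = i \<and> s <= t then min (least_reg x k s) c else least_reg x k s)" for k s
  have zle: "z k s <= least_reg x k s" for k s by (simp add: z_def)
  have "z \<in> feasible x" unfolding feasible_def
  proof (intro CollectI allI impI conjI)
    fix k assume k: "k < d"
    show "0 <= z k s" if "0 <= s" for s using feasible_nonneg[OF L k that] c by (auto simp: z_def min_def)
    show "z k s <= z k u" if "0 <= s" "s <= u" for s u
      using feasible_mono[OF L k that] that(2) by (auto simp: z_def min_def)
    show "0 <= x k s + (\<Sum>j<d. r k j * z j s)" if s: "0 <= s" for s
    proof (cases "z k s = least_reg x k s")
      case True
      have "0 <= x k s + r k k * least_reg x k s + (\<Sum>j\<in>{..<d} - {k}. r k j * least_reg x j s)"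
        using feasible_feasible[OF L k s] by (simp add: sum_split[OF k])
      also have "... <= x k s + r k k * z k s + (\<Sum>j\<in>{..<d} - {k}. r k j * z j s)"
        unfolding True by (intro add_left_mono off_mono[OF k] zle)
      finally show ?thesis by (simp add: sum_split[OF k])
    next
      case False
      then have ks: "k = i" "s <= t" "z k s = c" by (auto simp: z_def min_def split: if_splits)
      have "(\<Sum>j\<in>{..<d} - {i}. r i j * z j s) = (\<Sum>j\<in>{..<d} - {i}. r i j * least_reg x j s)"
        by (intro sum.cong) (auto simp: z_def)
      then show ?thesis using H s ks by (auto simp: sum_split[OF i] algebra_simps)
    qed
  qed
  then have "least_reg x i t <= z i t"
    unfolding least_reg_def using t feasible_nonneg[OF _ i, of _ x t]
    by (intro cINF_lower bdd_belowI2[where m = 0]) auto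
  also have "... <= c" by (simp add: z_def)
  finally show "least_reg x i t <= c" .
qed

text \<open>\<open>regulated_oscillation\<close> transfers the modulus of continuity of
  \<open>x\<close>. The horizon \<open>t + 1\<close> leaves room to the right of \<open>t\<close>;
  two points near \<open>t\<close> give the oscillation \<open>2 * e'\<close>, and \<open>e'\<close>
  is chosen so that \<open>K * (2 * e') < e\<close> even if \<open>K = 0\<close>.\<close>

lemma least_reg_continuous:
  assumes x: "\<And>i. i < d ==> continuous_on {0..} (x i)" and i: "i < d"
  shows "continuous_on {0..} (least_reg x i)"
proof -
  have "continuous (at t within {0..}) (least_reg x i)" if t: "0 <= t" for t
  proof -
    define T where "T = t + 1"
    have reg: "regulated T x (least_reg x)" by (rule regulated_least_reg[OF x])
    show ?thesis unfolding continuous_within_eps_delta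
    proof (intro allI impI)
      fix e :: real assume e: "0 < e"
      define e' where "e' = e / (2 * (K + 1))"
      have e': "0 < e'" "K * (2 * e') < e" using e K_nonneg by (auto simp: e'_def field_simps)
      have "\<exists>\<delta>>0. \<forall>s\<ge>0. \<bar>s - t\<bar> < \<delta> --> \<bar>x k s - x k t\<bar> < e'" if "k < d" for k
      proof -
        have "continuous (at t within {0..}) (x k)" using x[OF that] t by (simp add: continuous_on_eq_continuous_within)
        then show ?thesis using e' unfolding continuous_within_eps_delta dist_real_def by (metis atLeast_iff)
      qed
      then obtain \<delta> where \<delta>: "\<And>k. k < d ==> 0 < \<delta> k"
        "\<And>k s. k < d ==> 0 <= s ==> \<bar>s - t\<bar> < \<delta> k ==> \<bar>x k s - x k t\<bar> < e'" by metis
      define \<delta>0 where "\<delta>0 = Min (insert 1 (\<delta> ` {..<d}))"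
      have \<delta>0: "0 < \<delta>0" "\<delta>0 <= 1" "\<And>k. k < d ==> \<delta>0 <= \<delta> k" using \<delta>(1) by (auto simp: \<delta>0_def)
      have "\<bar>least_reg x i s - least_reg x i t\<bar> < e" if s: "0 <= s" "\<bar>s - t\<bar> < \<delta>0" for s
      proof -
        have osc: "\<bar>x k u - x k u'\<bar> <= 2 * e'" if "k < d" "min s t <= u" "u <= max s t" "min s t <= u'" "u' <= max s t" for k u u'
        proof -
          have "0 <= u" "\<bar>u - t\<bar> < \<delta> k" "0 <= u'" "\<bar>u' - t\<bar> < \<delta> k"
            using that s t \<delta>0(3)[OF that(1)] by (auto simp: min_def max_def split: if_splits)
          then show ?thesis using \<delta>(2)[OF that(1), of u] \<delta>(2)[OF that(1), of u'] by linarith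
        qed
        have "least_reg x i (max s t) - least_reg x i (min s t) <= K * (2 * e')"
          by (rule regulated_oscillation[OF reg]) (use s t \<delta>0 e' i osc in "auto simp: T_def min_def max_def")
        moreover have "least_reg x i (min s t) <= least_reg x i (max s t)"
          by (rule regulated_mono[OF reg i]) (use s t \<delta>0 in "auto simp: T_def")
        ultimately show ?thesis using e'(2) by (auto simp: min_def max_def split: if_splits)
      qed
      then show "\<exists>d>0. \<forall>x'\<in>{0..}. dist x' t < d --> dist (least_reg x i x') (least_reg x i t) < e"
        using \<delta>0(1) by (auto simp: dist_real_def intro!: exI[of _ \<delta>0])
    qed
  qed
  then show ?thesis by (simp add: continuous_on_eq_continuous_within)
qed

text \<open>Freeze coordinate \<open>i\<close> at its final level \<open>y i t\<close> and let
  \<open>f\<close> be the resulting path. If the second alternative fails, \<open>f\<close> has a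
  positive minimum on \<open>[0, t]\<close>, attained by continuity; then a smaller level would be
  admissible, against leastness, unless \<open>y i t = 0\<close>.\<close>

lemma regulated_complementary:
  assumes y: "regulated T x y" and t: "0 <= t" "t <= T" and i: "i < d"
    and cont: "\<And>k. k < d ==> continuous_on {0..T} (x k)" "\<And>k. k < d ==> continuous_on {0..T} (y k)"
  shows "y i t = 0 \<or> (\<exists>s. 0 <= s \<and> s <= t \<and> x i s + (\<Sum>k<d. r i k * y k s) = 0 \<and> y i s = y i t)"
proof (rule disjCI)
  assume none: "\<not> (\<exists>s. 0 <= s \<and> s <= t \<and> x i s + (\<Sum>k<d. r i k * y k s) = 0 \<and> y i s = y i t)"
  have ri: "0 < r i i" by (rule diag_pos[OF i])
  define f where "f s = x i s + (\<Sum>k\<in>{..<d} - {i}. r i k * y k s) + r i i * y i t" for s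
  have "continuous_on {0..t} f" unfolding f_def
    using t i by (intro continuous_intros continuous_on_subset[OF cont(1)] continuous_on_subset[OF cont(2)]) auto
  then obtain u where u: "u \<in> {0..t}" "\<And>s. s \<in> {0..t} ==> f u <= f s"
    using continuous_attains_inf[of "{0..t}" f] t by auto
  have uT: "0 <= u" "u <= T" "u <= t" using u t by auto
  have z: "f u = (x i u + (\<Sum>k<d. r i k * y k u)) + r i i * (y i t - y i u)"
    by (simp add: f_def sum_split[OF i] algebra_simps)
  have g1: "0 <= x i u + (\<Sum>k<d. r i k * y k u)" by (rule regulated_feasible[OF y i uT(1,2)])
  have g2: "0 <= y i t - y i u" using regulated_mono[OF y i uT(1,3) t(2)] by simp
  have g3: "0 <= r i i * (y i t - y i u)" using ri g2 by simp
  have "0 < f u"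
  proof (rule ccontr)
    assume "\<not> 0 < f u"
    then have "x i u + (\<Sum>k<d. r i k * y k u) = 0" "r i i * (y i t - y i u) = 0"
      using z g1 g3 by linarith+
    then have "x i u + (\<Sum>k<d. r i k * y k u) = 0 \<and> y i u = y i t" using ri by simp
    then show False using none uT by blast
  qed
  define c where "c = max 0 (y i t - f u / r i i)"
  have c: "y i t - c <= f u / r i i" by (simp add: c_def)
  have "y i t <= c"
  proof (rule regulated_least[OF y i t])
    show "0 <= c" by (simp add: c_def)
    fix s assume s: "0 <= s" "s <= t"
    have "r i i * (y i t - c) <= f u" using c ri by (simp add: pos_le_divide_eq mult.commute)
    also have "f u <= f s" using u(2) s by simp
    finally show "0 <= x i s + (\<Sum>k\<in>{..<d} - {i}. r i k * y k s) + r i i * c"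
      by (simp add: f_def algebra_simps)
  qed
  moreover have "0 < f u / r i i" using \<open>0 < f u\<close> ri by simp
  ultimately have "y i t <= 0" by (auto simp: c_def max_def split: if_splits)
  then show "y i t = 0" using regulated_nonneg[OF y i t] by simp
qed

text \<open>Where \<open>y i 0\<close> is positive, complementarity forces
  \<open>x + r y = 0\<close> at time 0 in that coordinate, hence \<open>(r y) i <= 0\<close> as
  \<open>x\<close> starts nonnegative; \<open>max_principle\<close> with \<open>c = 0\<close> leaves
  only \<open>y i 0 = 0\<close>.\<close>

lemma regulated_start:
  assumes y: "regulated T x y" and T: "0 <= T" and i: "i < d"
    and x0: "\<And>i. i < d ==> 0 <= x i 0"
    and cont: "\<And>k. k < d ==> continuous_on {0..T} (x k)" "\<And>k. k < d ==> continuous_on {0..T} (y k)"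
  shows "y i 0 = 0"
proof -
  have "y i 0 <= K * 0"
  proof (rule max_principle[OF _ order.refl i, of "\<lambda>i. y i 0"])
    fix k assume k: "k < d" and pos: "0 < y k 0"
    have "x k 0 + (\<Sum>j<d. r k j * y j 0) = 0"
      using regulated_complementary[OF y order.refl T k cont] pos by auto
    then show "(\<Sum>j<d. r k j * y j 0) <= 0" using x0[OF k] by linarith
  qed
  then show ?thesis using regulated_nonneg[OF y i order.refl T] by simp
qed

text \<open>Restart at time \<open>a\<close> from the reflected state. A level admissible after
  \<open>a\<close> becomes admissible from time 0 on when \<open>y i a\<close> is added, since up to
  \<open>a\<close> that amount already suffices.\<close>

lemma regulated_shift:
  assumes y: "regulated (a + T) x y" and a: "0 <= a"
  shows "regulated T (\<lambda>i t. (x i a + (\<Sum>k<d. r i k * y k a)) + (x i (a + t) - x i a)) (\<lambda>i t. y i (a + t) - y i a)"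
  unfolding regulated_def
proof (intro allI impI conjI ballI)
  fix i assume i: "i < d"
  show "0 <= y i (a + t) - y i a" if "t \<in> {0..T}" for t
    using regulated_mono[OF y i a, of "a + t"] that by simp
  show "y i (a + s) - y i a <= y i (a + t) - y i a" if "t \<in> {0..T}" "s \<in> {0..t}" for s t
    using regulated_mono[OF y i, of "a + s" "a + t"] that a by simp
  have eq: "x i a + (\<Sum>k<d. r i k * y k a) + (x i (a + t) - x i a) + (\<Sum>k<d. r i k * (y k (a + t) - y k a))
      = x i (a + t) + (\<Sum>k<d. r i k * y k (a + t))" for t
    by (simp add: algebra_simps sum_subtractf)
  show "0 <= x i a + (\<Sum>k<d. r i k * y k a) + (x i (a + t) - x i a) + (\<Sum>k<d. r i k * (y k (a + t) - y k a))"
    if "t \<in> {0..T}" for t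
    unfolding eq by (rule regulated_feasible[OF y i]) (use that a in auto)
  fix t c assume t: "t \<in> {0..T}" and c: "0 <= c"
    and H: "\<forall>s\<in>{0..t}. 0 <= x i a + (\<Sum>k<d. r i k * y k a) + (x i (a + s) - x i a) +
        (\<Sum>k\<in>{..<d} - {i}. r i k * (y k (a + s) - y k a)) + r i i * c"
  have "y i (a + t) <= c + y i a"
  proof (rule regulated_least[OF y i])
    show "0 <= a + t" "a + t <= a + T" using a t by auto
    show "0 <= c + y i a" using c regulated_nonneg[OF y i a] t by auto
    fix s assume s: "0 <= s" "s <= a + t"
    show "0 <= x i s + (\<Sum>k\<in>{..<d} - {i}. r i k * y k s) + r i i * (c + y i a)"
    proof (cases "s <= a")
      case True
      have "0 <= x i s + (\<Sum>k<d. r i k * y k s)" using s t True by (intro regulated_feasible[OF y i]) auto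
      also have "... = x i s + (\<Sum>k\<in>{..<d} - {i}. r i k * y k s) + r i i * y i s" by (simp add: sum_split[OF i])
      also have "... <= x i s + (\<Sum>k\<in>{..<d} - {i}. r i k * y k s) + r i i * (c + y i a)"
        using diag_pos[OF i] regulated_mono[OF y i s(1) True] t c by (intro add_left_mono mult_left_mono) auto
      finally show ?thesis .
    next
      case False
      then have "s - a \<in> {0..t}" using s by auto
      from H[rule_format, OF this] show ?thesis
        by (simp add: sum_split[OF i] algebra_simps sum_subtractf)
    qed
  qed
  then show "y i (a + t) - y i a <= c" by simp
qed

end

text \<open>\<open>C\<close> is an initial segment of \<open>(0, t]\<close>, with or without its
  right end point. As \<open>F\<close> is only right continuous, the case without end point is
  exhausted from inside by intervals \<open>(0, u n]\<close>.\<close>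

lemma emeasure_interval_measure_initial_le:
  fixes F :: "real => real"
  assumes mono: "\<And>x y. x <= y ==> F x <= F y" and cont: "\<And>a. continuous (at_right a) F"
    and F0: "F 0 = 0" and c: "0 <= c" and C: "C \<subseteq> {0<..t}" "\<And>s u. s \<in> C ==> 0 < u ==> u <= s ==> u \<in> C"
    and le: "\<And>s. s \<in> C ==> F s <= c"
  shows "emeasure (interval_measure F) C <= ennreal c"
proof (cases "C = {}")
  case False
  define s0 where "s0 = Sup C"
  have bdd: "bdd_above C" using C(1) by (intro bdd_aboveI[of _ t]) auto
  have up: "s <= s0" if "s \<in> C" for s unfolding s0_def by (rule cSup_upper[OF that bdd])
  have low: "u \<in> C" if "0 < u" "u < s0" for u
    using less_cSup_iff[OF False bdd, of u] that C(2) by (auto simp: s0_def)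
  have Ioc: "emeasure (interval_measure F) {0<..s} <= ennreal c" if "s \<in> C" for s
    using that C(1) le[OF that] by (subst emeasure_interval_measure_Ioc[OF _ mono cont]) (auto simp: F0 intro!: ennreal_leI)
  obtain s1 where s1: "s1 \<in> C" using False by blast
  then have "0 < s0" using up[OF s1] C(1) by fastforce
  show ?thesis
  proof (cases "s0 \<in> C")
    case True
    then have "C = {0<..s0}" using up C(1) low by (auto simp: le_less)
    then show ?thesis using Ioc[OF True] by simp
  next
    case notin: False
    define u where "u n = s0 - s0 / real (n + 2)" for n
    have u: "0 < u n" "u n < s0" for n using \<open>0 < s0\<close> by (auto simp: u_def field_simps add_pos_nonneg)
    have "incseq u" using \<open>0 < s0\<close> by (auto simp: u_def incseq_def field_simps)
    have lim: "u \<longlonglongrightarrow> s0 - 0" unfolding u_def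
      by (intro tendsto_diff tendsto_const real_tendsto_divide_at_top[OF tendsto_const] filterlim_compose[OF filterlim_real_sequentially filterlim_add_const_nat_at_top])
    have "C \<subseteq> (\<Union>n. {0<..u n})"
    proof
      fix s assume s: "s \<in> C"
      then have "s < s0" "0 < s" using up[OF s] notin C(1) by (auto simp: le_less)
      then have "\<forall>\<^sub>F n in sequentially. s < u n" using lim by (intro order_tendstoD(1)) auto
      then obtain n where "s < u n" by (auto simp: eventually_sequentially)
      then show "s \<in> (\<Union>n. {0<..u n})" using \<open>0 < s\<close> by (intro UN_I[of n]) simp_all
    qed
    then have "emeasure (interval_measure F) C <= emeasure (interval_measure F) (\<Union>n. {0<..u n})"
      by (intro emeasure_mono) auto
    also have "... = (SUP n. emeasure (interval_measure F) {0<..u n})"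
    proof (rule SUP_emeasure_incseq[symmetric])
      show "incseq (\<lambda>n. {0<..u n})"
        using incseq_SucD[OF \<open>incseq u\<close>] by (intro incseq_SucI subsetI) (metis greaterThanAtMost_iff order_trans)
    qed auto
    also have "... <= ennreal c" using Ioc low u by (intro SUP_least) auto
    finally show ?thesis .
  qed
qed simp

section \<open>Least levels and Stieltjes complementarity\<close>

context nonsingular_M
begin

text \<open>This direction yields uniqueness among cadlag solutions. If \<open>y i t\<close>
  exceeded an admissible level \<open>c\<close>, take \<open>c'\<close> halfway between them: where
  \<open>y i > c'\<close> the reflected path is at least \<open>\<delta> > 0\<close>, so
  complementarity makes that set null, while the part with \<open>y i <= c'\<close> has mass at most
  \<open>c'\<close>. But the total mass of \<open>(0, t]\<close> is
  \<open>y i t > c'\<close>.\<close>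

lemma regulatedI_cadlag:
  fixes x y z :: "nat => real => real"
  assumes z: "\<And>i t. i < d ==> 0 <= t ==> z i t = x i t + (\<Sum>k<d. r i k * y k t)"
    and nonneg: "\<And>i t. i < d ==> 0 <= t ==> 0 <= z i t" "\<And>i t. i < d ==> 0 <= t ==> 0 <= y i t"
    and mono: "\<And>i s t. i < d ==> 0 <= s ==> s <= t ==> y i s <= y i t"
    and y0: "\<And>i. i < d ==> y i 0 = 0"
    and rc: "\<And>i t. i < d ==> 0 <= t ==> continuous (at_right t) (y i)"
    and compl: "\<And>i. i < d ==> (\<integral>\<^sup>+t\<in>{0..}. ennreal (z i t) \<partial>interval_measure (\<lambda>t. y i (max 0 t))) = 0"
  shows "regulated T x y"
  unfolding regulated_def
proof (intro allI impI conjI ballI)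
  fix i assume i: "i < d"
  show "0 <= y i t" if "t \<in> {0..T}" for t using nonneg(2)[OF i] that by auto
  show "y i s <= y i t" if "s \<in> {0..t}" for s t using mono[OF i] that by auto
  show "0 <= x i t + (\<Sum>k<d. r i k * y k t)" if "t \<in> {0..T}" for t using nonneg(1)[OF i, of t] z[OF i, of t] that by auto
  fix t c assume t: "t \<in> {0..T}" and c: "0 <= c"
    and H: "\<forall>s\<in>{0..t}. 0 <= x i s + (\<Sum>k\<in>{..<d} - {i}. r i k * y k s) + r i i * c"
  show "y i t <= c"
  proof (rule ccontr)
    assume "\<not> y i t <= c"
    then have ct: "c < y i t" by simp
    define c' where "c' = (c + y i t) / 2"
    have c': "c < c'" "c' < y i t" "0 <= c'" using ct c by (auto simp: c'_def)
    define F where "F s = y i (max 0 s)" for s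
    have Fmono: "F a <= F b" if "a <= b" for a b using mono[OF i, of "max 0 a" "max 0 b"] that by (simp add: F_def)
    have Fcont: "continuous (at_right a) F" for a
    proof (cases "0 <= a")
      case True
      have "\<forall>\<^sub>F s in at_right a. F s = y i s"
        using True by (auto simp: F_def eventually_at_filter intro!: always_eventually)
      then show ?thesis using rc[OF i True] True
        by (auto simp: continuous_within F_def cong: filterlim_cong intro: tendsto_cong[THEN iffD1])
    next
      case False
      then have "\<forall>\<^sub>F s in at_right a. s < 0" by (intro eventually_at_right_less[THEN eventually_mono] order_tendstoD(2)[OF tendsto_ident_at]) auto
      then have "\<forall>\<^sub>F s in at_right a. F s = y i 0" by eventually_elim (simp add: F_def max_def)
      then have "(F \<longlongrightarrow> y i 0) (at_right a)" by (rule tendsto_eventually)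
      then show ?thesis using False by (simp add: continuous_within F_def max_def)
    qed
    let ?\<mu> = "interval_measure F"
    have "F \<in> borel_measurable borel" by (rule borel_measurable_mono) (simp add: mono_def Fmono)
    then have "{s \<in> space borel. F s > c'} \<in> sets borel" by (rule borel_measurable_less[OF borel_measurable_const])
    then have Dm: "{0<..t} \<inter> {s. F s > c'} \<in> sets borel" by auto
    let ?D = "{0<..t} \<inter> {s. F s > c'}"
    let ?C = "{0<..t} \<inter> {s. F s <= c'}"
    have ri: "0 < r i i" by (rule diag_pos[OF i])
    define \<delta> where "\<delta> = r i i * (c' - c)"
    have \<delta>: "0 < \<delta>" using ri c' by (simp add: \<delta>_def)
    have "ennreal \<delta> * emeasure ?\<mu> ?D = (\<integral>\<^sup>+s. ennreal \<delta> * indicator ?D s \<partial>?\<mu>)"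
      using Dm by (subst nn_integral_cmult_indicator) auto
    also have "... <= (\<integral>\<^sup>+s\<in>{0..}. ennreal (z i s) \<partial>?\<mu>)"
    proof (rule nn_integral_mono)
      fix s show "ennreal \<delta> * indicator ?D s <= ennreal (z i s) * indicator {0..} s"
      proof (cases "s \<in> ?D")
        case True
        then have s: "0 <= s" "s \<in> {0..t}" "c' < y i s" by (auto simp: F_def max_def)
        have "\<delta> <= r i i * (y i s - c)" unfolding \<delta>_def using ri s by (intro mult_left_mono) auto
        also have "... <= z i s" using H[rule_format, OF s(2)] by (simp add: z[OF i s(1)] sum_split[OF i] algebra_simps)
        finally show ?thesis using True by (auto simp: indicator_def intro!: ennreal_leI)
      qed simp
    qed
    also have "... = 0" using compl[OF i] by (simp add: F_def[abs_def])
    finally have D0: "emeasure ?\<mu> ?D = 0" using \<delta> by (simp add: ennreal_zero_less_mult_iff)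
    have F0: "F 0 = 0" using y0[OF i] by (simp add: F_def)
    have C: "emeasure ?\<mu> ?C <= ennreal c'"
      by (rule emeasure_interval_measure_initial_le[OF Fmono Fcont F0 c'(3), where t = t]) (auto intro: order_trans[OF Fmono])
    have Cm: "?C \<in> sets borel"
    proof -
      have "?C = {0<..t} - ?D" by auto
      then show ?thesis using Dm by simp
    qed
    have Ft: "F t = y i t" using t by (simp add: F_def max_def)
    have "ennreal (y i t) = emeasure ?\<mu> {0<..t}"
      using t by (subst emeasure_interval_measure_Ioc[OF _ Fmono Fcont]) (auto simp: F0 Ft)
    also have "{0<..t} = ?C \<union> ?D" by auto
    also have "emeasure ?\<mu> (?C \<union> ?D) <= emeasure ?\<mu> ?C + emeasure ?\<mu> ?D"
      using Cm Dm by (intro emeasure_subadditive) auto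
    also have "... <= ennreal c'" using C D0 by simp
    finally show False using c' by (simp add: ennreal_le_iff)
  qed
qed

text \<open>Away from time 0, the set where \<open>z > 0\<close> is covered by countably many
  rational intervals on which \<open>z\<close> stays positive; on each of them complementarity makes
  \<open>y\<close> constant, so it is null for the Stieltjes measure.\<close>

lemma complementary_integral:
  fixes z y :: "real => real"
  assumes z: "continuous_on {0..} z" and y: "continuous_on {0..} y"
    and zn: "\<And>t. 0 <= t ==> 0 <= z t" and yn: "\<And>t. 0 <= t ==> 0 <= y t"
    and mono: "\<And>s t. 0 <= s ==> s <= t ==> y s <= y t"
    and compl: "\<And>t. 0 <= t ==> y t = 0 \<or> (\<exists>s. 0 <= s \<and> s <= t \<and> z s = 0 \<and> y s = y t)"
  shows "(\<integral>\<^sup>+t\<in>{0..}. ennreal (z t) \<partial>interval_measure (\<lambda>t. y (max 0 t))) = 0"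
proof -
  define F where "F s = y (max 0 s)" for s
  let ?\<mu> = "interval_measure F"
  have Fmono: "F a <= F b" if "a <= b" for a b using mono[of "max 0 a" "max 0 b"] that by (simp add: F_def)
  have "continuous_on UNIV F" unfolding F_def
    by (intro continuous_on_compose2[OF y] continuous_intros) auto
  then have Fcont: "continuous (at_right a) F" for a
    by (simp add: continuous_at_imp_continuous_at_within continuous_on_eq_continuous_within)
  have null: "emeasure ?\<mu> {a<..b} = 0" if "a <= b" "F a = F b" for a b
    using that by (subst emeasure_interval_measure_Ioc[OF _ Fmono Fcont]) auto
  define P where "P = {(a::rat, b::rat). 0 <= a \<and> a <= b \<and> (\<forall>t\<in>{of_rat a..of_rat b}. 0 < z t)}"
  \<comment> \<open>The extra interval \<open>(-1, 0]\<close> accounts for time 0, which no interval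
    with nonnegative rational left end contains as \<open>(a, b]\<close>; \<open>F\<close> is
    constant on it.\<close>
  define N where "N = {-1<..(0::real)} \<union> (\<Union>(a, b)\<in>P. {of_rat a<..of_rat b})"
  have const: "F (of_rat a) = F (of_rat b)" if "(a, b) \<in> P" for a b
  proof -
    have ab: "0 <= real_of_rat a" "real_of_rat a <= of_rat b" "\<And>t. of_rat a <= t ==> t <= of_rat b ==> 0 < z t"
      using that by (auto simp: P_def of_rat_less_eq)
    have b0: "0 <= real_of_rat b" using ab by linarith
    have Fab: "F (of_rat a) = y (of_rat a)" "F (of_rat b) = y (of_rat b)" using ab(1) b0 by (simp_all add: F_def max_def)
    from compl[OF b0] show ?thesis
    proof (elim disjE exE conjE)
      assume "y (of_rat b) = 0"
      then have "y (of_rat a) = 0" using mono[OF ab(1,2)] yn[OF ab(1)] by simp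
      then show ?thesis using \<open>y (of_rat b) = 0\<close> by (simp add: Fab)
    next
      fix s assume s: "0 <= s" "s <= of_rat b" "z s = 0" "y s = y (of_rat b)"
      \<comment> \<open>The interval contains no zero of \<open>z\<close>, so \<open>y\<close>
        reached its final level before the left end.\<close>
      have "s <= of_rat a"
      proof (rule ccontr)
        assume "\<not> s <= of_rat a"
        then have "0 < z s" using s by (intro ab(3)) auto
        then show False using s by simp
      qed
      then show ?thesis using mono[OF s(1), of "of_rat a"] mono[OF ab(1,2)] s(4) by (simp add: Fab)
    qed
  qed
  have null_N: "N \<in> null_sets ?\<mu>" unfolding N_def
  proof (intro null_sets.Un null_sets_UN')
    show "{-1<..(0::real)} \<in> null_sets ?\<mu>" using null[of "-1" 0] by (auto simp: null_sets_def F_def)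
    show "countable P" by simp
    fix p assume "p \<in> P"
    then show "(case p of (a, b) => {of_rat a<..of_rat b}) \<in> null_sets ?\<mu>"
      using const null by (cases p) (auto simp: null_sets_def P_def of_rat_less_eq)
  qed
  have inN: "t \<in> N" if t: "0 <= t" "0 < z t" for t
  proof (cases "t = 0")
    case False
    then have "0 < t" using t by simp
    have "continuous (at t within {0..}) z" using z t by (simp add: continuous_on_eq_continuous_within)
    then obtain \<delta> where \<delta>: "0 < \<delta>" "\<And>s. 0 <= s ==> \<bar>s - t\<bar> < \<delta> ==> \<bar>z s - z t\<bar> < z t"
      using t(2) unfolding continuous_within_eps_delta dist_real_def by (metis atLeast_iff)
    obtain a where a: "max 0 (t - \<delta>) < of_rat a" "of_rat a < t" using of_rat_dense[of "max 0 (t - \<delta>)" t] \<open>0 < t\<close> \<delta>(1) by auto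
    obtain b where b: "t < of_rat b" "of_rat b < t + \<delta>" using of_rat_dense[of t "t + \<delta>"] \<delta>(1) by auto
    have "0 < z s" if "of_rat a <= s" "s <= of_rat b" for s
    proof -
      have "0 <= s" using a(1) that(1) by linarith
      moreover have "\<bar>s - t\<bar> < \<delta>" using a(1) b(2) that by linarith
      ultimately have "\<bar>z s - z t\<bar> < z t" by (rule \<delta>(2))
      then show ?thesis by linarith
    qed
    moreover have "real_of_rat 0 < of_rat a" "real_of_rat a < of_rat b" using a b by auto
    ultimately have "(a, b) \<in> P" unfolding P_def of_rat_less by auto
    then show ?thesis using a b unfolding N_def by fastforce
  qed (simp add: N_def)
  have "{t \<in> space ?\<mu>. ennreal (z t) * indicator {0..} t \<noteq> 0} \<subseteq> N"
  proof
    fix t assume "t \<in> {t \<in> space ?\<mu>. ennreal (z t) * indicator {0..} t \<noteq> 0}"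
    then have "0 <= t" "z t \<noteq> 0" by (auto simp: indicator_def split: if_splits)
    then show "t \<in> N" using zn[of t] by (intro inN) auto
  qed
  with null_N have "AE t in ?\<mu>. ennreal (z t) * indicator {0..} t = 0" by (rule AE_I')
  then have "(\<integral>\<^sup>+t\<in>{0..}. ennreal (z t) \<partial>?\<mu>) = (\<integral>\<^sup>+t. 0 \<partial>?\<mu>)" by (rule nn_integral_cong_AE)
  then show ?thesis by (simp add: F_def[abs_def])
qed

end

section \<open>The Skorokhod map on continuous paths\<close>

lemma mult_mat_vec_index:
  "A \<in> carrier_mat n m ==> u \<in> carrier_vec m ==> i < n ==> (A *\<^sub>v u) $ i = (\<Sum>k<m. A $$ (i, k) * u $ k)"
  by (auto simp: scalar_prod_def atLeast0LessThan intro!: sum.cong)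

locale reflection =
  fixes d :: nat and R :: "real mat" and v :: "nat => real"
  assumes R_carrier: "R \<in> carrier_mat d d"
    and nonsingular: "nonsingular_M d (\<lambda>i j. R $$ (i, j)) v"
begin

sublocale nonsingular_M d "\<lambda>i j. R $$ (i, j)" v by (rule nonsingular)

text \<open>Defined on all continuous paths, also those that start outside the orthant, so that
  Lipschitz bounds and measurability carry no condition on the start; \<open>reflected_eq\<close>
  identifies the reflected path with \<open>reflected\<close> for nonnegative starts.\<close>

definition reg_path :: "(real => real vec) => real => real vec" where
  "reg_path X = (\<lambda>t\<in>{0..}. Matrix.vec d (\<lambda>i. least_reg (\<lambda>i t. X t $ i) i t))"

definition refl_path :: "(real => real vec) => real => real vec" where
  "refl_path X = (\<lambda>t\<in>{0..}. Matrix.vec d (\<lambda>i. X t $ i + (\<Sum>k<d. R $$ (i, k) * reg_path X t $ k)))"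

lemma reg_path_cont_paths: "X \<in> cont_paths d ==> reg_path X \<in> cont_paths d"
  unfolding reg_path_def by (intro cont_paths_vecI least_reg_continuous cont_paths_continuous)

lemma refl_path_cont_paths: "X \<in> cont_paths d ==> refl_path X \<in> cont_paths d"
  unfolding refl_path_def
  by (intro cont_paths_vecI continuous_intros; rule cont_paths_continuous) (auto intro: reg_path_cont_paths)

lemma refl_path_index:
  "0 <= t ==> i < d ==> refl_path X t $ i = X t $ i + (\<Sum>k<d. R $$ (i, k) * reg_path X t $ k)"
  by (simp add: refl_path_def)

lemma regulated_cong:
  assumes "\<And>i t. i < d ==> 0 <= t ==> t <= T ==> x i t = x' i t" "\<And>i t. i < d ==> 0 <= t ==> t <= T ==> y i t = y' i t"
    and "regulated T x y"
  shows "regulated T x' y'"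
proof -
  have 1: "(\<Sum>k<d. R $$ (i, k) * y k s) = (\<Sum>k<d. R $$ (i, k) * y' k s)" if "0 <= s" "s <= T" for i s
    using assms(2) that by (intro sum.cong) auto
  have 2: "(\<Sum>k\<in>{..<d} - {i}. R $$ (i, k) * y k s) = (\<Sum>k\<in>{..<d} - {i}. R $$ (i, k) * y' k s)" if "0 <= s" "s <= T" for i s
    using assms(2) that by (intro sum.cong) auto
  show ?thesis unfolding regulated_def
  proof (intro allI impI conjI ballI)
    fix i assume i: "i < d"
    show "0 <= y' i t" if "t \<in> {0..T}" for t
      using regulated_nonneg[OF assms(3) i, of t] assms(2)[OF i, of t] that by simp
    show "y' i s <= y' i t" if "t \<in> {0..T}" "s \<in> {0..t}" for s t
      using regulated_mono[OF assms(3) i, of s t] assms(2)[OF i] that by simp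
    show "0 <= x' i t + (\<Sum>k<d. R $$ (i, k) * y' k t)" if "t \<in> {0..T}" for t
      using regulated_feasible[OF assms(3) i, of t] assms(1)[OF i] 1[of t i] that by simp
    fix t c assume t: "t \<in> {0..T}" and c: "0 <= c"
      and H: "\<forall>s\<in>{0..t}. 0 <= x' i s + (\<Sum>k\<in>{..<d} - {i}. R $$ (i, k) * y' k s) + R $$ (i, i) * c"
    have "y i t <= c"
    proof (rule regulated_least[OF assms(3) i])
      show "0 <= t" "t <= T" using t by auto
      fix s assume s: "0 <= s" "s <= t"
      then have "s <= T" using t by simp
      with H[rule_format, of s] s 2[of s i] assms(1)[OF i s(1)]
      show "0 <= x i s + (\<Sum>k\<in>{..<d} - {i}. R $$ (i, k) * y k s) + R $$ (i, i) * c" by simp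
    qed (use c in auto)
    then show "y' i t <= c" using assms(2)[OF i] t by simp
  qed
qed

lemma regulated_reg_path:
  assumes "X \<in> cont_paths d"
  shows "regulated T (\<lambda>i t. X t $ i) (\<lambda>i t. reg_path X t $ i)"
  by (rule regulated_cong[OF refl _ regulated_least_reg])
    (auto simp: reg_path_def intro: cont_paths_continuous[OF assms])

lemma reg_path_eqI:
  assumes "X \<in> cont_paths d" "regulated T (\<lambda>i t. X t $ i) y" "i < d" "0 <= t" "t <= T"
  shows "reg_path X t $ i = y i t"
  by (rule regulated_unique[OF regulated_reg_path[OF assms(1)] assms(2-5)])

lemma cont_paths_cadlag: "X \<in> cont_paths d ==> X \<in> cadlag_paths d"
  unfolding cadlag_paths_def
proof (intro CollectI conjI allI impI)
  assume X: "X \<in> cont_paths d"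
  then show "X \<in> {0..} \<rightarrow>\<^sub>E carrier_vec d" by (simp add: cont_paths_def)
  fix i assume i: "i < d"
  have c: "continuous (at t within {0..}) (\<lambda>s. X s $ i)" if "0 <= t" for t
    using cont_paths_continuous[OF X i] that by (simp add: continuous_on_eq_continuous_within)
  show "continuous (at_right t) (\<lambda>s. X s $ i)" if "0 <= t" for t
    using that by (intro continuous_within_subset[OF c]) auto
  show "\<exists>l. ((\<lambda>s. X s $ i) \<longlongrightarrow> l) (at_left t)" if t: "0 < t" for t
  proof -
    have "continuous (at t within {0..}) (\<lambda>s. X s $ i)" using t c by simp
    then have "continuous (at t within {0<..}) (\<lambda>s. X s $ i)" by (rule continuous_within_subset) auto
    then have "continuous (at t) (\<lambda>s. X s $ i)" using t by (simp add: at_within_open[of t "{0<..}"])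
    then have "((\<lambda>s. X s $ i) \<longlongrightarrow> X t $ i) (at t)" by (simp add: continuous_within)
    then show ?thesis by (auto simp: filterlim_at_split)
  qed
qed

lemma skorokhod_solution_regulated:
  assumes X: "X \<in> cont_paths d" and sol: "skorokhod_solution d R X z y"
  shows "regulated T (\<lambda>i t. X t $ i) (\<lambda>i t. y t $ i)"
proof (rule regulatedI_cadlag[where z = "\<lambda>i t. z t $ i"])
  note S = sol[unfolded skorokhod_solution_def]
  have yc: "y t \<in> carrier_vec d" if "0 <= t" for t using S that by (auto simp: cadlag_paths_def PiE_def Pi_def)
  fix i assume i: "i < d"
  show "z t $ i = X t $ i + (\<Sum>k<d. R $$ (i, k) * y t $ k)" if t: "0 <= t" for t
  proof -
    have "z t = X t + R *\<^sub>v y t" using S t by blast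
    then show ?thesis using i R_carrier cont_paths_carrier[OF X t]
      by (simp add: mult_mat_vec_index[OF R_carrier yc[OF t] i] del: index_mult_mat_vec)
  qed
  show "0 <= z t $ i" "0 <= y t $ i" if "0 <= t" for t using S i that by blast+
  show "y s $ i <= y t $ i" if "0 <= s" "s <= t" for s t
    using S i that unfolding mono_on_def by auto
  show "y 0 $ i = 0" using S i by blast
  show "continuous (at_right t) (\<lambda>t. y t $ i)" if "0 <= t" for t
    using S i that unfolding cadlag_paths_def by blast
  show "(\<integral>\<^sup>+t\<in>{0..}. ennreal (z t $ i) \<partial>interval_measure (\<lambda>t. y (max 0 t) $ i)) = 0" using S i by blast
qed

lemma reg_path_complementary:
  assumes X: "X \<in> cont_paths d" and i: "i < d" and t: "0 <= t"
  shows "reg_path X t $ i = 0 \<or> (\<exists>s. 0 <= s \<and> s <= t \<and> refl_path X s $ i = 0 \<and> reg_path X s $ i = reg_path X t $ i)"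
proof -
  have "continuous_on {0..t} (\<lambda>t. X t $ k)" "continuous_on {0..t} (\<lambda>t. reg_path X t $ k)" if "k < d" for k
    using cont_paths_continuous[OF X that] cont_paths_continuous[OF reg_path_cont_paths[OF X] that]
    by (auto elim: continuous_on_subset)
  from regulated_complementary[OF regulated_reg_path[OF X] t order.refl i this]
  show ?thesis using refl_path_index[OF _ i] by force
qed

lemma reg_path_nonneg: "X \<in> cont_paths d ==> i < d ==> 0 <= t ==> 0 <= reg_path X t $ i"
  using regulated_nonneg[OF regulated_reg_path, of X i t t] by simp

lemma reg_path_mono: "X \<in> cont_paths d ==> i < d ==> 0 <= s ==> s <= t ==> reg_path X s $ i <= reg_path X t $ i"
  using regulated_mono[OF regulated_reg_path, of X i s t t] by simp

lemma refl_path_nonneg: "X \<in> cont_paths d ==> i < d ==> 0 <= t ==> 0 <= refl_path X t $ i"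
  using regulated_feasible[OF regulated_reg_path, of X i t t] by (simp add: refl_path_index)

lemma reg_path_0:
  assumes X: "X \<in> cont_paths d" and X0: "\<And>i. i < d ==> 0 <= X 0 $ i" and i: "i < d"
  shows "reg_path X 0 $ i = 0"
proof (rule regulated_start[OF regulated_reg_path[OF X] order.refl i X0])
  show "continuous_on {0..0} (\<lambda>t. X t $ k)" "continuous_on {0..0} (\<lambda>t. reg_path X t $ k)" for k by auto
qed

lemma skorokhod_solution_paths:
  assumes X: "X \<in> cont_paths d" and X0: "\<And>i. i < d ==> 0 <= X 0 $ i"
  shows "skorokhod_solution d R X (refl_path X) (reg_path X)"
  unfolding skorokhod_solution_def
proof (intro conjI allI impI)
  note Y = reg_path_cont_paths[OF X] and Z = refl_path_cont_paths[OF X]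
  show "refl_path X \<in> cadlag_paths d" "reg_path X \<in> cadlag_paths d" using Y Z by (simp_all add: cont_paths_cadlag)
  show "refl_path X t = X t + R *\<^sub>v reg_path X t" if t: "0 <= t" for t
  proof (rule eq_vecI)
    show "dim_vec (refl_path X t) = dim_vec (X t + R *\<^sub>v reg_path X t)"
      using cont_paths_carrier[OF Z t] R_carrier by simp
    fix i assume "i < dim_vec (X t + R *\<^sub>v reg_path X t)"
    then have i: "i < d" using R_carrier by simp
    show "refl_path X t $ i = (X t + R *\<^sub>v reg_path X t) $ i"
      using i R_carrier mult_mat_vec_index[OF R_carrier cont_paths_carrier[OF Y t] i]
      by (simp add: refl_path_index[OF t i] del: index_mult_mat_vec)
  qed
  fix i assume i: "i < d"
  show "0 <= refl_path X t $ i" "0 <= reg_path X t $ i" if "0 <= t" for t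
    using refl_path_nonneg[OF X i that] reg_path_nonneg[OF X i that] by auto
  show "mono_on {0..} (\<lambda>t. reg_path X t $ i)" using reg_path_mono[OF X i] by (auto simp: mono_on_def)
  show "reg_path X 0 $ i = 0" by (rule reg_path_0[OF X X0 i])
  show "(\<integral>\<^sup>+t\<in>{0..}. ennreal (refl_path X t $ i) \<partial>interval_measure (\<lambda>t. reg_path X (max 0 t) $ i)) = 0"
    by (rule complementary_integral)
      (use cont_paths_continuous[OF Y i] cont_paths_continuous[OF Z i] refl_path_nonneg[OF X i] reg_path_nonneg[OF X i]
        reg_path_mono[OF X i] reg_path_complementary[OF X i] in auto)
qed

text \<open>The competitors in the definite description are only cadlag, so uniqueness goes through
  \<open>skorokhod_solution_regulated\<close>; at negative times both sides are
  \<open>undefined\<close>.\<close>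

lemma skorokhod_map_eq:
  assumes X: "X \<in> cont_paths d" and X0: "\<And>i. i < d ==> 0 <= X 0 $ i"
  shows "skorokhod_map d R X = (refl_path X, reg_path X)"
  unfolding skorokhod_map_def
proof (rule the_equality)
  show "case (refl_path X, reg_path X) of (z, y) => skorokhod_solution d R X z y"
    using skorokhod_solution_paths[OF X X0] by simp
  fix p :: "(real => real vec) \<times> (real => real vec)"
  assume "case p of (z, y) => skorokhod_solution d R X z y"
  then obtain z y where p: "p = (z, y)" and S: "skorokhod_solution d R X z y" by (cases p) auto
  note Y = reg_path_cont_paths[OF X]
  have ext: "t < 0 ==> y t = undefined" "t < 0 ==> z t = undefined" for t
    using S by (auto simp: skorokhod_solution_def cadlag_paths_def PiE_def extensional_def)
  have yt: "y t = reg_path X t" if t: "0 <= t" for t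
  proof -
    have "y t \<in> carrier_vec d" using S t by (auto simp: skorokhod_solution_def cadlag_paths_def PiE_def Pi_def)
    moreover have "reg_path X t $ i = y t $ i" if "i < d" for i
      by (rule reg_path_eqI[OF X skorokhod_solution_regulated[OF X S] that t order.refl])
    ultimately show ?thesis using cont_paths_carrier[OF Y t] by (intro eq_vecI) auto
  qed
  have "y = reg_path X"
  proof
    fix t show "y t = reg_path X t" using yt[of t] ext(1)[of t] cont_paths_undefined[OF Y, of t] by (cases "0 <= t") auto
  qed
  moreover have "z = refl_path X"
  proof
    fix t
    show "z t = refl_path X t"
    proof (cases "0 <= t")
      case True
      then have "z t = X t + R *\<^sub>v y t" using S by (simp add: skorokhod_solution_def)
      also have "... = refl_path X t"
        using skorokhod_solution_paths[OF X X0] True yt[OF True] by (simp add: skorokhod_solution_def)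
      finally show ?thesis .
    qed (use ext(2)[of t] cont_paths_undefined[OF refl_path_cont_paths[OF X], of t] in auto)
  qed
  ultimately show "p = (refl_path X, reg_path X)" using p by simp
qed

lemma reflected_eq:
  "X \<in> cont_paths d ==> (\<And>i. i < d ==> 0 <= X 0 $ i) ==> reflected d R X = refl_path X"
  unfolding reflected_def by (subst skorokhod_map_eq) auto

text \<open>The 1 is for the driving path; the rest is for the regulators, whose distance is at most
  \<open>K\<close> times that of the driving paths.\<close>

definition lip :: real where
  "lip = 1 + K * (\<Sum>i<d. \<Sum>k<d. \<bar>R $$ (i, k)\<bar>)"

lemma lip_nonneg: "0 <= lip"
  unfolding lip_def using K_nonneg by (intro add_nonneg_nonneg mult_nonneg_nonneg sum_nonneg) auto

lemma refl_path_lipschitz: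
  assumes X: "X \<in> cont_paths d" and X': "X' \<in> cont_paths d" and T: "0 <= T"
  shows "path_dist d T (refl_path X) (refl_path X') <= lip * path_dist d T X X'"
proof (rule path_dist_leI[OF refl_path_cont_paths[OF X] refl_path_cont_paths[OF X']])
  let ?e = "path_dist d T X X'"
  have e: "0 <= ?e" by (rule path_dist_nonneg[OF X X'])
  show "0 <= lip * ?e" using lip_nonneg e by simp
  fix t i assume t: "0 <= t" "t <= T" and i: "i < d"
  have y: "\<bar>reg_path X t $ k - reg_path X' t $ k\<bar> <= K * ?e" if "k < d" for k
    by (rule regulated_lipschitz[OF regulated_reg_path[OF X] regulated_reg_path[OF X'] T e _ that t])
      (rule path_dist_upper[OF X X'])
  have "\<bar>refl_path X t $ i - refl_path X' t $ i\<bar>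
      = \<bar>(X t $ i - X' t $ i) + (\<Sum>k<d. R $$ (i, k) * (reg_path X t $ k - reg_path X' t $ k))\<bar>"
    using t i by (simp add: refl_path_index algebra_simps sum_subtractf)
  also have "... <= \<bar>X t $ i - X' t $ i\<bar> + (\<Sum>k<d. \<bar>R $$ (i, k)\<bar> * (K * ?e))"
  proof (rule order_trans[OF abs_triangle_ineq], intro add_left_mono order_trans[OF sum_abs] sum_mono)
    fix k assume "k \<in> {..<d}"
    then show "\<bar>R $$ (i, k) * (reg_path X t $ k - reg_path X' t $ k)\<bar> <= \<bar>R $$ (i, k)\<bar> * (K * ?e)"
      unfolding abs_mult using y by (intro mult_left_mono) auto
  qed
  also have "... <= ?e + (\<Sum>i<d. \<Sum>k<d. \<bar>R $$ (i, k)\<bar>) * (K * ?e)"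
  proof (intro add_mono path_dist_upper[OF X X' t i])
    have "(\<Sum>k<d. \<bar>R $$ (i, k)\<bar>) <= (\<Sum>i<d. \<Sum>k<d. \<bar>R $$ (i, k)\<bar>)"
      using i by (intro member_le_sum[of i _ "\<lambda>i. \<Sum>k<d. \<bar>R $$ (i, k)\<bar>"] sum_nonneg) auto
    then show "(\<Sum>k<d. \<bar>R $$ (i, k)\<bar> * (K * ?e)) <= (\<Sum>i<d. \<Sum>k<d. \<bar>R $$ (i, k)\<bar>) * (K * ?e)"
      unfolding sum_distrib_right[symmetric] using K_nonneg e by (intro mult_right_mono) auto
  qed
  also have "... = lip * ?e" by (simp add: lip_def algebra_simps)
  finally show "\<bar>refl_path X t $ i - refl_path X' t $ i\<bar> <= lip * ?e" .
qed

lemma measurable_refl_path: "refl_path \<in> path_borel d \<rightarrow>\<^sub>M path_borel d"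
proof (rule measurable_path_borelI)
  show "refl_path X \<in> cont_paths d" if "X \<in> space (path_borel d)" for X
    using that by (simp add: topspace_path_topology refl_path_cont_paths)
  fix t i assume t: "0 <= (t::real)" and i: "i < d"
  have "continuous_map (path_topology d) euclideanreal (\<lambda>X. refl_path X t $ i)"
  proof (rule continuous_map_path_topology_lipschitz)
    fix X X' assume X: "X \<in> cont_paths d" "X' \<in> cont_paths d"
    show "\<bar>refl_path X t $ i - refl_path X' t $ i\<bar> <= lip * path_dist d t X X'"
      using path_dist_upper[OF refl_path_cont_paths[OF X(1)] refl_path_cont_paths[OF X(2)] t order.refl i]
        refl_path_lipschitz[OF X t] by linarith
  qed
  then show "(\<lambda>X. refl_path X t $ i) \<in> borel_measurable (path_borel d)" by (rule borel_measurable_borel_of)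
qed

text \<open>The semiflow property of reflection, from \<open>regulated_shift\<close> and uniqueness.
  It is the source of the Markov property of the limit.\<close>

lemma refl_path_shift:
  assumes X: "X \<in> cont_paths d" and a: "0 <= a"
  shows "(\<lambda>t\<in>{0..}. refl_path X (a + t)) =
    refl_path (\<lambda>t\<in>{0..}. refl_path X a + (X (a + t) - X a))"
proof (rule cont_paths_eqI)
  let ?X' = "\<lambda>t\<in>{0..}. refl_path X a + (X (a + t) - X a)"
  note Z = refl_path_cont_paths[OF X]
  have idx: "?X' t $ i = refl_path X a $ i + (X (a + t) $ i - X a $ i)" if "0 <= t" "i < d" for t i
    using that a cont_paths_carrier[OF X, of "a + t"] cont_paths_carrier[OF X, of a] cont_paths_carrier[OF Z, of a] by auto
  have sh: "continuous_on {0..} (\<lambda>t. f (a + t))" if "continuous_on {0..} f" for f :: "real => real"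
    using a by (intro continuous_on_compose2[OF that] continuous_intros) auto
  have X': "?X' \<in> cont_paths d" unfolding cont_paths_def
  proof (intro CollectI conjI allI impI)
    show "?X' \<in> {0..} \<rightarrow>\<^sub>E carrier_vec d"
      using a cont_paths_carrier[OF X] cont_paths_carrier[OF Z] by auto
    fix i assume i: "i < d"
    show "continuous_on {0..} (\<lambda>t. ?X' t $ i)"
      by (subst continuous_on_cong[OF refl idx[OF _ i]])
        (use i in "auto intro!: continuous_intros sh cont_paths_continuous[OF X]")
  qed
  then show "refl_path ?X' \<in> cont_paths d" by (rule refl_path_cont_paths)
  show "(\<lambda>t\<in>{0..}. refl_path X (a + t)) \<in> cont_paths d" unfolding cont_paths_def
  proof (intro CollectI conjI allI impI)
    show "(\<lambda>t\<in>{0..}. refl_path X (a + t)) \<in> {0..} \<rightarrow>\<^sub>E carrier_vec d"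
      using a cont_paths_carrier[OF Z] by auto
    fix i assume i: "i < d"
    show "continuous_on {0..} (\<lambda>t. (\<lambda>t\<in>{0..}. refl_path X (a + t)) t $ i)"
      by (subst continuous_on_cong[OF refl, where g = "\<lambda>t. refl_path X (a + t) $ i"])
        (auto intro!: sh cont_paths_continuous[OF Z i])
  qed
  fix t i assume t: "0 <= (t::real)" and i: "i < d"
  have reg: "regulated t (\<lambda>i t. ?X' t $ i) (\<lambda>i t. reg_path X (a + t) $ i - reg_path X a $ i)"
    by (rule regulated_cong[OF _ refl regulated_shift[OF regulated_reg_path[OF X] a]])
      (use a in "simp add: idx refl_path_index del: restrict_apply")
  have "refl_path ?X' t $ i = ?X' t $ i + (\<Sum>k<d. R $$ (i, k) * (reg_path X (a + t) $ k - reg_path X a $ k))"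
    unfolding refl_path_index[OF t i] by (intro arg_cong2[where f = "(+)"] sum.cong refl)
      (simp only: reg_path_eqI[OF X' reg _ t order.refl] lessThan_iff)
  also have "... = refl_path X (a + t) $ i"
    using a t i unfolding idx[OF t i] by (simp add: refl_path_index algebra_simps sum_subtractf)
  finally show "(\<lambda>t\<in>{0..}. refl_path X (a + t)) t $ i = refl_path ?X' t $ i" using t by simp
qed

end

subsection \<open>Increments of Brownian motion\<close>

text \<open>The time axis is cut into dyadic cells; \<open>incr_algebra \<Omega> W d S\<close> is generated by the increments of the
  coordinates of \<open>W\<close> over the cells that lie in the set \<open>S\<close> of pairs (coordinate, time).\<close>

definition cells :: "nat => nat => (nat \<times> real) set => (nat \<times> nat) set" where
  "cells d n S = {(i, k). i < d \<and> k < n * 2 ^ n \<and>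
     (\<forall>t. real k / 2 ^ n < t \<and> t < real (Suc k) / 2 ^ n --> (i, t) \<in> S)}"

definition incr :: "(real => real vec) => nat => nat \<times> nat => real" where
  "incr w n = (\<lambda>(i, k). w (real (Suc k) / 2 ^ n) $ i - w (real k / 2 ^ n) $ i)"

definition incr_sets ::
  "'w set => ('w => real => real vec) => nat => nat => (nat \<times> real) set => 'w set set" where
  "incr_sets \<Omega> W d n S = {(\<lambda>x. restrict (incr (W x) n) (cells d n S)) -` B \<inter> \<Omega> | B.
     B \<in> sets (PiM (cells d n S) (\<lambda>_. borel))}"

definition incr_algebra ::
  "'w set => ('w => real => real vec) => nat => (nat \<times> real) set => 'w measure" where
  "incr_algebra \<Omega> W d S = sigma \<Omega> (\<Union>n. incr_sets \<Omega> W d n S)"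

lemma incr_sets_Pow: "incr_sets \<Omega> W d n S \<subseteq> Pow \<Omega>"
  by (auto simp: incr_sets_def)

lemma space_incr_algebra [simp]: "space (incr_algebra \<Omega> W d S) = \<Omega>"
  unfolding incr_algebra_def by (rule space_measure_of) (use incr_sets_Pow in blast)

lemma sets_incr_algebra: "sets (incr_algebra \<Omega> W d S) = sigma_sets \<Omega> (\<Union>n. incr_sets \<Omega> W d n S)"
  unfolding incr_algebra_def by (rule sets_measure_of) (use incr_sets_Pow in blast)

lemma cells_refine:
  assumes c: "(i, k) \<in> cells d n S"
  shows "(i, 2 * k) \<in> cells d (Suc n) S" "(i, Suc (2 * k)) \<in> cells d (Suc n) S"
proof -
  have i: "i < d" and k: "k < n * 2 ^ n" and S: "\<And>t. real k / 2 ^ n < t ==> t < real (Suc k) / 2 ^ n ==> (i, t) \<in> S"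
    using c by (auto simp: cells_def)
  have "Suc (2 * k) < 2 * (n * 2 ^ n)" using k by linarith
  also have "... <= Suc n * 2 ^ Suc n" by simp
  finally have k': "Suc (2 * k) < Suc n * 2 ^ Suc n" .
  have eq: "real (2 * k) / 2 ^ Suc n = real k / 2 ^ n" "real (Suc (Suc (2 * k))) / 2 ^ Suc n = real (Suc k) / 2 ^ n"
    by (simp_all add: field_simps)
  have mid: "real (2 * k) / 2 ^ Suc n < real (Suc (2 * k)) / 2 ^ Suc n"
    "real (Suc (2 * k)) / 2 ^ Suc n < real (Suc (Suc (2 * k))) / 2 ^ Suc n"
    by (intro divide_strict_right_mono; simp)+
  show "(i, 2 * k) \<in> cells d (Suc n) S" unfolding cells_def
    using i k' S mid eq by (auto simp del: power_Suc of_nat_Suc of_nat_mult)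
  show "(i, Suc (2 * k)) \<in> cells d (Suc n) S" unfolding cells_def
    using i k' S mid eq by (auto simp del: power_Suc of_nat_Suc of_nat_mult)
qed

lemma incr_refine: "incr w n (i, k) = incr w (Suc n) (i, 2 * k) + incr w (Suc n) (i, Suc (2 * k))"
proof -
  have eq: "real (2 * k) / 2 ^ Suc n = real k / 2 ^ n" "real (Suc (Suc (2 * k))) / 2 ^ Suc n = real (Suc k) / 2 ^ n"
    by (simp_all add: field_simps)
  show ?thesis unfolding incr_def prod.case eq by simp
qed

text \<open>Each cell of level \<open>n\<close> splits into two cells of level \<open>n + 1\<close>
  inside the same set, and its increment is the sum of theirs. The levels therefore increase, which
  makes their union closed under intersection.\<close>

lemma incr_sets_Suc: "incr_sets \<Omega> W d n S \<subseteq> incr_sets \<Omega> W d (Suc n) S"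
proof
  fix A assume "A \<in> incr_sets \<Omega> W d n S"
  then obtain B where B: "B \<in> sets (PiM (cells d n S) (\<lambda>_. borel))"
    and A: "A = (\<lambda>x. restrict (incr (W x) n) (cells d n S)) -` B \<inter> \<Omega>" by (auto simp: incr_sets_def)
  let ?P = "PiM (cells d (Suc n) S) (\<lambda>_. borel) :: (nat \<times> nat => real) measure"
  let ?f = "\<lambda>p. \<lambda>c\<in>cells d n S. p (fst c, 2 * snd c) + p (fst c, Suc (2 * snd c)) :: real"
  have f: "?f \<in> ?P \<rightarrow>\<^sub>M PiM (cells d n S) (\<lambda>_. borel)"
  proof (rule measurable_restrict)
    fix c assume "c \<in> cells d n S"
    then show "(\<lambda>p. p (fst c, 2 * snd c) + p (fst c, Suc (2 * snd c)) :: real) \<in> borel_measurable ?P"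
      using cells_refine[of "fst c" "snd c" d n S]
      by (intro borel_measurable_add measurable_component_singleton) auto
  qed
  have "?f (restrict (incr (W x) (Suc n)) (cells d (Suc n) S)) = restrict (incr (W x) n) (cells d n S)" for x
  proof
    fix c show "?f (restrict (incr (W x) (Suc n)) (cells d (Suc n) S)) c = restrict (incr (W x) n) (cells d n S) c"
    proof (cases "c \<in> cells d n S")
      case True
      obtain i k where c: "c = (i, k)" by (cases c)
      then show ?thesis using True cells_refine[of i k d n S] by (simp add: incr_refine[of _ n])
    qed simp
  qed
  then have "A = (\<lambda>x. restrict (incr (W x) (Suc n)) (cells d (Suc n) S)) -` (?f -` B \<inter> space ?P) \<inter> \<Omega>"
    unfolding A by (auto simp: space_PiM)
  moreover have "?f -` B \<inter> space ?P \<in> sets ?P" using f B by (rule measurable_sets)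
  ultimately show "A \<in> incr_sets \<Omega> W d (Suc n) S" unfolding incr_sets_def by blast
qed

lemma incr_sets_mono: "m <= n ==> incr_sets \<Omega> W d m S \<subseteq> incr_sets \<Omega> W d n S"
  by (rule lift_Suc_mono_le[of "\<lambda>n. incr_sets \<Omega> W d n S"]) (rule incr_sets_Suc)

lemma Int_stable_incr_sets: "Int_stable (\<Union>n. incr_sets \<Omega> W d n S)"
proof (rule Int_stableI)
  fix a b assume "a \<in> (\<Union>n. incr_sets \<Omega> W d n S)" "b \<in> (\<Union>n. incr_sets \<Omega> W d n S)"
  then obtain m n where "a \<in> incr_sets \<Omega> W d m S" "b \<in> incr_sets \<Omega> W d n S" by blast
  then have "a \<in> incr_sets \<Omega> W d (max m n) S" "b \<in> incr_sets \<Omega> W d (max m n) S"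
    using incr_sets_mono[of m "max m n" \<Omega> W d S] incr_sets_mono[of n "max m n" \<Omega> W d S] by auto
  then obtain A B where "A \<in> sets (PiM (cells d (max m n) S) (\<lambda>_. borel))" "B \<in> sets (PiM (cells d (max m n) S) (\<lambda>_. borel))"
    "a = (\<lambda>x. restrict (incr (W x) (max m n)) (cells d (max m n) S)) -` A \<inter> \<Omega>"
    "b = (\<lambda>x. restrict (incr (W x) (max m n)) (cells d (max m n) S)) -` B \<inter> \<Omega>"
    unfolding incr_sets_def by blast
  then have "a \<inter> b \<in> incr_sets \<Omega> W d (max m n) S"
    unfolding incr_sets_def by (intro CollectI exI[of _ "A \<inter> B"]) auto
  then show "a \<inter> b \<in> (\<Union>n. incr_sets \<Omega> W d n S)" by blast
qed

lemma measurable_incr: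
  assumes c: "c \<in> cells d n S"
  shows "(\<lambda>x. incr (W x) n c) \<in> borel_measurable (incr_algebra \<Omega> W d S)"
proof -
  have "(\<lambda>x. restrict (incr (W x) n) (cells d n S)) \<in> incr_algebra \<Omega> W d S \<rightarrow>\<^sub>M PiM (cells d n S) (\<lambda>_. borel)"
  proof (rule measurableI)
    show "restrict (incr (W x) n) (cells d n S) \<in> space (PiM (cells d n S) (\<lambda>_. borel))" for x
      by (auto simp: space_PiM)
    fix B :: "(nat \<times> nat => real) set" assume "B \<in> sets (PiM (cells d n S) (\<lambda>_. borel))"
    then have "(\<lambda>x. restrict (incr (W x) n) (cells d n S)) -` B \<inter> \<Omega> \<in> (\<Union>n. incr_sets \<Omega> W d n S)"
      unfolding incr_sets_def by blast
    then show "(\<lambda>x. restrict (incr (W x) n) (cells d n S)) -` B \<inter> space (incr_algebra \<Omega> W d S)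
        \<in> sets (incr_algebra \<Omega> W d S)"
      by (simp add: sets_incr_algebra sigma_sets.Basic)
  qed
  from measurable_compose[OF this measurable_component_singleton[OF c]] show ?thesis using c by simp
qed

text \<open>Round \<open>s\<close> up and \<open>t\<close> down to the dyadic grid: the increment
  between the grid points telescopes over cells contained in \<open>S\<close>, and continuity of the
  path gives the limit.\<close>

lemma measurable_increment:
  assumes W: "\<And>x. x \<in> \<Omega> ==> W x \<in> cont_paths d"
    and st: "0 <= s" "s <= t" and i: "i < d" and S: "\<And>u. s < u ==> u < t ==> (i, u) \<in> S"
  shows "(\<lambda>x. W x t $ i - W x s $ i) \<in> borel_measurable (incr_algebra \<Omega> W d S)"
proof (cases "s = t")
  case False
  then have lt: "s < t" using st by simp
  define a where "a n = nat \<lceil>s * 2 ^ n\<rceil>" for n :: nat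
  define b where "b n = nat \<lfloor>t * 2 ^ n\<rfloor>" for n :: nat
  have a: "s * 2 ^ n <= real (a n)" "real (a n) < s * 2 ^ n + 1" for n
    using st by (auto simp: a_def; linarith)+
  have b: "real (b n) <= t * 2 ^ n" "t * 2 ^ n < real (b n) + 1" for n
    using st by (auto simp: b_def; linarith)+
  \<comment> \<open>Cells of level \<open>n\<close> stop at time \<open>n\<close>; the cut-off is
    void once \<open>n >= t\<close>.\<close>
  define f where "f n x = (\<Sum>k\<in>{a n..<b n} \<inter> {..<n * 2 ^ n}. incr (W x) n (i, k))" for n x
  have inv0: "(\<lambda>n. 1 / 2 ^ n :: real) \<longlonglongrightarrow> 0"
    by (rule LIMSEQ_divide_realpow_zero) simp
  have lim_a: "(\<lambda>n. real (a n) / 2 ^ n) \<longlonglongrightarrow> s"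
  proof (rule tendsto_sandwich[of "\<lambda>_. s" _ _ "\<lambda>n. s + 1 / 2 ^ n"])
    show "\<forall>\<^sub>F n in sequentially. s <= real (a n) / 2 ^ n" using a(1) by (simp add: pos_le_divide_eq)
    show "\<forall>\<^sub>F n in sequentially. real (a n) / 2 ^ n <= s + 1 / 2 ^ n"
      using a(2) by (intro always_eventually allI) (simp add: pos_divide_le_eq distrib_right less_imp_le)
    show "(\<lambda>n. s + 1 / 2 ^ n) \<longlonglongrightarrow> s" using tendsto_add[OF tendsto_const inv0, of s] by simp
  qed simp
  have lim_b: "(\<lambda>n. real (b n) / 2 ^ n) \<longlonglongrightarrow> t"
  proof (rule tendsto_sandwich[of "\<lambda>n. t - 1 / 2 ^ n" _ _ "\<lambda>_. t"])
    show "\<forall>\<^sub>F n in sequentially. real (b n) / 2 ^ n <= t" using b(1) by (simp add: pos_divide_le_eq)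
    show "\<forall>\<^sub>F n in sequentially. t - 1 / 2 ^ n <= real (b n) / 2 ^ n"
    proof (intro always_eventually allI)
      fix n have "t * 2 ^ n - 1 <= real (b n)" using b(2)[of n] by linarith
      then show "t - 1 / 2 ^ n <= real (b n) / 2 ^ n" by (simp add: pos_le_divide_eq left_diff_distrib)
    qed
    show "(\<lambda>n. t - 1 / 2 ^ n) \<longlonglongrightarrow> t" using tendsto_diff[OF tendsto_const inv0, of t] by simp
  qed simp
  show ?thesis
  proof (rule borel_measurable_LIMSEQ_real)
    fix n
    show "f n \<in> borel_measurable (incr_algebra \<Omega> W d S)" unfolding f_def
    proof (rule borel_measurable_sum)
      fix k assume k: "k \<in> {a n..<b n} \<inter> {..<n * 2 ^ n}"
      have "(i, k) \<in> cells d n S" unfolding cells_def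
      proof (intro CollectI prod.case[THEN iffD2] conjI allI impI S i)
        fix u assume u: "real k / 2 ^ n < u \<and> u < real (Suc k) / 2 ^ n"
        have "s * 2 ^ n <= real k" using a(1)[of n] k by (auto intro: order_trans)
        then have "s <= real k / 2 ^ n" by (simp add: pos_le_divide_eq)
        then show "s < u" using u by linarith
        have "real (Suc k) <= real (b n)" using k by simp
        then have "real (Suc k) <= t * 2 ^ n" using b(1)[of n] by linarith
        then have "real (Suc k) / 2 ^ n <= t" by (simp add: pos_divide_le_eq del: of_nat_Suc)
        then show "u < t" using u by linarith
      qed (use k in auto)
      then show "(\<lambda>x. incr (W x) n (i, k)) \<in> borel_measurable (incr_algebra \<Omega> W d S)" by (rule measurable_incr)
    qed
  next
    fix x assume "x \<in> space (incr_algebra \<Omega> W d S)"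
    then have w: "W x \<in> cont_paths d" by (simp add: W)
    note wc = cont_paths_continuous[OF w i]
    have "(\<lambda>n. W x (real (b n) / 2 ^ n) $ i - W x (real (a n) / 2 ^ n) $ i) \<longlonglongrightarrow> W x t $ i - W x s $ i"
      using st by (intro tendsto_diff continuous_on_tendsto_compose[OF wc lim_b] continuous_on_tendsto_compose[OF wc lim_a]) auto
    moreover have "\<forall>\<^sub>F n in sequentially. W x (real (b n) / 2 ^ n) $ i - W x (real (a n) / 2 ^ n) $ i = f n x"
    proof -
      obtain n0 where n0: "t <= real n0" using real_arch_simple by blast
      have "\<forall>\<^sub>F n in sequentially. real (a n) / 2 ^ n < (s + t) / 2" using lim_a lt by (intro order_tendstoD(2)) auto
      moreover have "\<forall>\<^sub>F n in sequentially. (s + t) / 2 < real (b n) / 2 ^ n" using lim_b lt by (intro order_tendstoD(1)) auto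
      ultimately show ?thesis using eventually_ge_at_top[of n0]
      proof eventually_elim
        case (elim n)
        then have "real (a n) / 2 ^ n < real (b n) / 2 ^ n" by linarith
        then have ab: "a n <= b n" by (simp add: divide_less_cancel)
        have "real (b n) <= real n * 2 ^ n"
          using b(1)[of n] n0 elim(3) by (meson mult_right_mono of_nat_mono order_trans zero_le_numeral zero_le_power)
        then have "real (b n) <= real (n * 2 ^ n)" by simp
        then have "b n <= n * 2 ^ n" by linarith
        then have "{a n..<b n} \<inter> {..<n * 2 ^ n} = {a n..<b n}" by auto
        then show ?case unfolding f_def incr_def
          using sum_Suc_diff'[OF ab, of "\<lambda>k. W x (real k / 2 ^ n) $ i"] by simp
      qed
    qed
    ultimately show "(\<lambda>n. f n x) \<longlonglongrightarrow> W x t $ i - W x s $ i" by (rule Lim_transform_eventually)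
  qed
qed simp

section \<open>Brownian motion: independent increments and uniqueness in law\<close>

lemma
  assumes "standard_BM M d W"
  shows BM_measurable: "W \<in> M \<rightarrow>\<^sub>M path_borel d"
    and BM_0: "x \<in> space M ==> W x 0 = 0\<^sub>v d"
    and BM_normal: "i < d ==> 0 <= s ==> s < t ==>
      distributed M lborel (\<lambda>x. W x t $ i - W x s $ i) (normal_density 0 (sqrt (t - s)))"
    and BM_indep: "0 <= \<tau> 0 ==> (\<And>k. k < n ==> \<tau> k < \<tau> (Suc k)) ==>
      prob_space.indep_vars M (\<lambda>_. borel) (\<lambda>(i, k) x. W x (\<tau> (Suc k)) $ i - W x (\<tau> k) $ i) ({..<d} \<times> {..<n})"
  using assms unfolding standard_BM_def by blast+

lemma BM_cont_paths: "standard_BM M d W ==> x \<in> space M ==> W x \<in> cont_paths d"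
  by (rule measurable_path_borel_cont_paths[OF BM_measurable])

lemma BM_indep_cells:
  assumes M: "prob_space M" and W: "standard_BM M d W"
  shows "prob_space.indep_vars M (\<lambda>_. borel) (\<lambda>c x. incr (W x) n c) ({..<d} \<times> {..<n * 2 ^ n})"
proof -
  have "prob_space.indep_vars M (\<lambda>_. borel)
      (\<lambda>(i, k) x. W x (real (Suc k) / 2 ^ n) $ i - W x (real k / 2 ^ n) $ i) ({..<d} \<times> {..<n * 2 ^ n})"
    by (rule BM_indep[OF W, of "\<lambda>k. real k / 2 ^ n"]) (auto intro!: divide_strict_right_mono)
  then show ?thesis by (simp add: incr_def case_prod_unfold)
qed

lemma cells_subset: "cells d n S \<subseteq> {..<d} \<times> {..<n * 2 ^ n}"
  by (auto simp: cells_def)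

text \<open>Disjoint sets contain disjoint families of cells, since a cell is a nonempty interval;
  this gives independence on each level. Finitely many events can be moved to one common level, and
  the union over the levels is an intersection-stable generator.\<close>

lemma BM_indep_incr_algebra:
  assumes M: "prob_space M" and W: "standard_BM M d W" and S: "disjoint_family_on S L"
  shows "prob_space.indep_sets M (\<lambda>b. sets (incr_algebra (space M) W d (S b))) L"
proof -
  interpret prob_space M by fact
  have level: "indep_sets (\<lambda>b. incr_sets (space M) W d n (S b)) L" for n
  proof -
    have "disjoint_family_on (\<lambda>b. cells d n (S b)) L" unfolding disjoint_family_on_def
    proof (intro ballI impI equals0I)
      fix b b' c assume b: "b \<in> L" "b' \<in> L" "b \<noteq> b'" and c: "c \<in> cells d n (S b) \<inter> cells d n (S b')"
      obtain i k where ik: "c = (i, k)" by (cases c)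
      have "real k / 2 ^ n < real (Suc k) / 2 ^ n" by (intro divide_strict_right_mono) auto
      then obtain t where "real k / 2 ^ n < t" "t < real (Suc k) / 2 ^ n" using dense by blast
      then have "(i, t) \<in> S b \<inter> S b'" using c unfolding ik cells_def by blast
      then show False using S b unfolding disjoint_family_on_def by blast
    qed
    from indep_vars_restrict[OF BM_indep_cells[OF M W] cells_subset this]
    show ?thesis unfolding indep_vars_def2 incr_sets_def by simp
  qed
  have "indep_sets (\<lambda>b. \<Union>n. incr_sets (space M) W d n (S b)) L"
  proof (rule indep_setsI)
    show "(\<Union>n. incr_sets (space M) W d n (S b)) \<subseteq> events" if "b \<in> L" for b
      using level that unfolding indep_sets_def by blast
    fix A J assume J: "J \<noteq> {}" "J \<subseteq> L" "finite J" and A: "\<forall>j\<in>J. A j \<in> (\<Union>n. incr_sets (space M) W d n (S j))"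
    then have "\<forall>j\<in>J. \<exists>n. A j \<in> incr_sets (space M) W d n (S j)" by simp
    from bchoice[OF this] obtain n where n: "\<forall>j\<in>J. A j \<in> incr_sets (space M) W d (n j) (S j)" ..
    have "\<forall>j\<in>J. A j \<in> incr_sets (space M) W d (Max (n ` J)) (S j)"
    proof
      fix j assume j: "j \<in> J"
      then have "n j <= Max (n ` J)" using J by (intro Max_ge) auto
      then show "A j \<in> incr_sets (space M) W d (Max (n ` J)) (S j)"
        using n j incr_sets_mono[of "n j" "Max (n ` J)" "space M" W d "S j"] by blast
    qed
    then show "prob (\<Inter>j\<in>J. A j) = (\<Prod>j\<in>J. prob (A j))"
      by (rule indep_setsD[OF level J(2,1,3)])
  qed
  then have "indep_sets (\<lambda>b. sigma_sets (space M) (\<Union>n. incr_sets (space M) W d n (S b))) L"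
    by (rule indep_sets_sigma) (rule Int_stable_incr_sets)
  then show ?thesis by (simp add: sets_incr_algebra)
qed

lemma distributed_distr_eq:
  assumes "distributed M N X f" "distributed M' N X' f"
  shows "distr M N X = distr M' N X'"
  using assms by (simp add: distributed_def)

text \<open>Increments see a path only up to its starting point, hence the detour over \<open>center\<close>.\<close>

definition center :: "nat => (real => real vec) => real => real vec" where
  "center d x = (\<lambda>t\<in>{0..}. Matrix.vec d (\<lambda>i. x t $ i - x 0 $ i))"

lemma center_cont_paths: "x \<in> cont_paths d ==> center d x \<in> cont_paths d"
  unfolding center_def by (intro cont_paths_vecI continuous_intros cont_paths_continuous)

lemma center_eq: "x \<in> cont_paths d ==> x 0 = 0\<^sub>v d ==> center d x = x"
  by (rule cont_paths_eqI[OF center_cont_paths]) (auto simp: center_def)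

text \<open>The increments over the cells of one level are independent centred normals whose
  variance is the cell length, so the two laws agree on an intersection-stable generator of the
  increment algebra. \<open>center d\<close> recovers the paths from their increments, as both start
  at 0.\<close>

lemma BM_law_unique:
  assumes M: "prob_space M" and W: "standard_BM M d W" and N: "prob_space N" and V: "standard_BM N d V"
  shows "distr M (path_borel d) W = distr N (path_borel d) V"
proof -
  let ?I = "\<lambda>n. cells d n UNIV"
  let ?S = "incr_algebra (cont_paths d) (\<lambda>x. x) d UNIV"
  let ?E = "\<Union>n. incr_sets (cont_paths d) (\<lambda>x. x) d n UNIV"
  let ?f = "\<lambda>n x. restrict (incr x n) (?I n)"
  have incrm: "(\<lambda>x. incr x n c) \<in> borel_measurable (path_borel d)" if "c \<in> ?I n" for n c
    using that by (auto simp: incr_def cells_def intro!: borel_measurable_diff measurable_path_eval)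
  have fm: "?f n \<in> path_borel d \<rightarrow>\<^sub>M PiM (?I n) (\<lambda>_. borel)" for n
    by (rule measurable_restrict) (rule incrm)
  have E: "?E \<subseteq> sets (path_borel d)"
  proof
    fix A assume "A \<in> ?E"
    then obtain n B where "B \<in> sets (PiM (?I n) (\<lambda>_. borel))" "A = ?f n -` B \<inter> cont_paths d"
      unfolding incr_sets_def by blast
    then show "A \<in> sets (path_borel d)" using measurable_sets[OF fm] by (simp add: topspace_path_topology)
  qed
  have id: "(\<lambda>x. x) \<in> path_borel d \<rightarrow>\<^sub>M ?S"
  proof (rule measurableI)
    show "x \<in> space (path_borel d) ==> x \<in> space ?S" for x by (simp add: topspace_path_topology)
    fix A assume "A \<in> sets ?S"
    then have "A \<in> sigma_sets (cont_paths d) ?E" by (simp add: sets_incr_algebra)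
    then have "A \<in> sets (path_borel d)" using sets.sigma_sets_subset[OF E] by (auto simp: topspace_path_topology)
    then show "(\<lambda>x. x) -` A \<inter> space (path_borel d) \<in> sets (path_borel d)"
      using sets.sets_into_space[of A "path_borel d"] by (simp add: Int_absorb2)
  qed
  have same: "emeasure (distr M ?S W) A = emeasure (distr N ?S V) A"
    if M: "prob_space M" and W: "standard_BM M d W" and N: "prob_space N" and V: "standard_BM N d V"
      and A: "A \<in> ?E" for A and M :: "'x measure" and N :: "'y measure" and W V
  proof -
    interpret M: prob_space M by fact
    interpret N: prob_space N by fact
    note Wm = BM_measurable[OF W] and Vm = BM_measurable[OF V]
    note Ws = measurable_compose[OF Wm id] and Vs = measurable_compose[OF Vm id]
    obtain n B where B: "B \<in> sets (PiM (?I n) (\<lambda>_. borel))" and AB: "A = ?f n -` B \<inter> cont_paths d"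
      using A unfolding incr_sets_def by blast
    have AS: "A \<in> sets ?S" using A by (simp add: sets_incr_algebra sigma_sets.Basic)
    have eqM: "emeasure (distr M ?S W) A = emeasure (distr M (PiM (?I n) (\<lambda>_. borel)) (\<lambda>w. ?f n (W w))) B"
      using measurable_compose[OF Wm fm] B Ws AS BM_cont_paths[OF W] unfolding AB
      by (simp add: emeasure_distr) (intro arg_cong[where f = "emeasure M"], auto)
    have eqN: "emeasure (distr N ?S V) A = emeasure (distr N (PiM (?I n) (\<lambda>_. borel)) (\<lambda>w. ?f n (V w))) B"
      using measurable_compose[OF Vm fm] B Vs AS BM_cont_paths[OF V] unfolding AB
      by (simp add: emeasure_distr) (intro arg_cong[where f = "emeasure N"], auto)
    show ?thesis
    \<comment> \<open>The product criterion for independence needs a nonempty index set, which fails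
      for level 0 and for \<open>d = 0\<close>.\<close>
    proof (cases "?I n = {}")
      case True
      then have "?f n = (\<lambda>x _. undefined)" by (simp add: fun_eq_iff)
      then have "A = {} \<or> A = cont_paths d" unfolding AB by auto
      moreover have "emeasure (distr M ?S W) (cont_paths d) = 1" "emeasure (distr N ?S V) (cont_paths d) = 1"
        using M.prob_space_distr[OF Ws, THEN prob_space.emeasure_space_1] N.prob_space_distr[OF Vs, THEN prob_space.emeasure_space_1]
        by simp_all
      ultimately show ?thesis by auto
    next
      case False
      have mM: "(\<lambda>w. incr (W w) n c) \<in> borel_measurable M" if "c \<in> ?I n" for c
        using measurable_compose[OF Wm incrm[OF that]] .
      have mN: "(\<lambda>w. incr (V w) n c) \<in> borel_measurable N" if "c \<in> ?I n" for c
        using measurable_compose[OF Vm incrm[OF that]] .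
      have "distr M (PiM (?I n) (\<lambda>_. borel)) (\<lambda>w. ?f n (W w)) = PiM (?I n) (\<lambda>c. distr M borel (\<lambda>w. incr (W w) n c))"
        by (rule M.indep_vars_iff_distr_eq_PiM'[OF False, THEN iffD1])
          (rule mM M.indep_vars_subset[OF BM_indep_cells[OF M W] cells_subset]; assumption?)+
      also have "... = PiM (?I n) (\<lambda>c. distr N borel (\<lambda>w. incr (V w) n c))"
      proof (rule PiM_cong)
        fix c assume c: "c \<in> ?I n"
        obtain i k where ik: "c = (i, k)" by (cases c)
        have lt: "real k / 2 ^ n < real (Suc k) / 2 ^ n" by (intro divide_strict_right_mono) auto
        have i: "i < d" using c ik by (auto simp: cells_def)
        have "distr M lborel (\<lambda>w. incr (W w) n c) = distr N lborel (\<lambda>w. incr (V w) n c)"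
          unfolding ik incr_def prod.case
          by (rule distributed_distr_eq[OF BM_normal[OF W i _ lt] BM_normal[OF V i _ lt]]) auto
        moreover have "distr M borel (\<lambda>w. incr (W w) n c) = distr M lborel (\<lambda>w. incr (W w) n c)"
          "distr N borel (\<lambda>w. incr (V w) n c) = distr N lborel (\<lambda>w. incr (V w) n c)"
          by (rule distr_cong; simp)+
        ultimately show "distr M borel (\<lambda>w. incr (W w) n c) = distr N borel (\<lambda>w. incr (V w) n c)" by simp
      qed simp
      also have "... = distr N (PiM (?I n) (\<lambda>_. borel)) (\<lambda>w. ?f n (V w))"
        by (rule N.indep_vars_iff_distr_eq_PiM'[OF False, THEN iffD1, symmetric])
          (rule mN N.indep_vars_subset[OF BM_indep_cells[OF N V] cells_subset]; assumption?)+
      finally show ?thesis unfolding eqM eqN by simp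
    qed
  qed
  interpret M: prob_space M by fact
  interpret N: prob_space N by fact
  note Ws = measurable_compose[OF BM_measurable[OF W] id] and Vs = measurable_compose[OF BM_measurable[OF V] id]
  have laws: "distr M ?S W = distr N ?S V"
  proof (rule measure_eqI_generator_eq[OF Int_stable_incr_sets[of "cont_paths d" "\<lambda>x. x" d UNIV], where \<Omega> = "cont_paths d" and A = "\<lambda>_. cont_paths d"])
    show "?E \<subseteq> Pow (cont_paths d)" using incr_sets_Pow by blast
    show "A \<in> ?E ==> emeasure (distr M ?S W) A = emeasure (distr N ?S V) A" for A
      by (rule same[OF M W N V])
    show "sets (distr M ?S W) = sigma_sets (cont_paths d) ?E" "sets (distr N ?S V) = sigma_sets (cont_paths d) ?E"
      by (simp_all add: sets_incr_algebra)
    have "(\<lambda>x. restrict (incr x 0) (?I 0)) -` space (PiM (?I 0) (\<lambda>_. borel)) \<inter> cont_paths d = cont_paths d"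
      by (auto simp: space_PiM)
    then have "cont_paths d \<in> incr_sets (cont_paths d) (\<lambda>x. x) d 0 UNIV"
      unfolding incr_sets_def by (intro CollectI exI[of _ "space (PiM (?I 0) (\<lambda>_. borel))"]) auto
    then show "range (\<lambda>_. cont_paths d) \<subseteq> ?E" by blast
    show "emeasure (distr M ?S W) (cont_paths d) \<noteq> \<infinity>"
      using M.prob_space_distr[OF Ws, THEN prob_space.emeasure_space_1] by simp
  qed simp_all
  have cm: "center d \<in> ?S \<rightarrow>\<^sub>M path_borel d"
  proof (rule measurable_path_borelI)
    show "x \<in> space ?S ==> center d x \<in> cont_paths d" for x by (simp add: center_cont_paths)
    fix t i assume "0 <= (t::real)" "i < d"
    then show "(\<lambda>x. center d x t $ i) \<in> borel_measurable ?S"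
      using measurable_increment[of "cont_paths d" "\<lambda>x. x" d 0 t i UNIV] by (simp add: center_def)
  qed
  have "distr M (path_borel d) W = distr M (path_borel d) (\<lambda>w. center d (W w))"
    by (rule distr_cong) (simp_all add: center_eq BM_cont_paths[OF W] BM_0[OF W])
  also have "... = distr (distr M ?S W) (path_borel d) (center d)"
    by (subst distr_distr[OF cm Ws]) (simp add: comp_def)
  also have "... = distr (distr N ?S V) (path_borel d) (center d)" by (simp only: laws)
  also have "... = distr N (path_borel d) (\<lambda>w. center d (V w))"
    by (subst distr_distr[OF cm Vs]) (simp add: comp_def)
  also have "... = distr N (path_borel d) V"
    by (rule distr_cong) (simp_all add: center_eq BM_cont_paths[OF V] BM_0[OF V])
  finally show ?thesis .
qed

subsection \<open>Independence and laws\<close>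

lemma indep_elements_measurable:
  assumes "indep_elements M S X T Y"
  shows "X \<in> M \<rightarrow>\<^sub>M S" "Y \<in> M \<rightarrow>\<^sub>M T"
  using assms by (auto simp: indep_elements_def)

lemma indep_elements_iff_prob:
  assumes M: "prob_space M" and X: "X \<in> M \<rightarrow>\<^sub>M S" and Y: "Y \<in> M \<rightarrow>\<^sub>M T"
  shows "indep_elements M S X T Y \<longleftrightarrow> (\<forall>A\<in>sets S. \<forall>B\<in>sets T.
    measure M ((X -` A \<inter> space M) \<inter> (Y -` B \<inter> space M)) = measure M (X -` A \<inter> space M) * measure M (Y -` B \<inter> space M))"
proof -
  interpret prob_space M by fact
  have XS: "X \<in> space M \<rightarrow> space S" and YT: "Y \<in> space M \<rightarrow> space T" using X Y by (auto simp: measurable_def)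
  have "{X -` A \<inter> space M | A. A \<in> sets S} \<subseteq> events" "{Y -` A \<inter> space M | A. A \<in> sets T} \<subseteq> events"
    using measurable_sets[OF X] measurable_sets[OF Y] by auto
  moreover have "(\<forall>a\<in>{X -` A \<inter> space M | A. A \<in> sets S}. \<forall>b\<in>{Y -` A \<inter> space M | A. A \<in> sets T}. prob (a \<inter> b) = prob a * prob b) \<longleftrightarrow>
    (\<forall>A\<in>sets S. \<forall>B\<in>sets T. prob ((X -` A \<inter> space M) \<inter> (Y -` B \<inter> space M)) = prob (X -` A \<inter> space M) * prob (Y -` B \<inter> space M))"
    by blast
  ultimately show ?thesis
    unfolding indep_elements_def indep_sets2_eq sets_vimage_algebra2[OF XS] sets_vimage_algebra2[OF YT]
    using X Y by simp
qed

lemma indep_elements_distr: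
  assumes M: "prob_space M" and ind: "indep_elements M S X T Y"
  shows "distr M (S \<Otimes>\<^sub>M T) (\<lambda>x. (X x, Y x)) = distr M S X \<Otimes>\<^sub>M distr M T Y"
proof -
  interpret prob_space M by fact
  note X = indep_elements_measurable(1)[OF ind] and Y = indep_elements_measurable(2)[OF ind]
  have XY: "(\<lambda>x. (X x, Y x)) \<in> M \<rightarrow>\<^sub>M S \<Otimes>\<^sub>M T" using X Y by (rule measurable_Pair)
  interpret X: prob_space "distr M S X" by (rule prob_space_distr[OF X])
  interpret Y: prob_space "distr M T Y" by (rule prob_space_distr[OF Y])
  show ?thesis
  proof (rule pair_measure_eqI[symmetric])
    fix A B assume A: "A \<in> sets (distr M S X)" and B: "B \<in> sets (distr M T Y)"
    then have AB: "A \<in> sets S" "B \<in> sets T" by auto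
    have "emeasure (distr M (S \<Otimes>\<^sub>M T) (\<lambda>x. (X x, Y x))) (A \<times> B)
        = ennreal (prob ((X -` A \<inter> space M) \<inter> (Y -` B \<inter> space M)))"
      using AB by (simp add: emeasure_distr[OF XY] emeasure_eq_measure) (intro arg_cong[where f = prob], auto)
    also have "... = ennreal (prob (X -` A \<inter> space M)) * ennreal (prob (Y -` B \<inter> space M))"
      using ind AB unfolding indep_elements_iff_prob[OF M X Y] by (simp add: ennreal_mult'')
    finally show "emeasure (distr M S X) A * emeasure (distr M T Y) B
        = emeasure (distr M (S \<Otimes>\<^sub>M T) (\<lambda>x. (X x, Y x))) (A \<times> B)"
      using AB by (simp add: emeasure_distr X Y emeasure_eq_measure)
  qed (auto intro: X.sigma_finite_measure_axioms Y.sigma_finite_measure_axioms)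
qed

lemma indep_elements_compose:
  assumes M: "prob_space M" and ind: "indep_elements M S X T Y" and f: "f \<in> S \<rightarrow>\<^sub>M S'" and g: "g \<in> T \<rightarrow>\<^sub>M T'"
  shows "indep_elements M S' (\<lambda>x. f (X x)) T' (\<lambda>x. g (Y x))"
proof -
  note X = indep_elements_measurable(1)[OF ind] and Y = indep_elements_measurable(2)[OF ind]
  show ?thesis unfolding indep_elements_iff_prob[OF M measurable_compose[OF X f] measurable_compose[OF Y g]]
  proof (intro ballI)
    fix A B assume A: "A \<in> sets S'" and B: "B \<in> sets T'"
    have fA: "(\<lambda>x. f (X x)) -` A \<inter> space M = X -` (f -` A \<inter> space S) \<inter> space M"
      using measurable_space[OF X] by auto
    have gB: "(\<lambda>x. g (Y x)) -` B \<inter> space M = Y -` (g -` B \<inter> space T) \<inter> space M"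
      using measurable_space[OF Y] by auto
    show "measure M (((\<lambda>x. f (X x)) -` A \<inter> space M) \<inter> ((\<lambda>x. g (Y x)) -` B \<inter> space M)) =
       measure M ((\<lambda>x. f (X x)) -` A \<inter> space M) * measure M ((\<lambda>x. g (Y x)) -` B \<inter> space M)"
      unfolding fA gB using ind measurable_sets[OF f A] measurable_sets[OF g B]
      unfolding indep_elements_iff_prob[OF M X Y] by blast
  qed
qed

text \<open>Fubini after \<open>indep_elements_distr\<close>. It serves to integrate out a Brownian
  path while the initial state or the past is held fixed.\<close>

lemma indep_elements_integral:
  fixes h :: "'a \<times> 'b => real"
  assumes M: "prob_space M" and ind: "indep_elements M S X T Y"
    and h: "h \<in> borel_measurable (S \<Otimes>\<^sub>M T)" and B: "\<And>p. p \<in> space (S \<Otimes>\<^sub>M T) ==> \<bar>h p\<bar> <= B"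
  shows "(\<integral>w. h (X w, Y w) \<partial>M) = (\<integral>w. (\<integral>y. h (X w, y) \<partial>distr M T Y) \<partial>M)"
proof -
  interpret prob_space M by fact
  note X = indep_elements_measurable(1)[OF ind] and Y = indep_elements_measurable(2)[OF ind]
  have XY: "(\<lambda>w. (X w, Y w)) \<in> M \<rightarrow>\<^sub>M S \<Otimes>\<^sub>M T" using X Y by (rule measurable_Pair)
  interpret X: prob_space "distr M S X" by (rule prob_space_distr[OF X])
  interpret Y: prob_space "distr M T Y" by (rule prob_space_distr[OF Y])
  interpret XY: pair_prob_space "distr M S X" "distr M T Y" ..
  have hm: "h \<in> borel_measurable (distr M S X \<Otimes>\<^sub>M distr M T Y)" using h by (simp cong: measurable_cong_sets)
  have hi: "integrable (distr M S X \<Otimes>\<^sub>M distr M T Y) h"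
    by (rule XY.integrable_const_bound[where B = B]) (use B hm in "auto simp: space_pair_measure intro!: AE_I2")
  have hi': "(\<lambda>x. \<integral>y. h (x, y) \<partial>distr M T Y) \<in> borel_measurable S"
    using Y.borel_measurable_lebesgue_integral[of "\<lambda>x y. h (x, y)" S] h
    by (simp cong: measurable_cong_sets sets_pair_measure_cong)
  have "(\<integral>w. h (X w, Y w) \<partial>M) = (\<integral>p. h p \<partial>distr M (S \<Otimes>\<^sub>M T) (\<lambda>w. (X w, Y w)))"
    by (rule integral_distr[OF XY h, symmetric])
  also have "... = (\<integral>p. h p \<partial>(distr M S X \<Otimes>\<^sub>M distr M T Y))"
    by (simp only: indep_elements_distr[OF M ind])
  also have "... = (\<integral>x. (\<integral>y. h (x, y) \<partial>distr M T Y) \<partial>distr M S X)"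
    by (rule XY.integral_fst'[OF hi, symmetric])
  also have "... = (\<integral>w. (\<integral>y. h (X w, y) \<partial>distr M T Y) \<partial>M)"
    by (rule integral_distr[OF X hi'])
  finally show ?thesis .
qed

text \<open>With \<open>X\<close> held fixed by \<open>indep_elements_integral\<close>, the joint
  probability factors inside the integral because the two pieces of \<open>Y\<close> are
  independent. It is used with a Brownian path cut into past and future.\<close>

lemma indep_elements_assoc:
  assumes M: "prob_space M" and ind: "indep_elements M S X T Y"
    and f: "f \<in> T \<rightarrow>\<^sub>M T1" and g: "g \<in> T \<rightarrow>\<^sub>M T2"
    and ind2: "indep_elements M T1 (\<lambda>w. f (Y w)) T2 (\<lambda>w. g (Y w))"
  shows "indep_elements M (S \<Otimes>\<^sub>M T1) (\<lambda>w. (X w, f (Y w))) T2 (\<lambda>w. g (Y w))"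
proof -
  interpret prob_space M by fact
  note X = indep_elements_measurable(1)[OF ind] and Y = indep_elements_measurable(2)[OF ind]
  note fY = measurable_compose[OF Y f] and gY = measurable_compose[OF Y g]
  have XfY: "(\<lambda>w. (X w, f (Y w))) \<in> M \<rightarrow>\<^sub>M S \<Otimes>\<^sub>M T1" by (rule measurable_Pair[OF X fY])
  show ?thesis unfolding indep_elements_iff_prob[OF M XfY gY]
  proof (intro ballI)
    fix A C assume A: "A \<in> sets (S \<Otimes>\<^sub>M T1)" and C: "C \<in> sets T2"
    define \<mu> where "\<mu> = distr M T Y"
    interpret \<mu>: prob_space \<mu> unfolding \<mu>_def by (rule prob_space_distr[OF Y])
    define hA where "hA = (\<lambda>p. indicator A (fst p, f (snd p)) :: real)"
    define hC where "hC = (\<lambda>y. indicator C (g y) :: real)"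
    have fm: "(\<lambda>p. (fst p, f (snd p))) \<in> S \<Otimes>\<^sub>M T \<rightarrow>\<^sub>M S \<Otimes>\<^sub>M T1"
      by (intro measurable_Pair measurable_fst measurable_compose[OF measurable_snd f])
    have hAm: "hA \<in> borel_measurable (S \<Otimes>\<^sub>M T)" unfolding hA_def
      by (rule measurable_compose[OF fm borel_measurable_indicator[OF A]])
    have hCm: "hC \<in> borel_measurable T" unfolding hC_def
      by (rule measurable_compose[OF g borel_measurable_indicator[OF C]])
    have hACm: "(\<lambda>p. hA p * hC (snd p)) \<in> borel_measurable (S \<Otimes>\<^sub>M T)"
      by (intro borel_measurable_times hAm measurable_compose[OF measurable_snd hCm])
    let ?c = "prob ((\<lambda>w. g (Y w)) -` C \<inter> space M)"
    \<comment> \<open>At fixed \<open>x\<close> the section of \<open>A\<close> is an event of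
      \<open>f (Y w)\<close> alone, to which \<open>ind2\<close> applies.\<close>
    have sp: "(\<integral>y. hA (x, y) * hC y \<partial>\<mu>) = (\<integral>y. hA (x, y) \<partial>\<mu>) * ?c" if x: "x \<in> space S" for x
    proof -
      have Ax: "(\<lambda>b. (x, b)) -` A \<inter> space T1 \<in> sets T1"
        by (rule measurable_sets[OF measurable_Pair1'[OF x] A])
      let ?Ax = "(\<lambda>b. (x, b)) -` A \<inter> space T1"
      have hAx: "hA (x, y) = indicator (f -` ?Ax \<inter> space T) y" if "y \<in> space T" for y
        using that measurable_space[OF f that] by (auto simp: hA_def indicator_def)
      have hCy: "hC y = indicator (g -` C \<inter> space T) y" if "y \<in> space T" for y
        using that by (auto simp: hC_def indicator_def)
      have meas: "f -` ?Ax \<inter> space T \<in> sets T" "g -` C \<inter> space T \<in> sets T"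
        using measurable_sets[OF f Ax] measurable_sets[OF g C] by auto
      have "(\<integral>y. hA (x, y) * hC y \<partial>\<mu>) = (\<integral>y. indicator ((f -` ?Ax \<inter> space T) \<inter> (g -` C \<inter> space T)) y \<partial>\<mu>)"
        by (rule Bochner_Integration.integral_cong[OF refl]) (simp add: \<mu>_def hAx hCy indicator_inter_arith)
      also have "... = measure \<mu> ((f -` ?Ax \<inter> space T) \<inter> (g -` C \<inter> space T))"
        using meas by (simp add: \<mu>_def)
      also have "... = prob (((\<lambda>w. f (Y w)) -` ?Ax \<inter> space M) \<inter> ((\<lambda>w. g (Y w)) -` C \<inter> space M))"
        using meas measurable_space[OF Y] unfolding \<mu>_def
        by (subst measure_distr[OF Y]) (auto intro!: arg_cong[where f = prob])
      also have "... = prob ((\<lambda>w. f (Y w)) -` ?Ax \<inter> space M) * ?c"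
        using ind2 Ax C unfolding indep_elements_iff_prob[OF M fY gY] by blast
      also have "prob ((\<lambda>w. f (Y w)) -` ?Ax \<inter> space M) = measure \<mu> (f -` ?Ax \<inter> space T)"
        using meas measurable_space[OF Y] unfolding \<mu>_def
        by (subst measure_distr[OF Y]) (auto intro!: arg_cong[where f = prob])
      also have "... = (\<integral>y. hA (x, y) \<partial>\<mu>)"
      proof -
        have "(\<integral>y. hA (x, y) \<partial>\<mu>) = (\<integral>y. indicator (f -` ?Ax \<inter> space T) y \<partial>\<mu>)"
          by (rule Bochner_Integration.integral_cong[OF refl]) (simp add: \<mu>_def hAx)
        then show ?thesis using meas by (simp add: \<mu>_def)
      qed
      finally show ?thesis .
    qed
    have "prob (((\<lambda>w. (X w, f (Y w))) -` A \<inter> space M) \<inter> ((\<lambda>w. g (Y w)) -` C \<inter> space M))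
        = (\<integral>w. indicator (((\<lambda>w. (X w, f (Y w))) -` A \<inter> space M) \<inter> ((\<lambda>w. g (Y w)) -` C \<inter> space M)) w \<partial>M)"
      using measurable_sets[OF XfY A] measurable_sets[OF gY C] by simp
    also have "... = (\<integral>w. hA (X w, Y w) * hC (Y w) \<partial>M)"
      by (rule Bochner_Integration.integral_cong[OF refl]) (auto simp: hA_def hC_def indicator_def)
    also have "... = (\<integral>w. (\<integral>y. hA (X w, y) * hC y \<partial>\<mu>) \<partial>M)"
      using indep_elements_integral[OF M ind hACm, of 1] unfolding \<mu>_def
      by (simp add: hA_def hC_def indicator_def)
    also have "... = (\<integral>w. (\<integral>y. hA (X w, y) \<partial>\<mu>) * ?c \<partial>M)"
      by (rule Bochner_Integration.integral_cong[OF refl]) (simp add: sp measurable_space[OF X])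
    also have "... = (\<integral>w. (\<integral>y. hA (X w, y) \<partial>\<mu>) \<partial>M) * ?c" by simp
    also have "(\<integral>w. (\<integral>y. hA (X w, y) \<partial>\<mu>) \<partial>M) = (\<integral>w. hA (X w, Y w) \<partial>M)"
      using indep_elements_integral[OF M ind hAm, of 1] unfolding \<mu>_def
      by (simp add: hA_def indicator_def)
    also have "... = (\<integral>w. indicator ((\<lambda>w. (X w, f (Y w))) -` A \<inter> space M) w \<partial>M)"
      by (rule Bochner_Integration.integral_cong[OF refl]) (auto simp: hA_def indicator_def)
    also have "... = prob ((\<lambda>w. (X w, f (Y w))) -` A \<inter> space M)"
      using measurable_sets[OF XfY A] by simp
    finally show "prob (((\<lambda>w. (X w, f (Y w))) -` A \<inter> space M) \<inter> ((\<lambda>w. g (Y w)) -` C \<inter> space M)) =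
       prob ((\<lambda>w. (X w, f (Y w))) -` A \<inter> space M) * ?c" .
  qed
qed

text \<open>Independence says that the joint law is a product, which is a statement about the law of
  \<open>W\<close> only. The empty index set is treated apart because the product criterion excludes
  it.\<close>

lemma indep_vars_transfer:
  assumes M: "prob_space M" and N: "prob_space N" and W: "W \<in> M \<rightarrow>\<^sub>M S" and V: "V \<in> N \<rightarrow>\<^sub>M S"
    and law: "distr M S W = distr N S V" and F: "\<And>i. i \<in> I ==> F i \<in> S \<rightarrow>\<^sub>M T i"
    and ind: "prob_space.indep_vars M T (\<lambda>i w. F i (W w)) I"
  shows "prob_space.indep_vars N T (\<lambda>i w. F i (V w)) I"
proof -
  interpret M: prob_space M by fact
  interpret N: prob_space N by fact
  note WF = measurable_compose[OF W F] and VF = measurable_compose[OF V F]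
  show ?thesis
  proof (cases "I = {}")
    case True
    then show ?thesis unfolding N.indep_vars_def2 N.indep_sets_def by simp
  next
    case False
    have Fr: "(\<lambda>x. \<lambda>i\<in>I. F i x) \<in> S \<rightarrow>\<^sub>M PiM I T" by (rule measurable_restrict) (rule F)
    have 1: "distr N (PiM I T) (\<lambda>w. \<lambda>i\<in>I. F i (V w)) = distr M (PiM I T) (\<lambda>w. \<lambda>i\<in>I. F i (W w))"
      using distr_distr[OF Fr V] distr_distr[OF Fr W] law by (simp add: comp_def)
    have 2: "distr N (T i) (\<lambda>w. F i (V w)) = distr M (T i) (\<lambda>w. F i (W w))" if "i \<in> I" for i
      using distr_distr[OF F[OF that] V] distr_distr[OF F[OF that] W] law by (simp add: comp_def)
    have "distr M (PiM I T) (\<lambda>w. \<lambda>i\<in>I. F i (W w)) = PiM I (\<lambda>i. distr M (T i) (\<lambda>w. F i (W w)))"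
      by (rule M.indep_vars_iff_distr_eq_PiM'[OF False, THEN iffD1, OF WF ind])
    also have "... = PiM I (\<lambda>i. distr N (T i) (\<lambda>w. F i (V w)))"
      by (rule PiM_cong) (simp_all add: 2)
    finally show ?thesis unfolding 1[symmetric]
      using N.indep_vars_iff_distr_eq_PiM'[OF False, of "\<lambda>i w. F i (V w)" T] VF by simp
  qed
qed

lemma grid_nonneg:
  fixes \<tau> :: "nat => real"
  assumes "0 <= \<tau> 0" "\<And>k. k < n ==> \<tau> k < \<tau> (Suc k)" "k <= n"
  shows "0 <= \<tau> k"
  using assms(3)
proof (induction k)
  case (Suc k)
  then show ?case using assms(2)[of k] by simp
qed (rule assms(1))

text \<open>Normality and independence of the increments are properties of the law; starting at 0 is
  demanded at every point of the space and therefore enters as a separate hypothesis.\<close>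

lemma standard_BM_transfer:
  assumes M: "prob_space M" and N: "prob_space N" and W: "standard_BM M d W" and V: "V \<in> N \<rightarrow>\<^sub>M path_borel d"
    and law: "distr M (path_borel d) W = distr N (path_borel d) V" and V0: "\<And>w. w \<in> space N ==> V w 0 = 0\<^sub>v d"
  shows "standard_BM N d V"
  unfolding standard_BM_def
proof (intro conjI allI impI ballI V V0; (elim conjE)?)
  note Wm = BM_measurable[OF W]
  fix i s t assume i: "i < d" and st: "0 <= s" "s < (t::real)"
  have f: "(\<lambda>x. x t $ i - x s $ i) \<in> path_borel d \<rightarrow>\<^sub>M lborel"
    using i st by (auto intro!: borel_measurable_diff measurable_path_eval)
  have "distr N lborel (\<lambda>w. V w t $ i - V w s $ i) = distr M lborel (\<lambda>w. W w t $ i - W w s $ i)"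
    using distr_distr[OF f V] distr_distr[OF f Wm] law by (simp add: comp_def)
  then show "distributed N lborel (\<lambda>w. V w t $ i - V w s $ i) (normal_density 0 (sqrt (t - s)))"
    using BM_normal[OF W i st] measurable_compose[OF V f] by (simp add: distributed_def)
next
  note Wm = BM_measurable[OF W]
  fix n :: nat and \<tau> :: "nat => real" assume \<tau>: "0 <= \<tau> 0" "\<forall>k<n. \<tau> k < \<tau> (Suc k)"
  have \<tau>0: "0 <= \<tau> k" if "k <= n" for k
    by (rule grid_nonneg[of \<tau> n]) (use \<tau> that in auto)
  let ?F = "\<lambda>(i, k) x. x (\<tau> (Suc k)) $ i - x (\<tau> k) $ i :: real"
  have "prob_space.indep_vars M (\<lambda>_. borel) (\<lambda>c w. ?F c (W w)) ({..<d} \<times> {..<n})"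
    using BM_indep[OF W, of \<tau> n] \<tau> by (simp add: case_prod_unfold)
  then have "prob_space.indep_vars N (\<lambda>_. borel) (\<lambda>c w. ?F c (V w)) ({..<d} \<times> {..<n})"
    by (rule indep_vars_transfer[OF M N Wm V law, rotated])
      (auto intro!: borel_measurable_diff measurable_path_eval \<tau>0)
  then show "prob_space.indep_vars N (\<lambda>_. borel) (\<lambda>(i, k) w. V w (\<tau> (Suc k)) $ i - V w (\<tau> k) $ i) ({..<d} \<times> {..<n})"
    by (simp add: case_prod_unfold)
qed

section \<open>Past, future, coordinates and projections of a Brownian motion\<close>

definition shift_path :: "nat => real => (real => real vec) => real => real vec" where
  "shift_path d a x = (\<lambda>t\<in>{0..}. Matrix.vec d (\<lambda>i. x (a + t) $ i - x a $ i))"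

definition stop_path :: "nat => real => (real => real vec) => real => real vec" where
  "stop_path d a x = (\<lambda>t\<in>{0..}. Matrix.vec d (\<lambda>i. x (min a t) $ i))"

lemma shift_path_cont_paths: "x \<in> cont_paths d ==> 0 <= a ==> shift_path d a x \<in> cont_paths d"
  unfolding shift_path_def
  by (intro cont_paths_vecI continuous_intros continuous_on_compose2[OF cont_paths_continuous]) auto

lemma stop_path_cont_paths: "x \<in> cont_paths d ==> 0 <= a ==> stop_path d a x \<in> cont_paths d"
  unfolding stop_path_def
  by (intro cont_paths_vecI continuous_intros continuous_on_compose2[OF cont_paths_continuous]) auto

lemma measurable_shift_path: "0 <= a ==> shift_path d a \<in> path_borel d \<rightarrow>\<^sub>M path_borel d"
  by (rule measurable_path_borelI)
    (auto simp: topspace_path_topology shift_path_cont_paths, auto simp: shift_path_def intro!: borel_measurable_diff measurable_path_eval)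

lemma measurable_stop_path: "0 <= a ==> stop_path d a \<in> path_borel d \<rightarrow>\<^sub>M path_borel d"
  by (rule measurable_path_borelI)
    (auto simp: topspace_path_topology stop_path_cont_paths, auto simp: stop_path_def intro!: measurable_path_eval)

lemma BM_shift:
  assumes M: "prob_space M" and W: "standard_BM M d W" and a: "0 <= a"
  shows "standard_BM M d (\<lambda>x. shift_path d a (W x))"
  unfolding standard_BM_def
proof (intro conjI allI impI ballI; (elim conjE)?)
  show "(\<lambda>x. shift_path d a (W x)) \<in> M \<rightarrow>\<^sub>M path_borel d"
    by (rule measurable_compose[OF BM_measurable[OF W] measurable_shift_path[OF a]])
  show "shift_path d a (W x) 0 = 0\<^sub>v d" for x by (auto simp: shift_path_def)
  fix i s t assume i: "i < d" and st: "0 <= s" "s < (t::real)"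
  have "distributed M lborel (\<lambda>x. W x (a + t) $ i - W x (a + s) $ i) (normal_density 0 (sqrt ((a + t) - (a + s))))"
    by (rule BM_normal[OF W i]) (use a st in auto)
  then show "distributed M lborel (\<lambda>x. shift_path d a (W x) t $ i - shift_path d a (W x) s $ i) (normal_density 0 (sqrt (t - s)))"
    using i st by (simp add: shift_path_def)
next
  fix n :: nat and \<tau> :: "nat => real" assume \<tau>: "0 <= \<tau> 0" "\<forall>k<n. \<tau> k < \<tau> (Suc k)"
  have \<tau>0: "0 <= \<tau> k" if "k <= n" for k
    by (rule grid_nonneg[of \<tau> n]) (use \<tau> that in auto)
  interpret prob_space M by fact
  have "indep_vars (\<lambda>_. borel) (\<lambda>(i, k) x. W x (a + \<tau> (Suc k)) $ i - W x (a + \<tau> k) $ i) ({..<d} \<times> {..<n})"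
    by (rule BM_indep[OF W, of "\<lambda>k. a + \<tau> k"]) (use \<tau> a in auto)
  then show "indep_vars (\<lambda>_. borel)
     (\<lambda>(i, k) x. shift_path d a (W x) (\<tau> (Suc k)) $ i - shift_path d a (W x) (\<tau> k) $ i) ({..<d} \<times> {..<n})"
    by (rule indep_vars_cong[THEN iffD1, OF refl _ refl, rotated]) (use \<tau>0 a in "auto simp: shift_path_def")
qed

lemma indep_vars_incr_algebra:
  assumes M: "prob_space M" and W: "standard_BM M d W" and S: "disjoint_family_on S L"
    and f: "\<And>b. b \<in> L ==> f b \<in> incr_algebra (space M) W d (S b) \<rightarrow>\<^sub>M T b"
  shows "prob_space.indep_vars M T f L"
proof -
  interpret prob_space M by fact
  note ind = BM_indep_incr_algebra[OF M W S]
  have sub: "{f b -` A \<inter> space M | A. A \<in> sets (T b)} \<subseteq> sets (incr_algebra (space M) W d (S b))" if "b \<in> L" for b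
    using measurable_sets[OF f[OF that]] by auto
  show ?thesis unfolding indep_vars_def2
  proof (intro conjI ballI)
    fix b assume b: "b \<in> L"
    have "sets (incr_algebra (space M) W d (S b)) \<subseteq> events" using ind b by (simp add: indep_sets_def)
    then show "f b \<in> M \<rightarrow>\<^sub>M T b"
      using measurable_sets[OF f[OF b]] measurable_space[OF f[OF b]] by (intro measurableI) auto
  qed (rule indep_sets_mono_sets[OF ind sub])
qed

lemma indep_var_elements:
  assumes M: "prob_space M" and ind: "prob_space.indep_vars M (case_bool S T) (case_bool X Y) UNIV"
  shows "indep_elements M S X T Y"
proof -
  interpret prob_space M by fact
  have iv: "indep_var S X T Y" using ind by (simp add: indep_var_def)
  note X = indep_var_rv1[OF iv] and Y = indep_var_rv2[OF iv]
  show ?thesis unfolding indep_elements_iff_prob[OF M X Y]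
  proof (intro ballI)
    fix A B assume AB: "A \<in> sets S" "B \<in> sets T"
    have "(\<lambda>x. (X x, Y x)) -` (A \<times> B) \<inter> space M = (X -` A \<inter> space M) \<inter> (Y -` B \<inter> space M)" by auto
    with indep_varD[OF iv AB]
    show "prob ((X -` A \<inter> space M) \<inter> (Y -` B \<inter> space M)) = prob (X -` A \<inter> space M) * prob (Y -` B \<inter> space M)" by simp
  qed
qed

text \<open>The stopped path uses increments before \<open>a\<close> (its values are increments from
  time 0, where \<open>W\<close> vanishes), the shifted path those after \<open>a\<close>, and these
  two time sets are disjoint.\<close>

lemma BM_indep_stop_shift:
  assumes M: "prob_space M" and W: "standard_BM M d W" and a: "0 <= a"
  shows "indep_elements M (path_borel d) (\<lambda>x. stop_path d a (W x)) (path_borel d) (\<lambda>x. shift_path d a (W x))"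
proof (rule indep_var_elements[OF M])
  let ?S = "\<lambda>b. if b then {(i::nat, t). t < a} else {(i, t). a < t}"
  note WP = BM_cont_paths[OF W]
  have stop: "(\<lambda>x. stop_path d a (W x)) \<in> incr_algebra (space M) W d {(i, t). t < a} \<rightarrow>\<^sub>M path_borel d"
  proof (rule measurable_path_borelI)
    fix t i assume t: "0 <= (t::real)" and i: "i < d"
    have "(\<lambda>x. W x (min a t) $ i - W x 0 $ i) \<in> borel_measurable (incr_algebra (space M) W d {(i, t). t < a})"
      by (rule measurable_increment[OF WP]) (use a t i in auto)
    then show "(\<lambda>x. stop_path d a (W x) t $ i) \<in> borel_measurable (incr_algebra (space M) W d {(i, t). t < a})"
      by (rule measurable_cong[THEN iffD1, rotated]) (use t i BM_0[OF W] in "simp add: stop_path_def")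
  qed (simp add: WP stop_path_cont_paths a)
  have shift: "(\<lambda>x. shift_path d a (W x)) \<in> incr_algebra (space M) W d {(i, t). a < t} \<rightarrow>\<^sub>M path_borel d"
  proof (rule measurable_path_borelI)
    fix t i assume t: "0 <= (t::real)" and i: "i < d"
    have "(\<lambda>x. W x (a + t) $ i - W x a $ i) \<in> borel_measurable (incr_algebra (space M) W d {(i, t). a < t})"
      by (rule measurable_increment[OF WP]) (use a t i in auto)
    then show "(\<lambda>x. shift_path d a (W x) t $ i) \<in> borel_measurable (incr_algebra (space M) W d {(i, t). a < t})"
      using t i by (simp add: shift_path_def)
  qed (simp add: WP shift_path_cont_paths a)
  show "prob_space.indep_vars M (case_bool (path_borel d) (path_borel d))
     (case_bool (\<lambda>x. stop_path d a (W x)) (\<lambda>x. shift_path d a (W x))) UNIV"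
    by (rule indep_vars_incr_algebra[OF M W, of ?S])
      (use stop shift in "auto simp: disjoint_family_on_def split: bool.split")
qed

lemma coord_path_cont_paths: "x \<in> cont_paths d ==> j < d ==> coord_path j x \<in> cont_paths 1"
  unfolding coord_path_def by (intro cont_paths_vecI cont_paths_continuous)

lemma measurable_coord_path: "j < d ==> coord_path j \<in> path_borel d \<rightarrow>\<^sub>M path_borel 1"
  by (rule measurable_path_borelI)
    (simp add: topspace_path_topology coord_path_cont_paths del: One_nat_def, simp add: coord_path_def measurable_path_eval)

text \<open>The same argument with sets that are disjoint in the coordinate instead of in
  time.\<close>

lemma BM_indep_coord:
  assumes M: "prob_space M" and W: "standard_BM M d W"
  shows "prob_space.indep_vars M (\<lambda>_. path_borel 1) (\<lambda>j x. coord_path j (W x)) {..<d}"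
proof (rule indep_vars_incr_algebra[OF M W, of "\<lambda>j. {j} \<times> UNIV"])
  show "disjoint_family_on (\<lambda>j. {j} \<times> UNIV) {..<d}" by (auto simp: disjoint_family_on_def)
  fix j assume "j \<in> {..<d}"
  then have j: "j < d" by simp
  note WP = BM_cont_paths[OF W]
  show "(\<lambda>x. coord_path j (W x)) \<in> incr_algebra (space M) W d ({j} \<times> UNIV) \<rightarrow>\<^sub>M path_borel 1"
  proof (rule measurable_path_borelI)
    fix t and i :: nat assume t: "0 <= (t::real)" and i: "i < 1"
    have "(\<lambda>x. W x t $ j - W x 0 $ j) \<in> borel_measurable (incr_algebra (space M) W d ({j} \<times> UNIV))"
      by (rule measurable_increment[OF WP]) (use j t in auto)
    then show "(\<lambda>x. coord_path j (W x) t $ i) \<in> borel_measurable (incr_algebra (space M) W d ({j} \<times> UNIV))"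
      by (rule measurable_cong[THEN iffD1, rotated]) (use t i j BM_0[OF W] in "simp add: coord_path_def")
  qed (rule coord_path_cont_paths[OF WP j], simp)
qed

text \<open>Brownian scaling by \<open>c\<close> combined with projection onto the direction
  \<open>a\<close>; for \<open>a\<close> of Euclidean length 1 the result is a standard Brownian
  motion, whatever \<open>c > 0\<close> is.\<close>

definition lincomb_path :: "nat => (nat => real) => real => (real => real vec) => real => real vec" where
  "lincomb_path d a c x = (\<lambda>t\<in>{0..}. Matrix.vec 1 (\<lambda>_. \<Sum>k<d. a k * (c * x (t / c\<^sup>2) $ k)))"

lemma lincomb_path_cont_paths:
  assumes "x \<in> cont_paths d"
  shows "lincomb_path d a c x \<in> cont_paths 1"
proof -
  have "continuous_on {0..} (\<lambda>t. t / c\<^sup>2)" unfolding divide_inverse by (intro continuous_intros)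
  then have "continuous_on {0..} (\<lambda>t. x (t / c\<^sup>2) $ k)" if "k < d" for k
    by (rule continuous_on_compose2[OF cont_paths_continuous[OF assms that]]) auto
  then show ?thesis unfolding lincomb_path_def
    by (intro cont_paths_vecI continuous_on_sum continuous_on_mult_left) auto
qed

lemma measurable_lincomb_path: "lincomb_path d a c \<in> path_borel d \<rightarrow>\<^sub>M path_borel 1"
proof (rule measurable_path_borelI)
  show "lincomb_path d a c x \<in> cont_paths 1" if "x \<in> space (path_borel d)" for x
    using that by (simp add: topspace_path_topology lincomb_path_cont_paths del: One_nat_def)
  fix t and i :: nat assume "0 <= (t::real)" "i < 1"
  then show "(\<lambda>x. lincomb_path d a c x t $ i) \<in> borel_measurable (path_borel d)"
    by (auto simp: lincomb_path_def intro!: borel_measurable_sum borel_measurable_times measurable_path_eval)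
qed

lemma BM_lincomb:
  assumes M: "prob_space M" and W: "standard_BM M d W" and a: "(\<Sum>k<d. (a k)\<^sup>2) = 1" and c: "0 < c"
  shows "standard_BM M 1 (\<lambda>w. lincomb_path d a c (W w))"
proof -
  interpret prob_space M by fact
  let ?B = "\<lambda>w. lincomb_path d a c (W w)"
  have incr: "?B w t $ 0 - ?B w s $ 0 = (\<Sum>k<d. a k * (c * (W w (t / c\<^sup>2) $ k - W w (s / c\<^sup>2) $ k)))"
    if "0 <= s" "0 <= t" for w s t
    using that by (simp add: lincomb_path_def algebra_simps sum_subtractf)
  show ?thesis unfolding standard_BM_def
  proof (intro conjI allI impI ballI; (elim conjE)?)
    show "?B \<in> M \<rightarrow>\<^sub>M path_borel 1" by (rule measurable_compose[OF BM_measurable[OF W] measurable_lincomb_path])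
    show "?B w 0 = 0\<^sub>v 1" if "w \<in> space M" for w
      using BM_0[OF W that] by (auto simp: lincomb_path_def)
  next
    fix i :: nat and s t :: real assume i: "i < 1" and st: "0 <= s" "s < t"
    have st': "0 <= s / c\<^sup>2" "s / c\<^sup>2 < t / c\<^sup>2" using st c by (auto intro: divide_strict_right_mono)
    \<comment> \<open>Zero coefficients are discarded, because the sum rule for normal densities
      needs positive standard deviations.\<close>
    define A where "A = {k. k < d \<and> a k \<noteq> 0}"
    have A: "finite A" "A \<noteq> {}" "\<And>k. k \<in> A ==> k < d" "\<And>k. k \<in> A ==> a k \<noteq> 0"
    proof -
      show "A \<noteq> {}"
      proof
        assume "A = {}"
        then have "(\<Sum>k<d. (a k)\<^sup>2) = 0" unfolding A_def by (intro sum.neutral) auto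
        then show False using a by simp
      qed
    qed (auto simp: A_def)
    let ?X = "\<lambda>k w. a k * (c * (W w (t / c\<^sup>2) $ k - W w (s / c\<^sup>2) $ k))"
    \<comment> \<open>A grid with a single step, so that \<open>BM_indep\<close> speaks of the
      increments of all coordinates over one interval.\<close>
    let ?\<tau> = "\<lambda>k::nat. if k = 0 then s / c\<^sup>2 else t / c\<^sup>2"
    have "indep_vars (\<lambda>_. borel) (\<lambda>(i, k) w. W w (?\<tau> (Suc k)) $ i - W w (?\<tau> k) $ i) ({..<d} \<times> {..<1})"
      by (rule BM_indep[OF W]) (use st' in auto)
    then have "indep_vars (\<lambda>k. PiM ({k} \<times> {..<1}) (\<lambda>_. borel))
      (\<lambda>j w. \<lambda>x\<in>{j} \<times> {..<1}. (case x of (i, k) => \<lambda>w. W w (?\<tau> (Suc k)) $ i - W w (?\<tau> k) $ i) w) A"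
      by (rule indep_vars_restrict) (use A(3) in "auto simp: disjoint_family_on_def")
    then have "indep_vars (\<lambda>_. borel) (\<lambda>j w. a j * (c * (\<lambda>x\<in>{j} \<times> {..<1}.
        (case x of (i, k) => \<lambda>w. W w (?\<tau> (Suc k)) $ i - W w (?\<tau> k) $ i) w) (j, 0))) A"
      by (rule indep_vars_compose2[where Y = "\<lambda>j p. a j * (c * p (j, 0))"])
        (auto intro!: borel_measurable_times measurable_component_singleton)
    then have ind: "indep_vars (\<lambda>_. borel) ?X A"
      by simp
    have nor: "distributed M lborel (?X k) (normal_density 0 (\<bar>a k\<bar> * sqrt (t - s)))" if k: "k \<in> A" for k
    proof -
      have pos: "0 < sqrt (t / c\<^sup>2 - s / c\<^sup>2)" using st' by simp
      have ne: "a k * c \<noteq> 0" using A(4)[OF k] c by simp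
      have eq: "\<bar>a k * c\<bar> * sqrt (t / c\<^sup>2 - s / c\<^sup>2) = \<bar>a k\<bar> * sqrt (t - s)"
        using c by (simp add: abs_mult real_sqrt_divide flip: diff_divide_distrib)
      show ?thesis
        using normal_density_affine[OF BM_normal[OF W A(3)[OF k] st'] pos ne, of 0] unfolding eq
        by (simp add: mult.assoc)
    qed
    have "distributed M lborel (\<lambda>w. \<Sum>k\<in>A. ?X k w)
        (normal_density (\<Sum>k\<in>A. 0) (sqrt (\<Sum>k\<in>A. (\<bar>a k\<bar> * sqrt (t - s))\<^sup>2)))"
      by (rule sum_indep_normal[OF A(1,2) ind]) (use nor A(4) st in auto)
    also have "(\<Sum>k\<in>A. (\<bar>a k\<bar> * sqrt (t - s))\<^sup>2) = (\<Sum>k<d. (a k)\<^sup>2) * (t - s)"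
    proof -
      have "(\<Sum>k\<in>A. (\<bar>a k\<bar> * sqrt (t - s))\<^sup>2) = (\<Sum>k\<in>A. (a k)\<^sup>2 * (t - s))"
        using st by (simp add: power_mult_distrib)
      also have "... = (\<Sum>k<d. (a k)\<^sup>2 * (t - s))" by (rule sum.mono_neutral_left) (auto simp: A_def)
      finally show ?thesis by (simp add: sum_distrib_right)
    qed
    also have "(\<lambda>w. \<Sum>k\<in>A. ?X k w) = (\<lambda>w. ?B w t $ i - ?B w s $ i)"
    proof
      fix w
      have "(\<Sum>k\<in>A. ?X k w) = (\<Sum>k<d. ?X k w)" by (rule sum.mono_neutral_left) (auto simp: A_def)
      then show "(\<Sum>k\<in>A. ?X k w) = ?B w t $ i - ?B w s $ i" using i st incr[of s t w] by simp
    qed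
    finally show "distributed M lborel (\<lambda>w. ?B w t $ i - ?B w s $ i) (normal_density 0 (sqrt (t - s)))"
      by (simp add: a)
  next
    fix n :: nat and \<tau> :: "nat => real" assume \<tau>: "0 <= \<tau> 0" "\<forall>k<n. \<tau> k < \<tau> (Suc k)"
    have \<tau>0: "0 <= \<tau> k" if "k <= n" for k
      by (rule grid_nonneg[of \<tau> n]) (use \<tau> that in auto)
    let ?D = "\<lambda>(i, k) w. W w (\<tau> (Suc k) / c\<^sup>2) $ i - W w (\<tau> k / c\<^sup>2) $ i"
    have "indep_vars (\<lambda>_. borel) ?D ({..<d} \<times> {..<n})"
      by (rule BM_indep[OF W, of "\<lambda>k. \<tau> k / c\<^sup>2"]) (use \<tau> c in "auto intro!: divide_strict_right_mono")
    \<comment> \<open>The increments are grouped by time step: each increment of the projection uses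
      only the group of its own step.\<close>
    then have "indep_vars (\<lambda>p. PiM ({..<d} \<times> {snd p}) (\<lambda>_. borel))
        (\<lambda>p w. \<lambda>x\<in>{..<d} \<times> {snd p}. ?D x w) ({..<1::nat} \<times> {..<n})"
      by (rule indep_vars_restrict) (auto simp: disjoint_family_on_def)
    then have "indep_vars (\<lambda>_. borel) (\<lambda>p w. \<Sum>l<d. a l * (c * (\<lambda>x\<in>{..<d} \<times> {snd p}. ?D x w) (l, snd p))) ({..<1::nat} \<times> {..<n})"
      by (rule indep_vars_compose2[where Y = "\<lambda>p q. \<Sum>l<d. a l * (c * q (l, snd p))"])
        (auto intro!: borel_measurable_sum borel_measurable_times measurable_component_singleton)
    then show "indep_vars (\<lambda>_. borel) (\<lambda>(i, k) w. ?B w (\<tau> (Suc k)) $ i - ?B w (\<tau> k) $ i) ({..<1} \<times> {..<n})"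
      by (rule indep_vars_cong[THEN iffD1, OF refl _ refl, rotated])
        (use \<tau>0 incr in "auto simp: fun_eq_iff")
  qed
qed

lemma BM_coord:
  assumes M: "prob_space M" and W: "standard_BM M d W" and j: "j < d"
  shows "standard_BM M 1 (\<lambda>w. coord_path j (W w))"
proof -
  have "(\<Sum>k<d. (if k = j then 1 else 0 :: real) * (1 * y k)) = y j" for y :: "nat => real"
    using j by (simp add: if_distrib[of "\<lambda>x. x * _"] sum.delta cong: if_cong)
  then have "lincomb_path d (\<lambda>k. if k = j then 1 else 0) 1 = coord_path j"
    by (auto simp: lincomb_path_def coord_path_def fun_eq_iff)
  moreover have "(\<Sum>k<d. (if k = j then 1 else 0 :: real)\<^sup>2) = 1"
    using j by (simp add: if_distrib[of "\<lambda>x. x\<^sup>2"] sum.delta cong: if_cong)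
  ultimately show ?thesis using BM_lincomb[OF M W, of "\<lambda>k. if k = j then 1 else 0" 1] by simp
qed

subsection \<open>Matrices\<close>

lemma zero_less_one_nat: "(0::nat) < 1"
  by simp

lemma pow_mat_Suc_left:
  assumes A: "A \<in> carrier_mat n n"
  shows "A ^\<^sub>m (Suc k) = A * A ^\<^sub>m k"
proof (induction k)
  case (Suc k)
  have "A ^\<^sub>m (Suc (Suc k)) = (A * A ^\<^sub>m k) * A" using Suc by simp
  also have "... = A * A ^\<^sub>m (Suc k)" using A by (simp add: assoc_mult_mat[OF A _ A])
  finally show ?case .
qed (use A in simp)

lemma mat_mult_index: "A \<in> carrier_mat n m ==> B \<in> carrier_mat m l ==> i < n ==> j < l ==>
  (A * B) $$ (i, j) = (\<Sum>k<m. A $$ (i, k) * B $$ (k, j))"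
  by (auto simp: scalar_prod_def atLeast0LessThan intro!: sum.cong)

text \<open>With \<open>R = s (I - t A)\<close>, where \<open>t < 1\<close> and the powers of \<open>A\<close> are bounded, a partial sum of the
  Neumann series of \<open>(I - t A)\<^sup>-\<^sup>1\<close> applied to the vector of ones is the required vector \<open>v\<close>.\<close>

lemma M_matrix_reflection:
  assumes d: "0 < d" and R: "M_matrix d R"
  obtains v where "reflection d R v"
proof -
  obtain s B where Rc: "R \<in> carrier_mat d d" and s: "s > 0" and B: "B \<in> carrier_mat d d"
    and Bn: "\<And>i j. i < d ==> j < d ==> 0 <= B $$ (i, j)"
    and rho: "spectral_radius (map_mat complex_of_real B) < s" and RB: "R = s \<cdot>\<^sub>m 1\<^sub>m d - B"
    using R unfolding M_matrix_def by blast
  let ?C = "map_mat complex_of_real"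
  define \<rho> where "\<rho> = spectral_radius (?C B)"
  have CB: "?C B \<in> carrier_mat d d" using B by simp
  have "\<rho> \<in> norm ` spectrum (?C B)" unfolding \<rho>_def by (rule spectral_radius_mem_max(1)[OF CB d])
  then have \<rho>0: "0 <= \<rho>" by auto
  \<comment> \<open>Strictly between the spectral radius of \<open>B\<close> and \<open>s\<close>:
    division of \<open>B\<close> by \<open>u\<close> gives spectral radius below 1, hence bounded
    powers, and still leaves the factor \<open>u / s < 1\<close> that makes the Neumann series
    converge.\<close>
  define u where "u = (\<rho> + s) / 2"
  have u: "\<rho> < u" "u < s" "0 < u" using rho \<rho>0 by (auto simp: u_def \<rho>_def)
  define A where "A = (1 / u) \<cdot>\<^sub>m B"
  have A: "A \<in> carrier_mat d d" and An: "\<And>i j. i < d ==> j < d ==> 0 <= A $$ (i, j)"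
    using B Bn u by (auto simp: A_def)
  have CA: "?C A \<in> carrier_mat d d" using A by simp
  have "spectral_radius (?C A) < 1"
  proof -
    have "spectral_radius (?C A) \<in> norm ` spectrum (?C A)" by (rule spectral_radius_mem_max(1)[OF CA d])
    then obtain k where k: "eigenvalue (?C A) k" "spectral_radius (?C A) = norm k" by (auto simp: spectrum_def)
    then obtain x where x: "x \<in> carrier_vec d" "x \<noteq> 0\<^sub>v d" "?C A *\<^sub>v x = k \<cdot>\<^sub>v x"
      using A by (auto simp: eigenvalue_def eigenvector_def)
    have "?C B = complex_of_real u \<cdot>\<^sub>m ?C A" using u B by (intro eq_matI) (auto simp: A_def)
    then have "?C B *\<^sub>v x = complex_of_real u \<cdot>\<^sub>v (?C A *\<^sub>v x)" using CA x(1) by (intro eq_vecI) auto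
    also have "... = (complex_of_real u * k) \<cdot>\<^sub>v x" using x by (simp add: smult_smult_assoc)
    finally have "eigenvalue (?C B) (complex_of_real u * k)"
      using x B unfolding eigenvalue_def eigenvector_def by auto
    then have "norm (complex_of_real u * k) <= \<rho>"
      unfolding \<rho>_def by (intro spectral_radius_mem_max(2)[OF CB d]) (simp add: spectrum_def)
    then have "u * norm k <= \<rho>" using u by (simp add: norm_mult)
    then have "u * norm k < u * 1" using u by linarith
    then have "norm k < 1" using u(3) by (simp only: mult_less_cancel_left_pos)
    then show ?thesis using k by simp
  qed
  moreover have "\<exists>n_as. jordan_nf (?C A) n_as"
    using char_poly_factorized[OF CA] jordan_nf_exists[OF CA] by blast
  ultimately obtain c where c: "\<And>k. norm_bound (?C A ^\<^sub>m k) c"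
    using spectral_radius_jnf_norm_bound_less_1[OF CA] by blast
  have Apow: "\<bar>(A ^\<^sub>m k) $$ (i, j)\<bar> <= c" if "i < d" "j < d" for k i j
  proof -
    have "?C A ^\<^sub>m k = ?C (A ^\<^sub>m k)" by (rule of_real_hom.mat_hom_pow[OF A, symmetric])
    moreover have "A ^\<^sub>m k \<in> carrier_mat d d" using A by simp
    ultimately show ?thesis using c[of k] that A unfolding norm_bound_def by (auto split: if_splits)
  qed
  define q where "q k i = (\<Sum>j<d. (A ^\<^sub>m k) $$ (i, j))" for k i
  have q0: "q 0 i = 1" if "i < d" for i
    using that A by (simp add: q_def if_distrib sum.delta cong: if_cong)
  have qSuc: "q (Suc k) i = (\<Sum>l<d. A $$ (i, l) * q k l)" if "i < d" for k i
  proof -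
    have Ak: "A ^\<^sub>m k \<in> carrier_mat d d" using A by simp
    have "q (Suc k) i = (\<Sum>j<d. \<Sum>l<d. A $$ (i, l) * (A ^\<^sub>m k) $$ (l, j))"
      unfolding q_def pow_mat_Suc_left[OF A] by (rule sum.cong[OF refl]) (use mat_mult_index[OF A Ak that] in auto)
    also have "... = (\<Sum>l<d. A $$ (i, l) * q k l)"
      unfolding q_def sum_distrib_left by (rule sum.swap)
    finally show ?thesis .
  qed
  have qn: "0 <= q k i" if "i < d" for k i
    using that by (induction k arbitrary: i) (auto simp: q0 qSuc intro!: sum_nonneg mult_nonneg_nonneg An)
  have qb: "q k i <= real d * c" if "i < d" for k i
  proof -
    have "q k i <= (\<Sum>j<d. c)" unfolding q_def
    proof (rule sum_mono)
      fix j assume "j \<in> {..<d}"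
      then show "(A ^\<^sub>m k) $$ (i, j) <= c" using Apow[OF that, of j k] by (simp add: abs_le_iff)
    qed
    then show ?thesis by simp
  qed
  define t where "t = u / s"
  have t: "0 < t" "t < 1" using u s by (auto simp: t_def)
  have "(\<lambda>n. t ^ n * (real d * c)) \<longlonglongrightarrow> 0 * (real d * c)"
    using t by (intro tendsto_mult LIMSEQ_realpow_zero tendsto_const) auto
  then have "\<forall>\<^sub>F n in sequentially. t ^ n * (real d * c) < 1" by (intro order_tendstoD(2)) auto
  then obtain n0 where n0: "\<And>n. n \<ge> n0 ==> t ^ n * (real d * c) < 1" by (auto simp: eventually_sequentially)
  \<comment> \<open>Large enough for the remainder: row \<open>i\<close> of \<open>R v\<close> is
    \<open>s (1 - t ^ n * q n i)\<close>, and \<open>q n i <= d * c\<close>. The successor ensures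
    that the term for \<open>k = 0\<close>, which is 1, occurs in \<open>v\<close>.\<close>
  define n where "n = Suc n0"
  have tn: "t ^ n * (real d * c) < 1" by (rule n0) (simp add: n_def)
  define v where "v i = (\<Sum>k<n. t ^ k * q k i)" for i
  have Rij: "R $$ (i, j) = (if i = j then s else 0) - s * t * A $$ (i, j)" if "i < d" "j < d" for i j
    using that B s u by (simp add: RB A_def t_def)
  have "reflection d R v"
  proof (unfold_locales)
    show "R \<in> carrier_mat d d" by (rule Rc)
    fix i assume i: "i < d"
    { fix j assume "j < d" "i \<noteq> j"
      then show "R $$ (i, j) <= 0" using i s t An[OF i] by (simp add: Rij) }
    have "1 <= v i" unfolding v_def n_def sum.lessThan_Suc_shift
      using t qn[OF i] by (simp add: q0[OF i] sum_nonneg)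
    then show "0 < v i" by simp
    have "(\<Sum>j<d. s * t * A $$ (i, j) * v j) = s * (\<Sum>k<n. t ^ Suc k * q (Suc k) i)"
    proof -
      have "(\<Sum>j<d. s * t * A $$ (i, j) * v j) = (\<Sum>j<d. \<Sum>k<n. s * (t ^ Suc k * (A $$ (i, j) * q k j)))"
        by (simp add: v_def sum_distrib_left algebra_simps)
      also have "... = (\<Sum>k<n. \<Sum>j<d. s * (t ^ Suc k * (A $$ (i, j) * q k j)))" by (rule sum.swap)
      also have "... = s * (\<Sum>k<n. t ^ Suc k * q (Suc k) i)" by (simp add: qSuc[OF i] sum_distrib_left)
      finally show ?thesis .
    qed
    also have "(\<Sum>k<n. t ^ Suc k * q (Suc k) i) = v i - 1 + t ^ n * q n i"
      using sum.lessThan_Suc_shift[of "\<lambda>k. t ^ k * q k i" n] by (simp add: v_def q0[OF i])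
    finally have AV: "(\<Sum>j<d. s * t * A $$ (i, j) * v j) = s * (v i - 1 + t ^ n * q n i)" .
    have "(\<Sum>j<d. R $$ (i, j) * v j) = (\<Sum>j<d. (if i = j then s * v j else 0) - s * t * A $$ (i, j) * v j)"
      by (rule sum.cong) (auto simp: Rij[OF i] left_diff_distrib)
    also have "... = s * v i - s * (v i - 1 + t ^ n * q n i)"
      using i by (simp add: sum_subtractf AV)
    also have "... = s * (1 - t ^ n * q n i)" by (simp add: algebra_simps)
    finally have "(\<Sum>j<d. R $$ (i, j) * v j) = s * (1 - t ^ n * q n i)" .
    moreover have "t ^ n * q n i < 1"
      using mult_left_mono[OF qb[OF i, of n] zero_le_power[OF less_imp_le[OF t(1)], of n]] tn by linarith
    ultimately show "0 < (\<Sum>j<d. R $$ (i, j) * v j)" using s by simp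
  qed
  then show ?thesis by (rule that)
qed

section \<open>Submatrices and inverses\<close>

lemma card_less_inter: "m <= n ==> card {i. i < n \<and> i \<in> {..<m}} = m" for m n :: nat
proof -
  assume "m <= n"
  then have "{i. i < n \<and> i \<in> {..<m}} = {..<m}" by auto
  then show ?thesis by simp
qed

lemma card_single_inter: "j < n ==> card {i. i < n \<and> i \<in> {j}} = 1" for j n :: nat
proof -
  assume "j < n"
  then have "{i. i < n \<and> i \<in> {j}} = {j}" by auto
  then show ?thesis by simp
qed

lemma pick_lessThan: "i < m ==> pick {..<m} i = i"
proof -
  assume "i < m"
  then have "{a \<in> {..<m}. a < i} = {..<i}" by auto
  then show "pick {..<m} i = i" using pick_card_in_set[of i "{..<m}"] \<open>i < m\<close> by simp
qed

lemma pick_single: "pick {j} 0 = j"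
proof -
  have e: "{a \<in> {j}. a < j} = {}" by auto
  have "pick {j} (card {a \<in> {j}. a < j}) = j" by (rule pick_card_in_set) simp
  then show ?thesis unfolding e by (simp del: pick.simps)
qed

context
  fixes A :: "real mat" and d m :: nat
  assumes A: "A \<in> carrier_mat d d" and m: "m <= d"
begin

lemma dims: "dim_row A = d" "dim_col A = d"
  using A by auto

lemma submatrix_principal: "submatrix A {..<m} {..<m} \<in> carrier_mat m m"
  "i < m ==> k < m ==> submatrix A {..<m} {..<m} $$ (i, k) = A $$ (i, k)"
  by (rule carrier_matI; simp only: dim_submatrix dims card_less_inter[OF m])
    (simp only: submatrix_index dims card_less_inter[OF m] pick_lessThan)

lemma submatrix_row: "j < d ==> submatrix A {j} {..<m} \<in> carrier_mat 1 m"
  "j < d ==> k < m ==> submatrix A {j} {..<m} $$ (0, k) = A $$ (j, k)"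
  by (rule carrier_matI; simp only: dim_submatrix dims card_less_inter[OF m] card_single_inter)
    (simp only: submatrix_index dims card_less_inter[OF m] card_single_inter zero_less_one pick_lessThan pick_single)

lemma submatrix_col: "j < d ==> submatrix A {..<m} {j} \<in> carrier_mat m 1"
  "j < d ==> k < m ==> submatrix A {..<m} {j} $$ (k, 0) = A $$ (k, j)"
  by (rule carrier_matI; simp only: dim_submatrix dims card_less_inter[OF m] card_single_inter)
    (simp only: submatrix_index dims card_less_inter[OF m] card_single_inter zero_less_one pick_lessThan pick_single)

end

lemma mat_inv_eqI:
  assumes A: "A \<in> carrier_mat n n" and B: "B \<in> carrier_mat n n" and BA: "B * A = 1\<^sub>m n"
  shows "mat_inv A = B" "A * B = 1\<^sub>m n"
proof -
  have AB: "A * B = 1\<^sub>m n" by (rule mat_mult_left_right_inverse[OF B A BA])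
  then have "A \<in> Units (ring_mat TYPE(real) n ())"
    using A B BA unfolding Units_def ring_mat_def by auto
  then obtain C where C: "mat_inverse A = Some C" using mat_inverse(1)[OF A, where b = "()"] by (cases "mat_inverse A") auto
  then have C': "A * C = 1\<^sub>m n" "C \<in> carrier_mat n n" using mat_inverse(2)[OF A C] by auto
  have "B = B * (A * C)" using B C' by simp
  also have "... = (B * A) * C" by (rule assoc_mult_mat[OF B A C'(2), symmetric])
  also have "... = C" using BA C' by simp
  finally show "mat_inv A = B" using C by (simp add: mat_inv_def)
  show "A * B = 1\<^sub>m n" by (rule AB)
qed

lemma mat_inv_det:
  assumes A: "A \<in> carrier_mat n n" and det: "det A \<noteq> 0"
  shows "mat_inv A \<in> carrier_mat n n" "A * mat_inv A = 1\<^sub>m n" "mat_inv A * A = 1\<^sub>m n"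
proof -
  obtain C where C: "mat_inverse A = Some C"
    using mat_inverse(1)[OF A, where b = "()"] det_non_zero_imp_unit[OF A det, of "()"] by (cases "mat_inverse A") auto
  with mat_inverse(2)[OF A C] show "mat_inv A \<in> carrier_mat n n" "A * mat_inv A = 1\<^sub>m n" "mat_inv A * A = 1\<^sub>m n"
    by (auto simp: mat_inv_def)
qed

section \<open>Block elimination and the coefficients \<open>w_coeff\<close>\<close>

context reflection
begin

text \<open>For a row before \<open>m\<close>, dropping the columns from \<open>m\<close> on removes
  only nonpositive terms from \<open>R v\<close>.\<close>

lemma principal_nonsingular:
  assumes "m <= d"
  shows "nonsingular_M m (\<lambda>i j. R $$ (i, j)) v"
proof
  fix i j assume i: "i < m"
  { assume "j < m" "i \<noteq> j" then show "R $$ (i, j) <= 0" using i assms by (intro offdiag) auto }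
  show "0 < v i" using i assms by (intro v_pos) auto
  have "0 < (\<Sum>j<d. R $$ (i, j) * v j)" using i assms by (intro rv_pos) auto
  also have "... = (\<Sum>j<m. R $$ (i, j) * v j) + (\<Sum>j\<in>{m..<d}. R $$ (i, j) * v j)"
    using assms by (subst sum.union_disjoint[symmetric]) (auto intro!: sum.cong)
  also have "... <= (\<Sum>j<m. R $$ (i, j) * v j) + 0"
    using i assms v_pos by (intro add_left_mono sum_nonpos mult_nonpos_nonneg offdiag) (auto intro: less_imp_le)
  finally show "0 < (\<Sum>j<m. R $$ (i, j) * v j)" by simp
qed

definition principal_inv :: "nat => real mat" where
  "principal_inv m = mat_inv (submatrix R {..<m} {..<m})"

text \<open>A kernel vector and its negative both satisfy the hypothesis of
  \<open>max_principle\<close> with \<open>c = 0\<close>, so the vector vanishes.\<close>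

lemma principal_det:
  assumes m: "m <= d"
  shows "det (submatrix R {..<m} {..<m}) \<noteq> 0"
proof
  let ?A = "submatrix R {..<m} {..<m}"
  note A = submatrix_principal[OF R_carrier m]
  interpret P: nonsingular_M m "\<lambda>i j. R $$ (i, j)" v by (rule principal_nonsingular[OF m])
  assume "det ?A = 0"
  then obtain x where x: "x \<in> carrier_vec m" "x \<noteq> 0\<^sub>v m" "?A *\<^sub>v x = 0\<^sub>v m"
    using det_0_iff_vec_prod_zero[OF A(1)] by blast
  have zero: "(\<Sum>j<m. R $$ (i, j) * x $ j) = 0" if "i < m" for i
  proof -
    have "(\<Sum>j<m. R $$ (i, j) * x $ j) = (\<Sum>j<m. ?A $$ (i, j) * x $ j)" using that by (intro sum.cong) (auto simp: A(2))
    also have "... = (?A *\<^sub>v x) $ i" by (rule mult_mat_vec_index[OF A(1) x(1) that, symmetric])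
    finally show ?thesis using x(3) that by simp
  qed
  have "x $ i = 0" if "i < m" for i
  proof -
    have "x $ i <= P.K * 0" by (rule P.max_principle[OF _ order.refl that]) (simp add: zero)
    moreover have "- x $ i <= P.K * 0"
      by (rule P.max_principle[OF _ order.refl that, of "\<lambda>i. - x $ i"]) (simp add: zero sum_negf)
    ultimately show ?thesis by simp
  qed
  then have "x = 0\<^sub>v m" using x(1) by (intro eq_vecI) auto
  then show False using x(2) by simp
qed

text \<open>The last claim is inverse positivity: the block maps minus a column of its inverse to
  minus a unit vector, so \<open>max_principle\<close> with \<open>c = 0\<close> makes that vector
  nonpositive.\<close>

lemma principal_inv:
  assumes m: "m <= d"
  shows "principal_inv m \<in> carrier_mat m m"
    and "i < m ==> j < m ==> (\<Sum>k<m. R $$ (i, k) * principal_inv m $$ (k, j)) = (if i = j then 1 else 0)"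
    and "i < m ==> j < m ==> (\<Sum>k<m. principal_inv m $$ (i, k) * R $$ (k, j)) = (if i = j then 1 else 0)"
    and "i < m ==> j < m ==> 0 <= principal_inv m $$ (i, j)"
proof -
  let ?A = "submatrix R {..<m} {..<m}"
  note A = submatrix_principal[OF R_carrier m]
  note I = mat_inv_det[OF A(1) principal_det[OF m], folded principal_inv_def]
  interpret P: nonsingular_M m "\<lambda>i j. R $$ (i, j)" v by (rule principal_nonsingular[OF m])
  show "principal_inv m \<in> carrier_mat m m" by (rule I(1))
  have r: "(\<Sum>k<m. R $$ (i, k) * principal_inv m $$ (k, j)) = (if i = j then 1 else 0)" if "i < m" "j < m" for i j
  proof -
    have "(\<Sum>k<m. R $$ (i, k) * principal_inv m $$ (k, j)) = (?A * principal_inv m) $$ (i, j)"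
      unfolding mat_mult_index[OF A(1) I(1) that] by (intro sum.cong) (use that in "auto simp: A(2)")
    then show ?thesis using I(2) that by simp
  qed
  then show "i < m ==> j < m ==> (\<Sum>k<m. R $$ (i, k) * principal_inv m $$ (k, j)) = (if i = j then 1 else 0)" .
  show "(\<Sum>k<m. principal_inv m $$ (i, k) * R $$ (k, j)) = (if i = j then 1 else 0)" if "i < m" "j < m"
  proof -
    have "(\<Sum>k<m. principal_inv m $$ (i, k) * R $$ (k, j)) = (principal_inv m * ?A) $$ (i, j)"
      unfolding mat_mult_index[OF I(1) A(1) that] by (intro sum.cong) (use that in "auto simp: A(2)")
    then show ?thesis using I(3) that by simp
  qed
  show "0 <= principal_inv m $$ (i, j)" if "i < m" "j < m"
  proof -
    have "- principal_inv m $$ (i, j) <= P.K * 0"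
    proof (rule P.max_principle[OF _ order.refl that(1), of "\<lambda>i. - principal_inv m $$ (i, j)"])
      fix k assume "k < m"
      then show "(\<Sum>l<m. R $$ (k, l) * - principal_inv m $$ (l, j)) <= 0"
        using r[OF _ that(2), of k] by (simp add: sum_negf)
    qed
    then show ?thesis by simp
  qed
qed

text \<open>Block elimination of the first \<open>m\<close> coordinates: \<open>elim m l\<close> is the row
  \<open>- R\<^bsub>l,[1:m]\<^esub> R\<^sub>m\<^sup>-\<^sup>1\<close> and \<open>schur m\<close> the Schur complement.\<close>

definition elim :: "nat => nat => nat => real" where
  "elim m l i = - (\<Sum>k<m. R $$ (l, k) * principal_inv m $$ (k, i))"

definition schur :: "nat => nat => nat => real" where
  "schur m l k = R $$ (l, k) + (\<Sum>i<m. elim m l i * R $$ (i, k))"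

lemma schur_eliminated:
  assumes m: "m <= d" and k: "k < m"
  shows "schur m l k = 0"
proof -
  have "(\<Sum>i<m. elim m l i * R $$ (i, k)) = - (\<Sum>i<m. \<Sum>n<m. R $$ (l, n) * (principal_inv m $$ (n, i) * R $$ (i, k)))"
    by (simp add: elim_def sum_negf sum_distrib_right mult.assoc)
  also have "(\<Sum>i<m. \<Sum>n<m. R $$ (l, n) * (principal_inv m $$ (n, i) * R $$ (i, k)))
      = (\<Sum>n<m. R $$ (l, n) * (\<Sum>i<m. principal_inv m $$ (n, i) * R $$ (i, k)))"
    unfolding sum_distrib_left by (rule sum.swap)
  also have "... = (\<Sum>n<m. if n = k then R $$ (l, n) else 0)"
    by (rule sum.cong) (use k in "auto simp: principal_inv(3)[OF m]")
  also have "... = R $$ (l, k)" using k by simp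
  finally show ?thesis by (simp add: schur_def)
qed

text \<open>The row of \<open>R\<close> is nonpositive off the diagonal and the inverse block is
  nonnegative.\<close>

lemma elim_nonneg:
  assumes "m <= l" "l < d" "i < m"
  shows "0 <= elim m l i"
  unfolding elim_def neg_0_le_iff_le using assms
  by (intro sum_nonpos mult_nonpos_nonneg offdiag principal_inv(4)) auto

lemma schur_offdiag:
  assumes "m <= l" "l < d" "m <= k" "k < d" "l \<noteq> k"
  shows "schur m l k <= 0"
  unfolding schur_def using assms
  by (intro add_nonpos_nonpos offdiag sum_nonpos mult_nonneg_nonpos elim_nonneg) auto

text \<open>Add to row \<open>l\<close> of \<open>R v > 0\<close> the nonnegative multiples
  \<open>elim m l i\<close> of the first \<open>m\<close> rows: the Schur complement is again a
  nonsingular M-matrix, with the same witness \<open>v\<close>.\<close>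

lemma schur_v_pos:
  assumes m: "m <= l" and l: "l < d"
  shows "0 < (\<Sum>k\<in>{m..<d}. schur m l k * v k)"
proof -
  have "0 < (\<Sum>k<d. R $$ (l, k) * v k) + (\<Sum>i<m. elim m l i * (\<Sum>k<d. R $$ (i, k) * v k))"
  proof (rule add_pos_nonneg[OF rv_pos[OF l]], rule sum_nonneg, rule mult_nonneg_nonneg)
    fix i assume "i \<in> {..<m}"
    then show "0 <= elim m l i" "0 <= (\<Sum>k<d. R $$ (i, k) * v k)"
      using m l rv_pos[of i] by (auto intro: elim_nonneg less_imp_le)
  qed
  also have "(\<Sum>i<m. elim m l i * (\<Sum>k<d. R $$ (i, k) * v k)) = (\<Sum>k<d. (\<Sum>i<m. elim m l i * R $$ (i, k)) * v k)"
    unfolding sum_distrib_left sum_distrib_right by (subst sum.swap) (simp add: mult.assoc)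
  also have "(\<Sum>k<d. R $$ (l, k) * v k) + ... = (\<Sum>k<d. schur m l k * v k)"
    by (simp add: schur_def sum.distrib distrib_right)
  also have "... = (\<Sum>k\<in>{m..<d}. schur m l k * v k)"
    using m l by (intro sum.mono_neutral_right) (auto simp: schur_eliminated)
  finally show ?thesis .
qed

text \<open>Follows from the row inequality, whose other terms are nonpositive. As
  \<open>1 - w_coeff R l l = schur l l l\<close>, this is the negativity of the limit drift.\<close>

lemma schur_diag_pos:
  assumes l: "l < d"
  shows "0 < schur l l l"
proof -
  have "0 < (\<Sum>k\<in>{l..<d}. schur l l k * v k)" by (rule schur_v_pos[OF order.refl l])
  also have "... = schur l l l * v l + (\<Sum>k\<in>{l..<d} - {l}. schur l l k * v k)" using l by (intro sum.remove) auto
  also have "... <= schur l l l * v l + 0"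
    using l v_pos by (intro add_left_mono sum_nonpos mult_nonpos_nonneg schur_offdiag) (auto intro: less_imp_le)
  finally show ?thesis using v_pos[OF l] by (simp add: zero_less_mult_iff)
qed

lemma row_times_inv_index:
  assumes j: "j < d" and i: "i < m" and m: "m <= d"
  shows "(submatrix R {j} {..<m} * principal_inv m) $$ (0, i) = - elim m j i"
  unfolding mat_mult_index[OF submatrix_row(1)[OF R_carrier m j] principal_inv(1)[OF m] zero_less_one_nat i] elim_def
  using submatrix_row(2)[OF R_carrier m j] by simp

lemma w_coeff_elim:
  assumes "i < j" "j < d"
  shows "w_coeff R i j = elim j j i"
proof -
  have "submatrix R {j} {..<j} * principal_inv j \<in> carrier_mat 1 j"
    using assms submatrix_row(1)[OF R_carrier, of j j] principal_inv(1)[of j] by auto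
  then have "(- (submatrix R {j} {..<j} * principal_inv j)) $$ (0, i) = - (submatrix R {j} {..<j} * principal_inv j) $$ (0, i)"
    using assms(1) by (intro index_uminus_mat(1)) (simp_all only: carrier_matD zero_less_one_nat)
  then show ?thesis
    using assms row_times_inv_index[of j i j] by (simp add: w_coeff_def principal_inv_def[symmetric])
qed

lemma w_coeff_diag:
  assumes j: "j < d"
  shows "1 - w_coeff R j j = schur j j j"
proof -
  have jd: "j <= d" using j by simp
  have c: "submatrix R {j} {..<j} * principal_inv j \<in> carrier_mat 1 j"
    using submatrix_row(1)[OF R_carrier jd j] principal_inv(1)[OF jd] by auto
  have "(submatrix R {j} {..<j} * principal_inv j * submatrix R {..<j} {j}) $$ (0, 0)
      = (\<Sum>i<j. - elim j j i * R $$ (i, j))"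
    unfolding mat_mult_index[OF c submatrix_col(1)[OF R_carrier jd j] zero_less_one_nat zero_less_one_nat]
    by (rule sum.cong) (auto simp: row_times_inv_index[OF j _ jd] submatrix_col(2)[OF R_carrier jd j])
  then show ?thesis by (simp add: w_coeff_def principal_inv_def[symmetric] schur_def sum_negf)
qed

text \<open>For \<open>R = I - P'\<close> the blocks in the two definitions are transposes of one
  another up to sign. Uniqueness of inverses makes \<open>mat_inv ?C\<close> the transpose of
  \<open>principal_inv j\<close>, and the signs of the off-diagonal blocks compensate.\<close>

lemma w_coeff_routing_eq:
  assumes P: "P \<in> carrier_mat d d" and RP: "R = 1\<^sub>m d - transpose_mat P" and j: "j < d" and ij: "i <= j"
  shows "w_coeff R i j = w_coeff_routing P i j"
proof -
  have jd: "j <= d" using j by simp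
  have idx: "R $$ (a, b) = (if a = b then 1 else 0) - P $$ (b, a)" if "a < d" "b < d" for a b
    using that P by (simp add: RP)
  let ?A = "submatrix R {..<j} {..<j}"
  let ?C = "1\<^sub>m j - submatrix P {..<j} {..<j}"
  note A = submatrix_principal[OF R_carrier jd] and SP = submatrix_principal[OF P jd]
  have C: "?C \<in> carrier_mat j j" by (rule minus_carrier_mat[OF SP(1)])
  have CA: "?C = transpose_mat ?A"
    using A(1) SP(1) jd by (intro eq_matI) (auto simp: A(2) SP(2) idx)
  note I = mat_inv_det[OF A(1) principal_det[OF jd], folded principal_inv_def]
  have "mat_inv ?C = transpose_mat (principal_inv j)"
  proof (rule mat_inv_eqI(1)[OF C])
    show "transpose_mat (principal_inv j) \<in> carrier_mat j j" using I(1) by simp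
    have "transpose_mat (principal_inv j) * ?C = transpose_mat (?A * principal_inv j)"
      unfolding CA by (rule transpose_mult[OF A(1) I(1), symmetric])
    then show "transpose_mat (principal_inv j) * ?C = 1\<^sub>m j" by (simp add: I(2))
  qed
  then have inv: "mat_inv ?C $$ (a, b) = principal_inv j $$ (b, a)" "mat_inv ?C \<in> carrier_mat j j" if "a < j" "b < j" for a b
    using that I(1) by auto
  have invc: "mat_inv ?C \<in> carrier_mat j j" using \<open>mat_inv ?C = transpose_mat (principal_inv j)\<close> I(1) by simp
  note pc = submatrix_col[OF P jd j] and pr = submatrix_row[OF P jd j]
  have e: "(mat_inv ?C * submatrix P {..<j} {j}) $$ (a, 0) = elim j j a" if a: "a < j" for a
  proof -
    have "(mat_inv ?C * submatrix P {..<j} {j}) $$ (a, 0) = (\<Sum>k<j. mat_inv ?C $$ (a, k) * submatrix P {..<j} {j} $$ (k, 0))"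
      by (rule mat_mult_index[OF invc pc(1) a zero_less_one_nat])
    also have "... = (\<Sum>k<j. - (R $$ (j, k) * principal_inv j $$ (k, a)))"
      by (rule sum.cong) (use a j in "auto simp: inv pc(2) idx")
    finally show ?thesis by (simp add: elim_def sum_negf)
  qed
  show ?thesis
  proof (cases "i < j")
    case True
    then show ?thesis using w_coeff_elim[OF True j] e[OF True] by (simp add: w_coeff_routing_def)
  next
    case False
    then have i: "i = j" using ij by simp
    have ec: "mat_inv ?C * submatrix P {..<j} {j} \<in> carrier_mat j 1" using invc pc(1) by simp
    have "(submatrix P {j} {..<j} * mat_inv ?C * submatrix P {..<j} {j}) $$ (0, 0)
        = (submatrix P {j} {..<j} * (mat_inv ?C * submatrix P {..<j} {j})) $$ (0, 0)"
      by (simp only: assoc_mult_mat[OF pr(1) invc pc(1)])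
    also have "... = (\<Sum>k<j. submatrix P {j} {..<j} $$ (0, k) * (mat_inv ?C * submatrix P {..<j} {j}) $$ (k, 0))"
      by (rule mat_mult_index[OF pr(1) ec zero_less_one_nat zero_less_one_nat])
    also have "... = (\<Sum>k<j. - (elim j j k * R $$ (k, j)))"
      by (rule sum.cong) (use j in "auto simp: pr(2) e idx")
    finally have "w_coeff_routing P j j = P $$ (j, j) - (\<Sum>k<j. elim j j k * R $$ (k, j))"
      by (simp add: w_coeff_routing_def sum_negf)
    also have "... = 1 - schur j j j" using j by (simp add: schur_def idx)
    finally show ?thesis using w_coeff_diag[OF j] i by simp
  qed
qed

end

subsection \<open>The limit process\<close>

lemma reflection_one: "reflection d (1\<^sub>m d) (\<lambda>_. 1)"
proof
  fix i assume "i < d"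
  then have "(\<Sum>j<d. 1\<^sub>m d $$ (i, j) * 1 :: real) = (\<Sum>j<d. if i = j then 1 else 0)"
    by (intro sum.cong) auto
  also have "... = 1" using \<open>i < d\<close> by simp
  finally show "0 < (\<Sum>j<d. 1\<^sub>m d $$ (i, j) * 1 :: real)" by simp
qed auto

text \<open>With the identity as reflection matrix the map acts on each coordinate separately, so
  one map expresses all the one-dimensional reflections at once.\<close>

interpretation one: reflection d "1\<^sub>m d" "\<lambda>_. 1" for d
  by (rule reflection_one)

definition free_path :: "nat => (nat => real) => (nat => real) => real vec => (real => real vec) => real => real vec" where
  "free_path d \<theta> \<sigma> z w = (\<lambda>t\<in>{0..}. Matrix.vec d (\<lambda>j. z $ j + \<theta> j * t + \<sigma> j * w t $ j))"

definition limit_path :: "nat => (nat => real) => (nat => real) => real vec => (real => real vec) => real => real vec" where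
  "limit_path d \<theta> \<sigma> z w = one.refl_path d (free_path d \<theta> \<sigma> z w)"

lemma free_path_cont_paths: "w \<in> cont_paths d ==> free_path d \<theta> \<sigma> z w \<in> cont_paths d"
  unfolding free_path_def by (intro cont_paths_vecI continuous_intros cont_paths_continuous)

lemma free_path_index: "0 <= t ==> j < d ==> free_path d \<theta> \<sigma> z w t $ j = z $ j + \<theta> j * t + \<sigma> j * w t $ j"
  by (simp add: free_path_def)

lemma limit_path_cont_paths: "w \<in> cont_paths d ==> limit_path d \<theta> \<sigma> z w \<in> cont_paths d"
  unfolding limit_path_def by (intro one.refl_path_cont_paths free_path_cont_paths)

lemma measurable_limit_path:
  "(\<lambda>p. limit_path d \<theta> \<sigma> (fst p) (snd p)) \<in> vec_borel d \<Otimes>\<^sub>M path_borel d \<rightarrow>\<^sub>M path_borel d"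
  unfolding limit_path_def
proof (rule measurable_compose[OF _ one.measurable_refl_path], rule measurable_path_borelI)
  fix p assume "p \<in> space (vec_borel d \<Otimes>\<^sub>M path_borel d)"
  then show "free_path d \<theta> \<sigma> (fst p) (snd p) \<in> cont_paths d"
    by (intro free_path_cont_paths) (auto simp: space_pair_measure topspace_path_topology)
next
  fix t j assume "0 <= (t::real)" "j < d"
  then show "(\<lambda>p. free_path d \<theta> \<sigma> (fst p) (snd p) t $ j) \<in> borel_measurable (vec_borel d \<Otimes>\<^sub>M path_borel d)"
    by (simp only: free_path_index)
      (intro borel_measurable_add borel_measurable_times borel_measurable_const
        measurable_compose[OF measurable_fst measurable_vec_component] measurable_compose[OF measurable_snd measurable_path_eval])
qed

definition limit_lip :: "nat => (nat => real) => real" where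
  "limit_lip d \<sigma> = one.lip d * (1 + (\<Sum>j<d. \<bar>\<sigma> j\<bar>))"

lemma limit_lip_nonneg: "0 <= limit_lip d \<sigma>"
  unfolding limit_lip_def by (intro mult_nonneg_nonneg one.lip_nonneg add_nonneg_nonneg sum_nonneg) auto

lemma limit_path_lipschitz:
  assumes w: "w \<in> cont_paths d" "w' \<in> cont_paths d" and T: "0 <= T" and e: "0 <= e"
    and z: "\<And>j. j < d ==> \<bar>z $ j - z' $ j\<bar> <= e" and we: "path_dist d T w w' <= e"
  shows "path_dist d T (limit_path d \<theta> \<sigma> z w) (limit_path d \<theta> \<sigma> z' w') <= limit_lip d \<sigma> * e"
proof -
  let ?X = "free_path d \<theta> \<sigma> z w" and ?X' = "free_path d \<theta> \<sigma> z' w'"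
  have "path_dist d T ?X ?X' <= (1 + (\<Sum>j<d. \<bar>\<sigma> j\<bar>)) * e"
  proof (rule path_dist_leI[OF free_path_cont_paths[OF w(1)] free_path_cont_paths[OF w(2)]])
    show "0 <= (1 + (\<Sum>j<d. \<bar>\<sigma> j\<bar>)) * e" using e by (intro mult_nonneg_nonneg add_nonneg_nonneg sum_nonneg) auto
    fix t i assume t: "0 <= t" "t <= T" and i: "i < d"
    have "?X t $ i - ?X' t $ i = (z $ i - z' $ i) + \<sigma> i * (w t $ i - w' t $ i)"
      using t i by (simp add: free_path_index algebra_simps)
    also have "\<bar>...\<bar> <= \<bar>z $ i - z' $ i\<bar> + \<bar>\<sigma> i\<bar> * \<bar>w t $ i - w' t $ i\<bar>"
      by (metis abs_mult abs_triangle_ineq)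
    also have "... <= e + (\<Sum>j<d. \<bar>\<sigma> j\<bar>) * e"
    proof (intro add_mono z[OF i] mult_mono)
      show "\<bar>\<sigma> i\<bar> <= (\<Sum>j<d. \<bar>\<sigma> j\<bar>)" using i by (intro member_le_sum[of i _ "\<lambda>j. \<bar>\<sigma> j\<bar>"]) auto
      show "\<bar>w t $ i - w' t $ i\<bar> <= e" using path_dist_upper[OF w t i] we by linarith
    qed (auto intro: sum_nonneg)
    finally show "\<bar>?X t $ i - ?X' t $ i\<bar> <= (1 + (\<Sum>j<d. \<bar>\<sigma> j\<bar>)) * e" by (simp add: algebra_simps)
  qed
  then have "one.lip d * path_dist d T ?X ?X' <= one.lip d * ((1 + (\<Sum>j<d. \<bar>\<sigma> j\<bar>)) * e)"
    by (intro mult_left_mono one.lip_nonneg)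
  then show ?thesis
    using one.refl_path_lipschitz[OF free_path_cont_paths[OF w(1)] free_path_cont_paths[OF w(2)] T, of \<theta> \<sigma> z \<theta> \<sigma> z']
    unfolding limit_path_def limit_lip_def by (simp add: mult.assoc)
qed

text \<open>By \<open>refl_path_shift\<close>, shifting the free path re-bases it at the reflected
  state; hence the future depends on the past only through the state at time
  \<open>a\<close>.\<close>

lemma limit_path_shift:
  assumes w: "w \<in> cont_paths d" and a: "0 <= a"
  shows "(\<lambda>t\<in>{0..}. limit_path d \<theta> \<sigma> z w (a + t)) = limit_path d \<theta> \<sigma> (limit_path d \<theta> \<sigma> z w a) (shift_path d a w)"
proof -
  let ?X = "free_path d \<theta> \<sigma> z w"
  note X = free_path_cont_paths[OF w, of \<theta> \<sigma> z]
  note Z = one.refl_path_cont_paths[OF X]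
  have "(\<lambda>t\<in>{0..}. one.refl_path d ?X a + (?X (a + t) - ?X a)) =
      free_path d \<theta> \<sigma> (one.refl_path d ?X a) (shift_path d a w)" (is "?L = ?R")
  proof
    fix t
    show "?L t = ?R t"
    proof (cases "0 <= t")
      case True
      show ?thesis
      proof (rule eq_vecI)
        show "dim_vec (?L t) = dim_vec (?R t)"
          using True a cont_paths_carrier[OF X a] by (simp add: free_path_def)
        fix j assume "j < dim_vec (?R t)"
        then have j: "j < d" using True by (simp add: free_path_def)
        have at: "0 <= a + t" using True a by simp
        have "?L t $ j = one.refl_path d ?X a $ j + (?X (a + t) $ j - ?X a $ j)"
          using True j cont_paths_carrier[OF X a] cont_paths_carrier[OF X at] cont_paths_carrier[OF Z a] by simp
        also have "... = ?R t $ j"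
          using True a j at by (simp add: free_path_index shift_path_def algebra_simps)
        finally show "?L t $ j = ?R t $ j" .
      qed
    qed (simp add: free_path_def)
  qed
  then show ?thesis using one.refl_path_shift[OF X a] unfolding limit_path_def by simp
qed

text \<open>The Lipschitz bound at distance 0: driving paths that agree up to \<open>a\<close> have
  the same reflection up to \<open>a\<close>, so the flow does not anticipate.\<close>

lemma limit_path_stop:
  assumes w: "w \<in> cont_paths d" and t: "0 <= t" "t <= a"
  shows "limit_path d \<theta> \<sigma> z w t = limit_path d \<theta> \<sigma> z (stop_path d a w) t"
proof -
  have a: "0 <= a" using t by simp
  note s = stop_path_cont_paths[OF w a]
  have "path_dist d a w (stop_path d a w) <= 0"
    by (rule path_dist_leI[OF w s]) (auto simp: stop_path_def)
  then have le: "path_dist d a (limit_path d \<theta> \<sigma> z w) (limit_path d \<theta> \<sigma> z (stop_path d a w)) <= limit_lip d \<sigma> * 0"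
    by (intro limit_path_lipschitz w s a) auto
  note L = limit_path_cont_paths[OF w, of \<theta> \<sigma> z] and L' = limit_path_cont_paths[OF s, of \<theta> \<sigma> z]
  show ?thesis
  proof (rule eq_vecI)
    show "dim_vec (limit_path d \<theta> \<sigma> z w t) = dim_vec (limit_path d \<theta> \<sigma> z (stop_path d a w) t)"
      using cont_paths_carrier[OF L t(1)] cont_paths_carrier[OF L' t(1)] by simp
    fix j assume "j < dim_vec (limit_path d \<theta> \<sigma> z (stop_path d a w) t)"
    then have j: "j < d" using cont_paths_carrier[OF L' t(1)] by simp
    show "limit_path d \<theta> \<sigma> z w t $ j = limit_path d \<theta> \<sigma> z (stop_path d a w) t $ j"
      using path_dist_upper[OF L L' t j] le by simp
  qed
qed

text \<open>The off-diagonal terms vanish, so leastness for coordinate \<open>j\<close> is literally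
  that of the one-dimensional problem, and uniqueness applies.\<close>

lemma coord_refl_path_one:
  assumes X: "X \<in> cont_paths d" and j: "j < d"
  shows "coord_path j (one.refl_path d X) = one.refl_path 1 (coord_path j X)"
proof (rule cont_paths_eqI)
  note Y = one.reg_path_cont_paths[OF X] and Z = one.refl_path_cont_paths[OF X]
  show "coord_path j (one.refl_path d X) \<in> cont_paths 1" by (rule coord_path_cont_paths[OF Z j])
  note X1 = coord_path_cont_paths[OF X j]
  then show "one.refl_path 1 (coord_path j X) \<in> cont_paths 1" by (rule one.refl_path_cont_paths)
  have sum: "(\<Sum>k<d. 1\<^sub>m d $$ (j, k) * f k) = f j" for f :: "nat => real"
  proof -
    have "(\<Sum>k<d. 1\<^sub>m d $$ (j, k) * f k) = (\<Sum>k<d. if k = j then f k else 0)"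
      using j by (intro sum.cong) auto
    then show ?thesis using j by simp
  qed
  have sum': "(\<Sum>k\<in>{..<d} - {j}. 1\<^sub>m d $$ (j, k) * f k) = 0" for f :: "nat => real"
    using j by (intro sum.neutral) auto
  have idx: "one.refl_path d X s $ j = X s $ j + one.reg_path d X s $ j" if "0 <= s" for s
    unfolding one.refl_path_index[OF that j] sum ..
  fix t and i :: nat assume t: "0 <= (t::real)" and i: "i < 1"
  have reg: "one.regulated 1 t (\<lambda>i s. coord_path j X s $ i) (\<lambda>_ s. one.reg_path d X s $ j)"
    unfolding one.regulated_def
  proof (intro allI impI conjI ballI)
    fix k :: nat assume k: "k < 1"
    show "0 <= one.reg_path d X s $ j" if "s \<in> {0..t}" for s
      using that by (intro one.reg_path_nonneg[OF X j]) auto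
    show "one.reg_path d X u $ j <= one.reg_path d X s $ j" if "s \<in> {0..t}" "u \<in> {0..s}" for s u
      using that by (intro one.reg_path_mono[OF X j]) auto
    show "0 <= coord_path j X s $ k + (\<Sum>l<1. 1\<^sub>m 1 $$ (k, l) * one.reg_path d X s $ j)" if "s \<in> {0..t}" for s
      using that k one.refl_path_nonneg[OF X j, of s] by (simp add: coord_path_def idx)
    fix s c assume s: "s \<in> {0..t}" and c: "0 <= c"
      and H: "\<forall>u\<in>{0..s}. 0 <= coord_path j X u $ k + (\<Sum>l\<in>{..<1} - {k}. 1\<^sub>m 1 $$ (k, l) * one.reg_path d X u $ j) + 1\<^sub>m 1 $$ (k, k) * c"
    show "one.reg_path d X s $ j <= c"
    proof (rule one.regulated_least[OF one.regulated_reg_path[OF X] j, of s s])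
      fix u assume u: "0 <= u" "u <= s"
      then have "0 <= X u $ j + c" using H[rule_format, of u] k by (simp add: coord_path_def)
      then show "0 <= X u $ j + (\<Sum>k\<in>{..<d} - {j}. 1\<^sub>m d $$ (j, k) * one.reg_path d X u $ k) + 1\<^sub>m d $$ (j, j) * c"
        using j by (simp add: sum')
    qed (use s c in auto)
  qed
  have "one.refl_path 1 (coord_path j X) t $ i = coord_path j X t $ i + (\<Sum>k<1. 1\<^sub>m 1 $$ (i, k) * one.reg_path d X t $ j)"
    unfolding one.refl_path_index[OF t i]
    by (intro arg_cong2[where f = "(+)"] sum.cong refl)
      (simp only: one.reg_path_eqI[OF X1 reg _ t order.refl] lessThan_iff)
  also have "... = one.refl_path d X t $ j"
    using i t by (simp add: coord_path_def idx)
  finally show "coord_path j (one.refl_path d X) t $ i = one.refl_path 1 (coord_path j X) t $ i"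
    using i t by (simp add: coord_path_def)
qed

lemma coord_limit_path:
  assumes w: "w \<in> cont_paths d" and j: "j < d"
  shows "coord_path j (limit_path d \<theta> \<sigma> z w) =
    one.refl_path 1 (\<lambda>t\<in>{0..}. Matrix.vec 1 (\<lambda>_. z $ j + \<theta> j * t + \<sigma> j * (coord_path j w t $ 0)))"
proof -
  have "coord_path j (free_path d \<theta> \<sigma> z w) =
    (\<lambda>t\<in>{0..}. Matrix.vec 1 (\<lambda>_. z $ j + \<theta> j * t + \<sigma> j * (coord_path j w t $ 0)))"
    using j by (auto simp: coord_path_def free_path_def fun_eq_iff)
  then show ?thesis unfolding limit_path_def coord_refl_path_one[OF free_path_cont_paths[OF w] j] by simp
qed

lemma SRBM_1d_limit_path:
  assumes N: "prob_space N" and V: "standard_BM N d V" and ind: "indep_elements N (vec_borel d) \<xi> (path_borel d) V"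
    and \<xi>: "\<And>x. x \<in> space N ==> 0 <= \<xi> x $ j" and j: "j < d" and \<sigma>: "0 < \<sigma> j"
  shows "SRBM_1d N (\<lambda>x. \<xi> x $ j) (\<theta> j) ((\<sigma> j)\<^sup>2) (\<lambda>x. coord_path j (limit_path d \<theta> \<sigma> (\<xi> x) (V x)))"
  unfolding SRBM_1d_def
proof (intro conjI exI[of _ "\<lambda>x. coord_path j (V x)"] ballI)
  show "0 < (\<sigma> j)\<^sup>2" using \<sigma> by simp
  show "standard_BM N 1 (\<lambda>x. coord_path j (V x))" by (rule BM_coord[OF N V j])
  show "indep_elements N borel (\<lambda>x. \<xi> x $ j) (path_borel 1) (\<lambda>x. coord_path j (V x))"
    by (rule indep_elements_compose[OF N ind measurable_vec_component[OF j] measurable_coord_path[OF j]])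
  fix x assume x: "x \<in> space N"
  show "0 <= \<xi> x $ j" by (rule \<xi>[OF x])
  note v = BM_cont_paths[OF V x]
  let ?X = "\<lambda>t\<in>{0..}. Matrix.vec 1 (\<lambda>_. \<xi> x $ j + \<theta> j * t + sqrt ((\<sigma> j)\<^sup>2) * (coord_path j (V x) t $ 0))"
  have "reflected 1 (1\<^sub>m 1) ?X = one.refl_path 1 ?X"
  proof (rule one.reflected_eq)
    have c: "continuous_on {0..} (\<lambda>t. coord_path j (V x) t $ 0)"
      by (rule cont_paths_continuous[OF coord_path_cont_paths[OF v j]]) simp
    show "?X \<in> cont_paths 1" by (intro cont_paths_vecI continuous_intros c)
    show "0 <= ?X 0 $ i" if "i < 1" for i
      using that \<xi>[OF x] BM_0[OF V x] j by (simp add: coord_path_def)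
  qed
  then show "coord_path j (limit_path d \<theta> \<sigma> (\<xi> x) (V x)) = reflected 1 (1\<^sub>m 1) ?X"
    using \<sigma> by (simp add: coord_limit_path[OF v j] del: One_nat_def)
qed

text \<open>Rectangles form an intersection-stable generator of the product algebra; on them the
  probability factors first between \<open>X\<close> and \<open>Y\<close> and then over the
  coordinates.\<close>

lemma indep_vars_pairs:
  fixes d :: nat
  assumes N: "prob_space N" and X: "X \<in> N \<rightarrow>\<^sub>M S" and Y: "Y \<in> N \<rightarrow>\<^sub>M T" and ind: "indep_elements N S X T Y"
    and f: "\<And>j. j < d ==> f j \<in> borel_measurable S" and g: "\<And>j. j < d ==> g j \<in> T \<rightarrow>\<^sub>M U"
    and A: "prob_space.indep_vars N (\<lambda>_. borel) (\<lambda>j x. f j (X x) :: real) {..<d}"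
    and B: "prob_space.indep_vars N (\<lambda>_. U) (\<lambda>j x. g j (Y x)) {..<d}"
  shows "prob_space.indep_vars N (\<lambda>_. borel \<Otimes>\<^sub>M U) (\<lambda>j x. (f j (X x), g j (Y x))) {..<d}"
proof (cases "d = 0")
  case True
  interpret prob_space N by fact
  show ?thesis using True by (simp add: indep_vars_def2 indep_sets_def)
next
  case False
  interpret prob_space N by fact
  note fX = measurable_compose[OF X f] and gY = measurable_compose[OF Y g]
  let ?E = "{a \<times> b | a b. a \<in> sets (borel :: real measure) \<and> b \<in> sets U}"
  show ?thesis
  proof (subst indep_vars_finite[where E = "\<lambda>_. ?E"])
    show "{..<d} \<noteq> {}" using False by auto
    show "sets (borel \<Otimes>\<^sub>M U) = sigma_sets (space (borel \<Otimes>\<^sub>M U)) ?E"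
      by (simp add: sets_pair_measure space_pair_measure)
    show "(\<lambda>x. (f j (X x), g j (Y x))) \<in> N \<rightarrow>\<^sub>M borel \<Otimes>\<^sub>M U" if "j \<in> {..<d}" for j
      using that by (intro measurable_Pair fX gY) auto
    show "Int_stable ?E" by (rule Int_stable_pair_measure_generator)
    show "space (borel \<Otimes>\<^sub>M U) \<in> ?E" unfolding space_pair_measure
      by (intro CollectI exI[of _ "space borel"] exI[of _ "space U"] conjI refl sets.top)
    show "?E \<subseteq> Pow (space (borel \<Otimes>\<^sub>M U))"
      using sets.sets_into_space by (fastforce simp: space_pair_measure)
    show "\<forall>C\<in>{..<d} \<rightarrow> ?E. prob (\<Inter>j\<in>{..<d}. (\<lambda>x. (f j (X x), g j (Y x))) -` C j \<inter> space N) =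
      (\<Prod>j<d. prob ((\<lambda>x. (f j (X x), g j (Y x))) -` C j \<inter> space N))"
    proof
      fix C assume C: "C \<in> {..<d} \<rightarrow> ?E"
      have "\<forall>j\<in>{..<d}. \<exists>p. C j = fst p \<times> snd p \<and> fst p \<in> sets borel \<and> snd p \<in> sets U"
      proof
        fix j assume "j \<in> {..<d}"
        with C have "C j \<in> ?E" by (rule funcset_mem)
        then obtain a b where "C j = a \<times> b" "a \<in> sets borel" "b \<in> sets U" by (elim CollectE exE conjE)
        then show "\<exists>p. C j = fst p \<times> snd p \<and> fst p \<in> sets borel \<and> snd p \<in> sets U"
          by (intro exI[of _ "(a, b)"]) simp
      qed
      from bchoice[OF this] obtain p where p: "\<And>j. j < d ==> C j = fst (p j) \<times> snd (p j)"
        "\<And>j. j < d ==> fst (p j) \<in> sets borel" "\<And>j. j < d ==> snd (p j) \<in> sets U" by auto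
      define SA where "SA j = f j -` fst (p j) \<inter> space S" for j
      define TB where "TB j = g j -` snd (p j) \<inter> space T" for j
      have SA: "SA j \<in> sets S" if "j < d" for j unfolding SA_def by (rule measurable_sets[OF f[OF that] p(2)[OF that]])
      have TB: "TB j \<in> sets T" if "j < d" for j unfolding TB_def by (rule measurable_sets[OF g[OF that] p(3)[OF that]])
      note P = ind[unfolded indep_elements_iff_prob[OF N X Y], rule_format]
      have XA: "(\<lambda>x. f j (X x)) -` fst (p j) \<inter> space N = X -` SA j \<inter> space N" for j
        using measurable_space[OF X] by (auto simp: SA_def)
      have YB: "(\<lambda>x. g j (Y x)) -` snd (p j) \<inter> space N = Y -` TB j \<inter> space N" for j
        using measurable_space[OF Y] by (auto simp: TB_def)
      have split: "(\<lambda>x. (f j (X x), g j (Y x))) -` C j \<inter> space N = (X -` SA j \<inter> space N) \<inter> (Y -` TB j \<inter> space N)"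
        if "j < d" for j
      proof -
        have "(\<lambda>x. (f j (X x), g j (Y x))) -` C j \<inter> space N
          = ((\<lambda>x. f j (X x)) -` fst (p j) \<inter> space N) \<inter> ((\<lambda>x. g j (Y x)) -` snd (p j) \<inter> space N)"
          unfolding p(1)[OF that] by auto
        then show ?thesis unfolding XA YB .
      qed
      have IS: "(\<Inter>j\<in>{..<d}. SA j) \<in> sets S" and IT: "(\<Inter>j\<in>{..<d}. TB j) \<in> sets T"
        using False SA TB by (auto intro!: sets.finite_INT)
      have XI: "X -` (\<Inter>j\<in>{..<d}. SA j) \<inter> space N = (\<Inter>j\<in>{..<d}. X -` SA j \<inter> space N)"
        and YI: "Y -` (\<Inter>j\<in>{..<d}. TB j) \<inter> space N = (\<Inter>j\<in>{..<d}. Y -` TB j \<inter> space N)"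
        using False by auto
      have "(\<Inter>j\<in>{..<d}. (\<lambda>x. (f j (X x), g j (Y x))) -` C j \<inter> space N)
          = (\<Inter>j\<in>{..<d}. (X -` SA j \<inter> space N) \<inter> (Y -` TB j \<inter> space N))"
        by (intro INF_cong refl split) simp
      also have "... = (X -` (\<Inter>j\<in>{..<d}. SA j) \<inter> space N) \<inter> (Y -` (\<Inter>j\<in>{..<d}. TB j) \<inter> space N)"
        unfolding XI YI INT_Int_distrib ..
      also have "prob ... = prob (\<Inter>j\<in>{..<d}. X -` SA j \<inter> space N) * prob (\<Inter>j\<in>{..<d}. Y -` TB j \<inter> space N)"
        using P[OF IS IT] unfolding XI YI .
      also have "prob (\<Inter>j\<in>{..<d}. X -` SA j \<inter> space N) = (\<Prod>j<d. prob (X -` SA j \<inter> space N))"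
        using indep_varsD_finite[OF A, of "\<lambda>j. fst (p j)"] False p(2) unfolding XA by auto
      also have "prob (\<Inter>j\<in>{..<d}. Y -` TB j \<inter> space N) = (\<Prod>j<d. prob (Y -` TB j \<inter> space N))"
        using indep_varsD_finite[OF B, of "\<lambda>j. snd (p j)"] False p(3) unfolding YB by auto
      also have "(\<Prod>j<d. prob (X -` SA j \<inter> space N)) * (\<Prod>j<d. prob (Y -` TB j \<inter> space N))
          = (\<Prod>j<d. prob ((X -` SA j \<inter> space N) \<inter> (Y -` TB j \<inter> space N)))"
        unfolding prod.distrib[symmetric] by (intro prod.cong refl) (simp add: P SA TB)
      also have "... = (\<Prod>j<d. prob ((\<lambda>x. (f j (X x), g j (Y x))) -` C j \<inter> space N))"
        by (intro prod.cong refl) (simp add: split)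
      finally show "prob (\<Inter>j\<in>{..<d}. (\<lambda>x. (f j (X x), g j (Y x))) -` C j \<inter> space N) =
        (\<Prod>j<d. prob ((\<lambda>x. (f j (X x), g j (Y x))) -` C j \<inter> space N))" .
    qed
  qed simp_all
qed

lemma indep_coord_limit_path:
  assumes N: "prob_space N" and V: "standard_BM N d V" and ind: "indep_elements N (vec_borel d) \<xi> (path_borel d) V"
    and \<xi>: "prob_space.indep_vars N (\<lambda>_. borel) (\<lambda>j x. \<xi> x $ j) {..<d}"
  shows "prob_space.indep_vars N (\<lambda>_. path_borel 1) (\<lambda>j x. coord_path j (limit_path d \<theta> \<sigma> (\<xi> x) (V x))) {..<d}"
proof -
  interpret prob_space N by fact
  note m = indep_elements_measurable[OF ind]
  have pairs: "indep_vars (\<lambda>_. borel \<Otimes>\<^sub>M path_borel 1) (\<lambda>j x. (\<xi> x $ j, coord_path j (V x))) {..<d}"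
    by (rule indep_vars_pairs[where f = "\<lambda>j v. v $ j" and g = coord_path and X = \<xi> and Y = V, OF N m ind])
      (assumption | rule measurable_vec_component measurable_coord_path \<xi> BM_indep_coord[OF N V])+
  let ?G = "\<lambda>j p. one.refl_path 1 (\<lambda>t\<in>{0..}. Matrix.vec 1 (\<lambda>_. fst p + \<theta> j * t + \<sigma> j * (snd p t $ 0)))"
  have G: "?G j \<in> borel \<Otimes>\<^sub>M path_borel 1 \<rightarrow>\<^sub>M path_borel 1" for j
  proof (rule measurable_compose[OF _ one.measurable_refl_path], rule measurable_path_borelI)
    fix p :: "real \<times> (real => real vec)" assume "p \<in> space (borel \<Otimes>\<^sub>M path_borel 1)"
    then have "snd p \<in> cont_paths 1" by (simp add: space_pair_measure topspace_path_topology mem_Times_iff del: One_nat_def)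
    then have "continuous_on {0..} (\<lambda>t. snd p t $ 0)" by (rule cont_paths_continuous) simp
    then show "(\<lambda>t\<in>{0..}. Matrix.vec 1 (\<lambda>_. fst p + \<theta> j * t + \<sigma> j * (snd p t $ 0))) \<in> cont_paths 1"
      by (intro cont_paths_vecI continuous_intros)
  next
    fix t and i :: nat assume t: "0 <= (t::real)" and i: "i < 1"
    have "(\<lambda>p. fst p + \<theta> j * t + \<sigma> j * (snd p t $ 0)) \<in> borel_measurable (borel \<Otimes>\<^sub>M path_borel 1)"
      using t by (intro borel_measurable_add borel_measurable_times borel_measurable_const
          measurable_fst measurable_compose[OF measurable_snd measurable_path_eval]) auto
    then show "(\<lambda>p. (\<lambda>t\<in>{0..}. Matrix.vec 1 (\<lambda>_. fst p + \<theta> j * t + \<sigma> j * (snd p t $ 0))) t $ i)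
       \<in> borel_measurable (borel \<Otimes>\<^sub>M path_borel 1)" using t i by simp
  qed
  have "indep_vars (\<lambda>_. path_borel 1) (\<lambda>j x. ?G j (\<xi> x $ j, coord_path j (V x))) {..<d}"
    by (rule indep_vars_compose2[OF pairs G])
  \<comment> \<open>The two families of paths agree only on \<open>space N\<close>, hence the
    comparison through preimages cut down to that set.\<close>
  moreover have "indep_sets (\<lambda>j. {(\<lambda>x. ?G j (\<xi> x $ j, coord_path j (V x))) -` A \<inter> space N | A. A \<in> sets (path_borel 1)}) {..<d}
    \<longleftrightarrow> indep_sets (\<lambda>j. {(\<lambda>x. coord_path j (limit_path d \<theta> \<sigma> (\<xi> x) (V x))) -` A \<inter> space N | A. A \<in> sets (path_borel 1)}) {..<d}"
  proof (rule indep_sets_cong[OF refl])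
    fix j assume j: "j \<in> {..<d}"
    have "(\<lambda>x. ?G j (\<xi> x $ j, coord_path j (V x))) -` A \<inter> space N
      = (\<lambda>x. coord_path j (limit_path d \<theta> \<sigma> (\<xi> x) (V x))) -` A \<inter> space N" for A
      using coord_limit_path[OF BM_cont_paths[OF V]] j by auto
    then show "{(\<lambda>x. ?G j (\<xi> x $ j, coord_path j (V x))) -` A \<inter> space N | A. A \<in> sets (path_borel 1)}
      = {(\<lambda>x. coord_path j (limit_path d \<theta> \<sigma> (\<xi> x) (V x))) -` A \<inter> space N | A. A \<in> sets (path_borel 1)}" by simp
  qed
  moreover have "(\<lambda>x. coord_path j (limit_path d \<theta> \<sigma> (\<xi> x) (V x))) \<in> N \<rightarrow>\<^sub>M path_borel 1" if "j \<in> {..<d}" for j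
    using measurable_compose[OF measurable_compose[OF measurable_Pair[OF m] measurable_limit_path] measurable_coord_path] that
    by simp
  ultimately show ?thesis unfolding indep_vars_def2 by blast
qed

subsection \<open>The strong Markov property\<close>

definition later :: "(real => real vec) => real => real => real vec" where
  "later x a = (\<lambda>t\<in>{0..}. x (a + t))"

lemma later_index: "0 <= t ==> later x a t = x (a + t)"
  by (simp add: later_def)

lemma later_cont_paths:
  assumes x: "x \<in> cont_paths d" and a: "0 <= a"
  shows "later x a \<in> cont_paths d"
  unfolding cont_paths_def
proof (intro CollectI conjI allI impI)
  show "later x a \<in> {0..} \<rightarrow>\<^sub>E carrier_vec d" using cont_paths_carrier[OF x] a by (simp add: later_def)
  fix i assume i: "i < d"
  have "continuous_on {0..} (\<lambda>t. x (a + t) $ i)"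
    using a by (intro continuous_on_compose2[OF cont_paths_continuous[OF x i]] continuous_intros) auto
  then show "continuous_on {0..} (\<lambda>t. later x a t $ i)"
    by (rule continuous_on_cong[THEN iffD1, OF refl, rotated]) (simp add: later_index)
qed

lemma later_tendsto:
  assumes x: "x \<in> cont_paths d" and a: "0 <= a" "\<And>n. 0 <= b n" and b: "b \<longlonglongrightarrow> a"
  shows "(\<lambda>n. path_dist d S (later x (b n)) (later x a)) \<longlonglongrightarrow> 0"
proof (rule tendstoI)
  fix e :: real assume e: "0 < e"
  have "\<forall>\<^sub>F n in sequentially. \<forall>i\<in>{..<d}. \<forall>t\<in>{0..S}. \<bar>x (b n + t) $ i - x (a + t) $ i\<bar> <= e / 2"
  proof (rule eventually_ball_finite, simp, intro ballI)
    fix i assume "i \<in> {..<d}"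
    \<comment> \<open>The extra 1 in the horizon covers the times \<open>b n + t\<close> once
      \<open>b n\<close> is within 1 of \<open>a\<close>.\<close>
    then have "uniformly_continuous_on {0..a + 1 + S} (\<lambda>t. x t $ i)"
      using cont_paths_continuous[OF x, of i]
      by (intro compact_uniformly_continuous) (auto elim: continuous_on_subset)
    then obtain \<delta> where \<delta>: "\<delta> > 0" "\<And>s t. s \<in> {0..a + 1 + S} ==> t \<in> {0..a + 1 + S} ==> dist t s < \<delta> ==> dist (x t $ i) (x s $ i) < e / 2"
      using e unfolding uniformly_continuous_on_def by (metis half_gt_zero)
    have "\<forall>\<^sub>F n in sequentially. dist (b n) a < min \<delta> 1" using b \<delta>(1) by (intro tendstoD) auto
    then show "\<forall>\<^sub>F n in sequentially. \<forall>t\<in>{0..S}. \<bar>x (b n + t) $ i - x (a + t) $ i\<bar> <= e / 2"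
    proof eventually_elim
      case (elim n)
      show ?case
      proof
        fix t assume t: "t \<in> {0..S}"
        have "dist (x (b n + t) $ i) (x (a + t) $ i) < e / 2"
          using elim t a(1) a(2)[of n] by (intro \<delta>(2)) (auto simp: dist_real_def)
        then show "\<bar>x (b n + t) $ i - x (a + t) $ i\<bar> <= e / 2" by (simp add: dist_real_def)
      qed
    qed
  qed
  then show "\<forall>\<^sub>F n in sequentially. dist (path_dist d S (later x (b n)) (later x a)) 0 < e"
  proof eventually_elim
    case (elim n)
    note L = later_cont_paths[OF x a(2)] later_cont_paths[OF x a(1)]
    have "path_dist d S (later x (b n)) (later x a) <= e / 2"
      using elim e by (intro path_dist_leI L) (auto simp: later_index)
    then show ?case using path_dist_nonneg[OF L, of S] e by (simp add: dist_real_def)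
  qed
qed

lemma norm_indicat_scaleR_le:
  fixes x B :: real
  assumes "\<bar>x\<bar> <= B"
  shows "norm (indicat_real S w *\<^sub>R x) <= B"
  using assms abs_ge_zero[of x] order_trans by (cases "w \<in> S") auto

text \<open>Rounding upward makes a stopping time take countably many values, and whether a value is
  taken is known by that time.\<close>

definition grid_up :: "nat => real => real" where
  "grid_up n a = real (nat \<lceil>a * 2 ^ n\<rceil>) / 2 ^ n"

lemma grid_up_bounds: "0 <= a ==> a <= grid_up n a" "0 <= a ==> grid_up n a <= a + 1 / 2 ^ n"
proof -
  assume a: "0 <= a"
  have "a * 2 ^ n <= real (nat \<lceil>a * 2 ^ n\<rceil>)" by linarith
  then show "a <= grid_up n a" by (simp add: grid_up_def pos_le_divide_eq)
  have "0 <= a * 2 ^ n" using a by simp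
  then have "real (nat \<lceil>a * 2 ^ n\<rceil>) <= a * 2 ^ n + 1" by linarith
  then show "grid_up n a <= a + 1 / 2 ^ n" by (simp add: grid_up_def pos_divide_le_eq distrib_right)
qed

lemma grid_up_tendsto:
  assumes "0 <= a"
  shows "(\<lambda>n. grid_up n a) \<longlonglongrightarrow> a"
proof (rule tendsto_sandwich[of "\<lambda>_. a" _ _ "\<lambda>n. a + 1 / 2 ^ n"])
  have "(\<lambda>n. 1 / 2 ^ n :: real) \<longlonglongrightarrow> 0" by (rule LIMSEQ_divide_realpow_zero) simp
  then show "(\<lambda>n. a + 1 / 2 ^ n) \<longlonglongrightarrow> a" using tendsto_add[OF tendsto_const, of "\<lambda>n. 1 / 2 ^ n" 0 _ a] by simp
qed (use grid_up_bounds[OF assms] in auto)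

lemma grid_up_nonneg: "0 <= grid_up n a"
  by (simp add: grid_up_def)

text \<open>For the dyadic approximations of \<open>T\<close> measurability is checked value by
  value; path continuity gives the limit.\<close>

lemma measurable_later:
  assumes X: "X \<in> M \<rightarrow>\<^sub>M path_borel d" and T: "T \<in> borel_measurable M" and T0: "\<And>x. x \<in> space M ==> 0 <= T x"
  shows "(\<lambda>x. later (X x) (T x)) \<in> M \<rightarrow>\<^sub>M path_borel d"
proof (rule measurable_path_borelI)
  note XP = measurable_path_borel_cont_paths[OF X]
  show "later (X x) (T x) \<in> cont_paths d" if "x \<in> space M" for x by (rule later_cont_paths[OF XP[OF that] T0[OF that]])
  fix t i assume t: "0 <= (t::real)" and i: "i < d"
  show "(\<lambda>x. later (X x) (T x) t $ i) \<in> borel_measurable M"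
  proof (rule borel_measurable_LIMSEQ_real)
    show "(\<lambda>x. X x (grid_up n (T x) + t) $ i) \<in> borel_measurable M" for n
    proof -
      have "(\<lambda>x. nat \<lceil>T x * 2 ^ n\<rceil>) \<in> M \<rightarrow>\<^sub>M count_space UNIV" using T by measurable
      moreover have "(\<lambda>x. X x (real k / 2 ^ n + t) $ i) \<in> borel_measurable M" for k
        by (rule measurable_compose[OF X measurable_path_eval[OF _ i]]) (use t in simp)
      ultimately have "(\<lambda>x. X x (real (nat \<lceil>T x * 2 ^ n\<rceil>) / 2 ^ n + t) $ i) \<in> borel_measurable M"
        by (rule measurable_compose_countable[rotated])
      then show ?thesis by (simp add: grid_up_def)
    qed
    fix x assume x: "x \<in> space M"
    have "(\<lambda>n. grid_up n (T x) + t) \<longlonglongrightarrow> T x + t" by (intro tendsto_intros grid_up_tendsto T0[OF x])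
    then have "(\<lambda>n. X x (grid_up n (T x) + t) $ i) \<longlonglongrightarrow> X x (T x + t) $ i"
      using t T0[OF x] grid_up_nonneg
      by (intro continuous_on_tendsto_compose[OF cont_paths_continuous[OF XP[OF x] i]]) (auto intro!: always_eventually add_nonneg_nonneg)
    then show "(\<lambda>n. X x (grid_up n (T x) + t) $ i) \<longlonglongrightarrow> later (X x) (T x) t $ i"
      using t by (simp add: later_index)
  qed
qed

text \<open>\<open>f n x\<close> is \<open>1 - n * I n x\<close> cut off at 0, where
  \<open>I n x\<close> is the distance to \<open>C\<close> on \<open>[0, n]\<close>. A path outside
  the closed set \<open>C\<close> keeps some distance \<open>e\<close> from it on some
  \<open>[0, T]\<close>, so \<open>f n x\<close> vanishes once \<open>n >= T\<close> and
  \<open>n * e >= 1\<close>.\<close>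

lemma closed_indicator_lipschitz:
  assumes C: "closedin (path_topology d) C" and ne: "C \<noteq> {}"
  obtains f :: "nat => (real => real vec) => real"
  where "\<And>n x y. x \<in> cont_paths d ==> y \<in> cont_paths d ==> \<bar>f n x - f n y\<bar> <= real n * path_dist d (real n) x y"
    and "\<And>n x. x \<in> cont_paths d ==> \<bar>f n x\<bar> <= 1"
    and "\<And>x. x \<in> cont_paths d ==> (\<lambda>n. f n x) \<longlonglongrightarrow> indicator C x"
proof -
  have CP: "C \<subseteq> cont_paths d" using closedin_subset[OF C] by (simp add: topspace_path_topology)
  define I where "I n x = (INF y\<in>C. path_dist d (real n) x y)" for n x
  have bdd: "bdd_below ((\<lambda>y. path_dist d (real n) x y) ` C)" if "x \<in> cont_paths d" for n x
    using path_dist_nonneg[OF that] CP by (intro bdd_belowI2[where m = 0]) auto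
  have I0: "0 <= I n x" if "x \<in> cont_paths d" for n x
    unfolding I_def using path_dist_nonneg[OF that] CP by (intro cINF_greatest[OF ne]) auto
  have Ilip: "I n x <= path_dist d (real n) x y + I n y" if "x \<in> cont_paths d" "y \<in> cont_paths d" for n x y
  proof -
    have "I n x - path_dist d (real n) x y <= I n y" unfolding I_def[of n y]
    proof (rule cINF_greatest[OF ne])
      fix z assume z: "z \<in> C"
      have "I n x <= path_dist d (real n) x z" unfolding I_def by (rule cINF_lower[OF bdd[OF \<open>x \<in> cont_paths d\<close>] z])
      also have "... <= path_dist d (real n) x y + path_dist d (real n) y z"
        using z CP by (intro path_dist_triangle that) auto
      finally show "I n x - path_dist d (real n) x y <= path_dist d (real n) y z" by simp
    qed
    then show ?thesis by simp
  qed
  define f where "f n x = max 0 (1 - real n * I n x)" for n x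
  show ?thesis
  proof
    show "\<bar>f n x - f n y\<bar> <= real n * path_dist d (real n) x y" if xy: "x \<in> cont_paths d" "y \<in> cont_paths d" for n x y
    proof -
      have "\<bar>I n x - I n y\<bar> <= path_dist d (real n) x y"
        using Ilip[OF xy, of n] Ilip[OF xy(2,1), of n] by (simp add: path_dist_commute[of d _ y x] abs_le_iff)
      then have "real n * \<bar>I n x - I n y\<bar> <= real n * path_dist d (real n) x y" by (intro mult_left_mono) auto
      moreover have "\<bar>f n x - f n y\<bar> <= \<bar>real n * I n x - real n * I n y\<bar>" by (auto simp: f_def max_def)
      moreover have "\<bar>real n * I n x - real n * I n y\<bar> = real n * \<bar>I n x - I n y\<bar>"
        by (simp add: abs_mult flip: right_diff_distrib)
      ultimately show ?thesis by linarith
    qed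
    show "\<bar>f n x\<bar> <= 1" if "x \<in> cont_paths d" for n x
      using mult_nonneg_nonneg[OF of_nat_0_le_iff I0[OF that], of n n] by (simp add: f_def)
    show "(\<lambda>n. f n x) \<longlonglongrightarrow> indicator C x" if x: "x \<in> cont_paths d" for x
    proof (cases "x \<in> C")
      case True
      have "I n x = 0" for n
      proof (rule antisym[OF _ I0[OF x]])
        show "I n x <= 0" unfolding I_def
          using cINF_lower[OF bdd[OF x] True, of n] path_dist_self[OF x, of "real n"] by simp
      qed
      then show ?thesis using True by (simp add: f_def)
    next
      case False
      have "openin (path_topology d) (cont_paths d - C)" using C by (simp add: closedin_def topspace_path_topology)
      moreover have "x \<in> cont_paths d - C" using x False by simp
      ultimately have "\<exists>T>0. \<exists>e>0. \<forall>y\<in>cont_paths d. (\<forall>t\<in>{0..T}. \<forall>i<d. \<bar>y t $ i - x t $ i\<bar> < e) --> y \<in> cont_paths d - C"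
        unfolding openin_path_topology by blast
      then obtain T e where Te: "T > 0" "e > 0"
        "\<And>y. y \<in> cont_paths d ==> \<forall>t\<in>{0..T}. \<forall>i<d. \<bar>y t $ i - x t $ i\<bar> < e ==> y \<in> cont_paths d - C"
        by blast
      obtain n0 where n0: "max T (1 / e) <= real n0" using real_arch_simple by blast
      have "f n x = 0" if n: "n0 <= n" for n
      proof -
        have nT: "T <= real n" "1 / e <= real n" using n0 n by linarith+
        have "e <= I n x" unfolding I_def
        proof (rule cINF_greatest[OF ne], rule ccontr)
          fix y assume y: "y \<in> C" and "\<not> e <= path_dist d (real n) x y"
          then have lt: "path_dist d (real n) x y < e" and yP: "y \<in> cont_paths d" using CP by auto
          have "y \<in> cont_paths d - C"
          proof (rule Te(3)[OF yP], intro ballI allI impI)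
            fix t i assume "t \<in> {0..T}" "i < d"
            then show "\<bar>y t $ i - x t $ i\<bar> < e"
              using path_dist_upper[OF x yP, of t "real n" i] nT(1) lt by (simp add: abs_minus_commute)
          qed
          then show False using y by simp
        qed
        then have "real n * e <= real n * I n x" by (intro mult_left_mono) auto
        moreover have "1 <= real n * e" using nT(2) Te(2) by (simp add: pos_divide_le_eq)
        ultimately show ?thesis by (simp add: f_def)
      qed
      then have "\<forall>\<^sub>F n in sequentially. f n x = indicator C x" using False by (auto simp: eventually_sequentially)
      then show ?thesis by (rule tendsto_eventually)
    qed
  qed
qed

text \<open>Closed sets are an intersection-stable generator of the Borel sets, and their indicators
  are limits of bounded Lipschitz functions.\<close>

lemma path_measure_eqI:
  assumes \<mu>: "finite_measure \<mu>" and \<nu>: "finite_measure \<nu>"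
    and s\<mu>: "sets \<mu> = sets (path_borel d)" and s\<nu>: "sets \<nu> = sets (path_borel d)"
    and eq: "\<And>g T C B. (\<And>x y. x \<in> cont_paths d ==> y \<in> cont_paths d ==> \<bar>g x - g y\<bar> <= C * path_dist d T x y) ==> 0 <= C ==>
       (\<And>x. x \<in> cont_paths d ==> \<bar>g x\<bar> <= B) ==> (\<integral>x. g x \<partial>\<mu>) = (\<integral>x. g x \<partial>\<nu>)"
  shows "\<mu> = \<nu>"
proof -
  interpret \<mu>: finite_measure \<mu> by fact
  interpret \<nu>: finite_measure \<nu> by fact
  have sp: "space \<mu> = cont_paths d" "space \<nu> = cont_paths d"
    using sets_eq_imp_space_eq[OF s\<mu>] sets_eq_imp_space_eq[OF s\<nu>] by (simp_all add: topspace_path_topology)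
  let ?E = "{C. closedin (path_topology d) C}"
  have E: "?E \<subseteq> sets (path_borel d)" by (auto intro: borel_of_closedin)
  have gen: "sets (path_borel d) = sigma_sets (cont_paths d) ?E"
  proof
    show "sigma_sets (cont_paths d) ?E \<subseteq> sets (path_borel d)"
      using sets.sigma_sets_subset[OF E] by (simp add: topspace_path_topology)
    have "U \<in> sigma_sets (cont_paths d) ?E" if "openin (path_topology d) U" for U
    proof -
      have "closedin (path_topology d) (cont_paths d - U)"
        using closedin_diff[OF closedin_topspace that] by (simp add: topspace_path_topology)
      then have "cont_paths d - (cont_paths d - U) \<in> sigma_sets (cont_paths d) ?E"
        by (intro sigma_sets.Compl sigma_sets.Basic) simp
      then show ?thesis using openin_subset[OF that] by (simp add: double_diff topspace_path_topology)
    qed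
    then show "sets (path_borel d) \<subseteq> sigma_sets (cont_paths d) ?E"
      unfolding sets_borel_of topspace_path_topology by (intro sigma_sets_mono) auto
  qed
  show ?thesis
  proof (rule measure_eqI_generator_eq[where E = ?E and \<Omega> = "cont_paths d" and A = "\<lambda>_. cont_paths d"])
    show "Int_stable ?E" by (auto simp: Int_stable_def intro: closedin_Int)
    show "?E \<subseteq> Pow (cont_paths d)" using closedin_subset[of "path_topology d"] by (auto simp: topspace_path_topology)
    show "sets \<mu> = sigma_sets (cont_paths d) ?E" "sets \<nu> = sigma_sets (cont_paths d) ?E" using s\<mu> s\<nu> gen by auto
    show "range (\<lambda>_. cont_paths d) \<subseteq> ?E" using closedin_topspace[of "path_topology d"] by (auto simp: topspace_path_topology)
    show "emeasure \<mu> (cont_paths d) \<noteq> \<infinity>" using \<mu>.emeasure_finite[of "cont_paths d"] by simp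
    fix C assume "C \<in> ?E"
    then have C: "closedin (path_topology d) C" by simp
    show "emeasure \<mu> C = emeasure \<nu> C"
    proof (cases "C = {}")
      case False
      obtain f where f: "\<And>n x y. x \<in> cont_paths d ==> y \<in> cont_paths d ==> \<bar>f n x - f n y\<bar> <= real n * path_dist d (real n) x y"
        "\<And>n x. x \<in> cont_paths d ==> \<bar>f n x\<bar> <= 1" "\<And>x. x \<in> cont_paths d ==> (\<lambda>n. f n x) \<longlonglongrightarrow> indicator C x"
        using closed_indicator_lipschitz[OF C False] by blast
      have Cm: "C \<in> sets (path_borel d)" by (rule borel_of_closedin[OF C])
      have fm: "f n \<in> borel_measurable (path_borel d)" for n
        by (rule borel_measurable_borel_of, rule continuous_map_path_topology_lipschitz[OF f(1)])
      have "(\<lambda>n. \<integral>x. f n x \<partial>\<mu>) \<longlonglongrightarrow> (\<integral>x. indicator C x \<partial>\<mu>)"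
        by (rule integral_dominated_convergence[where w = "\<lambda>_. 1"])
          (use Cm fm f sp in "auto intro!: AE_I2 simp: measurable_cong_sets[OF s\<mu> refl] s\<mu>")
      moreover have "(\<lambda>n. \<integral>x. f n x \<partial>\<nu>) \<longlonglongrightarrow> (\<integral>x. indicator C x \<partial>\<nu>)"
        by (rule integral_dominated_convergence[where w = "\<lambda>_. 1"])
          (use Cm fm f sp in "auto intro!: AE_I2 simp: measurable_cong_sets[OF s\<nu> refl] s\<nu>")
      moreover have "(\<integral>x. f n x \<partial>\<mu>) = (\<integral>x. f n x \<partial>\<nu>)" for n
        by (rule eq[OF f(1) _ f(2)]) auto
      ultimately have "(\<integral>x. indicator C x \<partial>\<mu>) = (\<integral>x. indicator C x \<partial>\<nu> :: real)" using LIMSEQ_unique by simp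
      then have "measure \<mu> C = measure \<nu> C" using Cm s\<mu> s\<nu> by simp
      then show ?thesis by (simp add: \<mu>.emeasure_eq_measure \<nu>.emeasure_eq_measure)
    qed simp
  qed simp
qed

section \<open>The Markov property at deterministic, discrete and general stopping times\<close>

locale limit_process =
  fixes N :: "'v measure" and d :: nat and \<xi> :: "'v => real vec" and V :: "'v => real => real vec"
    and \<theta> \<sigma> :: "nat => real"
  assumes N: "prob_space N" and V: "standard_BM N d V"
    and ind: "indep_elements N (vec_borel d) \<xi> (path_borel d) V"
begin

abbreviation "flow \<equiv> limit_path d \<theta> \<sigma>"

definition Z :: "'v => real => real vec" where
  "Z x = flow (\<xi> x) (V x)"

definition law :: "(real => real vec) measure" where
  "law = distr N (path_borel d) V"

text \<open>The kernel demanded by \<open>diffusion\<close>: the law of the flow started at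
  \<open>z\<close>. Integrating \<open>g\<close> against it gives \<open>avg g z\<close>.\<close>

definition kern :: "real vec => (real => real vec) measure" where
  "kern z = distr law (path_borel d) (flow z)"

definition avg :: "((real => real vec) => real) => real vec => real" where
  "avg g z = (\<integral>w. g (flow z w) \<partial>law)"

lemmas xi_measurable = indep_elements_measurable(1)[OF ind] and V_measurable = indep_elements_measurable(2)[OF ind]

lemma Z_measurable: "Z \<in> N \<rightarrow>\<^sub>M path_borel d"
  using measurable_compose[OF measurable_Pair[OF xi_measurable V_measurable] measurable_limit_path[of d \<theta> \<sigma>]]
  by (simp add: Z_def[abs_def])

lemma Z_cont_paths: "x \<in> space N ==> Z x \<in> cont_paths d"
  by (rule measurable_path_borel_cont_paths[OF Z_measurable])

lemma prob_law: "prob_space law"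
  unfolding law_def by (rule prob_space.prob_space_distr[OF N V_measurable])

lemma sets_law: "sets law = sets (path_borel d)"
  by (simp add: law_def)

lemma space_law: "space law = cont_paths d"
  by (simp add: law_def topspace_path_topology)

lemma limit_path_measurable_law:
  assumes "z \<in> carrier_vec d"
  shows "flow z \<in> path_borel d \<rightarrow>\<^sub>M path_borel d"
proof -
  have "z \<in> space (vec_borel d)" using assms by (simp add: topspace_vec_topology)
  from measurable_compose[OF measurable_Pair1'[OF this] measurable_limit_path[of d \<theta> \<sigma>]] show ?thesis by simp
qed

lemma kern_measurable: "kern \<in> vec_borel d \<rightarrow>\<^sub>M prob_algebra (path_borel d)"
  unfolding kern_def
proof (rule measurable_distr_prob_space2)
  have "law \<in> space (prob_algebra (path_borel d))"
    using prob_law sets_law by (simp add: space_prob_algebra)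
  then show "(\<lambda>_. law) \<in> vec_borel d \<rightarrow>\<^sub>M prob_algebra (path_borel d)" by simp
  show "(\<lambda>(x, y). flow x y) \<in> vec_borel d \<Otimes>\<^sub>M path_borel d \<rightarrow>\<^sub>M path_borel d"
    using measurable_limit_path[of d \<theta> \<sigma>] by (simp add: case_prod_unfold)
qed

lemma measure_kern:
  assumes "z \<in> carrier_vec d" "B \<in> sets (path_borel d)"
  shows "measure (kern z) B = avg (indicator B) z"
proof -
  have m: "flow z \<in> law \<rightarrow>\<^sub>M path_borel d"
    using limit_path_measurable_law[OF assms(1)] by (simp add: law_def)
  have "avg (indicator B) z = (\<integral>x. indicator B x \<partial>kern z)"
    unfolding avg_def kern_def using assms(2) by (subst integral_distr[OF m]) auto
  moreover have "B \<inter> space (kern z) = B"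
    using sets.sets_into_space[OF assms(2)] by (auto simp: kern_def)
  ultimately show ?thesis by simp
qed

lemma avg_measurable:
  assumes "g \<in> borel_measurable (path_borel d)"
  shows "avg g \<in> borel_measurable (vec_borel d)"
proof -
  interpret law: prob_space law by (rule prob_law)
  have "(\<lambda>p. g (flow (fst p) (snd p))) \<in> borel_measurable (vec_borel d \<Otimes>\<^sub>M law)"
    using measurable_compose[OF measurable_limit_path assms, of \<theta> \<sigma>]
    by (simp cong: measurable_cong_sets sets_pair_measure_cong add: sets_law)
  from law.borel_measurable_lebesgue_integral[of "\<lambda>z w. g (flow z w)" "vec_borel d"] this
  show ?thesis unfolding avg_def[abs_def] by (simp add: case_prod_unfold)
qed

lemma avg_bound:
  assumes g: "g \<in> borel_measurable (path_borel d)" and B: "\<And>x. x \<in> cont_paths d ==> \<bar>g x\<bar> <= B" and z: "z \<in> carrier_vec d"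
  shows "\<bar>avg g z\<bar> <= B" "integrable law (\<lambda>w. g (flow z w))"
proof -
  interpret law: prob_space law by (rule prob_law)
  have bd: "\<bar>g (flow z w)\<bar> <= B" if "w \<in> space law" for w
    using that by (intro B limit_path_cont_paths) (simp add: space_law)
  have m: "(\<lambda>w. g (flow z w)) \<in> borel_measurable law"
    using measurable_compose[OF limit_path_measurable_law[OF z] g] by (simp add: law_def)
  show int: "integrable law (\<lambda>w. g (flow z w))"
    by (rule law.integrable_const_bound[where B = B]) (use bd m in "auto intro!: AE_I2")
  have "\<bar>avg g z\<bar> <= (\<integral>w. \<bar>g (flow z w)\<bar> \<partial>law)" unfolding avg_def by (rule integral_abs_bound)
  also have "... <= (\<integral>w. B \<partial>law)" using int bd by (intro integral_mono integrable_abs) auto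
  finally show "\<bar>avg g z\<bar> <= B" by (simp add: law.prob_space)
qed

text \<open>A quantitative Feller property, inherited from the Lipschitz flow. It permits passing to
  the limit in the states at approximating stopping times.\<close>

lemma avg_lipschitz:
  assumes lip: "\<And>x y. x \<in> cont_paths d ==> y \<in> cont_paths d ==> \<bar>g x - g y\<bar> <= C * path_dist d T x y"
    and C: "0 <= C" and T: "0 <= T" and B: "\<And>x. x \<in> cont_paths d ==> \<bar>g x\<bar> <= B"
    and z: "z \<in> carrier_vec d" "z' \<in> carrier_vec d" and e: "0 <= e" "\<And>i. i < d ==> \<bar>z $ i - z' $ i\<bar> <= e"
  shows "\<bar>avg g z - avg g z'\<bar> <= C * limit_lip d \<sigma> * e"
proof -
  interpret law: prob_space law by (rule prob_law)
  have gm: "g \<in> borel_measurable (path_borel d)"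
    by (rule borel_measurable_borel_of, rule continuous_map_path_topology_lipschitz[OF lip])
  note int = avg_bound(2)[OF gm B z(1)] avg_bound(2)[OF gm B z(2)]
  have "\<bar>avg g z - avg g z'\<bar> = \<bar>\<integral>w. g (flow z w) - g (flow z' w) \<partial>law\<bar>"
    unfolding avg_def using int by simp
  also have "... <= (\<integral>w. \<bar>g (flow z w) - g (flow z' w)\<bar> \<partial>law)" by (rule integral_abs_bound)
  also have "... <= (\<integral>w. C * limit_lip d \<sigma> * e \<partial>law)"
  proof (rule integral_mono)
    show "integrable law (\<lambda>w. \<bar>g (flow z w) - g (flow z' w)\<bar>)"
      using int by (intro integrable_abs Bochner_Integration.integrable_diff)
    fix w assume "w \<in> space law"
    then have w: "w \<in> cont_paths d" by (simp add: space_law)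
    have "\<bar>g (flow z w) - g (flow z' w)\<bar>
        <= C * path_dist d T (flow z w) (flow z' w)"
      by (intro lip limit_path_cont_paths w)
    also have "... <= C * (limit_lip d \<sigma> * e)"
      using path_dist_self[OF w, of T] e by (intro mult_left_mono C limit_path_lipschitz w T) auto
    finally show "\<bar>g (flow z w) - g (flow z' w)\<bar> <= C * limit_lip d \<sigma> * e" by simp
  qed simp
  finally show ?thesis by (simp add: law.prob_space)
qed

abbreviation F :: "real => 'v measure" where
  "F \<equiv> natural_filtration N d Z"

lemma space_F: "space (F t) = space N"
  unfolding natural_filtration_def by (rule space_measure_of) auto

lemma sets_F: "sets (F t) = sigma_sets (space N) {(\<lambda>x. Z x s) -` A \<inter> space N | s A. 0 <= s \<and> s <= t \<and> A \<in> sets (vec_borel d)}"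
  unfolding natural_filtration_def by (rule sets_measure_of) auto

lemma filtration_F: "filtration (space N) F"
proof
  show "sets (F s) \<subseteq> sets (F t)" if "s <= t" for s t
    unfolding sets_F using that by (intro sigma_sets_mono') (auto intro: order_trans)
qed (rule space_F)

text \<open>States up to time \<open>q\<close> are functionals of \<open>\<xi>\<close> and of the
  Brownian path stopped at \<open>q\<close> (\<open>limit_path_stop\<close>), so every past event is
  a preimage under this pair.\<close>

lemma F_past:
  assumes q: "0 <= q" and E: "E \<in> sets (F q)"
  obtains G where "G \<in> sets (vec_borel d \<Otimes>\<^sub>M path_borel d)"
    "E = {x \<in> space N. (\<xi> x, stop_path d q (V x)) \<in> G}"
proof -
  let ?P = "\<lambda>x. (\<xi> x, stop_path d q (V x))" and ?Q = "vec_borel d \<Otimes>\<^sub>M path_borel d"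
  have P: "?P \<in> N \<rightarrow>\<^sub>M ?Q"
    by (rule measurable_Pair[OF xi_measurable measurable_compose[OF V_measurable measurable_stop_path[OF q]]])
  then have PS: "?P \<in> space N \<rightarrow> space ?Q" by (auto dest: measurable_space)
  let ?A = "vimage_algebra (space N) ?P ?Q"
  have "{(\<lambda>x. Z x s) -` A \<inter> space N | s A. 0 <= s \<and> s <= q \<and> A \<in> sets (vec_borel d)} \<subseteq> sets ?A"
  proof
    fix E assume "E \<in> {(\<lambda>x. Z x s) -` A \<inter> space N | s A. 0 <= s \<and> s <= q \<and> A \<in> sets (vec_borel d)}"
    then obtain s A where s: "0 <= s" "s <= q" and A: "A \<in> sets (vec_borel d)" and E: "E = (\<lambda>x. Z x s) -` A \<inter> space N"
      by (elim CollectE exE conjE)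
    let ?f = "\<lambda>p. flow (fst p) (snd p) s"
    have f: "?f \<in> ?Q \<rightarrow>\<^sub>M vec_borel d" by (rule measurable_compose[OF measurable_limit_path measurable_path_at[OF s(1)]])
    have Zs: "Z x s = ?f (?P x)" if "x \<in> space N" for x
      using limit_path_stop[OF BM_cont_paths[OF V that] s] by (simp add: Z_def)
    have "E = ?P -` (?f -` A \<inter> space ?Q) \<inter> space N"
      unfolding E using Zs PS by auto
    then show "E \<in> sets ?A" using in_vimage_algebra[OF measurable_sets[OF f A]] by simp
  qed
  from sets.sigma_sets_subset[OF this] have "sets (F q) \<subseteq> sets ?A" by (simp add: sets_F)
  then have "E \<in> {?P -` G \<inter> space N | G. G \<in> sets ?Q}" using E sets_vimage_algebra2[OF PS] by auto
  then obtain G where "G \<in> sets ?Q" "E = ?P -` G \<inter> space N" by (elim CollectE exE conjE)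
  then show ?thesis by (intro that[of G]) auto
qed

lemma F_subset: "sets (F q) \<subseteq> sets N"
proof -
  have "{(\<lambda>x. Z x s) -` A \<inter> space N | s A. 0 <= s \<and> s <= q \<and> A \<in> sets (vec_borel d)} \<subseteq> sets N"
    using measurable_sets[OF measurable_compose[OF Z_measurable measurable_path_at]] by auto
  then show ?thesis using sets.sigma_sets_subset by (simp add: sets_F)
qed

lemma Z_at_carrier: "x \<in> space N ==> 0 <= t ==> Z x t \<in> carrier_vec d"
  by (rule cont_paths_carrier[OF Z_cont_paths])

text \<open>The past is encoded by \<open>?P\<close>; the future is the flow from
  \<open>Z w q\<close> along the shifted Brownian motion, which is independent of \<open>?P\<close>
  and again Brownian. \<open>indep_elements_integral\<close> averages over it.\<close>

lemma simple_Markov: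
  assumes q: "0 <= q" and E: "E \<in> sets (F q)" and g: "g \<in> borel_measurable (path_borel d)"
    and B: "\<And>x. x \<in> cont_paths d ==> \<bar>g x\<bar> <= B"
  shows "(LINT w:E|N. g (later (Z w) q)) = (LINT w:E|N. avg g (Z w q))"
proof -
  interpret prob_space N by (rule N)
  let ?P = "\<lambda>w. (\<xi> w, stop_path d q (V w))" and ?Q = "vec_borel d \<Otimes>\<^sub>M path_borel d"
  obtain G where G: "G \<in> sets ?Q" and EG: "E = {w \<in> space N. ?P w \<in> G}" by (rule F_past[OF q E])
  let ?f = "\<lambda>p. flow (fst p) (snd p) q"
  have f: "?f \<in> ?Q \<rightarrow>\<^sub>M vec_borel d" by (rule measurable_compose[OF measurable_limit_path measurable_path_at[OF q]])
  have i: "indep_elements N ?Q ?P (path_borel d) (\<lambda>w. shift_path d q (V w))"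
    by (rule indep_elements_assoc[where f = "stop_path d q" and g = "shift_path d q", OF N ind measurable_stop_path[OF q] measurable_shift_path[OF q] BM_indep_stop_shift[OF N V q]])
  have laweq: "distr N (path_borel d) (\<lambda>w. shift_path d q (V w)) = law"
    unfolding law_def by (rule BM_law_unique[OF N BM_shift[OF N V q] N V])
  define h where "h p = indicator G (fst p) * g (flow (?f (fst p)) (snd p))" for p
  have hm: "h \<in> borel_measurable (?Q \<Otimes>\<^sub>M path_borel d)"
    unfolding h_def
    by (intro borel_measurable_times measurable_compose[OF measurable_fst borel_measurable_indicator[OF G]]
      measurable_compose[OF measurable_compose[OF measurable_Pair[OF measurable_compose[OF measurable_fst f] measurable_snd]
        measurable_limit_path, simplified] g])
  have hB: "\<bar>h p\<bar> <= \<bar>B\<bar>" if "p \<in> space (?Q \<Otimes>\<^sub>M path_borel d)" for p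
  proof -
    have "snd p \<in> cont_paths d" using that by (auto simp: space_pair_measure topspace_path_topology)
    then have "\<bar>g (flow (?f (fst p)) (snd p))\<bar> <= \<bar>B\<bar>"
      using B[OF limit_path_cont_paths, of "snd p" \<theta> \<sigma> "?f (fst p)"] by linarith
    then show ?thesis by (simp add: h_def abs_mult indicator_def)
  qed
  have Zq: "?f (?P w) = Z w q" if "w \<in> space N" for w
    using limit_path_stop[OF BM_cont_paths[OF V that] q order.refl] by (simp add: Z_def)
  have Zl: "later (Z w) q = flow (Z w q) (shift_path d q (V w))" if "w \<in> space N" for w
    using limit_path_shift[OF BM_cont_paths[OF V that] q] by (simp add: Z_def later_def)
  have "(LINT w:E|N. g (later (Z w) q)) = (\<integral>w. h (?P w, shift_path d q (V w)) \<partial>N)"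
    unfolding set_lebesgue_integral_def
  proof (rule Bochner_Integration.integral_cong[OF refl])
    fix w assume w: "w \<in> space N"
    show "indicat_real E w *\<^sub>R g (later (Z w) q) = h (?P w, shift_path d q (V w))"
      using w Zq[OF w] Zl[OF w] by (simp add: h_def EG indicator_def)
  qed
  also have "... = (\<integral>w. (\<integral>y. h (?P w, y) \<partial>law) \<partial>N)"
    using indep_elements_integral[OF N i hm hB] by (simp only: laweq)
  also have "... = (LINT w:E|N. avg g (Z w q))"
    unfolding set_lebesgue_integral_def
  proof (rule Bochner_Integration.integral_cong[OF refl])
    fix w assume w: "w \<in> space N"
    show "(\<integral>y. h (?P w, y) \<partial>law) = indicat_real E w *\<^sub>R avg g (Z w q)"
      using w Zq[OF w] by (simp add: h_def EG indicator_def avg_def)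
  qed
  finally show ?thesis .
qed

lemma later_Z_measurable:
  assumes "T \<in> borel_measurable N" "\<And>x. x \<in> space N ==> 0 <= T x"
  shows "(\<lambda>x. later (Z x) (T x)) \<in> N \<rightarrow>\<^sub>M path_borel d"
  by (rule measurable_later[OF Z_measurable assms])

lemma Z_T_measurable:
  assumes "T \<in> borel_measurable N" "\<And>x. x \<in> space N ==> 0 <= T x"
  shows "(\<lambda>x. Z x (T x)) \<in> N \<rightarrow>\<^sub>M vec_borel d"
  using measurable_compose[OF later_Z_measurable[OF assms] measurable_path_at[OF order.refl]] by (simp add: later_index)

text \<open>Split \<open>A\<close> according to the value of the rounded stopping time and apply
  \<open>simple_Markov\<close> on each piece.\<close>

lemma grid_Markov:
  assumes T: "stopping_time F T" and T0: "\<And>w. w \<in> space N ==> 0 <= T w"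
    and A: "A \<in> sets (filtration.pre_sigma (space N) F T)"
    and g: "g \<in> borel_measurable (path_borel d)" and B: "\<And>x. x \<in> cont_paths d ==> \<bar>g x\<bar> <= B"
  shows "(LINT w:A|N. g (later (Z w) (grid_up n (T w)))) = (LINT w:A|N. avg g (Z w (grid_up n (T w))))"
proof -
  interpret prob_space N by (rule N)
  interpret filt: filtration "space N" F by (rule filtration_F)
  have Tm: "T \<in> borel_measurable N" by (rule measurable_stopping_time[OF T F_subset space_F])
  have AT: "{w \<in> A. T w <= t} \<in> sets (F t)" for t by (rule filt.sets_pre_sigmaD[OF T A])
  have AN: "A \<subseteq> space N" using sets.sets_into_space[OF A] by (simp add: filt.space_pre_sigma)
  define c where "c k = real k / 2 ^ n" for k :: nat
  define Ak where "Ak k = {w \<in> A. nat \<lceil>T w * 2 ^ n\<rceil> = k}" for k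
  have c0: "0 <= c k" for k by (simp add: c_def)
  \<comment> \<open>Rounding is upward, so the value \<open>c k\<close> is taken exactly when
    \<open>T\<close> lies in \<open>(c (k - 1), c k]\<close>, which is decided at time
    \<open>c k\<close>; for \<open>k = 0\<close> only the upper bound remains.\<close>
  have Ak: "Ak k \<in> sets (F (c k))" for k
  proof (cases k)
    case 0
    have "nat \<lceil>T w * 2 ^ n\<rceil> = 0 \<longleftrightarrow> T w <= 0" for w
      using mult_le_cancel_right_pos[of "2 ^ n" "T w" 0] by simp
    then have "Ak k = {w \<in> A. T w <= c k}"
      unfolding Ak_def c_def 0 by simp
    then show ?thesis using AT by simp
  next
    case (Suc m)
    have iff: "nat \<lceil>T w * 2 ^ n\<rceil> = k \<longleftrightarrow> T w <= c k \<and> \<not> T w <= c m" for w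
    proof -
      have "T w <= c j \<longleftrightarrow> T w * 2 ^ n <= real j" for j by (simp add: c_def pos_le_divide_eq)
      then show ?thesis unfolding Suc by (auto simp: nat_eq_iff ceiling_eq_iff)
    qed
    have "Ak k = {w \<in> A. T w <= c k} - {w \<in> A. T w <= c m}" unfolding Ak_def iff by auto
    moreover have "sets (F (c m)) \<subseteq> sets (F (c k))" by (rule filt.sets_F_mono) (simp add: c_def Suc divide_right_mono)
    ultimately show ?thesis using AT by (auto intro!: sets.Diff)
  qed
  have UA: "A = (\<Union>k. Ak k)" by (auto simp: Ak_def)
  have AkN: "Ak k \<in> sets N" for k using Ak F_subset by blast
  have disj: "Ak i \<inter> Ak j = {}" if "i \<noteq> j" for i j using that by (auto simp: Ak_def)
  have up: "grid_up n (T w) = c k" if "w \<in> Ak k" for w k using that by (simp add: Ak_def grid_up_def c_def)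
  have gT: "(\<lambda>w. grid_up n (T w)) \<in> borel_measurable N" unfolding grid_up_def using Tm by measurable
  have int1: "set_integrable N (\<Union>k. Ak k) (\<lambda>w. g (later (Z w) (grid_up n (T w))))"
    unfolding set_integrable_def
  proof (rule integrable_const_bound[where B = "\<bar>B\<bar>"])
    show "(\<lambda>w. indicat_real (\<Union>k. Ak k) w *\<^sub>R g (later (Z w) (grid_up n (T w)))) \<in> borel_measurable N"
      using AkN by (intro borel_measurable_scaleR borel_measurable_indicator sets.countable_UN'
        measurable_compose[OF later_Z_measurable[OF gT grid_up_nonneg] g]) auto
    show "AE w in N. norm (indicat_real (\<Union>k. Ak k) w *\<^sub>R g (later (Z w) (grid_up n (T w)))) <= \<bar>B\<bar>"
    proof (rule AE_I2)
      fix w assume "w \<in> space N"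
      from B[OF later_cont_paths[OF Z_cont_paths[OF this] grid_up_nonneg[of n "T w"]]]
      show "norm (indicat_real (\<Union>k. Ak k) w *\<^sub>R g (later (Z w) (grid_up n (T w)))) <= \<bar>B\<bar>"
        by (rule order_trans[OF norm_indicat_scaleR_le abs_ge_self])
    qed
  qed
  have int2: "set_integrable N (\<Union>k. Ak k) (\<lambda>w. avg g (Z w (grid_up n (T w))))"
    unfolding set_integrable_def
  proof (rule integrable_const_bound[where B = "\<bar>B\<bar>"])
    show "(\<lambda>w. indicat_real (\<Union>k. Ak k) w *\<^sub>R avg g (Z w (grid_up n (T w)))) \<in> borel_measurable N"
      using AkN by (intro borel_measurable_scaleR borel_measurable_indicator sets.countable_UN'
        measurable_compose[OF Z_T_measurable[OF gT grid_up_nonneg] avg_measurable[OF g]]) auto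
    show "AE w in N. norm (indicat_real (\<Union>k. Ak k) w *\<^sub>R avg g (Z w (grid_up n (T w)))) <= \<bar>B\<bar>"
    proof (rule AE_I2)
      fix w assume "w \<in> space N"
      from avg_bound(1)[OF g B Z_at_carrier[OF this grid_up_nonneg[of n "T w"]]]
      show "norm (indicat_real (\<Union>k. Ak k) w *\<^sub>R avg g (Z w (grid_up n (T w)))) <= \<bar>B\<bar>"
        by (rule order_trans[OF norm_indicat_scaleR_le abs_ge_self])
    qed
  qed
  have "(LINT w:A|N. g (later (Z w) (grid_up n (T w)))) = (\<Sum>k. LINT w:Ak k|N. g (later (Z w) (grid_up n (T w))))"
    unfolding UA by (rule lebesgue_integral_countable_add[OF AkN disj int1])
  also have "... = (\<Sum>k. LINT w:Ak k|N. avg g (Z w (grid_up n (T w))))"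
  proof (rule suminf_cong)
    fix k
    have "(LINT w:Ak k|N. g (later (Z w) (grid_up n (T w)))) = (LINT w:Ak k|N. g (later (Z w) (c k)))"
      by (rule set_lebesgue_integral_cong[OF AkN]) (simp add: up)
    also have "... = (LINT w:Ak k|N. avg g (Z w (c k)))" by (rule simple_Markov[OF c0 Ak g B])
    also have "... = (LINT w:Ak k|N. avg g (Z w (grid_up n (T w))))"
      by (rule set_lebesgue_integral_cong[OF AkN]) (simp add: up)
    finally show "(LINT w:Ak k|N. g (later (Z w) (grid_up n (T w)))) = (LINT w:Ak k|N. avg g (Z w (grid_up n (T w))))" .
  qed
  also have "... = (LINT w:A|N. avg g (Z w (grid_up n (T w))))"
    unfolding UA by (rule lebesgue_integral_countable_add[OF AkN disj int2, symmetric])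
  finally show ?thesis .
qed

text \<open>The limit of \<open>grid_Markov\<close> as the grid is refined: the left side converges
  by path continuity, the right side by \<open>avg_lipschitz\<close>, both dominated by
  \<open>B\<close>.\<close>

lemma strong_Markov_lipschitz:
  assumes T: "stopping_time F T" and T0: "\<And>p. p \<in> space N ==> 0 <= T p"
    and A: "A \<in> sets (filtration.pre_sigma (space N) F T)" and AN: "A \<in> sets N"
    and lip: "\<And>x y. x \<in> cont_paths d ==> y \<in> cont_paths d ==> \<bar>g x - g y\<bar> <= C * path_dist d S x y"
    and C: "0 <= C" and S: "0 <= S" and B: "\<And>x. x \<in> cont_paths d ==> \<bar>g x\<bar> <= B"
  shows "(LINT p:A|N. g (later (Z p) (T p))) = (LINT p:A|N. avg g (Z p (T p)))"
proof -
  interpret prob_space N by (rule N)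
  have Tm: "T \<in> borel_measurable N" by (rule measurable_stopping_time[OF T F_subset space_F])
  have gm: "g \<in> borel_measurable (path_borel d)"
    by (rule borel_measurable_borel_of, rule continuous_map_path_topology_lipschitz[OF lip])
  have gT: "(\<lambda>p. grid_up n (T p)) \<in> borel_measurable N" for n unfolding grid_up_def using Tm by measurable
  have dist: "(\<lambda>n. path_dist d S (later (Z p) (grid_up n (T p))) (later (Z p) (T p))) \<longlonglongrightarrow> 0" if "p \<in> space N" for p
    by (rule later_tendsto[OF Z_cont_paths[OF that] T0[OF that] grid_up_nonneg grid_up_tendsto[OF T0[OF that]]])
  have lim1: "(\<lambda>n. LINT p:A|N. g (later (Z p) (grid_up n (T p)))) \<longlonglongrightarrow> (LINT p:A|N. g (later (Z p) (T p)))"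
    unfolding set_lebesgue_integral_def
  proof (rule integral_dominated_convergence[where w = "\<lambda>_. B"])
    show "(\<lambda>p. indicat_real A p *\<^sub>R g (later (Z p) (T p))) \<in> borel_measurable N"
      by (intro borel_measurable_scaleR borel_measurable_indicator AN measurable_compose[OF later_Z_measurable[OF Tm T0] gm])
    show "(\<lambda>p. indicat_real A p *\<^sub>R g (later (Z p) (grid_up n (T p)))) \<in> borel_measurable N" for n
      by (intro borel_measurable_scaleR borel_measurable_indicator AN measurable_compose[OF later_Z_measurable[OF gT grid_up_nonneg] gm])
    show "AE p in N. norm (indicat_real A p *\<^sub>R g (later (Z p) (grid_up n (T p)))) <= B" for n
      using B[OF later_cont_paths[OF Z_cont_paths grid_up_nonneg]] by (intro AE_I2 norm_indicat_scaleR_le) simp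
    show "AE p in N. (\<lambda>n. indicat_real A p *\<^sub>R g (later (Z p) (grid_up n (T p)))) \<longlonglongrightarrow> indicat_real A p *\<^sub>R g (later (Z p) (T p))"
    proof (rule AE_I2)
      fix p assume p: "p \<in> space N"
      have "(\<lambda>n. g (later (Z p) (grid_up n (T p))) - g (later (Z p) (T p))) \<longlonglongrightarrow> 0"
      proof (rule Lim_null_comparison)
        show "\<forall>\<^sub>F n in sequentially. norm (g (later (Z p) (grid_up n (T p))) - g (later (Z p) (T p)))
            <= C * path_dist d S (later (Z p) (grid_up n (T p))) (later (Z p) (T p))"
          using lip[OF later_cont_paths[OF Z_cont_paths[OF p] grid_up_nonneg] later_cont_paths[OF Z_cont_paths[OF p] T0[OF p]]]
          by (intro always_eventually allI) simp
        show "(\<lambda>n. C * path_dist d S (later (Z p) (grid_up n (T p))) (later (Z p) (T p))) \<longlonglongrightarrow> 0"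
          using tendsto_mult[OF tendsto_const dist[OF p], of C] by simp
      qed
      then show "(\<lambda>n. indicat_real A p *\<^sub>R g (later (Z p) (grid_up n (T p)))) \<longlonglongrightarrow> indicat_real A p *\<^sub>R g (later (Z p) (T p))"
        by (intro tendsto_scaleR tendsto_const) (rule LIM_zero_cancel)
    qed
  qed simp
  have lim2: "(\<lambda>n. LINT p:A|N. avg g (Z p (grid_up n (T p)))) \<longlonglongrightarrow> (LINT p:A|N. avg g (Z p (T p)))"
    unfolding set_lebesgue_integral_def
  proof (rule integral_dominated_convergence[where w = "\<lambda>_. B"])
    show "(\<lambda>p. indicat_real A p *\<^sub>R avg g (Z p (T p))) \<in> borel_measurable N"
      by (intro borel_measurable_scaleR borel_measurable_indicator AN measurable_compose[OF Z_T_measurable[OF Tm T0] avg_measurable[OF gm]])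
    show "(\<lambda>p. indicat_real A p *\<^sub>R avg g (Z p (grid_up n (T p)))) \<in> borel_measurable N" for n
      by (intro borel_measurable_scaleR borel_measurable_indicator AN measurable_compose[OF Z_T_measurable[OF gT grid_up_nonneg] avg_measurable[OF gm]])
    show "AE p in N. norm (indicat_real A p *\<^sub>R avg g (Z p (grid_up n (T p)))) <= B" for n
      using avg_bound(1)[OF gm B Z_at_carrier[OF _ grid_up_nonneg]] by (intro AE_I2 norm_indicat_scaleR_le) simp
    show "AE p in N. (\<lambda>n. indicat_real A p *\<^sub>R avg g (Z p (grid_up n (T p)))) \<longlonglongrightarrow> indicat_real A p *\<^sub>R avg g (Z p (T p))"
    proof (rule AE_I2)
      fix p assume p: "p \<in> space N"
      let ?e = "\<lambda>n. path_dist d S (later (Z p) (grid_up n (T p))) (later (Z p) (T p))"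
      have "(\<lambda>n. avg g (Z p (grid_up n (T p))) - avg g (Z p (T p))) \<longlonglongrightarrow> 0"
      proof (rule Lim_null_comparison)
        show "\<forall>\<^sub>F n in sequentially. norm (avg g (Z p (grid_up n (T p))) - avg g (Z p (T p))) <= C * limit_lip d \<sigma> * ?e n"
        proof (intro always_eventually allI)
          fix n
          note L = later_cont_paths[OF Z_cont_paths[OF p] grid_up_nonneg[of n "T p"]] later_cont_paths[OF Z_cont_paths[OF p] T0[OF p]]
          have "\<bar>avg g (Z p (grid_up n (T p))) - avg g (Z p (T p))\<bar> <= C * limit_lip d \<sigma> * ?e n"
          proof (rule avg_lipschitz[OF lip C S B])
            show "0 <= ?e n" by (rule path_dist_nonneg[OF L])
            show "\<bar>Z p (grid_up n (T p)) $ i - Z p (T p) $ i\<bar> <= ?e n" if "i < d" for i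
              using path_dist_upper[OF L order.refl S that] by (simp add: later_index)
          qed (use Z_at_carrier[OF p] grid_up_nonneg T0[OF p] in auto)
          then show "norm (avg g (Z p (grid_up n (T p))) - avg g (Z p (T p))) <= C * limit_lip d \<sigma> * ?e n" by simp
        qed
        show "(\<lambda>n. C * limit_lip d \<sigma> * ?e n) \<longlonglongrightarrow> 0"
          using tendsto_mult[OF tendsto_const dist[OF p], of "C * limit_lip d \<sigma>"] by simp
      qed
      then show "(\<lambda>n. indicat_real A p *\<^sub>R avg g (Z p (grid_up n (T p)))) \<longlonglongrightarrow> indicat_real A p *\<^sub>R avg g (Z p (T p))"
        by (intro tendsto_scaleR tendsto_const) (rule LIM_zero_cancel)
    qed
  qed simp
  have "(\<lambda>n. LINT p:A|N. g (later (Z p) (grid_up n (T p)))) = (\<lambda>n. LINT p:A|N. avg g (Z p (grid_up n (T p))))"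
    using grid_Markov[OF T T0 A gm B] by (intro ext)
  then show ?thesis using lim1 lim2 LIMSEQ_unique by simp
qed

text \<open>Both sides of the strong Markov identity are finite measures in the path event. They
  agree on Lipschitz tests by \<open>strong_Markov_lipschitz\<close>, hence on all Borel
  sets.\<close>

lemma diffusion_Z: "diffusion N d Z"
  unfolding diffusion_def
proof (intro conjI Z_measurable bexI[OF _ kern_measurable] allI impI ballI; elim conjE)
  fix T A B
  assume T: "stopping_time F T" and T0': "\<forall>q\<in>space N. 0 <= T q"
    and A: "A \<in> sets (filtration.pre_sigma (space N) F T)" and B: "B \<in> sets (path_borel d)"
  have T0: "0 <= T q" if "q \<in> space N" for q using T0' that by blast
  interpret prob_space N by (rule N)
  interpret law: prob_space law by (rule prob_law)
  interpret filt: filtration "space N" F by (rule filtration_F)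
  have Tm: "T \<in> borel_measurable N" by (rule measurable_stopping_time[OF T F_subset space_F])
  have AN: "A \<in> sets N"
  proof -
    \<comment> \<open>\<open>A\<close> is assembled from its parts with \<open>T <= n\<close>, each
      of which is an event of the filtration.\<close>
    have eq: "A = (\<Union>n::nat. {q \<in> A. T q <= real n})" using real_arch_simple by auto
    have "{q \<in> A. T q <= real n} \<in> sets N" for n using filt.sets_pre_sigmaD[OF T A, of "real n"] F_subset by blast
    then have "(\<Union>n::nat. {q \<in> A. T q <= real n}) \<in> sets N" by (intro sets.countable_UN) auto
    with eq show ?thesis by (rule ssubst[where P = "\<lambda>x. x \<in> sets N"])
  qed
  \<comment> \<open>Restricting \<open>N\<close> to \<open>A\<close> turns the set integrals into
    integrals for one finite measure.\<close>
  define D where "D = density N (\<lambda>q. ennreal (indicat_real A q))"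
  have indA: "(\<lambda>q. indicat_real A q) \<in> borel_measurable N" using AN by simp
  have sD: "sets D = sets N" "space D = space N" by (simp_all add: D_def)
  interpret D: finite_measure D
  proof
    have "A \<inter> space N = A" using sets.sets_into_space[OF AN] by (rule Int_absorb2)
    then have "emeasure D (space D) = emeasure N A"
      unfolding D_def using AN by (simp add: emeasure_density ennreal_indicator flip: indicator_inter_arith)
    then show "emeasure D (space D) \<noteq> \<infinity>" by simp
  qed
  have intD: "(\<integral>q. f q \<partial>D) = (LINT q:A|N. f q)" if "f \<in> borel_measurable N" for f :: "'v => real"
    unfolding D_def set_lebesgue_integral_def using that indA by (subst integral_density) auto
  note LZ = later_Z_measurable[OF Tm T0] and ZT = Z_T_measurable[OF Tm T0]
  \<comment> \<open>Both restricted to \<open>A\<close>: \<open>\<nu>1\<close> is the law of the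
    path after \<open>T\<close>, and \<open>\<nu>2\<close> that of the flow from the state at
    \<open>T\<close> along an independent Brownian path.\<close>
  define \<nu>1 where "\<nu>1 = distr D (path_borel d) (\<lambda>q. later (Z q) (T q))"
  define \<nu>2 where "\<nu>2 = distr (D \<Otimes>\<^sub>M law) (path_borel d) (\<lambda>p. flow (Z (fst p) (T (fst p))) (snd p))"
  have LZD: "(\<lambda>q. later (Z q) (T q)) \<in> D \<rightarrow>\<^sub>M path_borel d" using LZ by (simp add: measurable_cong_sets[OF sD(1) refl])
  have ZTD: "(\<lambda>q. Z q (T q)) \<in> D \<rightarrow>\<^sub>M vec_borel d" using ZT by (simp add: measurable_cong_sets[OF sD(1) refl])
  have m2: "(\<lambda>p. flow (Z (fst p) (T (fst p))) (snd p)) \<in> D \<Otimes>\<^sub>M law \<rightarrow>\<^sub>M path_borel d"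
  proof -
    have "(\<lambda>p. (Z (fst p) (T (fst p)), snd p)) \<in> D \<Otimes>\<^sub>M law \<rightarrow>\<^sub>M vec_borel d \<Otimes>\<^sub>M path_borel d"
      by (intro measurable_Pair measurable_compose[OF measurable_fst ZTD]) (simp add: measurable_snd measurable_cong_sets[OF refl sets_law[symmetric]])
    from measurable_compose[OF this measurable_limit_path] show ?thesis by simp
  qed
  interpret DL: pair_sigma_finite D law ..
  have I1: "(\<integral>x. g x \<partial>\<nu>1) = (LINT q:A|N. g (later (Z q) (T q)))" if "g \<in> borel_measurable (path_borel d)" for g :: "(real => real vec) => real"
    unfolding \<nu>1_def integral_distr[OF LZD that] by (rule intD[OF measurable_compose[OF LZ that]])
  have fin: "finite_measure (D \<Otimes>\<^sub>M law)"
  proof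
    have "emeasure (D \<Otimes>\<^sub>M law) (space D \<times> space law) = emeasure D (space D) * emeasure law (space law)"
      by (rule law.emeasure_pair_measure_Times) auto
    then show "emeasure (D \<Otimes>\<^sub>M law) (space (D \<Otimes>\<^sub>M law)) \<noteq> \<infinity>"
      by (simp add: space_pair_measure law.emeasure_space_1 D.emeasure_finite)
  qed
  have I2: "(\<integral>x. g x \<partial>\<nu>2) = (LINT q:A|N. avg g (Z q (T q)))"
    if g: "g \<in> borel_measurable (path_borel d)" and b: "\<And>x. x \<in> cont_paths d ==> \<bar>g x\<bar> <= b" for g :: "(real => real vec) => real" and b
  proof -
    let ?h = "\<lambda>p. g (flow (Z (fst p) (T (fst p))) (snd p))"
    have "integrable (D \<Otimes>\<^sub>M law) ?h"
    proof (rule finite_measure.integrable_const_bound[OF fin, where B = b])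
      show "AE p in D \<Otimes>\<^sub>M law. norm (?h p) <= b"
        by (intro AE_I2) (auto simp: space_pair_measure space_law intro!: b limit_path_cont_paths)
    qed (rule measurable_compose[OF m2 g])
    then have "(\<integral>p. ?h p \<partial>(D \<Otimes>\<^sub>M law)) = (\<integral>q. (\<integral>w. ?h (q, w) \<partial>law) \<partial>D)" by (rule DL.integral_fst'[symmetric])
    also have "... = (\<integral>q. avg g (Z q (T q)) \<partial>D)" by (simp add: avg_def)
    also have "... = (LINT q:A|N. avg g (Z q (T q)))" by (rule intD[OF measurable_compose[OF ZT avg_measurable[OF g]]])
    finally show ?thesis unfolding \<nu>2_def integral_distr[OF m2 g] .
  qed
  have "\<nu>1 = \<nu>2"
  proof (rule path_measure_eqI)
    show "finite_measure \<nu>1" unfolding \<nu>1_def by (rule D.finite_measure_distr[OF LZD])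
    show "finite_measure \<nu>2" unfolding \<nu>2_def by (rule finite_measure.finite_measure_distr[OF fin m2])
    show "sets \<nu>1 = sets (path_borel d)" "sets \<nu>2 = sets (path_borel d)" by (simp_all add: \<nu>1_def \<nu>2_def)
    fix g :: "(real => real vec) => real" and S C b
    assume lip: "\<And>x y. x \<in> cont_paths d ==> y \<in> cont_paths d ==> \<bar>g x - g y\<bar> <= C * path_dist d S x y"
      and C: "0 <= C" and b: "\<And>x. x \<in> cont_paths d ==> \<bar>g x\<bar> <= b"
    have gm: "g \<in> borel_measurable (path_borel d)"
      by (rule borel_measurable_borel_of, rule continuous_map_path_topology_lipschitz[OF lip])
    have lip': "\<bar>g x - g y\<bar> <= C * path_dist d (max S 0) x y" if "x \<in> cont_paths d" "y \<in> cont_paths d" for x y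
      using lip[OF that] mult_left_mono[OF path_dist_mono[OF that, of S "max S 0"] C] by simp
    have "(\<integral>x. g x \<partial>\<nu>2) = (LINT q:A|N. avg g (Z q (T q)))" by (rule I2[OF gm b])
    moreover have "(LINT q:A|N. g (later (Z q) (T q))) = (LINT q:A|N. avg g (Z q (T q)))"
      by (rule strong_Markov_lipschitz[OF T T0 A AN lip' C _ b]) auto
    ultimately show "(\<integral>x. g x \<partial>\<nu>1) = (\<integral>x. g x \<partial>\<nu>2)" using I1[OF gm] by simp
  qed
  then have "(LINT q:A|N. indicat_real B (later (Z q) (T q))) = (LINT q:A|N. avg (indicator B) (Z q (T q)))"
    using I1[of "indicator B"] I2[of "indicator B" 1] B by (simp add: indicator_def)
  moreover have "(LINT q:A|N. indicat_real B (later (Z q) (T q))) = prob {q \<in> A. later (Z q) (T q) \<in> B}"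
  proof -
    have "{q \<in> A. later (Z q) (T q) \<in> B} = A \<inter> ((\<lambda>q. later (Z q) (T q)) -` B \<inter> space N)"
      using sets.sets_into_space[OF AN] by auto
    then have "{q \<in> A. later (Z q) (T q) \<in> B} \<in> sets N" using AN measurable_sets[OF LZ B] by simp
    moreover have "(LINT q:A|N. indicat_real B (later (Z q) (T q))) = (\<integral>q. indicat_real {q \<in> A. later (Z q) (T q) \<in> B} q \<partial>N)"
      unfolding set_lebesgue_integral_def by (rule Bochner_Integration.integral_cong[OF refl]) (simp add: indicator_def)
    ultimately show ?thesis by simp
  qed
  moreover have "(LINT q:A|N. measure (kern (Z q (T q))) B) = (LINT q:A|N. avg (indicator B) (Z q (T q)))"
    by (rule set_lebesgue_integral_cong[OF AN]) (use sets.sets_into_space[OF AN] T0 in "auto intro!: measure_kern Z_at_carrier B")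
  ultimately show "prob {q \<in> A. (\<lambda>t\<in>{0..}. Z q (T q + t)) \<in> B} = (LINT q:A|N. measure (kern (Z q (T q))) B)"
    by (simp add: later_def)
qed

end

subsection \<open>Pathwise estimates for the elimination of coordinates\<close>

context reflection
begin

text \<open>What row \<open>l\<close> becomes under block elimination; applied to a reflected path
  it retains only regulators with index at least \<open>m\<close>
  (\<open>reduced_refl_path\<close>).\<close>

definition reduced :: "nat => nat => (nat => real) => real" where
  "reduced m l x = x l + (\<Sum>i<m. elim m l i * x i)"

lemma reduced_R:
  assumes m: "m <= d"
  shows "reduced m l (\<lambda>i. \<Sum>k<d. R $$ (i, k) * y k) = (\<Sum>k\<in>{m..<d}. schur m l k * y k)"
proof -
  have "(\<Sum>i<m. elim m l i * (\<Sum>k<d. R $$ (i, k) * y k)) = (\<Sum>k<d. (\<Sum>i<m. elim m l i * R $$ (i, k)) * y k)"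
    unfolding sum_distrib_left sum_distrib_right by (subst sum.swap) (simp add: mult.assoc)
  then have "reduced m l (\<lambda>i. \<Sum>k<d. R $$ (i, k) * y k) = (\<Sum>k<d. schur m l k * y k)"
    by (simp add: reduced_def schur_def distrib_right sum.distrib)
  also have "... = (\<Sum>k\<in>{m..<d}. schur m l k * y k)"
    using m by (intro sum.mono_neutral_right) (auto simp: schur_eliminated)
  finally show ?thesis .
qed

lemma reduced_add: "reduced m l (\<lambda>i. x i + y i) = reduced m l x + reduced m l y"
  by (simp add: reduced_def distrib_left sum.distrib)

lemma reduced_cong: "m <= l ==> (\<And>i. i <= l ==> x i = y i) ==> reduced m l x = reduced m l y"
  by (simp add: reduced_def)

lemma reduced_refl_path:
  assumes X: "X \<in> cont_paths d" and m: "m <= l" and l: "l < d" and t: "0 <= t"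
  shows "reduced m l (\<lambda>i. refl_path X t $ i) =
    reduced m l (\<lambda>i. X t $ i) + (\<Sum>k\<in>{m..<d}. schur m l k * reg_path X t $ k)"
proof -
  have "reduced m l (\<lambda>i. refl_path X t $ i) = reduced m l (\<lambda>i. X t $ i + (\<Sum>k<d. R $$ (i, k) * reg_path X t $ k))"
    using l by (intro reduced_cong m) (simp add: refl_path_index[OF t])
  then show ?thesis using reduced_R[of m l "\<lambda>k. reg_path X t $ k"] m l by (simp add: reduced_add)
qed

text \<open>Take a time \<open>s <= t\<close> at which the regulator of coordinate \<open>i\<close>
  already has its value at \<open>t\<close> and the coordinate itself is 0, or \<open>s = 0\<close>.
  From \<open>s\<close> to \<open>t\<close> the later regulators enter with nonpositive weights and
  the earlier ones are eliminated, so the reduced coordinate rises by at most \<open>D\<close>; its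
  part from the earlier coordinates at time \<open>s\<close> is bounded through
  \<open>E\<close>.\<close>

lemma refl_path_upper_bound:
  assumes X: "X \<in> cont_paths d" and i: "i < d" and t: "0 <= t" "t <= \<tau>" and D: "0 <= D"
    and E: "\<And>k s. k < i ==> 0 <= s ==> s <= \<tau> ==> refl_path X s $ k <= E"
    and U: "\<And>s t. 0 <= s ==> s <= t ==> t <= \<tau> ==>
      reduced i i (\<lambda>k. X t $ k) - reduced i i (\<lambda>k. X s $ k) <= D"
  shows "refl_path X t $ i <= (\<Sum>k<i. elim i i k) * E + refl_path X 0 $ i + D"
proof -
  let ?Z = "refl_path X" and ?Y = "reg_path X"
  have nn: "0 <= ?Z s $ k" if "0 <= s" "k < d" for s k by (rule refl_path_nonneg[OF X that(2,1)])
  have "\<exists>s. 0 <= s \<and> s <= t \<and> ?Z s $ i <= ?Z 0 $ i \<and> ?Y s $ i = ?Y t $ i"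
    using reg_path_complementary[OF X i t(1)]
  proof
    assume "?Y t $ i = 0"
    then have "?Y 0 $ i = ?Y t $ i"
      using reg_path_nonneg[OF X i, of 0] reg_path_mono[OF X i, of 0 t] t by simp
    then show ?thesis using t by (intro exI[of _ 0]) simp
  next
    assume "\<exists>s. 0 <= s \<and> s <= t \<and> ?Z s $ i = 0 \<and> ?Y s $ i = ?Y t $ i"
    then show ?thesis using nn[OF order.refl i] by auto
  qed
  then obtain s where s: "0 <= s" "s <= t" "?Z s $ i <= ?Z 0 $ i" "?Y s $ i = ?Y t $ i" by blast
  have "(\<Sum>k\<in>{i..<d}. schur i i k * ?Y t $ k) <= (\<Sum>k\<in>{i..<d}. schur i i k * ?Y s $ k)"
  proof (rule sum_mono)
    fix k assume k: "k \<in> {i..<d}"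
    show "schur i i k * ?Y t $ k <= schur i i k * ?Y s $ k"
    proof (cases "k = i")
      case False
      then have "schur i i k <= 0" using k i by (intro schur_offdiag) auto
      moreover have "?Y s $ k <= ?Y t $ k" using k s by (intro reg_path_mono[OF X]) auto
      ultimately show ?thesis by (rule mult_left_mono_neg[rotated])
    qed (simp add: s(4))
  qed
  then have "reduced i i (\<lambda>k. ?Z t $ k) <= reduced i i (\<lambda>k. ?Z s $ k) + D"
    using U[OF s(1,2) t(2)] reduced_refl_path[OF X order.refl i s(1)] reduced_refl_path[OF X order.refl i t(1)] by simp
  moreover have "(\<Sum>k<i. elim i i k * ?Z s $ k) <= (\<Sum>k<i. elim i i k) * E"
    unfolding sum_distrib_right using s t i by (intro sum_mono mult_left_mono E elim_nonneg) auto
  moreover have "0 <= (\<Sum>k<i. elim i i k * ?Z t $ k)"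
    using i t by (intro sum_nonneg mult_nonneg_nonneg elim_nonneg nn) auto
  ultimately show ?thesis using s(3) by (simp add: reduced_def)
qed

text \<open>Suppose the maximal ratio \<open>\<mu>\<close> of the final regulators to
  \<open>v\<close> is positive, attained at \<open>p\<close>. At a time \<open>s\<close> where
  coordinate \<open>p\<close> is 0 and its regulator is already final, row \<open>p\<close> of
  \<open>schur\<close> applied to the regulators is at least \<open>\<mu>\<close> times the positive
  sum of \<open>schur_v_pos\<close>; yet the hypothesis on the driving path makes it
  nonpositive.\<close>

lemma reg_path_eq_0:
  assumes X: "X \<in> cont_paths d" and m: "m <= d" and \<tau>: "0 <= \<tau>"
    and x: "\<And>l t. m <= l ==> l < d ==> 0 <= t ==> t <= \<tau> ==>
      (\<Sum>i<m. elim m l i * refl_path X t $ i) <= reduced m l (\<lambda>i. X t $ i)"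
    and l: "m <= l" "l < d"
  shows "reg_path X \<tau> $ l = 0"
proof -
  let ?Z = "refl_path X" and ?Y = "reg_path X"
  define \<mu> where "\<mu> = Max ((\<lambda>l. ?Y \<tau> $ l / v l) ` {m..<d})"
  have "\<mu> \<in> (\<lambda>l. ?Y \<tau> $ l / v l) ` {m..<d}" unfolding \<mu>_def using l by (intro Max_in) auto
  then obtain p where p: "m <= p" "p < d" "\<mu> = ?Y \<tau> $ p / v p" by auto
  have Y\<mu>: "?Y \<tau> $ k <= \<mu> * v k" if "m <= k" "k < d" for k
  proof -
    have "?Y \<tau> $ k / v k <= \<mu>" unfolding \<mu>_def using that by (intro Max_ge) auto
    then show ?thesis using v_pos[OF that(2)] by (simp add: pos_divide_le_eq)
  qed
  have Yp: "?Y \<tau> $ p = \<mu> * v p" using p(3) v_pos[OF p(2)] by simp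
  have "\<mu> <= 0"
  proof (rule ccontr)
    assume "\<not> \<mu> <= 0"
    then have \<mu>: "0 < \<mu>" by simp
    then have "?Y \<tau> $ p \<noteq> 0" using Yp v_pos[OF p(2)] by simp
    with reg_path_complementary[OF X p(2) \<tau>]
    obtain s where s: "0 <= s" "s <= \<tau>" "?Z s $ p = 0" "?Y s $ p = ?Y \<tau> $ p" by blast
    have "(\<Sum>k\<in>{m..<d}. schur m p k * (\<mu> * v k)) <= (\<Sum>k\<in>{m..<d}. schur m p k * ?Y s $ k)"
    proof (rule sum_mono)
      fix k assume k: "k \<in> {m..<d}"
      show "schur m p k * (\<mu> * v k) <= schur m p k * ?Y s $ k"
      proof (cases "k = p")
        case False
        then have "schur m p k <= 0" using k p by (intro schur_offdiag) auto
        moreover have "?Y s $ k <= \<mu> * v k"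
          using reg_path_mono[OF X _ s(1,2), of k] Y\<mu>[of k] k by simp
        ultimately show ?thesis by (rule mult_left_mono_neg[rotated])
      qed (simp add: s(4) Yp)
    qed
    also have "... = reduced m p (\<lambda>i. ?Z s $ i) - reduced m p (\<lambda>i. X s $ i)"
      using reduced_refl_path[OF X p(1,2) s(1)] by simp
    also have "... <= 0" using x[OF p(1,2) s(1,2)] s(3) by (simp add: reduced_def)
    finally have "\<mu> * (\<Sum>k\<in>{m..<d}. schur m p k * v k) <= 0"
      by (simp add: sum_distrib_left mult.left_commute)
    then show False using schur_v_pos[OF p(1,2)] \<mu> by (simp add: mult_le_0_iff)
  qed
  then have "?Y \<tau> $ l <= 0"
    using Y\<mu>[OF l] v_pos[OF l(2)] mult_nonpos_nonneg[of \<mu> "v l"] by simp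
  then show ?thesis using reg_path_nonneg[OF X l(2) \<tau>] by simp
qed

definition rescale :: "(nat => real) => (real => real vec) => real => real vec" where
  "rescale g x = (\<lambda>t\<in>{0..}. Matrix.vec d (\<lambda>j. g j * x (t / (g j)\<^sup>2) $ j))"

lemma rescale_index: "0 <= t ==> j < d ==> rescale g x t $ j = g j * x (t / (g j)\<^sup>2) $ j"
  by (simp add: rescale_def)

lemma rescale_cont_paths:
  assumes x: "x \<in> cont_paths d"
  shows "rescale g x \<in> cont_paths d"
  unfolding rescale_def
proof (rule cont_paths_vecI)
  fix j assume j: "j < d"
  show "continuous_on {0..} (\<lambda>t. g j * x (t / (g j)\<^sup>2) $ j)"
    unfolding divide_inverse
    by (intro continuous_on_mult continuous_on_const continuous_on_id continuous_on_compose2[OF cont_paths_continuous[OF x j]]) auto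
qed

text \<open>On \<open>[0, T]\<close> a rescaled coordinate whose successors have not yet been reflected solves a
  one-dimensional Skorokhod problem for a perturbation of \<open>A\<close>.\<close>

lemma rescale_refl_path_dist:
  assumes X: "X \<in> cont_paths d" and A: "A \<in> cont_paths d" and T: "0 <= T" and e: "0 <= e"
    and g: "\<And>j. j < d ==> 0 < g j"
    and Y: "\<And>j k. j < k ==> k < d ==> reg_path X (T / (g j)\<^sup>2) $ k = 0"
    and err: "\<And>j t. j < d ==> 0 <= t ==> t <= T ==>
      \<bar>g j * (reduced j j (\<lambda>i. X (t / (g j)\<^sup>2) $ i) - (\<Sum>i<j. elim j j i * refl_path X (t / (g j)\<^sup>2) $ i)) - A t $ j\<bar> <= e"
  shows "path_dist d T (rescale g (refl_path X)) (one.refl_path d A) <= (1 + one.K d) * e"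
proof -
  let ?Z = "refl_path X" and ?Y = "reg_path X"
  \<comment> \<open>The factor \<open>schur j j j\<close> is absorbed into the regulator, so that
    the coordinate solves a problem with reflection 1.\<close>
  define y where "y j t = g j * (schur j j j * ?Y (t / (g j)\<^sup>2) $ j)" for j t
  define a where "a j t = g j * (reduced j j (\<lambda>i. X (t / (g j)\<^sup>2) $ i) - (\<Sum>i<j. elim j j i * ?Z (t / (g j)\<^sup>2) $ i))" for j t
  have c: "0 < g j * schur j j j" if "j < d" for j using g[OF that] schur_diag_pos[OF that] by simp
  have y': "y j t = (g j * schur j j j) * ?Y (t / (g j)\<^sup>2) $ j" for j t by (simp add: y_def mult.assoc)
  have Zt: "g j * ?Z (t / (g j)\<^sup>2) $ j = a j t + y j t" if j: "j < d" and t: "0 <= t" "t <= T" for j t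
  proof -
    let ?s = "t / (g j)\<^sup>2"
    have s: "0 <= ?s" using t by simp
    have "?s <= T / (g j)\<^sup>2" using t by (intro divide_right_mono) auto
    have Y0: "?Y ?s $ k = 0" if "j < k" "k < d" for k
      using reg_path_mono[OF X that(2) s \<open>?s <= T / (g j)\<^sup>2\<close>] Y[OF that] reg_path_nonneg[OF X that(2) s] by simp
    have "(\<Sum>k\<in>{j..<d}. schur j j k * ?Y ?s $ k) = (\<Sum>k\<in>{j}. schur j j k * ?Y ?s $ k)"
      using j Y0 by (intro sum.mono_neutral_right) auto
    then have "?Z ?s $ j = reduced j j (\<lambda>i. X ?s $ i) - (\<Sum>i<j. elim j j i * ?Z ?s $ i) + schur j j j * ?Y ?s $ j"
      using reduced_refl_path[OF X order.refl j s] by (simp add: reduced_def)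
    then show ?thesis by (simp add: a_def y_def distrib_left)
  qed
  have ident: "(\<Sum>k<d. (1\<^sub>m d :: real mat) $$ (i, k) * z k) = z i" "(\<Sum>k\<in>{..<d} - {i}. (1\<^sub>m d :: real mat) $$ (i, k) * z k) = 0"
    if "i < d" for i and z :: "nat => real"
  proof -
    show "(\<Sum>k\<in>{..<d} - {i}. (1\<^sub>m d :: real mat) $$ (i, k) * z k) = 0" using that by (intro sum.neutral) auto
    then show "(\<Sum>k<d. (1\<^sub>m d :: real mat) $$ (i, k) * z k) = z i" using that by (simp add: sum_split)
  qed
  \<comment> \<open>Leastness comes from complementarity of the original path: a zero of coordinate
    \<open>i\<close> at time \<open>u\<close> is a zero of the rescaled one at time
    \<open>u * (g i)\<^sup>2\<close>.\<close>
  have reg: "one.regulated d T a y"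
    unfolding one.regulated_def
  proof (intro allI impI conjI ballI)
    fix i assume i: "i < d"
    fix t assume t: "t \<in> {0..T}"
    let ?s = "t / (g i)\<^sup>2"
    show "0 <= y i t" unfolding y' using less_imp_le[OF c[OF i]] t by (intro mult_nonneg_nonneg[of "_ * _"] reg_path_nonneg[OF X i]) auto
    show "y i s <= y i t" if "s \<in> {0..t}" for s
      unfolding y' using c[OF i] that by (intro mult_left_mono reg_path_mono[OF X i] divide_right_mono) auto
    show "0 <= a i t + (\<Sum>k<d. 1\<^sub>m d $$ (i, k) * y k t)"
      unfolding ident(1)[OF i] using Zt[OF i, of t] t g[OF i] refl_path_nonneg[OF X i, of ?s]
      by (metis atLeastAtMost_iff divide_nonneg_nonneg mult_nonneg_nonneg less_imp_le zero_le_power2)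
    fix b assume b: "(0::real) <= b" and least: "\<forall>s\<in>{0..t}. 0 <= a i s + (\<Sum>k\<in>{..<d} - {i}. 1\<^sub>m d $$ (i, k) * y k s) + 1\<^sub>m d $$ (i, i) * b"
    have "0 <= ?s" using t by simp
    from reg_path_complementary[OF X i this] show "y i t <= b"
    proof
      assume "?Y ?s $ i = 0"
      then show ?thesis using b by (simp add: y_def)
    next
      assume "\<exists>u. 0 <= u \<and> u <= ?s \<and> ?Z u $ i = 0 \<and> ?Y u $ i = ?Y ?s $ i"
      then obtain u where u: "0 <= u" "u <= ?s" "?Z u $ i = 0" "?Y u $ i = ?Y ?s $ i" by blast
      define s where "s = u * (g i)\<^sup>2"
      have s: "0 <= s" "s <= t" "s / (g i)\<^sup>2 = u"
        using u(1,2) g[OF i] by (auto simp: s_def pos_le_divide_eq)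
      have "0 <= a i s + b" using least s i unfolding ident(2)[OF i] by simp
      moreover have "a i s + y i s = 0" using Zt[OF i, of s] s t u(3) by simp
      moreover have "y i s = y i t" by (simp add: y_def s(3) u(4))
      ultimately show ?thesis by simp
    qed
  qed
  have "one.regulated d T (\<lambda>i t. A t $ i) (\<lambda>i t. one.reg_path d A t $ i)" by (rule one.regulated_reg_path[OF A])
  note lip = one.regulated_lipschitz[OF reg this T e]
  show ?thesis
  proof (rule path_dist_leI[OF rescale_cont_paths[OF refl_path_cont_paths[OF X]] one.refl_path_cont_paths[OF A]])
    show "0 <= (1 + one.K d) * e" using one.K_nonneg[of d] e by simp
    fix t i assume t: "0 <= t" "t <= T" and i: "i < d"
    have "\<bar>y i t - one.reg_path d A t $ i\<bar> <= one.K d * e"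
      using err by (intro lip i t) (simp add: a_def)
    moreover have "\<bar>a i t - A t $ i\<bar> <= e" using err[OF i t] by (simp add: a_def)
    moreover have "rescale g ?Z t $ i = a i t + y i t" using Zt[OF i t] t i by (simp add: rescale_index)
    moreover have "one.refl_path d A t $ i = A t $ i + one.reg_path d A t $ i"
      using one.refl_path_index[OF t(1) i] ident(1)[OF i] by simp
    ultimately show "\<bar>rescale g ?Z t $ i - one.refl_path d A t $ i\<bar> <= (1 + one.K d) * e"
      by (simp add: distrib_right)
  qed
qed

end

subsection \<open>Events of probability close to one\<close>

text \<open>Probability is measured by a measurable event inside the property, because the
  properties \<open>Q\<close>, which often quantify over all times, are not shown to be
  measurable.\<close>

definition holds_wp :: "'w measure => 'i filter => real => ('i => 'w => bool) => bool" where
  "holds_wp M F e Q \<longleftrightarrow> (\<forall>\<^sub>F r in F. \<exists>A\<in>sets M. 1 - e <= measure M A \<and> (\<forall>x\<in>A. Q r x))"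

definition whp :: "'w measure => 'i filter => ('i => 'w => bool) => bool" where
  "whp M F Q \<longleftrightarrow> (\<forall>e>0. holds_wp M F e Q)"

text \<open>Tightness along the filter: the constant is chosen before the index.\<close>

definition bounded_wp :: "'w measure => 'i filter => (real => 'i => 'w => bool) => bool" where
  "bounded_wp M F Q \<longleftrightarrow> (\<forall>e>0. \<exists>C. holds_wp M F e (Q C))"

context prob_space
begin

lemma holds_wp_mono:
  assumes Q: "holds_wp M F e Q" and imp: "\<forall>\<^sub>F r in F. \<forall>x\<in>space M. Q r x --> Q' r x"
  shows "holds_wp M F e Q'"
  unfolding holds_wp_def
  using Q[unfolded holds_wp_def] imp
proof eventually_elim
  case (elim r)
  then obtain A where A: "A \<in> sets M" "1 - e <= measure M A" "\<And>x. x \<in> A ==> Q r x" by blast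
  have "Q' r x" if "x \<in> A" for x using elim(2) A(3)[OF that] sets.sets_into_space[OF A(1)] that by blast
  then show ?case using A(1,2) by blast
qed

lemma holds_wp_conj:
  assumes Q: "holds_wp M F a Q" and Q': "holds_wp M F b Q'"
  shows "holds_wp M F (a + b) (\<lambda>r x. Q r x \<and> Q' r x)"
  unfolding holds_wp_def
  using Q[unfolded holds_wp_def] Q'[unfolded holds_wp_def]
proof eventually_elim
  case (elim r)
  then obtain A B where A: "A \<in> sets M" "1 - a <= prob A" "\<And>x. x \<in> A ==> Q r x"
    and B: "B \<in> sets M" "1 - b <= prob B" "\<And>x. x \<in> B ==> Q' r x" by blast
  have "prob (A \<union> B) = prob A + prob B - prob (A \<inter> B)"
    using A(1) B(1) by (simp add: measure_Un3 fmeasurable_eq_sets)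
  moreover have "prob (A \<union> B) <= 1" by simp
  ultimately have "1 - (a + b) <= prob (A \<inter> B)" using A(2) B(2) by linarith
  then show ?case using A B by (intro bexI[of _ "A \<inter> B"]) auto
qed

lemma holds_wp_eventually:
  assumes "\<forall>\<^sub>F r in F. \<forall>x\<in>space M. Q r x" "0 <= e"
  shows "holds_wp M F e Q"
  unfolding holds_wp_def
  using assms(1) by eventually_elim (use assms(2) prob_space in \<open>auto intro!: bexI[of _ "space M"]\<close>)

lemma whp_mono:
  assumes "whp M F Q" "\<forall>\<^sub>F r in F. \<forall>x\<in>space M. Q r x --> Q' r x"
  shows "whp M F Q'"
  using assms holds_wp_mono unfolding whp_def by blast

lemma whp_conj:
  assumes Q: "whp M F Q" and Q': "whp M F Q'"
  shows "whp M F (\<lambda>r x. Q r x \<and> Q' r x)"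
  unfolding whp_def
proof (intro allI impI)
  fix e :: real assume "0 < e"
  then have "0 < e / 2" by simp
  with Q Q' have "holds_wp M F (e / 2) Q" "holds_wp M F (e / 2) Q'" unfolding whp_def by blast+
  from holds_wp_conj[OF this] show "holds_wp M F e (\<lambda>r x. Q r x \<and> Q' r x)" by simp
qed

lemma whp_eventually: "\<forall>\<^sub>F r in F. \<forall>x\<in>space M. Q r x ==> whp M F Q"
  unfolding whp_def by (intro allI impI holds_wp_eventually) auto

lemma whp_all_less:
  fixes n :: nat
  assumes "\<And>k. k < n ==> whp M F (Q k)"
  shows "whp M F (\<lambda>r x. \<forall>k<n. Q k r x)"
  using assms
proof (induction n)
  case 0
  show ?case by (rule whp_eventually) simp
next
  case (Suc n)
  have "whp M F (\<lambda>r x. (\<forall>k<n. Q k r x) \<and> Q n r x)"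
    by (rule whp_conj) (use Suc in auto)
  then show ?case by (rule whp_mono) (auto simp: less_Suc_eq)
qed

lemma bounded_wp_conj:
  assumes Q: "bounded_wp M F Q" and Q': "bounded_wp M F Q'"
    and mono: "\<And>C D r x. C <= D ==> Q C r x ==> Q D r x" "\<And>C D r x. C <= D ==> Q' C r x ==> Q' D r x"
  shows "bounded_wp M F (\<lambda>C r x. Q C r x \<and> Q' C r x)"
  unfolding bounded_wp_def
proof (intro allI impI)
  fix e :: real assume "0 < e"
  then have "0 < e / 2" by simp
  with Q Q' obtain C C' where C: "holds_wp M F (e / 2) (Q C)" "holds_wp M F (e / 2) (Q' C')"
    unfolding bounded_wp_def by blast
  have "holds_wp M F (e / 2 + e / 2) (\<lambda>r x. Q C r x \<and> Q' C' r x)" by (rule holds_wp_conj[OF C])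
  then have "holds_wp M F e (\<lambda>r x. Q (max C C') r x \<and> Q' (max C C') r x)"
    unfolding field_sum_of_halves
    by (rule holds_wp_mono) (use mono(1)[of C "max C C'"] mono(2)[of C' "max C C'"] in auto)
  then show "\<exists>C. holds_wp M F e (\<lambda>r x. Q C r x \<and> Q' C r x)" by blast
qed

lemma bounded_wp_all_less:
  fixes n :: nat
  assumes "\<And>k. k < n ==> bounded_wp M F (Q k)"
    and mono: "\<And>k C D r x. k < n ==> C <= D ==> Q k C r x ==> Q k D r x"
  shows "bounded_wp M F (\<lambda>C r x. \<forall>k<n. Q k C r x)"
  using assms
proof (induction n)
  case 0
  show ?case unfolding bounded_wp_def by (auto intro!: holds_wp_eventually)
next
  case (Suc n)
  have "bounded_wp M F (\<lambda>C r x. (\<forall>k<n. Q k C r x) \<and> Q n C r x)"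
  proof (rule bounded_wp_conj)
    show "bounded_wp M F (\<lambda>C r x. \<forall>k<n. Q k C r x)"
      by (rule Suc.IH) (use Suc.prems less_SucI in blast)+
    show "bounded_wp M F (Q n)" by (rule Suc.prems(1)) simp
    show "\<forall>k<n. Q k D r x" if "C <= D" "\<forall>k<n. Q k C r x" for C D r x
      using Suc.prems(2)[OF less_SucI that(1)] that(2) by blast
    show "Q n D r x" if "C <= D" "Q n C r x" for C D r x by (rule Suc.prems(2)[OF _ that]) simp
  qed
  moreover have "(\<lambda>C r x. \<forall>k<Suc n. Q k C r x) = (\<lambda>C r x. (\<forall>k<n. Q k C r x) \<and> Q n C r x)"
    by (auto simp: fun_eq_iff less_Suc_eq)
  ultimately show ?case by simp
qed

text \<open>On the good event the integrands differ by at most \<open>e / 4\<close>; the exceptional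
  event has probability at most \<open>\<epsilon>\<close> and contributes at most
  \<open>2 * \<bar>B\<bar> * \<epsilon> <= e / 2\<close>.\<close>

lemma whp_expectation_diff:
  fixes f g :: "'i => 'a => real"
  assumes close: "\<And>\<eta>. 0 < \<eta> ==> whp M F (\<lambda>r x. \<bar>f r x - g r x\<bar> <= \<eta>)"
    and meas: "\<forall>\<^sub>F r in F. f r \<in> borel_measurable M \<and> g r \<in> borel_measurable M"
    and bound: "\<forall>\<^sub>F r in F. \<forall>x\<in>space M. \<bar>f r x\<bar> <= B \<and> \<bar>g r x\<bar> <= B"
  shows "((\<lambda>r. (\<integral>x. f r x \<partial>M) - (\<integral>x. g r x \<partial>M)) \<longlongrightarrow> 0) F"
proof (rule tendstoI)
  fix e :: real assume e: "0 < e"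
  define \<epsilon> where "\<epsilon> = e / (4 * (\<bar>B\<bar> + 1))"
  have \<epsilon>: "0 < \<epsilon>" using e by (simp add: \<epsilon>_def)
  have "2 * \<bar>B\<bar> * \<epsilon> <= 2 * (\<bar>B\<bar> + 1) * \<epsilon>" using \<epsilon> by (intro mult_right_mono) auto
  also have "... = e / 2" by (simp add: \<epsilon>_def field_simps)
  finally have B\<epsilon>: "2 * \<bar>B\<bar> * \<epsilon> <= e / 2" .
  have "holds_wp M F \<epsilon> (\<lambda>r x. \<bar>f r x - g r x\<bar> <= e / 4)"
    using close[of "e / 4"] e \<epsilon> by (simp add: whp_def)
  then show "\<forall>\<^sub>F r in F. dist ((\<integral>x. f r x \<partial>M) - (\<integral>x. g r x \<partial>M)) 0 < e"
    unfolding holds_wp_def using meas bound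
  proof eventually_elim
    case (elim r)
    then obtain A where A: "A \<in> sets M" "1 - \<epsilon> <= prob A" "\<And>x. x \<in> A ==> \<bar>f r x - g r x\<bar> <= e / 4" by blast
    have fi: "integrable M (f r)" and gi: "integrable M (g r)"
      using elim by (auto intro!: integrable_const_bound[where B = B] AE_I2)
    let ?b = "\<lambda>x. e / 4 + 2 * \<bar>B\<bar> * indicat_real (space M - A) x"
    have bi: "integrable M ?b" using A(1) by (intro Bochner_Integration.integrable_add integrable_mult_right) (auto simp: integrable_indicator_iff emeasure_eq_measure)
    have "\<bar>\<integral>x. (f r x - g r x) \<partial>M\<bar> <= (\<integral>x. \<bar>f r x - g r x\<bar> \<partial>M)" by (rule integral_abs_bound)
    also have "... <= (\<integral>x. ?b x \<partial>M)"
    proof (rule integral_mono[OF _ bi])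
      show "integrable M (\<lambda>x. \<bar>f r x - g r x\<bar>)" using fi gi by simp
      fix x assume x: "x \<in> space M"
      then have "\<bar>f r x\<bar> <= \<bar>B\<bar>" "\<bar>g r x\<bar> <= \<bar>B\<bar>" using elim(3) by fastforce+
      then show "\<bar>f r x - g r x\<bar> <= ?b x" using A(3)[of x] x e by (cases "x \<in> A") auto
    qed
    also have "... = e / 4 + 2 * \<bar>B\<bar> * (1 - prob A)"
      using A(1) by (subst Bochner_Integration.integral_add) (auto simp: prob_space prob_compl integrable_indicator_iff emeasure_eq_measure)
    also have "... <= e / 4 + 2 * \<bar>B\<bar> * \<epsilon>" using A(2) by (intro add_left_mono mult_left_mono) auto
    also have "... < e" using B\<epsilon> e by simp
    finally show ?case using fi gi by (simp add: dist_real_def)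
  qed
qed

end

subsection \<open>Uniform bounds for rescaled Brownian motions\<close>

lemma closedin_path_all_le:
  fixes b :: "'i => real"
  assumes "\<And>i. i \<in> I ==> continuous_map (path_topology d) euclideanreal (f i)"
  shows "closedin (path_topology d) {x \<in> cont_paths d. \<forall>i\<in>I. f i x <= b i}"
proof (cases "I = {}")
  case True
  then show ?thesis using closedin_topspace[of "path_topology d"] by (simp add: topspace_path_topology)
next
  case False
  have "closedin (path_topology d) (\<Inter>i\<in>I. {x \<in> topspace (path_topology d). f i x \<in> {..b i}})"
    using False by (intro closedin_INT closedin_continuous_map_preimage[OF assms]) auto
  moreover have "(\<Inter>i\<in>I. {x \<in> topspace (path_topology d). f i x \<in> {..b i}}) = {x \<in> cont_paths d. \<forall>i\<in>I. f i x <= b i}"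
    using False by (auto simp: topspace_path_topology)
  ultimately show ?thesis by simp
qed

text \<open>By Brownian scaling \<open>lincomb_path d a c (W w)\<close> has the same law for all
  \<open>c > 0\<close>, so exhausting the path space by increasing closed sets yields one
  \<open>n\<close> valid on every scale at once.\<close>

lemma BM_lincomb_event:
  assumes M: "prob_space M" and W: "standard_BM M d W" and a: "(\<Sum>k<d. (a k)\<^sup>2) = 1"
    and C: "\<And>n. closedin (path_topology 1) (C n)" "\<And>m n. m <= n ==> C m \<subseteq> C n"
    and un: "\<And>x. x \<in> cont_paths 1 ==> \<exists>n::nat. x \<in> C n" and e: "0 < e"
  shows "\<exists>n. \<forall>c>0. \<exists>A\<in>sets M. 1 - e <= measure M A \<and> (\<forall>w\<in>A. lincomb_path d a c (W w) \<in> C n)"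
proof -
  interpret prob_space M by (rule M)
  define V where "V c w = lincomb_path d a c (W w)" for c w
  have BM: "standard_BM M 1 (V c)" if "0 < c" for c unfolding V_def[abs_def] by (rule BM_lincomb[OF M W a that])
  note Vm = BM_measurable[OF BM]
  define \<nu> where "\<nu> = distr M (path_borel 1) (V 1)"
  interpret \<nu>: prob_space \<nu> unfolding \<nu>_def by (rule prob_space_distr[OF Vm]) simp
  have Cs: "C n \<in> sets (path_borel 1)" for n by (rule borel_of_closedin[OF C(1)])
  have "(\<Union>n. C n) = space \<nu>"
    using un closedin_subset[OF C(1)] by (fastforce simp: \<nu>_def topspace_path_topology)
  moreover have "(\<lambda>n. \<nu>.prob (C n)) \<longlonglongrightarrow> \<nu>.prob (\<Union>n. C n)"
    using Cs C(2) by (intro \<nu>.finite_Lim_measure_incseq) (auto simp: \<nu>_def incseq_def)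
  ultimately have "(\<lambda>n. \<nu>.prob (C n)) \<longlonglongrightarrow> 1" using \<nu>.prob_space by simp
  then have "\<forall>\<^sub>F n in sequentially. 1 - e < \<nu>.prob (C n)" using e by (intro order_tendstoD(1)) auto
  then obtain n where n: "1 - e < \<nu>.prob (C n)" by (auto simp: eventually_sequentially)
  have "\<exists>A\<in>sets M. 1 - e <= prob A \<and> (\<forall>w\<in>A. V c w \<in> C n)" if c: "0 < c" for c
  proof (intro bexI conjI ballI)
    show "V c -` C n \<inter> space M \<in> sets M" by (rule measurable_sets[OF Vm[OF c] Cs])
    have "\<nu> = distr M (path_borel 1) (V c)" unfolding \<nu>_def by (rule BM_law_unique[OF M BM M BM]) (use c in auto)
    then have "\<nu>.prob (C n) = prob (V c -` C n \<inter> space M)" by (simp only: measure_distr[OF Vm[OF c] Cs])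
    then show "1 - e <= prob (V c -` C n \<inter> space M)" using n by simp
  qed auto
  then show ?thesis unfolding V_def by blast
qed

lemma cont_path_bound:
  assumes x: "x \<in> cont_paths d" and i: "i < d"
  obtains b :: nat where "\<And>t. 0 <= t ==> t <= T ==> \<bar>x t $ i\<bar> <= real b"
proof -
  have "compact ((\<lambda>t. x t $ i) ` {0..T})"
    by (intro compact_continuous_image continuous_on_subset[OF cont_paths_continuous[OF x i]]) auto
  then obtain b where b: "\<forall>y\<in>(\<lambda>t. x t $ i) ` {0..T}. norm y <= b"
    using compact_imp_bounded bounded_iff by blast
  obtain n :: nat where "b <= real n" using real_arch_simple by blast
  then have "\<bar>x t $ i\<bar> <= real n" if t: "0 <= t" "t <= T" for t
  proof -
    have "x t $ i \<in> (\<lambda>t. x t $ i) ` {0..T}" using t by (intro imageI) simp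
    then have "norm (x t $ i) <= b" using b by blast
    then show ?thesis using \<open>b <= real n\<close> by simp
  qed
  then show ?thesis by (rule that)
qed

lemma BM_lincomb_bounded:
  assumes M: "prob_space M" and W: "standard_BM M d W" and a: "(\<Sum>k<d. (a k)\<^sup>2) = 1" and e: "0 < e"
  shows "\<exists>n::nat. \<forall>c>0. \<exists>A\<in>sets M. 1 - e <= measure M A \<and>
    (\<forall>w\<in>A. \<forall>t\<in>{0..T}. \<bar>lincomb_path d a c (W w) t $ 0\<bar> <= real n)"
proof -
  let ?C = "\<lambda>n::nat. {x \<in> cont_paths 1. \<forall>t\<in>{0..T}. norm (x t $ 0) <= real n}"
  have "\<exists>n. \<forall>c>0. \<exists>A\<in>sets M. 1 - e <= measure M A \<and> (\<forall>w\<in>A. lincomb_path d a c (W w) \<in> ?C n)"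
  proof (rule BM_lincomb_event[OF M W a _ _ _ e])
    show "closedin (path_topology 1) (?C n)" for n
      by (rule closedin_path_all_le) (auto intro!: continuous_map_norm continuous_map_path_eval simp del: One_nat_def real_norm_def)
    show "?C m \<subseteq> ?C n" if "m <= n" for m n
    proof (intro subsetI CollectI conjI ballI; elim CollectE conjE)
      fix x t assume "\<forall>t\<in>{0..T}. norm (x t $ 0) <= real m" "t \<in> {0..T}"
      then have "norm (x t $ 0) <= real m" by blast
      then show "norm (x t $ 0) <= real n" using that by simp
    qed
    fix x assume x: "x \<in> cont_paths 1"
    obtain n :: nat where "\<And>t. 0 <= t ==> t <= T ==> \<bar>x t $ 0\<bar> <= real n" using cont_path_bound[OF x zero_less_one_nat] by blast
    then show "\<exists>n. x \<in> ?C n" using x by (intro exI[of _ n]) (simp del: One_nat_def)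
  qed
  then show ?thesis by (simp del: One_nat_def) blast
qed

text \<open>Continuity at time 0, uniformly over the scales; it controls the initial time block
  removed by \<open>trunc_path\<close>.\<close>

lemma BM_lincomb_start:
  assumes M: "prob_space M" and W: "standard_BM M d W" and a: "(\<Sum>k<d. (a k)\<^sup>2) = 1" and e: "0 < e" and \<eta>: "0 < \<eta>"
  shows "\<exists>n::nat. \<forall>c>0. \<exists>A\<in>sets M. 1 - e <= measure M A \<and>
    (\<forall>w\<in>A. \<forall>t\<in>{0..1 / real (Suc n)}. \<bar>lincomb_path d a c (W w) t $ 0 - lincomb_path d a c (W w) 0 $ 0\<bar> <= \<eta>)"
proof -
  let ?C = "\<lambda>n::nat. {x \<in> cont_paths 1. \<forall>t\<in>{0..1 / real (Suc n)}. norm (x t $ 0 - x 0 $ 0) <= \<eta>}"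
  have "\<exists>n. \<forall>c>0. \<exists>A\<in>sets M. 1 - e <= measure M A \<and> (\<forall>w\<in>A. lincomb_path d a c (W w) \<in> ?C n)"
  proof (rule BM_lincomb_event[OF M W a _ _ _ e])
    show "closedin (path_topology 1) (?C n)" for n
      by (rule closedin_path_all_le) (auto intro!: continuous_map_norm continuous_map_diff continuous_map_path_eval simp del: One_nat_def real_norm_def)
    show "?C m \<subseteq> ?C n" if "m <= n" for m n
    proof -
      have "1 / real (Suc n) <= 1 / real (Suc m)" using that by (intro divide_left_mono) auto
      then have "{0..1 / real (Suc n)} \<subseteq> {0..1 / real (Suc m)}" by simp
      then show ?thesis by blast
    qed
    fix x assume x: "x \<in> cont_paths 1"
    have "continuous_on {0..} (\<lambda>t. x t $ 0)" by (rule cont_paths_continuous[OF x]) simp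
    then have "\<exists>\<delta>>0. \<forall>t\<in>{0..}. dist t 0 < \<delta> --> dist (x t $ 0) (x 0 $ 0) < \<eta>"
      using \<eta> unfolding continuous_on_iff by (elim ballE[of _ _ 0] allE[of _ \<eta>]) auto
    then obtain \<delta> where \<delta>: "0 < \<delta>" "\<And>t. 0 <= t ==> t < \<delta> ==> \<bar>x t $ 0 - x 0 $ 0\<bar> < \<eta>"
      by (auto simp: dist_real_def)
    obtain n where n: "inverse (real (Suc n)) < \<delta>" using reals_Archimedean[OF \<delta>(1)] by blast
    have "\<bar>x t $ 0 - x 0 $ 0\<bar> <= \<eta>" if "t \<in> {0..1 / real (Suc n)}" for t
      using \<delta>(2)[of t] that n by (simp add: inverse_eq_divide)
    then show "\<exists>n. x \<in> ?C n" using x by (intro exI[of _ n]) (simp del: One_nat_def)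
  qed
  then show ?thesis by (simp del: One_nat_def of_nat_Suc) blast
qed

text \<open>A one-sided modulus with arbitrarily small constant and some finite slope; the slope is
  what the drift will beat. Short increments are below \<open>D\<close> by uniform continuity, long
  ones are bounded and are absorbed by the slope.\<close>

lemma BM_lincomb_modulus:
  assumes M: "prob_space M" and W: "standard_BM M d W" and a: "(\<Sum>k<d. (a k)\<^sup>2) = 1" and e: "0 < e" and D: "0 < D"
  shows "\<exists>n::nat. \<forall>c>0. \<exists>A\<in>sets M. 1 - e <= measure M A \<and>
    (\<forall>w\<in>A. \<forall>s t. 0 <= s --> s <= t --> t <= T -->
       \<sigma> * (lincomb_path d a c (W w) t $ 0 - lincomb_path d a c (W w) s $ 0) <= D + real n * (t - s))"
proof -
  let ?I = "{(s, t). 0 <= s \<and> s <= t \<and> t <= T}"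
  let ?f = "\<lambda>p x. \<sigma> * (x (snd p) $ 0 - x (fst p) $ 0)"
  let ?C = "\<lambda>n::nat. {x \<in> cont_paths 1. \<forall>p\<in>?I. ?f p x <= D + real n * (snd p - fst p)}"
  have "\<exists>n. \<forall>c>0. \<exists>A\<in>sets M. 1 - e <= measure M A \<and> (\<forall>w\<in>A. lincomb_path d a c (W w) \<in> ?C n)"
  proof (rule BM_lincomb_event[OF M W a _ _ _ e])
    show "closedin (path_topology 1) (?C n)" for n
      by (rule closedin_path_all_le)
        (auto intro!: continuous_map_real_mult_left continuous_map_diff continuous_map_path_eval simp del: One_nat_def)
    show "?C m \<subseteq> ?C n" if "m <= n" for m n
    proof
      fix x assume x: "x \<in> ?C m"
      have "?f p x <= D + real n * (snd p - fst p)" if p: "p \<in> ?I" for p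
      proof -
        have "?f p x <= D + real m * (snd p - fst p)"
          by (rule bspec[OF conjunct2[OF CollectD[OF x]] p])
        moreover have "real m * (snd p - fst p) <= real n * (snd p - fst p)"
          using \<open>m <= n\<close> p by (intro mult_right_mono) auto
        ultimately show ?thesis by simp
      qed
      then show "x \<in> ?C n" by (intro CollectI conjI conjunct1[OF CollectD[OF x]] ballI)
    qed
    fix x assume x: "x \<in> cont_paths 1"
    obtain b :: nat where b: "\<And>t. 0 <= t ==> t <= T ==> \<bar>x t $ 0\<bar> <= real b" using cont_path_bound[OF x zero_less_one_nat] by blast
    have "uniformly_continuous_on {0..T} (\<lambda>t. \<sigma> * x t $ 0)"
      by (intro compact_uniformly_continuous continuous_on_mult continuous_on_const
        continuous_on_subset[OF cont_paths_continuous[OF x zero_less_one_nat]]) auto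
    then obtain \<delta> where \<delta>: "0 < \<delta>" "\<forall>s\<in>{0..T}. \<forall>t\<in>{0..T}. dist t s < \<delta> --> dist (\<sigma> * x t $ 0) (\<sigma> * x s $ 0) < D"
      using D unfolding uniformly_continuous_on_def by blast
    obtain n :: nat where n: "2 * \<bar>\<sigma>\<bar> * real b / \<delta> <= real n" using real_arch_simple by blast
    have "?f (s, t) x <= D + real n * (t - s)" if st: "0 <= s" "s <= t" "t <= T" for s t
    proof (cases "t - s < \<delta>")
      case True
      then have "dist (\<sigma> * x t $ 0) (\<sigma> * x s $ 0) < D" using \<delta>(2) st by (auto simp: dist_real_def)
      then have "\<sigma> * x t $ 0 - \<sigma> * x s $ 0 < D" by (simp add: dist_real_def)
      moreover have "0 <= real n * (t - s)" using st by simp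
      ultimately show ?thesis by (simp add: right_diff_distrib)
    next
      case False
      have "\<sigma> * (x t $ 0 - x s $ 0) <= \<bar>\<sigma>\<bar> * \<bar>x t $ 0 - x s $ 0\<bar>" by (simp flip: abs_mult)
      also have "... <= \<bar>\<sigma>\<bar> * (2 * real b)" using b[of s] b[of t] st by (intro mult_left_mono) auto
      also have "... <= real n * \<delta>" using n \<delta>(1) by (simp add: pos_divide_le_eq mult.commute mult.left_commute)
      also have "... <= real n * (t - s)" using False by (intro mult_left_mono) auto
      finally show ?thesis using D by simp
    qed
    then show "\<exists>n. x \<in> ?C n" using x by (intro exI[of _ n]) (auto simp del: One_nat_def)
  qed
  then obtain n where n: "\<forall>c>0. \<exists>A\<in>sets M. 1 - e <= measure M A \<and> (\<forall>w\<in>A. lincomb_path d a c (W w) \<in> ?C n)" by (rule exE)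
  show ?thesis
  proof (intro exI[of _ n] allI impI)
    fix c :: real assume "0 < c"
    with n obtain A where A: "A \<in> sets M" "1 - e <= measure M A" "\<And>w. w \<in> A ==> lincomb_path d a c (W w) \<in> ?C n"
      by (elim allE impE bexE conjE) auto
    have "\<sigma> * (lincomb_path d a c (W w) t $ 0 - lincomb_path d a c (W w) s $ 0) <= D + real n * (t - s)"
      if "w \<in> A" "0 <= s" "s <= t" "t <= T" for w s t
      using bspec[OF conjunct2[OF CollectD[OF A(3)[OF that(1)]]], of "(s, t)"] that by simp
    then show "\<exists>A\<in>sets M. 1 - e <= measure M A \<and> (\<forall>w\<in>A. \<forall>s t. 0 <= s --> s <= t --> t <= T -->
       \<sigma> * (lincomb_path d a c (W w) t $ 0 - lincomb_path d a c (W w) s $ 0) <= D + real n * (t - s))"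
      by (intro bexI[OF _ A(1)] conjI A(2)) simp
  qed
qed

subsection \<open>Asymptotic independence on separated time scales\<close>

definition join_path :: "nat => (nat => real => real vec) => real => real vec" where
  "join_path d f = (\<lambda>t\<in>{0..}. Matrix.vec d (\<lambda>j. f j t $ 0))"

lemma join_path_index: "0 <= t ==> j < d ==> join_path d f t $ j = f j t $ 0"
  by (simp add: join_path_def)

lemma join_path_cong: "(\<And>j. j < d ==> f j = g j) ==> join_path d f = join_path d g"
  unfolding join_path_def by (intro restrict_ext eq_vecI) auto

lemma join_path_cont_paths: "(\<And>j. j < d ==> f j \<in> cont_paths 1) ==> join_path d f \<in> cont_paths d"
  unfolding join_path_def by (rule cont_paths_vecI) (simp add: cont_paths_continuous[where d = 1])

lemma measurable_join_path:
  assumes "\<And>j. j < d ==> f j \<in> M \<rightarrow>\<^sub>M path_borel 1"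
  shows "(\<lambda>x. join_path d (\<lambda>j. f j x)) \<in> M \<rightarrow>\<^sub>M path_borel d"
proof (rule measurable_path_borelI)
  show "join_path d (\<lambda>j. f j x) \<in> cont_paths d" if "x \<in> space M" for x
    by (intro join_path_cont_paths measurable_path_borel_cont_paths[OF assms that])
  fix t i assume t: "0 <= (t::real)" and i: "i < d"
  have "(\<lambda>x. f i x t $ 0) \<in> borel_measurable M"
    by (rule measurable_compose[OF assms[OF i] measurable_path_eval[OF t]]) simp
  then show "(\<lambda>x. join_path d (\<lambda>j. f j x) t $ i) \<in> borel_measurable M"
    using t i by (simp add: join_path_index)
qed

text \<open>Both joined laws are images of the product of the same one-dimensional laws.\<close>

lemma join_path_law_eq:
  fixes X Y :: "nat => 'w => real => real vec"
  assumes M: "prob_space M" and d: "0 < d"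
    and X: "prob_space.indep_vars M (\<lambda>_. path_borel 1) X {..<d}"
    and Y: "prob_space.indep_vars M (\<lambda>_. path_borel 1) Y {..<d}"
    and law: "\<And>j. j < d ==> distr M (path_borel 1) (X j) = distr M (path_borel 1) (Y j)"
  shows "distr M (path_borel d) (\<lambda>x. join_path d (\<lambda>j. X j x)) = distr M (path_borel d) (\<lambda>x. join_path d (\<lambda>j. Y j x))"
proof -
  interpret prob_space M by (rule M)
  let ?P = "PiM {..<d} (\<lambda>_. path_borel 1)"
  have G: "(\<lambda>f. join_path d f) \<in> ?P \<rightarrow>\<^sub>M path_borel d"
    using measurable_join_path[of d "\<lambda>j f. f j" ?P] by (simp add: measurable_component_singleton del: One_nat_def)
  have "distr M (path_borel d) (\<lambda>x. join_path d (\<lambda>j. Z j x)) = distr (PiM {..<d} (\<lambda>j. distr M (path_borel 1) (Z j))) (path_borel d) (\<lambda>f. join_path d f)"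
    if Z: "indep_vars (\<lambda>_. path_borel 1) Z {..<d}" for Z :: "nat => 'w => real => real vec"
  proof -
    have Zm: "Z j \<in> M \<rightarrow>\<^sub>M path_borel 1" if "j < d" for j using Z that unfolding indep_vars_def by auto
    have Zr: "(\<lambda>x. \<lambda>j\<in>{..<d}. Z j x) \<in> M \<rightarrow>\<^sub>M ?P" using Zm by (intro measurable_restrict) simp
    have "PiM {..<d} (\<lambda>j. distr M (path_borel 1) (Z j)) = distr M ?P (\<lambda>x. \<lambda>j\<in>{..<d}. Z j x)"
    proof -
      have "{..<d} \<noteq> {}" using d by blast
      from indep_vars_iff_distr_eq_PiM'[OF this, of Z "\<lambda>_. path_borel 1"] Z Zm show ?thesis by simp
    qed
    then have "distr (PiM {..<d} (\<lambda>j. distr M (path_borel 1) (Z j))) (path_borel d) (\<lambda>f. join_path d f)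
        = distr M (path_borel d) ((\<lambda>f. join_path d f) \<circ> (\<lambda>x. \<lambda>j\<in>{..<d}. Z j x))"
      by (simp only: distr_distr[OF G Zr])
    also have "((\<lambda>f. join_path d f) \<circ> (\<lambda>x. \<lambda>j\<in>{..<d}. Z j x)) = (\<lambda>x. join_path d (\<lambda>j. Z j x))"
      by (auto simp: fun_eq_iff intro!: join_path_cong[THEN fun_cong])
    finally show ?thesis ..
  qed
  moreover have "PiM {..<d} (\<lambda>j. distr M (path_borel 1) (X j)) = PiM {..<d} (\<lambda>j. distr M (path_borel 1) (Y j))"
    by (intro PiM_cong refl law) simp
  ultimately show ?thesis using X Y by (simp only:)
qed

text \<open>Zero up to \<open>\<eta>\<close> and frozen after \<open>T\<close>: all values are
  increments of \<open>x\<close> within \<open>[\<eta>, T]\<close>.\<close>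

definition trunc_path :: "real => real => (real => real vec) => real => real vec" where
  "trunc_path T \<eta> x = (\<lambda>t\<in>{0..}. Matrix.vec 1 (\<lambda>_. x (min T (max t \<eta>)) $ 0 - x \<eta> $ 0))"

lemma trunc_path_index: "0 <= t ==> trunc_path T \<eta> x t $ 0 = x (min T (max t \<eta>)) $ 0 - x \<eta> $ 0"
  by (simp add: trunc_path_def)

lemma trunc_path_cont_paths:
  assumes x: "x \<in> cont_paths 1" and \<eta>: "0 <= \<eta>" "\<eta> <= T"
  shows "trunc_path T \<eta> x \<in> cont_paths 1"
  unfolding trunc_path_def
proof (rule cont_paths_vecI)
  have "continuous_on {0..} (\<lambda>t. x (min T (max t \<eta>)) $ 0)"
    using \<eta> by (intro continuous_on_compose2[OF cont_paths_continuous[OF x zero_less_one_nat]] continuous_intros) auto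
  then show "continuous_on {0..} (\<lambda>t. x (min T (max t \<eta>)) $ 0 - x \<eta> $ 0)" by (intro continuous_intros)
qed

lemma measurable_trunc_path:
  assumes \<eta>: "0 <= \<eta>" "\<eta> <= T"
  shows "trunc_path T \<eta> \<in> path_borel 1 \<rightarrow>\<^sub>M path_borel 1"
proof (rule measurable_path_borelI)
  show "trunc_path T \<eta> x \<in> cont_paths 1" if "x \<in> space (path_borel 1)" for x
    using trunc_path_cont_paths[OF _ \<eta>] that by (simp add: topspace_path_topology)
  fix t :: real and i :: nat assume t: "0 <= t" and i: "i < 1"
  have "(\<lambda>x. x (min T (max t \<eta>)) $ 0 - x \<eta> $ 0) \<in> borel_measurable (path_borel 1)"
    using \<eta> t by (intro borel_measurable_diff measurable_path_eval) auto
  then show "(\<lambda>x. trunc_path T \<eta> x t $ i) \<in> borel_measurable (path_borel 1)"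
    using t i by (simp add: trunc_path_index)
qed

text \<open>Before \<open>\<eta>\<close> the truncated path is 0, and afterwards it lacks only the
  constant \<open>x \<eta>\<close>; both errors are values of \<open>x\<close> on
  \<open>[0, \<eta>]\<close>.\<close>

lemma trunc_path_error:
  assumes \<eta>: "0 <= \<eta>" and s: "0 <= t" "t <= T" "\<eta> <= T"
    and b: "\<And>s. 0 <= s ==> s <= \<eta> ==> \<bar>x s $ 0\<bar> <= e"
  shows "\<bar>x t $ 0 - trunc_path T \<eta> x t $ 0\<bar> <= e"
  using b[of t] b[of \<eta>] s \<eta> by (cases "t <= \<eta>") (auto simp: trunc_path_index min_def max_def)

text \<open>In original time, the end of the block of the preceding coordinate;
  \<open>block_start\<close> is the same instant on the clock of coordinate
  \<open>j\<close>.\<close>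

definition scale_start :: "real => (nat => real) => nat => real" where
  "scale_start T g j = (if j = 0 then 0 else T / (g (j - 1))\<^sup>2)"

text \<open>After truncation, coordinate \<open>j\<close> only uses the increments of \<open>w\<close> between
  \<open>scale_start T g j\<close> and \<open>scale_start T g (Suc j)\<close>, and these time blocks are disjoint.\<close>

lemma trunc_lincomb_law:
  fixes a :: "nat => nat => real"
  assumes M: "prob_space M" and W: "standard_BM M d W" and d: "0 < d" and T: "0 <= T"
    and a: "\<And>j. j < d ==> (\<Sum>k<d. (a j k)\<^sup>2) = 1"
    and g: "\<And>j. j < d ==> 0 < g j" and anti: "\<And>i j. i < j ==> j < d ==> g j <= g i"
    and \<eta>: "\<And>j. j < d ==> \<eta> j = (g j)\<^sup>2 * scale_start T g j"
  shows "distr M (path_borel d) (\<lambda>x. join_path d (\<lambda>j. trunc_path T (\<eta> j) (lincomb_path d (a j) (g j) (W x)))) =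
    distr M (path_borel d) (\<lambda>x. join_path d (\<lambda>j. trunc_path T (\<eta> j) (coord_path j (W x))))"
proof -
  interpret prob_space M by (rule M)
  have s0: "0 <= scale_start T g j" for j using T by (simp add: scale_start_def)
  have \<eta>0: "0 <= \<eta> j" if "j < d" for j unfolding \<eta>[OF that] using s0 by simp
  have \<eta>T: "\<eta> j <= T" if j: "j < d" for j
  proof (cases "j = 0")
    case False
    have le: "(g j)\<^sup>2 <= (g (j - 1))\<^sup>2" using anti[of "j - 1" j] g[OF j] j False by (intro power_mono) auto
    have "(g j)\<^sup>2 * T <= (g (j - 1))\<^sup>2 * T" by (intro mult_right_mono le T)
    moreover have "0 < g (j - 1)" using j by (intro g) simp
    ultimately show ?thesis using False by (simp add: \<eta>[OF j] scale_start_def pos_divide_le_eq mult.commute)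
  qed (use T j \<eta> in "simp add: scale_start_def")
  note tm = measurable_trunc_path[OF \<eta>0 \<eta>T]
  let ?X = "\<lambda>j x. trunc_path T (\<eta> j) (lincomb_path d (a j) (g j) (W x))"
  let ?Y = "\<lambda>j x. trunc_path T (\<eta> j) (coord_path j (W x))"
  note WP = BM_cont_paths[OF W]
  define S where "S j = {(i :: nat, t). scale_start T g j < t \<and> t < T / (g j)\<^sup>2}" for j
  have disj: "disjoint_family_on S {..<d}"
  proof -
    have "S i \<inter> S j = {}" if ij: "i < j" "j < d" for i j
    proof -
      have "g (j - 1) <= g i" using ij by (cases "i = j - 1") (auto intro!: anti)
      moreover have g0: "0 < g (j - 1)" "0 < g i" using ij by (auto intro!: g)
      ultimately have "(g (j - 1))\<^sup>2 <= (g i)\<^sup>2" by (intro power_mono) auto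
      then have "T / (g i)\<^sup>2 <= T / (g (j - 1))\<^sup>2"
        using T g0 by (intro divide_left_mono) (auto intro!: mult_pos_pos zero_less_power g)
      then show ?thesis using ij by (auto simp: S_def scale_start_def)
    qed
    then show ?thesis unfolding disjoint_family_on_def by (metis Int_commute lessThan_iff linorder_neqE_nat)
  qed
  show ?thesis
  proof (rule join_path_law_eq[OF M d])
    show "indep_vars (\<lambda>_. path_borel 1) ?X {..<d}"
    proof (rule indep_vars_incr_algebra[OF M W disj])
      fix j assume "j \<in> {..<d}"
      then have j: "j < d" by simp
      let ?A = "incr_algebra (space M) W d (S j)"
      show "?X j \<in> ?A \<rightarrow>\<^sub>M path_borel 1"
      proof (rule measurable_path_borelI)
        show "?X j x \<in> cont_paths 1" if "x \<in> space ?A" for x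
          using that by (intro trunc_path_cont_paths lincomb_path_cont_paths WP \<eta>0 \<eta>T j) simp
        fix t :: real and i :: nat assume t: "0 <= t" and i: "i < 1"
        define u where "u = min T (max t (\<eta> j))"
        have u: "\<eta> j <= u" "u <= T" "0 <= u" using \<eta>T[OF j] \<eta>0[OF j] T t by (auto simp: u_def)
        have start: "\<eta> j / (g j)\<^sup>2 = scale_start T g j" using g[OF j] by (simp add: \<eta>[OF j])
        have "(\<lambda>x. W x (u / (g j)\<^sup>2) $ k - W x (\<eta> j / (g j)\<^sup>2) $ k) \<in> borel_measurable ?A" if k: "k < d" for k
        proof (rule measurable_increment[OF WP _ _ k])
          show "0 <= \<eta> j / (g j)\<^sup>2" using \<eta>0[OF j] by simp
          show "\<eta> j / (g j)\<^sup>2 <= u / (g j)\<^sup>2" using u(1) by (rule divide_right_mono) simp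
          have "u / (g j)\<^sup>2 <= T / (g j)\<^sup>2" using u(2) by (rule divide_right_mono) simp
          then show "(k, s) \<in> S j" if "\<eta> j / (g j)\<^sup>2 < s" "s < u / (g j)\<^sup>2" for s
            using that by (simp add: S_def start)
        qed
        then have "(\<lambda>x. \<Sum>k<d. a j k * (g j * (W x (u / (g j)\<^sup>2) $ k - W x (\<eta> j / (g j)\<^sup>2) $ k))) \<in> borel_measurable ?A"
          by (intro borel_measurable_sum borel_measurable_times borel_measurable_const) simp
        moreover have "?X j x t $ i = (\<Sum>k<d. a j k * (g j * (W x (u / (g j)\<^sup>2) $ k - W x (\<eta> j / (g j)\<^sup>2) $ k)))" for x
          using t i u \<eta>0[OF j]
          by (simp add: trunc_path_index lincomb_path_def right_diff_distrib sum_subtractf flip: u_def)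
        ultimately show "(\<lambda>x. ?X j x t $ i) \<in> borel_measurable ?A" by simp
      qed
    qed
    show "indep_vars (\<lambda>_. path_borel 1) ?Y {..<d}"
      using indep_vars_compose2[OF BM_indep_coord[OF M W], of "\<lambda>j. trunc_path T (\<eta> j)" "\<lambda>_. path_borel 1"] tm by auto
    fix j assume j: "j < d"
    note L = BM_lincomb[OF M W a[OF j] g[OF j]] and C = BM_coord[OF M W j]
    have "distr M (path_borel 1) (?X j) = distr (distr M (path_borel 1) (\<lambda>x. lincomb_path d (a j) (g j) (W x))) (path_borel 1) (trunc_path T (\<eta> j))"
      by (subst distr_distr[OF tm[OF j j] BM_measurable[OF L]]) (simp add: comp_def)
    also have "... = distr (distr M (path_borel 1) (\<lambda>x. coord_path j (W x))) (path_borel 1) (trunc_path T (\<eta> j))"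
      by (simp only: BM_law_unique[OF M L M C])
    also have "... = distr M (path_borel 1) (?Y j)"
      by (subst distr_distr[OF tm[OF j j] BM_measurable[OF C]]) (simp add: comp_def)
    finally show "distr M (path_borel 1) (?X j) = distr M (path_borel 1) (?Y j)" .
  qed
qed

subsection \<open>The multiscale family\<close>

locale srbm_family = reflection d R v + prob_space M
  for d R v and M :: "'w measure" +
  fixes L :: "real mat" and \<gamma> :: "nat => real => real" and W :: "'w => real => real vec"
    and Z0 :: "real => 'w => real vec" and N :: "'v measure" and \<xi> :: "'v => real vec"
  assumes d: "0 < d" and W: "standard_BM M d W" and N: "prob_space N"
    and gamma_pos: "\<And>j r. j < d ==> r \<in> {0<..<1} ==> 0 < \<gamma> j r"
    and gamma_sep: "\<And>i j. i < j ==> j < d ==> ((\<lambda>r. \<gamma> j r / \<gamma> i r) \<longlongrightarrow> 0) (at_right 0)"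
    and L_tri: "\<And>i k. i < k ==> k < d ==> L $$ (i, k) = 0" and L_diag: "\<And>j. j < d ==> 0 < L $$ (j, j)"
    and Z0_nonneg: "\<And>r x j. r \<in> {0<..<1} ==> x \<in> space M ==> j < d ==> 0 <= Z0 r x $ j"
    and Z0_indep: "\<And>r. r \<in> {0<..<1} ==> indep_elements M (vec_borel d) (Z0 r) (path_borel d) W"
    and init_conv: "converges_weakly (vec_topology d)
                      M (\<lambda>r x. Matrix.vec d (\<lambda>j. \<gamma> j r * Z0 r x $ j)) N \<xi> (at_right 0)"
    and init_large: "\<And>j C. 1 <= j ==> j < d ==>
              ((\<lambda>r. prob {x \<in> space M. C < \<gamma> (j - 1) r * Z0 r x $ j}) \<longlongrightarrow> 1) (at_right 0)"
begin

abbreviation "F \<equiv> at_right (0::real)"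

lemma eventually_unit: "\<forall>\<^sub>F r in F. r \<in> {0<..<1}"
  by (rule eventually_at_right_real) simp

lemma W_cont_paths: "x \<in> space M ==> W x \<in> cont_paths d"
  by (rule BM_cont_paths[OF W])

definition X :: "real => 'w => real => real vec" where
  "X r x = (\<lambda>t\<in>{0..}. Matrix.vec d (\<lambda>i. Z0 r x $ i - t * (\<Sum>k<d. R $$ (i, k) * \<gamma> k r) + (\<Sum>k<d. L $$ (i, k) * W x t $ k)))"

definition Z :: "real => 'w => real => real vec" where
  "Z r x = refl_path (X r x)"

text \<open>Because the drift vector is \<open>- R \<delta>\<close>, elimination acts on it as on
  the regulators: only the scales \<open>\<gamma> k\<close> with \<open>k >= m\<close>
  survive.\<close>

definition drift :: "nat => nat => real => real" where
  "drift m l r = (\<Sum>k\<in>{m..<d}. schur m l k * \<gamma> k r)"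

definition noise :: "nat => nat => nat => real" where
  "noise m l k = reduced m l (\<lambda>i. L $$ (i, k))"

lemma X_cont_paths: "x \<in> space M ==> X r x \<in> cont_paths d"
  unfolding X_def
  by (intro cont_paths_vecI continuous_intros cont_paths_continuous[OF W_cont_paths]) auto

lemma X_index: "0 <= t ==> i < d ==>
    X r x t $ i = Z0 r x $ i - t * (\<Sum>k<d. R $$ (i, k) * \<gamma> k r) + (\<Sum>k<d. L $$ (i, k) * W x t $ k)"
  by (simp add: X_def)

lemma reduced_sum: "reduced m l (\<lambda>i. \<Sum>k<n. f i k * y k) = (\<Sum>k<n. reduced m l (\<lambda>i. f i k) * y k)"
  for n :: nat
proof -
  have "(\<Sum>i<m. elim m l i * (\<Sum>k<n. f i k * y k)) = (\<Sum>k<n. (\<Sum>i<m. elim m l i * f i k) * y k)"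
    unfolding sum_distrib_left sum_distrib_right by (subst sum.swap) (simp add: mult.assoc)
  then show ?thesis by (simp add: reduced_def distrib_right sum.distrib)
qed

lemma reduced_scale: "reduced m l (\<lambda>i. c * x i) = c * reduced m l x"
  by (simp add: reduced_def sum_distrib_left distrib_left mult.left_commute)

lemma reduced_X:
  assumes m: "m <= l" and l: "l < d" and t: "0 <= t"
  shows "reduced m l (\<lambda>i. X r x t $ i) =
    reduced m l (\<lambda>i. Z0 r x $ i) - t * drift m l r + (\<Sum>k<d. noise m l k * W x t $ k)"
proof -
  have "reduced m l (\<lambda>i. X r x t $ i) = reduced m l (\<lambda>i. Z0 r x $ i + (- t) * (\<Sum>k<d. R $$ (i, k) * \<gamma> k r) + (\<Sum>k<d. L $$ (i, k) * W x t $ k))"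
    using l by (intro reduced_cong m) (simp add: X_index[OF t])
  also have "... = reduced m l (\<lambda>i. Z0 r x $ i) + (- t) * reduced m l (\<lambda>i. \<Sum>k<d. R $$ (i, k) * \<gamma> k r) + (\<Sum>k<d. noise m l k * W x t $ k)"
    by (simp only: reduced_add reduced_scale reduced_sum noise_def)
  finally show ?thesis using m l by (simp add: reduced_R drift_def)
qed

lemma X_0: "x \<in> space M ==> i < d ==> X r x 0 $ i = Z0 r x $ i"
  using BM_0[OF W, of x] by (simp add: X_index)

lemma Z_0:
  assumes r: "r \<in> {0<..<1}" and x: "x \<in> space M" and i: "i < d"
  shows "Z r x 0 $ i = Z0 r x $ i"
proof -
  have "reg_path (X r x) 0 $ k = 0" if "k < d" for k
    using X_0[OF x] Z0_nonneg[OF r x] by (intro reg_path_0[OF X_cont_paths[OF x] _ that]) simp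
  then show ?thesis using X_0[OF x i] i by (simp add: Z_def refl_path_index)
qed

lemma Z_nonneg: "x \<in> space M ==> 0 <= t ==> i < d ==> 0 <= Z r x t $ i"
  unfolding Z_def by (rule refl_path_nonneg[OF X_cont_paths])

definition \<sigma> :: "nat => real" where
  "\<sigma> j = sqrt (\<Sum>k<d. (noise j j k)\<^sup>2)"

definition dir :: "nat => nat => real" where
  "dir j k = noise j j k / \<sigma> j"

text \<open>Equals \<open>- (1 - w_coeff R j j)\<close> by \<open>w_coeff_diag\<close>.\<close>

definition \<theta> :: "nat => real" where
  "\<theta> j = - schur j j j"

abbreviation "sZ j r x t k \<equiv> \<gamma> j r * Z r x (t / (\<gamma> j r)\<^sup>2) $ k"

abbreviation "noise_incr i j r x s t \<equiv>
  \<sigma> i * (lincomb_path d (dir i) (\<gamma> j r) (W x) t $ 0 - lincomb_path d (dir i) (\<gamma> j r) (W x) s $ 0)"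

abbreviation "flow \<equiv> limit_path d \<theta> \<sigma>"

text \<open>As \<open>L\<close> is lower triangular, the rows before \<open>j\<close> do not reach
  column \<open>j\<close>, so \<open>noise j j j\<close> is the positive diagonal entry of
  \<open>L\<close>.\<close>

lemma sigma_pos:
  assumes j: "j < d"
  shows "0 < \<sigma> j"
proof -
  have "noise j j j = L $$ (j, j)" using j by (simp add: noise_def reduced_def L_tri)
  then have "0 < (noise j j j)\<^sup>2" using L_diag[OF j] by simp
  also have "... <= (\<Sum>k<d. (noise j j k)\<^sup>2)" using j by (intro member_le_sum) auto
  finally show ?thesis by (simp add: \<sigma>_def)
qed

lemma dir_unit:
  assumes j: "j < d"
  shows "(\<Sum>k<d. (dir j k)\<^sup>2) = 1"
proof -
  have "(\<sigma> j)\<^sup>2 = (\<Sum>k<d. (noise j j k)\<^sup>2)" unfolding \<sigma>_def by (simp add: sum_nonneg)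
  moreover have "(\<Sum>k<d. (dir j k)\<^sup>2) = (\<Sum>k<d. (noise j j k)\<^sup>2) / (\<sigma> j)\<^sup>2"
    by (simp only: dir_def power_divide sum_divide_distrib)
  ultimately have "(\<Sum>k<d. (dir j k)\<^sup>2) = (\<sigma> j)\<^sup>2 / (\<sigma> j)\<^sup>2" by (simp only:)
  then show ?thesis using sigma_pos[OF j] by simp
qed

lemma sigma_lincomb:
  assumes j: "j < d" and t: "0 <= t"
  shows "\<sigma> j * lincomb_path d (dir j) c x t $ 0 = c * (\<Sum>k<d. noise j j k * x (t / c\<^sup>2) $ k)"
  using t sigma_pos[OF j]
  by (simp add: lincomb_path_def dir_def sum_distrib_left mult.left_commute)

section \<open>Scale separation and size of the initial states\<close>

lemma gamma_ratio:
  assumes ij: "i < j" "j < d" and c: "0 < c"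
  shows "\<forall>\<^sub>F r in F. \<gamma> j r <= c * \<gamma> i r"
  using order_tendstoD(2)[OF gamma_sep[OF ij] c] eventually_unit
proof eventually_elim
  case (elim r)
  then show ?case using gamma_pos[of i r] ij by (simp add: pos_divide_less_eq)
qed

lemma tail_small:
  fixes b :: "nat => real"
  assumes i: "i < d" and c: "0 < c"
  shows "\<forall>\<^sub>F r in F. \<bar>\<Sum>k\<in>{Suc i..<d}. b k * \<gamma> k r\<bar> <= c * \<gamma> i r"
proof -
  define S where "S = (\<Sum>k\<in>{Suc i..<d}. \<bar>b k\<bar>)"
  have S: "0 <= S" by (simp add: S_def sum_nonneg)
  define c' where "c' = c / (S + 1)"
  have c': "0 < c'" "S * c' <= c" using c S by (auto simp: c'_def pos_divide_le_eq divide_le_eq distrib_left)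
  have "\<forall>\<^sub>F r in F. \<forall>k\<in>{Suc i..<d}. \<gamma> k r <= c' * \<gamma> i r"
    by (intro eventually_ball_finite ballI gamma_ratio c') auto
  then show ?thesis using eventually_unit
  proof eventually_elim
    case (elim r)
    have "\<bar>\<Sum>k\<in>{Suc i..<d}. b k * \<gamma> k r\<bar> <= (\<Sum>k\<in>{Suc i..<d}. \<bar>b k\<bar> * (c' * \<gamma> i r))"
    proof (rule order_trans[OF sum_abs sum_mono])
      fix k assume k: "k \<in> {Suc i..<d}"
      then show "\<bar>b k * \<gamma> k r\<bar> <= \<bar>b k\<bar> * (c' * \<gamma> i r)"
        using elim gamma_pos[of k r] by (simp add: abs_mult mult_left_mono)
    qed
    also have "... = (S * c') * \<gamma> i r" by (simp add: S_def sum_distrib_right mult.assoc)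
    also have "... <= c * \<gamma> i r" using c'(2) gamma_pos[OF i elim(2)] by (intro mult_right_mono) auto
    finally show ?case .
  qed
qed

text \<open>The leading term is \<open>schur i i i * \<gamma> i r\<close>; half of it absorbs the
  later scales, which are negligible against \<open>\<gamma> i r\<close>.\<close>

lemma drift_lower:
  assumes i: "i < d"
  shows "\<forall>\<^sub>F r in F. schur i i i / 2 * \<gamma> i r <= drift i i r"
proof -
  have "0 < schur i i i / 2" using schur_diag_pos[OF i] by simp
  from tail_small[OF i this, of "schur i i"] show ?thesis
  proof eventually_elim
    case (elim r)
    have "drift i i r = schur i i i * \<gamma> i r + (\<Sum>k\<in>{Suc i..<d}. schur i i k * \<gamma> k r)"
      unfolding drift_def using i by (rule sum.atLeast_Suc_lessThan)
    moreover have "schur i i i / 2 * \<gamma> i r = schur i i i * \<gamma> i r / 2" by simp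
    ultimately show ?case using abs_le_D2[OF elim] by linarith
  qed
qed

text \<open>Weak convergence implies tightness: the continuous ramps \<open>f n\<close> dominate the
  indicator of exceeding \<open>n + 1\<close>, and their expectations under the limit law tend to
  0.\<close>

lemma init_bounded:
  assumes i: "i < d"
  shows "bounded_wp M F (\<lambda>C r x. \<gamma> i r * Z0 r x $ i <= C)"
  unfolding bounded_wp_def
proof (intro allI impI)
  fix eps :: real assume eps: "0 < eps"
  interpret N: prob_space N by (rule N)
  let ?z = "\<lambda>r x. Matrix.vec d (\<lambda>j. \<gamma> j r * Z0 r x $ j)"
  define f where "f n u = max 0 (min 1 (u $ i - real n))" for n :: nat and u :: "real vec"
  have f01: "0 <= f n u" "f n u <= 1" for n u by (auto simp: f_def)
  have fc: "continuous_map (vec_topology d) euclideanreal (f n)" for n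
  proof (rule continuous_map_vec_lipschitz[where C = 1])
    fix u v :: "real vec" and e :: real assume "\<And>i. i < d ==> \<bar>u $ i - v $ i\<bar> <= e"
    from this[OF i] show "\<bar>f n u - f n v\<bar> <= 1 * e" by (auto simp: f_def)
  qed
  have fm: "f n \<in> borel_measurable (vec_borel d)" for n by (rule borel_measurable_borel_of[OF fc])
  have xm: "\<xi> \<in> N \<rightarrow>\<^sub>M vec_borel d" and zm: "\<forall>\<^sub>F r in F. ?z r \<in> M \<rightarrow>\<^sub>M vec_borel d"
    and conv: "((\<lambda>r. \<integral>x. f n (?z r x) \<partial>M) \<longlongrightarrow> (\<integral>x. f n (\<xi> x) \<partial>N)) F" for n
    using init_conv fc[of n] f01[of n] unfolding converges_weakly_def by (auto intro!: exI[of _ 1] simp: abs_le_iff order_trans[OF _ f01(1)])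
  have "(\<lambda>n. \<integral>x. f n (\<xi> x) \<partial>N) \<longlonglongrightarrow> (\<integral>x. 0 \<partial>N)"
  proof (rule integral_dominated_convergence[where w = "\<lambda>_. 1"])
    show "(\<lambda>x. f n (\<xi> x)) \<in> borel_measurable N" for n by (rule measurable_compose[OF xm fm])
    show "AE x in N. (\<lambda>n. f n (\<xi> x)) \<longlonglongrightarrow> 0"
    proof (rule AE_I2)
      fix x
      obtain n0 :: nat where "\<xi> x $ i <= real n0" using real_arch_simple by blast
      then have "f n (\<xi> x) = 0" if "n0 <= n" for n using that by (simp add: f_def)
      then have "\<forall>\<^sub>F n in sequentially. f n (\<xi> x) = 0" by (auto simp: eventually_sequentially)
      then show "(\<lambda>n. f n (\<xi> x)) \<longlonglongrightarrow> 0" by (rule tendsto_eventually)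
    qed
    show "AE x in N. norm (f n (\<xi> x)) <= 1" for n using f01 by (intro AE_I2) (simp add: abs_le_iff order_trans[OF _ f01(1)])
  qed auto
  then have "\<forall>\<^sub>F n in sequentially. (\<integral>x. f n (\<xi> x) \<partial>N) < eps" using eps by (intro order_tendstoD(2)) auto
  then obtain n where "(\<integral>x. f n (\<xi> x) \<partial>N) < eps" by (auto simp: eventually_sequentially)
  then have "\<forall>\<^sub>F r in F. (\<integral>x. f n (?z r x) \<partial>M) < eps" by (rule order_tendstoD(2)[OF conv])
  then have "holds_wp M F eps (\<lambda>r x. \<gamma> i r * Z0 r x $ i <= real n + 1)"
    unfolding holds_wp_def using zm
  proof eventually_elim
    case (elim r)
    have comp: "?z r x $ i = \<gamma> i r * Z0 r x $ i" for x using i by simp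
    have m: "(\<lambda>x. \<gamma> i r * Z0 r x $ i) \<in> borel_measurable M"
      using measurable_compose[OF elim(2) measurable_vec_component[OF i]] by (simp only: comp)
    let ?A = "{x \<in> space M. \<gamma> i r * Z0 r x $ i <= real n + 1}"
    have A: "?A \<in> sets M" using m by measurable
    have "prob (space M - ?A) = (\<integral>x. indicat_real (space M - ?A) x \<partial>M)" using A by simp
    also have "... <= (\<integral>x. f n (?z r x) \<partial>M)"
    proof (rule integral_mono)
      show "integrable M (indicat_real (space M - ?A))" using A by (simp add: integrable_indicator_iff emeasure_eq_measure)
      show "integrable M (\<lambda>x. f n (?z r x))"
        using f01 by (intro integrable_const_bound[where B = 1] AE_I2 measurable_compose[OF elim(2) fm]) (simp add: abs_le_iff order_trans[OF _ f01(1)])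
      show "indicat_real (space M - ?A) x <= f n (?z r x)" for x
        using f01(1)[of n "?z r x"] i by (auto simp: f_def indicator_def)
    qed
    finally have "1 - eps <= prob ?A" using elim(1) prob_compl[OF A] by simp
    then show ?case using A by blast
  qed
  then show "\<exists>C. holds_wp M F eps (\<lambda>r x. \<gamma> i r * Z0 r x $ i <= C)" by blast
qed

text \<open>Tightness of coordinate \<open>i\<close> on its own scale, multiplied by the vanishing
  ratio of the scales.\<close>

lemma init_small:
  assumes ij: "i < j" "j < d" and \<eta>: "0 < \<eta>"
  shows "whp M F (\<lambda>r x. \<gamma> j r * Z0 r x $ i <= \<eta>)"
  unfolding whp_def
proof (intro allI impI)
  fix e :: real assume "0 < e"
  then obtain C where C: "holds_wp M F e (\<lambda>r x. \<gamma> i r * Z0 r x $ i <= C)"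
    using init_bounded[of i] ij unfolding bounded_wp_def by auto
  define c where "c = \<eta> / (\<bar>C\<bar> + 1)"
  have c: "0 < c" "c * \<bar>C\<bar> <= \<eta>" using \<eta> by (auto simp: c_def divide_le_eq distrib_left mult.commute)
  show "holds_wp M F e (\<lambda>r x. \<gamma> j r * Z0 r x $ i <= \<eta>)"
  proof (rule holds_wp_mono[OF C])
    show "\<forall>\<^sub>F r in F. \<forall>x\<in>space M. \<gamma> i r * Z0 r x $ i <= C --> \<gamma> j r * Z0 r x $ i <= \<eta>"
      using gamma_ratio[OF ij c(1)] eventually_unit
    proof eventually_elim
      case (elim r)
      show ?case
      proof (intro ballI impI)
        fix x assume x: "x \<in> space M" and le: "\<gamma> i r * Z0 r x $ i <= C"
        have "0 <= Z0 r x $ i" using Z0_nonneg[OF elim(2) x] ij by simp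
        then have "\<gamma> j r * Z0 r x $ i <= (c * \<gamma> i r) * Z0 r x $ i" by (intro mult_right_mono elim(1))
        also have "... <= c * C" using le c(1) by (simp add: mult.assoc)
        also have "... <= c * \<bar>C\<bar>" using c(1) by (intro mult_left_mono) auto
        finally show "\<gamma> j r * Z0 r x $ i <= \<eta>" using c(2) by simp
      qed
    qed
  qed
qed

text \<open>The hypothesis speaks of the scale just before \<open>l\<close>; for
  \<open>j <= l - 1\<close> the scale \<open>\<gamma> j\<close> is eventually at least as large,
  which can only enlarge the product since the state is nonnegative.\<close>

lemma init_big:
  assumes jl: "j < l" "l < d"
  shows "whp M F (\<lambda>r x. C <= \<gamma> j r * Z0 r x $ l)"
  unfolding whp_def
proof (intro allI impI)
  fix e :: real assume e: "0 < e"
  have "\<forall>\<^sub>F r in F. \<gamma> (l - 1) r <= 1 * \<gamma> j r"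
  proof (cases "j = l - 1")
    case False
    then show ?thesis using jl by (intro gamma_ratio) auto
  qed simp
  moreover have "\<forall>\<^sub>F r in F. 1 - e < prob {x \<in> space M. C < \<gamma> (l - 1) r * Z0 r x $ l}"
    using e jl by (intro order_tendstoD(1)[OF init_large]) auto
  ultimately show "holds_wp M F e (\<lambda>r x. C <= \<gamma> j r * Z0 r x $ l)"
    unfolding holds_wp_def using eventually_unit
  proof eventually_elim
    case (elim r)
    let ?A = "{x \<in> space M. C < \<gamma> (l - 1) r * Z0 r x $ l}"
    have "(\<lambda>x. Z0 r x $ l) \<in> borel_measurable M"
      by (rule measurable_compose[OF indep_elements_measurable(1)[OF Z0_indep[OF elim(3)]] measurable_vec_component[OF jl(2)]])
    then have "?A \<in> sets M" by measurable
    moreover have "C <= \<gamma> j r * Z0 r x $ l" if "x \<in> ?A" for x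
    proof -
      have "\<gamma> (l - 1) r * Z0 r x $ l <= \<gamma> j r * Z0 r x $ l"
        using elim(1) that Z0_nonneg[OF elim(3)] jl by (intro mult_right_mono) auto
      then show ?thesis using that by simp
    qed
    ultimately show ?case using elim(2) by (intro bexI[of _ ?A]) auto
  qed
qed

end

section \<open>Size of the coordinates on each time scale\<close>

context srbm_family
begin

text \<open>\<open>refl_path_upper_bound\<close> on the clock of scale \<open>g\<close>. There the
  reduced drift has rate \<open>drift i i r / g\<close>, so \<open>n * g <= drift i i r\<close> lets
  it cancel the slope \<open>n\<close> of the noise modulus.\<close>

lemma scaled_upper_bound:
  assumes r: "r \<in> {0<..<1}" and x: "x \<in> space M" and i: "i < d" and g: "0 < g" and D: "0 <= D"
    and drift: "n * g <= drift i i r"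
    and modulus: "\<And>s t. 0 <= s ==> s <= t ==> t <= T ==>
      \<sigma> i * (lincomb_path d (dir i) g (W x) t $ 0 - lincomb_path d (dir i) g (W x) s $ 0) <= D + n * (t - s)"
    and E: "\<And>k t. k < i ==> 0 <= t ==> t <= T ==> g * Z r x (t / g\<^sup>2) $ k <= E"
    and t: "0 <= t" "t <= T"
  shows "g * Z r x (t / g\<^sup>2) $ i <= (\<Sum>k<i. elim i i k) * E + g * Z0 r x $ i + D"
proof -
  have g2: "0 < g\<^sup>2" using g by simp
  have unscale: "0 <= s * g\<^sup>2" "s * g\<^sup>2 <= T" "s * g\<^sup>2 / g\<^sup>2 = s" if "0 <= s" "s <= T / g\<^sup>2" for s
    using that g2 g by (auto simp: pos_le_divide_eq)
  have "refl_path (X r x) (t / g\<^sup>2) $ i <= (\<Sum>k<i. elim i i k) * (E / g) + refl_path (X r x) 0 $ i + D / g"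
  proof (rule refl_path_upper_bound[OF X_cont_paths[OF x] i])
    show "0 <= t / g\<^sup>2" "t / g\<^sup>2 <= T / g\<^sup>2" using t g by (auto intro: divide_right_mono)
    show "0 <= D / g" using D g by simp
    show "refl_path (X r x) s $ k <= E / g" if "k < i" "0 <= s" "s <= T / g\<^sup>2" for k s
      using E[OF that(1) unscale(1,2)[OF that(2,3)]] unscale(3)[OF that(2,3)] g
      by (simp add: Z_def pos_le_divide_eq mult.commute)
    fix s u assume su: "0 <= s" "s <= u" "u <= T / g\<^sup>2"
    have sT: "s <= T / g\<^sup>2" and u0: "0 <= u" using su by auto
    note s' = unscale[OF su(1) sT] and u' = unscale[OF u0 su(3)]
    let ?N = "\<lambda>s. \<Sum>k<d. noise i i k * W x s $ k"
    have B: "\<sigma> i * lincomb_path d (dir i) g (W x) (s * g\<^sup>2) $ 0 = g * ?N s" "\<sigma> i * lincomb_path d (dir i) g (W x) (u * g\<^sup>2) $ 0 = g * ?N u"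
      using sigma_lincomb[OF i s'(1), of g "W x"] sigma_lincomb[OF i u'(1), of g "W x"] s'(3) u'(3) by simp_all
    have "s * g\<^sup>2 <= u * g\<^sup>2" using su(2) by (rule mult_right_mono) simp
    from modulus[OF s'(1) this u'(2)] have "g * ?N u - g * ?N s <= D + n * (u * g\<^sup>2 - s * g\<^sup>2)"
      using B by (simp add: right_diff_distrib)
    also have "n * (u * g\<^sup>2 - s * g\<^sup>2) = g * ((u - s) * (n * g))" by (simp add: power2_eq_square algebra_simps)
    also have "... <= g * ((u - s) * drift i i r)" using drift su g by (intro mult_left_mono) auto
    finally have "g * (?N u - ?N s - (u - s) * drift i i r) <= D" by (simp add: right_diff_distrib)
    then have "?N u - ?N s - (u - s) * drift i i r <= D / g" using g by (simp add: pos_le_divide_eq mult.commute)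
    then show "reduced i i (\<lambda>k. X r x u $ k) - reduced i i (\<lambda>k. X r x s $ k) <= D / g"
      using reduced_X[OF order.refl i su(1), of r x] reduced_X[OF order.refl i u0, of r x] by (simp add: left_diff_distrib)
  qed
  then have "g * Z r x (t / g\<^sup>2) $ i <= g * ((\<Sum>k<i. elim i i k) * (E / g) + Z0 r x $ i + D / g)"
    using g Z_0[OF r x i] by (simp add: Z_def)
  then show ?thesis using g by (simp add: distrib_left)
qed

lemma BM_modulus_wp:
  assumes ij: "i < d" "j < d" and e: "0 < e" and D: "0 < D"
  shows "\<exists>n::nat. holds_wp M F e (\<lambda>r x. \<forall>s t. 0 <= s --> s <= t --> t <= T -->
    noise_incr i j r x s t <= D + real n * (t - s))"
proof -
  obtain n :: nat where n: "\<forall>c>0. \<exists>A\<in>sets M. 1 - e <= measure M A \<and> (\<forall>x\<in>A. \<forall>s t. 0 <= s --> s <= t --> t <= T -->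
    \<sigma> i * (lincomb_path d (dir i) c (W x) t $ 0 - lincomb_path d (dir i) c (W x) s $ 0) <= D + real n * (t - s))"
    using BM_lincomb_modulus[OF prob_space_axioms W dir_unit[OF ij(1)] e D, of T "\<sigma> i"] by (rule exE)
  show ?thesis
    unfolding holds_wp_def
    by (rule exI[of _ n], rule eventually_mono[OF eventually_unit], rule n[rule_format], rule gamma_pos[OF ij(2)])
qed

definition lower_small :: "real => nat => nat => bool" where
  "lower_small T j i \<longleftrightarrow> (\<forall>\<eta>>0. whp M F (\<lambda>r x. \<forall>t\<in>{0..T}. sZ j r x t i <= \<eta>))"

text \<open>Earlier coordinates, initial state and noise modulus are each allowed
  \<open>\<eta> / 3\<close> and an exceptional probability of \<open>e / 3\<close>; the large drift
  removes the slope of the modulus.\<close>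

lemma lower_small_step:
  assumes T: "0 <= T" and ij: "i < j" "j < d" and IH: "\<And>k. k < i ==> lower_small T j k"
  shows "lower_small T j i"
  unfolding lower_small_def whp_def
proof (intro allI impI)
  fix \<eta> e :: real assume \<eta>: "0 < \<eta>" and e: "0 < e"
  have i: "i < d" using ij by simp
  define S where "S = (\<Sum>k<i. elim i i k)"
  have S: "0 <= S" unfolding S_def using i by (intro sum_nonneg elim_nonneg) auto
  define E where "E = \<eta> / (3 * (S + 1))"
  have E: "0 < E" using \<eta> S by (simp add: E_def)
  have "S * E <= (S + 1) * E" using E by (intro mult_right_mono) auto
  also have "... = \<eta> / 3" using S by (simp add: E_def field_simps)
  finally have SE: "S * E <= \<eta> / 3" .
  have "0 < e / 3" "0 < \<eta> / 3" using \<eta> e by simp_all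
  from BM_modulus_wp[OF i ij(2) this, of T] obtain n :: nat where n: "holds_wp M F (e / 3) (\<lambda>r x. \<forall>s t. 0 <= s --> s <= t --> t <= T -->
    noise_incr i j r x s t <= \<eta> / 3 + real n * (t - s))"
    by (rule exE)
  have init: "holds_wp M F (e / 3) (\<lambda>r x. \<gamma> j r * Z0 r x $ i <= \<eta> / 3)"
    using init_small[OF ij, of "\<eta> / 3"] \<eta> e by (simp add: whp_def)
  have "whp M F (\<lambda>r x. \<forall>k<i. \<forall>t\<in>{0..T}. sZ j r x t k <= E)"
    using IH E by (intro whp_all_less) (simp add: lower_small_def)
  then have low: "holds_wp M F (e / 3) (\<lambda>r x. \<forall>k<i. \<forall>t\<in>{0..T}. sZ j r x t k <= E)"
    using e by (simp add: whp_def)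
  \<comment> \<open>Chosen after \<open>n\<close>: once
    \<open>\<gamma> j r <= c * \<gamma> i r\<close>, the product \<open>n * \<gamma> j r\<close> is
    at most half the leading drift term of coordinate \<open>i\<close>, which is the bound provided
    by \<open>drift_lower\<close>.\<close>
  define c where "c = schur i i i / (2 * (real n + 1))"
  have c: "0 < c" using schur_diag_pos[OF i] by (simp add: c_def)
  have nc: "real n * c <= schur i i i / 2"
  proof -
    have "real n * c <= (real n + 1) * c" using c by (intro mult_right_mono) auto
    also have "... = schur i i i / 2" by (simp add: c_def field_simps)
    finally show ?thesis .
  qed
  have "holds_wp M F (e / 3 + (e / 3 + e / 3)) (\<lambda>r x. \<forall>t\<in>{0..T}. sZ j r x t i <= \<eta>)"
  proof (rule holds_wp_mono[OF holds_wp_conj[OF n holds_wp_conj[OF init low]]])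
    show "\<forall>\<^sub>F r in F. \<forall>x\<in>space M. (\<forall>s t. 0 <= s --> s <= t --> t <= T -->
       noise_incr i j r x s t <= \<eta> / 3 + real n * (t - s)) \<and>
       \<gamma> j r * Z0 r x $ i <= \<eta> / 3 \<and> (\<forall>k<i. \<forall>t\<in>{0..T}. sZ j r x t k <= E) -->
       (\<forall>t\<in>{0..T}. sZ j r x t i <= \<eta>)"
      using eventually_unit gamma_ratio[OF ij c] drift_lower[OF i]
    proof eventually_elim
      case (elim r)
      have "real n * \<gamma> j r <= real n * (c * \<gamma> i r)" using elim(2) by (rule mult_left_mono) simp
      also have "... <= schur i i i / 2 * \<gamma> i r"
        using mult_right_mono[OF nc, of "\<gamma> i r"] gamma_pos[OF i elim(1)] by (simp add: mult.assoc)
      finally have dr: "real n * \<gamma> j r <= drift i i r" using elim(3) by simp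
      have D: "0 <= \<eta> / 3" using \<eta> by simp
      show ?case
      proof (intro ballI impI; elim conjE)
        fix x t assume x: "x \<in> space M" and t: "t \<in> {0..T}" and init: "\<gamma> j r * Z0 r x $ i <= \<eta> / 3"
          and m: "\<forall>s t. 0 <= s --> s <= t --> t <= T -->
       noise_incr i j r x s t <= \<eta> / 3 + real n * (t - s)"
          and low: "\<forall>k<i. \<forall>t\<in>{0..T}. sZ j r x t k <= E"
        have "sZ j r x t i <= S * E + \<gamma> j r * Z0 r x $ i + \<eta> / 3"
          unfolding S_def
          by (rule scaled_upper_bound[OF elim(1) x i gamma_pos[OF ij(2) elim(1)] D dr m[rule_format] low[rule_format]])
            (use t in auto)
        then show "sZ j r x t i <= \<eta>" using init SE by simp
      qed
    qed
  qed
  then show "holds_wp M F e (\<lambda>r x. \<forall>t\<in>{0..T}. sZ j r x t i <= \<eta>)" by simp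
qed

lemma lower_small:
  assumes "0 <= T" "i < j" "j < d"
  shows "lower_small T j i"
  using assms(2) by (induction i rule: less_induct) (rule lower_small_step[OF assms(1) _ assms(3)], auto)

lemma lower_small_all:
  assumes "0 <= T" "j < d" "0 < \<eta>"
  shows "whp M F (\<lambda>r x. \<forall>k<j. \<forall>t\<in>{0..T}. sZ j r x t k <= \<eta>)"
  using lower_small[OF assms(1) _ assms(2)] assms(3) by (intro whp_all_less) (simp add: lower_small_def)

text \<open>On its own scale the drift is not large and is used only as nonnegative: the slope of
  the modulus over \<open>[0, T]\<close> goes into the constant \<open>1 + n * T\<close>, and slope
  0 is compared with the drift.\<close>

lemma scaled_bounded:
  assumes T: "0 <= T" and i: "i < d"
  shows "bounded_wp M F (\<lambda>C r x. \<forall>t\<in>{0..T}. sZ i r x t i <= C)"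
  unfolding bounded_wp_def
proof (intro allI impI)
  fix \<epsilon> :: real assume \<epsilon>: "0 < \<epsilon>"
  then have \<epsilon>3: "0 < \<epsilon> / 3" "0 < (1::real)" by simp_all
  obtain C where C: "holds_wp M F (\<epsilon> / 3) (\<lambda>r x. \<gamma> i r * Z0 r x $ i <= C)"
    using init_bounded[OF i] \<epsilon>3 unfolding bounded_wp_def by blast
  from BM_modulus_wp[OF i i \<epsilon>3, of T] obtain n :: nat where n: "holds_wp M F (\<epsilon> / 3) (\<lambda>r x. \<forall>s t. 0 <= s --> s <= t --> t <= T -->
    noise_incr i i r x s t <= 1 + real n * (t - s))"
    by (rule exE)
  have low: "holds_wp M F (\<epsilon> / 3) (\<lambda>r x. \<forall>k<i. \<forall>t\<in>{0..T}. sZ i r x t k <= 1)"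
    using lower_small_all[OF T i \<epsilon>3(2)] \<epsilon>3(1) by (simp add: whp_def)
  define K where "K = (\<Sum>k<i. elim i i k) * 1 + C + (1 + real n * T)"
  have "holds_wp M F (\<epsilon> / 3 + (\<epsilon> / 3 + \<epsilon> / 3)) (\<lambda>r x. \<forall>t\<in>{0..T}. sZ i r x t i <= K)"
  proof (rule holds_wp_mono[OF holds_wp_conj[OF n holds_wp_conj[OF C low]]])
    show "\<forall>\<^sub>F r in F. \<forall>x\<in>space M. (\<forall>s t. 0 <= s --> s <= t --> t <= T -->
       noise_incr i i r x s t <= 1 + real n * (t - s)) \<and>
       \<gamma> i r * Z0 r x $ i <= C \<and> (\<forall>k<i. \<forall>t\<in>{0..T}. sZ i r x t k <= 1) -->
       (\<forall>t\<in>{0..T}. sZ i r x t i <= K)"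
      using eventually_unit drift_lower[OF i]
    proof eventually_elim
      case (elim r)
      have g: "0 < \<gamma> i r" by (rule gamma_pos[OF i elim(1)])
      have "0 < schur i i i / 2 * \<gamma> i r" using schur_diag_pos[OF i] g by simp
      then have dr: "0 * \<gamma> i r <= drift i i r" using elim(2) by simp
      show ?case
      proof (intro ballI impI; elim conjE)
        fix x t assume x: "x \<in> space M" and t: "t \<in> {0..T}" and init: "\<gamma> i r * Z0 r x $ i <= C"
          and m: "\<forall>s t. 0 <= s --> s <= t --> t <= T -->
       noise_incr i i r x s t <= 1 + real n * (t - s)"
          and low: "\<forall>k<i. \<forall>t\<in>{0..T}. sZ i r x t k <= 1"
        have m': "noise_incr i i r x s t <= (1 + real n * T) + 0 * (t - s)"
          if "0 <= s" "s <= t" "t <= T" for s t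
        proof -
          have "real n * (t - s) <= real n * T" using that by (intro mult_left_mono) auto
          then show ?thesis using m[rule_format, OF that] by simp
        qed
        have "sZ i r x t i <= (\<Sum>k<i. elim i i k) * 1 + \<gamma> i r * Z0 r x $ i + (1 + real n * T)"
          by (rule scaled_upper_bound[OF elim(1) x i g _ dr m' low[rule_format]]) (use t T in auto)
        then show "sZ i r x t i <= K" using init by (simp add: K_def)
      qed
    qed
  qed
  then have "holds_wp M F \<epsilon> (\<lambda>r x. \<forall>t\<in>{0..T}. sZ i r x t i <= K)" by simp
  then show "\<exists>C. holds_wp M F \<epsilon> (\<lambda>r x. \<forall>t\<in>{0..T}. sZ i r x t i <= C)" by blast
qed

end

section \<open>Unreflected later coordinates and comparison with the limit flow\<close>

context srbm_family
begin

definition unit_dir :: "nat => nat => real" where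
  "unit_dir j k = (if k = j then 1 else 0)"

lemma unit_dir_unit: "j < d ==> (\<Sum>k<d. (unit_dir j k)\<^sup>2) = 1"
  by (simp add: unit_dir_def if_distrib[of "\<lambda>x. x\<^sup>2"] cong: if_cong)

lemma lincomb_unit_dir:
  assumes "j < d" "0 <= t"
  shows "lincomb_path d (unit_dir j) c x t $ 0 = c * x (t / c\<^sup>2) $ j"
  using assms by (simp add: lincomb_path_def unit_dir_def if_distrib[of "\<lambda>x. x * _"] cong: if_cong)

lemma lincomb_unit_dir_1: "j < d ==> lincomb_path d (unit_dir j) 1 x = coord_path j x"
  by (auto simp: lincomb_path_def coord_path_def unit_dir_def fun_eq_iff if_distrib[of "\<lambda>x. x * _"] cong: if_cong)

lemma BM_coord_bounded:
  assumes j: "j < d"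
  shows "bounded_wp M F (\<lambda>C r x. \<forall>k<d. \<forall>t\<in>{0..T}. \<bar>\<gamma> j r * W x (t / (\<gamma> j r)\<^sup>2) $ k\<bar> <= C)"
proof (rule bounded_wp_all_less)
  fix k assume k: "k < d"
  show "bounded_wp M F (\<lambda>C r x. \<forall>t\<in>{0..T}. \<bar>\<gamma> j r * W x (t / (\<gamma> j r)\<^sup>2) $ k\<bar> <= C)"
    unfolding bounded_wp_def
  proof (intro allI impI)
    fix e :: real assume e: "0 < e"
    obtain n :: nat where n: "\<forall>c>0. \<exists>A\<in>sets M. 1 - e <= measure M A \<and>
        (\<forall>x\<in>A. \<forall>t\<in>{0..T}. \<bar>lincomb_path d (unit_dir k) c (W x) t $ 0\<bar> <= real n)"
      using BM_lincomb_bounded[OF prob_space_axioms W unit_dir_unit[OF k] e, of T] by (rule exE)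
    have "holds_wp M F e (\<lambda>r x. \<forall>t\<in>{0..T}. \<bar>lincomb_path d (unit_dir k) (\<gamma> j r) (W x) t $ 0\<bar> <= real n)"
      unfolding holds_wp_def
      by (rule eventually_mono[OF eventually_unit], rule n[rule_format], rule gamma_pos[OF j])
    then show "\<exists>C. holds_wp M F e (\<lambda>r x. \<forall>t\<in>{0..T}. \<bar>\<gamma> j r * W x (t / (\<gamma> j r)\<^sup>2) $ k\<bar> <= C)"
      by (intro exI[of _ "real n"]) (simp add: lincomb_unit_dir[OF k])
  qed
qed (meson order_trans)

text \<open>On the clock of \<open>j\<close> every term of the equation reduced by the coordinates
  up to \<open>j\<close>, except the initial state, stays bounded in units of
  \<open>1 / \<gamma> j r\<close>, whereas the later coordinates start arbitrarily high in these
  units; \<open>reg_path_eq_0\<close> applies.\<close>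

lemma upper_unreflected:
  assumes T: "0 <= T" and j: "j < d"
  shows "whp M F (\<lambda>r x. \<forall>k. j < k --> k < d --> reg_path (X r x) (T / (\<gamma> j r)\<^sup>2) $ k = 0)"
  unfolding whp_def
proof (intro allI impI)
  fix \<epsilon> :: real assume \<epsilon>: "0 < \<epsilon>"
  \<comment> \<open>Coordinate \<open>j\<close> itself is eliminated together with its
    predecessors.\<close>
  define m where "m = Suc j"
  have m: "m <= d" using j by (simp add: m_def)
  let ?P = "\<lambda>C r x. \<forall>i<j. \<forall>t\<in>{0..T}. sZ j r x t i <= C"
  let ?Q = "\<lambda>C r x. \<forall>t\<in>{0..T}. sZ j r x t j <= C"
  let ?V = "\<lambda>C r x. \<forall>k<d. \<forall>t\<in>{0..T}. \<bar>\<gamma> j r * W x (t / (\<gamma> j r)\<^sup>2) $ k\<bar> <= C"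
  have \<epsilon>4: "0 < \<epsilon> / 4" using \<epsilon> by simp
  have P: "holds_wp M F (\<epsilon> / 4) (?P 1)" using lower_small_all[OF T j, of 1] \<epsilon>4 by (simp add: whp_def)
  obtain C1 where Q: "holds_wp M F (\<epsilon> / 4) (?Q C1)" using scaled_bounded[OF T j] \<epsilon>4 unfolding bounded_wp_def by blast
  obtain C2 where V: "holds_wp M F (\<epsilon> / 4) (?V C2)" using BM_coord_bounded[OF j, of T] \<epsilon>4 unfolding bounded_wp_def by blast
  define C where "C = Max {1, C1, C2}"
  have C: "0 <= C" "1 <= C" "C1 <= C" "C2 <= C" by (auto simp: C_def)
  \<comment> \<open>The required starting height. Its three terms bound the eliminated coordinates,
    the drift (of size at most \<open>\<gamma> j r\<close>, as only later scales remain in it) and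
    the noise.\<close>
  define E where "E l = (\<Sum>i<m. elim m l i) * C + T + (\<Sum>k<d. \<bar>noise m l k\<bar>) * C" for l
  have "whp M F (\<lambda>r x. \<forall>l<d. m <= l --> E l <= \<gamma> j r * Z0 r x $ l)"
  proof (rule whp_all_less)
    fix l assume l: "l < d"
    show "whp M F (\<lambda>r x. m <= l --> E l <= \<gamma> j r * Z0 r x $ l)"
    proof (cases "m <= l")
      case True
      then show ?thesis using init_big[of j l "E l"] l by (simp add: m_def)
    next
      case False
      then show ?thesis by (intro whp_eventually) simp
    qed
  qed
  then have big: "holds_wp M F (\<epsilon> / 4) (\<lambda>r x. \<forall>l<d. m <= l --> E l <= \<gamma> j r * Z0 r x $ l)" using \<epsilon>4 by (simp add: whp_def)
  have dr: "\<forall>\<^sub>F r in F. \<forall>l\<in>{..<d}. \<bar>drift m l r\<bar> <= 1 * \<gamma> j r"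
    unfolding drift_def m_def by (intro eventually_ball_finite ballI tail_small j) auto
  have "holds_wp M F (\<epsilon> / 4 + (\<epsilon> / 4 + (\<epsilon> / 4 + \<epsilon> / 4))) (\<lambda>r x. \<forall>k. j < k --> k < d --> reg_path (X r x) (T / (\<gamma> j r)\<^sup>2) $ k = 0)"
  proof (rule holds_wp_mono[OF holds_wp_conj[OF P holds_wp_conj[OF Q holds_wp_conj[OF V big]]]])
    show "\<forall>\<^sub>F r in F. \<forall>x\<in>space M. ?P 1 r x \<and> ?Q C1 r x \<and> ?V C2 r x \<and> (\<forall>l<d. m <= l --> E l <= \<gamma> j r * Z0 r x $ l) -->
       (\<forall>k. j < k --> k < d --> reg_path (X r x) (T / (\<gamma> j r)\<^sup>2) $ k = 0)"
      using eventually_unit dr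
    proof eventually_elim
      case (elim r)
      define g where "g = \<gamma> j r"
      have g: "0 < g" "0 < g\<^sup>2" using gamma_pos[OF j elim(1)] by (auto simp: g_def)
      show ?case
      proof (intro ballI impI allI; elim conjE)
        fix x k assume x: "x \<in> space M" and k: "j < k" "k < d"
          and P: "?P 1 r x" and Q: "?Q C1 r x" and V: "?V C2 r x" and big: "\<forall>l<d. m <= l --> E l <= \<gamma> j r * Z0 r x $ l"
        have mk: "m <= k" using k by (simp add: m_def)
        have "0 <= T / g\<^sup>2" using T g by simp
        have "reg_path (X r x) (T / g\<^sup>2) $ k = 0"
        proof (rule reg_path_eq_0[OF X_cont_paths[OF x] m \<open>0 <= T / g\<^sup>2\<close> _ mk k(2)])
          fix l s assume l: "m <= l" "l < d" and s: "0 <= s" "s <= T / g\<^sup>2"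
          define t where "t = s * g\<^sup>2"
          have t: "t \<in> {0..T}" "t / g\<^sup>2 = s" using s g by (auto simp: t_def pos_le_divide_eq)
          have e: "0 <= elim m l i" if "i < m" for i by (rule elim_nonneg[OF l that])
          have Zi: "g * Z r x s $ i <= C" if "i < m" for i
          proof (cases "i = j")
            case True
            then show ?thesis using bspec[OF Q t(1)] C by (simp add: t(2) flip: g_def)
          next
            case False
            then have "i < j" using that by (simp add: m_def)
            then show ?thesis using bspec[OF P[rule_format, OF \<open>i < j\<close>, THEN ballI] t(1)] P t C by (fastforce simp: g_def)
          qed
          have "g * (\<Sum>i<m. elim m l i * Z r x s $ i) <= (\<Sum>i<m. elim m l i) * C"
            unfolding sum_distrib_left sum_distrib_right
          proof (rule sum_mono)
            fix i assume "i \<in> {..<m}"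
            then have "elim m l i * (g * Z r x s $ i) <= elim m l i * C" using Zi e by (intro mult_left_mono) auto
            then show "g * (elim m l i * Z r x s $ i) <= elim m l i * C" by (simp add: mult.left_commute)
          qed
          moreover have "E l <= g * reduced m l (\<lambda>i. Z0 r x $ i)"
          proof -
            have "0 <= (\<Sum>i<m. elim m l i * Z0 r x $ i)"
              using m e Z0_nonneg[OF elim(1) x] by (intro sum_nonneg mult_nonneg_nonneg) auto
            then have "g * Z0 r x $ l <= g * reduced m l (\<lambda>i. Z0 r x $ i)" using g by (simp add: reduced_def)
            then show ?thesis using big l by (fastforce simp: g_def)
          qed
          moreover have "g * (s * drift m l r) <= T"
          proof -
            have "\<bar>drift m l r\<bar> <= g" using elim(2) l by (simp add: g_def)
            then have "g * (s * drift m l r) <= g * (s * g)" using s g by (intro mult_left_mono) auto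
            also have "... = t" by (simp add: t_def power2_eq_square)
            finally show ?thesis using t by simp
          qed
          moreover have "- ((\<Sum>k<d. \<bar>noise m l k\<bar>) * C) <= g * (\<Sum>k<d. noise m l k * W x s $ k)"
          proof -
            have "\<bar>g * (\<Sum>k<d. noise m l k * W x s $ k)\<bar> <= (\<Sum>k<d. \<bar>noise m l k\<bar>) * C"
              unfolding sum_distrib_left sum_distrib_right
            proof (rule order_trans[OF sum_abs sum_mono])
              fix k assume "k \<in> {..<d}"
              then have "\<bar>\<gamma> j r * W x (t / (\<gamma> j r)\<^sup>2) $ k\<bar> <= C2" using V t(1) by blast
              then have "\<bar>g * W x s $ k\<bar> <= C" using C t(2) by (simp add: g_def)
              then have "\<bar>noise m l k\<bar> * \<bar>g * W x s $ k\<bar> <= \<bar>noise m l k\<bar> * C" by (intro mult_left_mono) auto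
              then show "\<bar>g * (noise m l k * W x s $ k)\<bar> <= \<bar>noise m l k\<bar> * C" by (simp add: abs_mult mult.left_commute)
            qed
            then show ?thesis by linarith
          qed
          ultimately have "g * (\<Sum>i<m. elim m l i * Z r x s $ i) <= g * reduced m l (\<lambda>i. X r x s $ i)"
            unfolding reduced_X[OF l s(1)] E_def by (simp add: distrib_left right_diff_distrib)
          then show "(\<Sum>i<m. elim m l i * refl_path (X r x) s $ i) <= reduced m l (\<lambda>i. X r x s $ i)"
            using g by (simp add: Z_def)
        qed
        then show "reg_path (X r x) (T / (\<gamma> j r)\<^sup>2) $ k = 0" by (simp add: g_def)
      qed
    qed
  qed
  then show "holds_wp M F \<epsilon> (\<lambda>r x. \<forall>k. j < k --> k < d --> reg_path (X r x) (T / (\<gamma> j r)\<^sup>2) $ k = 0)" by simp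
qed

definition scaled_init :: "real => real vec => real vec" where
  "scaled_init r z = Matrix.vec d (\<lambda>j. \<gamma> j r * z $ j)"

definition scaled_BM :: "real => (real => real vec) => real => real vec" where
  "scaled_BM r w = join_path d (\<lambda>j. lincomb_path d (dir j) (\<gamma> j r) w)"

lemma scaled_BM_cont_paths: "w \<in> cont_paths d ==> scaled_BM r w \<in> cont_paths d"
  unfolding scaled_BM_def by (intro join_path_cont_paths lincomb_path_cont_paths)

text \<open>The reduced equation differs from the free limit path by the earlier coordinates, at
  time 0 and at the current time, and by the later scales in the drift. The two contributions of the
  earlier coordinates are nonnegative and enter with opposite signs, so one bound covers their
  difference.\<close>

lemma free_path_error:
  assumes r: "r \<in> {0<..<1}" and x: "x \<in> space M" and j: "j < d" and t: "0 <= t" "t <= T" and T: "0 <= T" and c: "0 <= c"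
    and Z: "\<And>k t. k < j ==> 0 <= t ==> t <= T ==> sZ j r x t k <= E"
    and tail: "\<bar>\<Sum>k\<in>{Suc j..<d}. schur j j k * \<gamma> k r\<bar> <= c * \<gamma> j r"
  shows "\<bar>\<gamma> j r * (reduced j j (\<lambda>i. X r x (t / (\<gamma> j r)\<^sup>2) $ i) - (\<Sum>i<j. elim j j i * Z r x (t / (\<gamma> j r)\<^sup>2) $ i))
      - free_path d \<theta> \<sigma> (scaled_init r (Z0 r x)) (scaled_BM r (W x)) t $ j\<bar> <= (\<Sum>i<j. elim j j i) * E + T * c"
proof -
  define g where "g = \<gamma> j r"
  have g: "0 < g" "0 < g\<^sup>2" using gamma_pos[OF j r] by (auto simp: g_def)
  define s where "s = t / g\<^sup>2"
  have s: "0 <= s" using t g by (simp add: s_def)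
  define \<tau> where "\<tau> = (\<Sum>k\<in>{Suc j..<d}. schur j j k * \<gamma> k r)"
  have bound: "0 <= g * (\<Sum>i<j. elim j j i * Z r x (u / g\<^sup>2) $ i)"
    "g * (\<Sum>i<j. elim j j i * Z r x (u / g\<^sup>2) $ i) <= (\<Sum>i<j. elim j j i) * E" if u: "0 <= u" "u <= T" for u
  proof -
    have "0 <= u / g\<^sup>2" using u g by simp
    then show "0 <= g * (\<Sum>i<j. elim j j i * Z r x (u / g\<^sup>2) $ i)"
      using j g by (intro mult_nonneg_nonneg sum_nonneg elim_nonneg Z_nonneg[OF x]) auto
    show "g * (\<Sum>i<j. elim j j i * Z r x (u / g\<^sup>2) $ i) <= (\<Sum>i<j. elim j j i) * E"
      unfolding sum_distrib_left sum_distrib_right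
    proof (rule sum_mono)
      fix i assume i: "i \<in> {..<j}"
      then have "elim j j i * (g * Z r x (u / g\<^sup>2) $ i) <= elim j j i * E"
        using j Z[of i u] u by (intro mult_left_mono elim_nonneg) (auto simp: g_def)
      then show "g * (elim j j i * Z r x (u / g\<^sup>2) $ i) <= elim j j i * E" by (simp add: mult.left_commute)
    qed
  qed
  have "(\<Sum>i<j. elim j j i * Z0 r x $ i) = (\<Sum>i<j. elim j j i * Z r x (0 / g\<^sup>2) $ i)"
    using j by (intro sum.cong refl) (simp add: Z_0[OF r x])
  then have init: "0 <= g * (\<Sum>i<j. elim j j i * Z0 r x $ i)" "g * (\<Sum>i<j. elim j j i * Z0 r x $ i) <= (\<Sum>i<j. elim j j i) * E"
    using bound[of 0] T by simp_all
  have drift: "drift j j r = schur j j j * g + \<tau>"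
    unfolding drift_def \<tau>_def g_def using j by (rule sum.atLeast_Suc_lessThan)
  have gs: "g * (s * g) = t" using g by (simp add: s_def power2_eq_square)
  have "\<bar>g * (s * \<tau>)\<bar> = g * s * \<bar>\<tau>\<bar>" using g s by (simp add: abs_mult)
  also have "... <= g * s * (c * g)" using tail g s by (intro mult_left_mono) (auto simp: \<tau>_def g_def)
  also have "... = t * c" using gs by (simp add: mult.commute mult.left_commute)
  also have "... <= T * c" using t c by (intro mult_right_mono) auto
  finally have tail': "\<bar>g * (s * \<tau>)\<bar> <= T * c" .
  have "g * (s * drift j j r) = schur j j j * t + g * (s * \<tau>)"
    using gs unfolding drift by (simp add: distrib_left mult.commute mult.left_commute)
  moreover have "free_path d \<theta> \<sigma> (scaled_init r (Z0 r x)) (scaled_BM r (W x)) t $ j =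
      g * Z0 r x $ j - schur j j j * t + g * (\<Sum>k<d. noise j j k * W x s $ k)"
    using t j sigma_lincomb[OF j t(1), of g "W x"]
    by (simp add: free_path_index scaled_init_def scaled_BM_def join_path_index \<theta>_def s_def flip: g_def)
  ultimately have eq: "g * (reduced j j (\<lambda>i. X r x s $ i) - (\<Sum>i<j. elim j j i * Z r x s $ i))
      - free_path d \<theta> \<sigma> (scaled_init r (Z0 r x)) (scaled_BM r (W x)) t $ j
    = g * (\<Sum>i<j. elim j j i * Z0 r x $ i) - g * (s * \<tau>) - g * (\<Sum>i<j. elim j j i * Z r x s $ i)"
    unfolding reduced_X[OF order.refl j s] by (simp add: reduced_def[of _ _ "\<lambda>i. Z0 r x $ i"] distrib_left right_diff_distrib)
  show ?thesis
    unfolding g_def[symmetric] s_def[symmetric] eq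
    using init bound[OF t] tail' unfolding s_def[symmetric] by linarith
qed

text \<open>\<open>rescale_refl_path_dist\<close> costs the factor \<open>1 + one.K d\<close>,
  whence \<open>e\<close>; the earlier coordinates (through \<open>E\<close>) and the later scales
  (through \<open>c\<close>) account for half of \<open>e\<close> each, with \<open>S\<close>
  bounding the elimination weights uniformly in \<open>j\<close>.\<close>

lemma close_to_limit_path:
  assumes T: "0 <= T" and \<eta>: "0 < \<eta>"
  shows "whp M F (\<lambda>r x. path_dist d T (rescale (\<lambda>j. \<gamma> j r) (Z r x))
    (flow (scaled_init r (Z0 r x)) (scaled_BM r (W x))) <= \<eta>)"
proof -
  define e where "e = \<eta> / (1 + one.K d)"
  have K: "0 <= one.K d" by (rule one.K_nonneg)
  have e: "0 < e" using \<eta> K by (simp add: e_def)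
  define S where "S = (\<Sum>j<d. \<Sum>i<j. elim j j i)"
  have Sj0: "0 <= (\<Sum>i<j. elim j j i)" if "j < d" for j using that by (intro sum_nonneg elim_nonneg) auto
  have S: "0 <= S" unfolding S_def by (rule sum_nonneg, rule Sj0) simp
  have Sj: "(\<Sum>i<j. elim j j i) <= S" if "j < d" for j unfolding S_def using that Sj0 by (intro member_le_sum) auto
  define E c where "E = e / (2 * (S + 1))" and "c = e / (2 * (T + 1))"
  have E: "0 < E" and c: "0 < c" using e S T by (auto simp: E_def c_def)
  have SE: "S * E <= e / 2"
  proof -
    have "S * E <= (S + 1) * E" using E by (intro mult_right_mono) auto
    also have "... = e / 2" using S by (simp add: E_def field_simps)
    finally show ?thesis .
  qed
  have Tc: "T * c <= e / 2"
  proof -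
    have "T * c <= (T + 1) * c" using c by (intro mult_right_mono) auto
    also have "... = e / 2" using T by (simp add: c_def field_simps)
    finally show ?thesis .
  qed
  have "whp M F (\<lambda>r x. \<forall>j<d. (\<forall>k<j. \<forall>t\<in>{0..T}. sZ j r x t k <= E) \<and>
      (\<forall>k. j < k --> k < d --> reg_path (X r x) (T / (\<gamma> j r)\<^sup>2) $ k = 0))"
    by (intro whp_all_less whp_conj lower_small_all upper_unreflected T E)
  then show ?thesis
  proof (rule whp_mono)
    have tail: "\<forall>\<^sub>F r in F. \<forall>j\<in>{..<d}. \<bar>\<Sum>k\<in>{Suc j..<d}. schur j j k * \<gamma> k r\<bar> <= c * \<gamma> j r"
      by (intro eventually_ball_finite ballI tail_small c) auto
    show "\<forall>\<^sub>F r in F. \<forall>x\<in>space M. (\<forall>j<d. (\<forall>k<j. \<forall>t\<in>{0..T}. sZ j r x t k <= E) \<and>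
        (\<forall>k. j < k --> k < d --> reg_path (X r x) (T / (\<gamma> j r)\<^sup>2) $ k = 0)) -->
      path_dist d T (rescale (\<lambda>j. \<gamma> j r) (Z r x)) (flow (scaled_init r (Z0 r x)) (scaled_BM r (W x))) <= \<eta>"
      using eventually_unit tail
    proof eventually_elim
      case (elim r)
      show ?case
      proof (intro ballI impI)
        fix x assume x: "x \<in> space M" and H: "\<forall>j<d. (\<forall>k<j. \<forall>t\<in>{0..T}. sZ j r x t k <= E) \<and>
        (\<forall>k. j < k --> k < d --> reg_path (X r x) (T / (\<gamma> j r)\<^sup>2) $ k = 0)"
        let ?A = "free_path d \<theta> \<sigma> (scaled_init r (Z0 r x)) (scaled_BM r (W x))"
        have "path_dist d T (rescale (\<lambda>j. \<gamma> j r) (refl_path (X r x))) (one.refl_path d ?A) <= (1 + one.K d) * e"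
        proof (rule rescale_refl_path_dist[OF X_cont_paths[OF x] _ T])
          show "?A \<in> cont_paths d" by (intro free_path_cont_paths scaled_BM_cont_paths W_cont_paths x)
          show "0 <= e" using e by simp
          show "0 < \<gamma> j r" if "j < d" for j by (rule gamma_pos[OF that elim(1)])
          show "reg_path (X r x) (T / (\<gamma> j r)\<^sup>2) $ k = 0" if "j < k" "k < d" for j k
            using H that less_trans[OF that] by simp
          fix j t assume j: "j < d" and t: "0 <= t" "t <= T"
          have "(\<Sum>i<j. elim j j i) * E <= S * E" using Sj[OF j] E by (intro mult_right_mono) auto
          then have le: "(\<Sum>i<j. elim j j i) * E + T * c <= e" using SE Tc by simp
          have Hj: "sZ j r x t k <= E" if "k < j" "0 <= t" "t <= T" for k t
            using H j that by simp
          show "\<bar>\<gamma> j r * (reduced j j (\<lambda>i. X r x (t / (\<gamma> j r)\<^sup>2) $ i) - (\<Sum>i<j. elim j j i * refl_path (X r x) (t / (\<gamma> j r)\<^sup>2) $ i)) - ?A t $ j\<bar> <= e"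
            using order_trans[OF free_path_error[OF elim(1) x j t T less_imp_le[OF c] Hj] le] elim(2) j by (simp add: Z_def)
        qed
        also have "(1 + one.K d) * e = \<eta>" using K by (simp add: e_def)
        finally show "path_dist d T (rescale (\<lambda>j. \<gamma> j r) (Z r x)) (flow (scaled_init r (Z0 r x)) (scaled_BM r (W x))) <= \<eta>"
          by (simp add: Z_def limit_path_def)
      qed
    qed
  qed
qed

end

section \<open>Decoupling of the noises and weak convergence\<close>

context srbm_family
begin

text \<open>For \<open>j > 0\<close> this is
  \<open>T * (\<gamma> j r / \<gamma> (j - 1) r)\<^sup>2\<close>, which tends to 0: the initial
  block discarded by truncation is negligible on the clock of \<open>j\<close>.\<close>

definition block_start :: "real => real => nat => real" where
  "block_start T r j = (\<gamma> j r)\<^sup>2 * scale_start T (\<lambda>j. \<gamma> j r) j"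

lemma block_start_nonneg: "0 <= T ==> 0 <= block_start T r j"
  by (simp add: block_start_def scale_start_def)

lemma block_start_small:
  assumes T: "0 <= T" and c: "0 < c"
  shows "\<forall>\<^sub>F r in F. \<forall>j\<in>{..<d}. block_start T r j <= c"
proof (rule eventually_ball_finite, simp, intro ballI)
  fix j assume "j \<in> {..<d}"
  then have j: "j < d" by simp
  show "\<forall>\<^sub>F r in F. block_start T r j <= c"
  proof (cases "j = 0")
    case True
    then show ?thesis using c by (simp add: block_start_def scale_start_def)
  next
    case False
    \<comment> \<open>The bound 1 allows the square of the ratio to be replaced by \<open>c'\<close>
      itself; \<open>T + 1\<close> avoids division by 0.\<close>
    define c' where "c' = min 1 (c / (T + 1))"
    have c': "0 < c'" "c' <= 1" "T * c' <= c"
    proof -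
      have "(T + 1) * c' <= (T + 1) * (c / (T + 1))" using T by (intro mult_left_mono) (auto simp: c'_def)
      also have "(T + 1) * (c / (T + 1)) = c" using T by simp
      finally have "T * c' + c' <= c" by (simp add: distrib_right)
      moreover show "0 < c'" "c' <= 1" using T c by (auto simp: c'_def)
      ultimately show "T * c' <= c" by simp
    qed
    have "j - 1 < j" using False by simp
    from gamma_ratio[OF this j c'(1)] eventually_unit show ?thesis
    proof eventually_elim
      case (elim r)
      have g: "0 < \<gamma> j r" "0 < \<gamma> (j - 1) r" using j elim(2) by (auto intro!: gamma_pos)
      define q where "q = \<gamma> j r / \<gamma> (j - 1) r"
      have q: "0 <= q" "q <= c'" using g elim(1) by (auto simp: q_def pos_divide_le_eq)
      have "q\<^sup>2 <= c' * 1" unfolding power2_eq_square using q c' by (intro mult_mono) auto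
      then have "T * q\<^sup>2 <= T * c'" using T by (intro mult_left_mono) auto
      moreover have "block_start T r j = T * q\<^sup>2"
        using False by (simp add: block_start_def scale_start_def q_def power_divide)
      ultimately show ?case using c' by simp
    qed
  qed
qed

lemma block_start_le:
  assumes T: "0 <= T"
  shows "\<forall>\<^sub>F r in F. \<forall>j\<in>{..<d}. block_start T r j <= T"
proof (cases "T = 0")
  case True
  then show ?thesis by (simp add: block_start_def scale_start_def)
next
  case False
  then show ?thesis using T by (intro block_start_small) auto
qed

text \<open>General in directions and scales, because it is applied both to the rescaled noises and,
  with \<open>unit_dir\<close> and scale 1, to \<open>W\<close> itself.\<close>

lemma trunc_close:
  assumes T: "0 <= T" and a: "\<And>j. j < d ==> (\<Sum>k<d. (a j k)\<^sup>2) = 1"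
    and c: "\<And>j r. j < d ==> r \<in> {0<..<1} ==> 0 < c j r" and e: "0 < e"
  shows "whp M F (\<lambda>r x. path_dist d T (join_path d (\<lambda>j. lincomb_path d (a j) (c j r) (W x)))
    (join_path d (\<lambda>j. trunc_path T (block_start T r j) (lincomb_path d (a j) (c j r) (W x)))) <= e)"
proof -
  let ?V = "\<lambda>j r x. lincomb_path d (a j) (c j r) (W x)"
  have "whp M F (\<lambda>r x. \<forall>s\<in>{0..block_start T r j}. \<bar>?V j r x s $ 0\<bar> <= e)" if j: "j < d" for j
    unfolding whp_def
  proof (intro allI impI)
    fix eps :: real assume eps: "0 < eps"
    obtain n :: nat where n: "\<forall>c>0. \<exists>A\<in>sets M. 1 - eps <= measure M A \<and>
      (\<forall>x\<in>A. \<forall>t\<in>{0..1 / real (Suc n)}. \<bar>lincomb_path d (a j) c (W x) t $ 0 - lincomb_path d (a j) c (W x) 0 $ 0\<bar> <= e)"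
      using BM_lincomb_start[OF prob_space_axioms W a[OF j] eps e] by (rule exE)
    have start: "holds_wp M F eps (\<lambda>r x. \<forall>t\<in>{0..1 / real (Suc n)}. \<bar>?V j r x t $ 0 - ?V j r x 0 $ 0\<bar> <= e)"
      unfolding holds_wp_def by (rule eventually_mono[OF eventually_unit], rule n[rule_format], rule c[OF j])
    show "holds_wp M F eps (\<lambda>r x. \<forall>s\<in>{0..block_start T r j}. \<bar>?V j r x s $ 0\<bar> <= e)"
    proof (rule holds_wp_mono[OF start])
      have "0 < 1 / real (Suc n)" by simp
      from block_start_small[OF T this]
      show "\<forall>\<^sub>F r in F. \<forall>x\<in>space M. (\<forall>t\<in>{0..1 / real (Suc n)}. \<bar>?V j r x t $ 0 - ?V j r x 0 $ 0\<bar> <= e) -->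
          (\<forall>s\<in>{0..block_start T r j}. \<bar>?V j r x s $ 0\<bar> <= e)"
      proof eventually_elim
        case (elim r)
        show ?case
        proof (intro ballI impI)
          fix x s assume x: "x \<in> space M" and H: "\<forall>t\<in>{0..1 / real (Suc n)}. \<bar>?V j r x t $ 0 - ?V j r x 0 $ 0\<bar> <= e"
            and s: "s \<in> {0..block_start T r j}"
          have "block_start T r j <= 1 / real (Suc n)" using elim j by blast
          then have "s \<in> {0..1 / real (Suc n)}" using s by simp
          then have "\<bar>?V j r x s $ 0 - ?V j r x 0 $ 0\<bar> <= e" using H by blast
          moreover have "?V j r x 0 $ 0 = 0" using BM_0[OF W x] by (simp add: lincomb_path_def)
          ultimately show "\<bar>?V j r x s $ 0\<bar> <= e" by simp
        qed
      qed
    qed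
  qed
  then have "whp M F (\<lambda>r x. \<forall>j<d. \<forall>s\<in>{0..block_start T r j}. \<bar>?V j r x s $ 0\<bar> <= e)" by (rule whp_all_less)
  then show ?thesis
  proof (rule whp_mono)
    show "\<forall>\<^sub>F r in F. \<forall>x\<in>space M. (\<forall>j<d. \<forall>s\<in>{0..block_start T r j}. \<bar>?V j r x s $ 0\<bar> <= e) -->
      path_dist d T (join_path d (\<lambda>j. ?V j r x)) (join_path d (\<lambda>j. trunc_path T (block_start T r j) (?V j r x))) <= e"
      using block_start_le[OF T]
    proof eventually_elim
      case (elim r)
      show ?case
      proof (intro ballI impI)
        fix x assume x: "x \<in> space M" and H: "\<forall>j<d. \<forall>s\<in>{0..block_start T r j}. \<bar>?V j r x s $ 0\<bar> <= e"
        have V: "?V j r x \<in> cont_paths 1" for j by (rule lincomb_path_cont_paths[OF W_cont_paths[OF x]])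
        show "path_dist d T (join_path d (\<lambda>j. ?V j r x)) (join_path d (\<lambda>j. trunc_path T (block_start T r j) (?V j r x))) <= e"
        proof (rule path_dist_leI)
          show "join_path d (\<lambda>j. ?V j r x) \<in> cont_paths d" by (rule join_path_cont_paths[OF V])
          show "join_path d (\<lambda>j. trunc_path T (block_start T r j) (?V j r x)) \<in> cont_paths d"
            by (rule join_path_cont_paths, rule trunc_path_cont_paths[OF V block_start_nonneg[OF T]]) (use elim in simp)
          show "0 <= e" using e by simp
          fix t j assume t: "0 <= t" "t <= T" and j: "j < d"
          have "\<bar>?V j r x t $ 0 - trunc_path T (block_start T r j) (?V j r x) t $ 0\<bar> <= e"
            by (rule trunc_path_error[OF block_start_nonneg[OF T] t]) (use elim j H in auto)
          then show "\<bar>join_path d (\<lambda>j. ?V j r x) t $ j - join_path d (\<lambda>j. trunc_path T (block_start T r j) (?V j r x)) t $ j\<bar> <= e"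
            using t j by (simp add: join_path_index)
        qed
      qed
    qed
  qed
qed

lemma Z0_measurable: "r \<in> {0<..<1} ==> Z0 r \<in> M \<rightarrow>\<^sub>M vec_borel d"
  by (rule indep_elements_measurable(1)[OF Z0_indep])

lemma Z_measurable:
  assumes r: "r \<in> {0<..<1}"
  shows "Z r \<in> M \<rightarrow>\<^sub>M path_borel d"
proof -
  have "X r \<in> M \<rightarrow>\<^sub>M path_borel d"
  proof (rule measurable_path_borelI)
    fix t i assume t: "0 <= (t::real)" and i: "i < d"
    have "(\<lambda>x. Z0 r x $ i) \<in> borel_measurable M" by (rule measurable_compose[OF Z0_measurable[OF r] measurable_vec_component[OF i]])
    moreover have "(\<lambda>x. W x t $ k) \<in> borel_measurable M" if "k < d" for k
      by (rule measurable_compose[OF BM_measurable[OF W] measurable_path_eval[OF t that]])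
    ultimately show "(\<lambda>x. X r x t $ i) \<in> borel_measurable M"
      unfolding X_index[OF t i]
      by (intro borel_measurable_add borel_measurable_diff borel_measurable_sum borel_measurable_times borel_measurable_const) auto
  qed (rule X_cont_paths)
  from measurable_compose[OF this measurable_refl_path] show ?thesis by (simp add: Z_def[abs_def])
qed

lemma measurable_rescale: "rescale g \<in> path_borel d \<rightarrow>\<^sub>M path_borel d"
proof (rule measurable_path_borelI)
  show "rescale g x \<in> cont_paths d" if "x \<in> space (path_borel d)" for x
    using that by (intro rescale_cont_paths) (simp add: topspace_path_topology)
  fix t i assume t: "0 <= (t::real)" and i: "i < d"
  have "(\<lambda>x. g i * x (t / (g i)\<^sup>2) $ i) \<in> borel_measurable (path_borel d)"
    using t i by (intro borel_measurable_times borel_measurable_const measurable_path_eval) auto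
  then show "(\<lambda>x. rescale g x t $ i) \<in> borel_measurable (path_borel d)" using t i by (simp add: rescale_index)
qed

lemma measurable_scaled_init: "scaled_init r \<in> vec_borel d \<rightarrow>\<^sub>M vec_borel d"
  by (rule measurable_vec_borelI)
    (auto simp: scaled_init_def intro!: borel_measurable_times measurable_vec_component)

lemma measurable_scaled_BM: "scaled_BM r \<in> path_borel d \<rightarrow>\<^sub>M path_borel d"
  unfolding scaled_BM_def[abs_def] by (intro measurable_join_path measurable_lincomb_path)

text \<open>Expectations are carried from the rescaled process to the limit through a function
  \<open>h\<close> of the scaled initial state and a driving path. Once the rescaled noise has been
  exchanged for \<open>W\<close>, only the law of the initial state depends on
  \<open>r\<close>.\<close>

theorem weak_convergence:
  assumes LP: "limit_process N' d \<xi>' V" and law: "distr N' (vec_borel d) \<xi>' = distr N (vec_borel d) \<xi>"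
  shows "converges_weakly (path_topology d) M (\<lambda>r q. rescale (\<lambda>j. \<gamma> j r) (Z r q)) N'
    (\<lambda>q. flow (\<xi>' q) (V q)) F"
proof -
  interpret LP: limit_process N' d \<xi>' V \<theta> \<sigma> by (rule LP)
  have Zm: "(\<lambda>q. rescale (\<lambda>j. \<gamma> j r) (Z r q)) \<in> M \<rightarrow>\<^sub>M path_borel d" if "r \<in> {0<..<1}" for r
    by (rule measurable_compose[OF Z_measurable[OF that] measurable_rescale])
  have LPZ: "LP.Z = (\<lambda>q. flow (\<xi>' q) (V q))" by (simp add: LP.Z_def fun_eq_iff)
  show ?thesis
  proof (rule converges_weakly_pathI[OF prob_space_axioms LP.N])
    show "\<forall>\<^sub>F r in F. (\<lambda>q. rescale (\<lambda>j. \<gamma> j r) (Z r q)) \<in> M \<rightarrow>\<^sub>M path_borel d"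
      by (rule eventually_mono[OF eventually_unit Zm])
    show "(\<lambda>q. flow (\<xi>' q) (V q)) \<in> N' \<rightarrow>\<^sub>M path_borel d" using LP.Z_measurable LPZ by simp
    fix g :: "(real => real vec) => real" and T0 C B
    assume lip0: "\<And>x y. x \<in> cont_paths d ==> y \<in> cont_paths d ==> \<bar>g x - g y\<bar> <= C * path_dist d T0 x y"
      and C: "0 <= C" and B: "\<And>x. x \<in> cont_paths d ==> \<bar>g x\<bar> <= B"
    define T where "T = max T0 0"
    have T: "0 <= T" by (simp add: T_def)
    have lip: "\<bar>g x - g y\<bar> <= C * path_dist d T x y" if "x \<in> cont_paths d" "y \<in> cont_paths d" for x y
      using lip0[OF that] mult_left_mono[OF path_dist_mono[OF that, of T0 T] C] by (simp add: T_def)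
    have gm: "g \<in> borel_measurable (path_borel d)"
      by (rule borel_measurable_borel_of, rule continuous_map_path_topology_lipschitz[OF lip])
    define h where "h p = g (flow (fst p) (snd p))" for p
    have hm: "h \<in> borel_measurable (vec_borel d \<Otimes>\<^sub>M path_borel d)"
      unfolding h_def[abs_def] by (rule measurable_compose[OF measurable_limit_path gm])
    have hB: "\<bar>h (z, w)\<bar> <= B" if "w \<in> cont_paths d" for z w
      unfolding h_def using that by (intro B) (simp add: limit_path_cont_paths)
    have hB': "\<bar>h p\<bar> <= B" if "p \<in> space (vec_borel d \<Otimes>\<^sub>M path_borel d)" for p
      using that hB by (auto simp: space_pair_measure topspace_path_topology)
    let ?z = "\<lambda>r q. scaled_init r (Z0 r q)"
    let ?l = "\<lambda>j r w. lincomb_path d (dir j) (\<gamma> j r) w"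
    let ?tr = "\<lambda>r f. join_path d (\<lambda>j. trunc_path T (block_start T r j) (f j))"
    let ?tB = "\<lambda>r w. ?tr r (\<lambda>j. ?l j r w)"
    let ?tW = "\<lambda>r w. ?tr r (\<lambda>j. coord_path j w)"
    have WW: "join_path d (\<lambda>j. coord_path j (W q)) = W q" if q: "q \<in> space M" for q
    proof (rule cont_paths_eqI)
      show "join_path d (\<lambda>j. coord_path j (W q)) \<in> cont_paths d"
        by (rule join_path_cont_paths, rule coord_path_cont_paths[OF W_cont_paths[OF q]])
    qed (auto simp: W_cont_paths[OF q] join_path_index coord_path_def)
    have tBm: "\<forall>\<^sub>F r in F. ?tB r \<in> path_borel d \<rightarrow>\<^sub>M path_borel d \<and> ?tW r \<in> path_borel d \<rightarrow>\<^sub>M path_borel d"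
      using block_start_le[OF T]
    proof eventually_elim
      case (elim r)
      have "trunc_path T (block_start T r j) \<in> path_borel 1 \<rightarrow>\<^sub>M path_borel 1" if "j < d" for j
        using elim that by (intro measurable_trunc_path block_start_nonneg T) simp
      then show ?case
        by (intro conjI measurable_join_path measurable_compose[OF measurable_lincomb_path] measurable_compose[OF measurable_coord_path]) auto
    qed
    note zm = measurable_compose[OF Z0_measurable measurable_scaled_init]
    have hcomp: "(\<lambda>q. h (?z r q, f (W q))) \<in> borel_measurable M"
      if "r \<in> {0<..<1}" "f \<in> path_borel d \<rightarrow>\<^sub>M path_borel d" for r f
      by (rule measurable_compose[OF measurable_Pair[OF zm[OF that(1)] measurable_compose[OF BM_measurable[OF W] that(2)]] hm])
    have f_cont: "f (W q) \<in> cont_paths d" if "f \<in> path_borel d \<rightarrow>\<^sub>M path_borel d" "q \<in> space M" for f q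
      using measurable_path_borel_cont_paths[OF measurable_compose[OF BM_measurable[OF W] that(1)] that(2)] .
    have t_cont: "\<forall>\<^sub>F r in F. \<forall>q\<in>space M. ?tB r (W q) \<in> cont_paths d \<and> ?tW r (W q) \<in> cont_paths d"
      using tBm
    proof eventually_elim
      case (elim r)
      then show ?case using f_cont[of "?tB r"] f_cont[of "?tW r"] by blast
    qed
    have t_meas: "\<forall>\<^sub>F r in F. (\<lambda>q. h (?z r q, ?tB r (W q))) \<in> borel_measurable M \<and> (\<lambda>q. h (?z r q, ?tW r (W q))) \<in> borel_measurable M"
      using tBm eventually_unit
    proof eventually_elim
      case (elim r)
      then show ?case using hcomp[of r "?tB r"] hcomp[of r "?tW r"] by blast
    qed
    have h_meas: "(\<lambda>q. h (?z r q, scaled_BM r (W q))) \<in> borel_measurable M" "(\<lambda>q. h (?z r q, W q)) \<in> borel_measurable M"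
      if "r \<in> {0<..<1}" for r
      using hcomp[OF that measurable_scaled_BM] hcomp[OF that, of "\<lambda>w. w"] by simp_all
    have ind: "indep_elements M (vec_borel d) (?z r) (path_borel d) (\<lambda>q. f (W q))"
      if "r \<in> {0<..<1}" "f \<in> path_borel d \<rightarrow>\<^sub>M path_borel d" for r f
      by (rule indep_elements_compose[OF prob_space_axioms Z0_indep[OF that(1)] measurable_scaled_init that(2)])
    define C2 where "C2 = C * limit_lip d \<sigma>"
    have C2: "0 <= C2" using C limit_lip_nonneg by (simp add: C2_def)
    have h_close: "whp M F (\<lambda>r q. \<bar>h (?z r q, f r q) - h (?z r q, f' r q)\<bar> <= \<eta>)"
      if close: "\<And>e. 0 < e ==> whp M F (\<lambda>r q. path_dist d T (f r q) (f' r q) <= e)"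
        and cont: "\<forall>\<^sub>F r in F. \<forall>q\<in>space M. f r q \<in> cont_paths d \<and> f' r q \<in> cont_paths d" and \<eta>: "0 < \<eta>" for f f' \<eta>
    proof -
      define e where "e = \<eta> / (C2 + 1)"
      have e: "0 < e" using \<eta> C2 by (simp add: e_def)
      have "C2 * e <= (C2 + 1) * e" using e by (intro mult_right_mono) auto
      then have C2e: "C2 * e <= \<eta>" using C2 by (simp add: e_def)
      show ?thesis
      proof (rule whp_mono[OF close[OF e]])
        show "\<forall>\<^sub>F r in F. \<forall>q\<in>space M. path_dist d T (f r q) (f' r q) <= e --> \<bar>h (?z r q, f r q) - h (?z r q, f' r q)\<bar> <= \<eta>"
          using cont
        proof eventually_elim
          case (elim r)
          show ?case
          proof (intro ballI impI)
            fix q assume q: "q \<in> space M" and le: "path_dist d T (f r q) (f' r q) <= e"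
            have P: "f r q \<in> cont_paths d" "f' r q \<in> cont_paths d" using elim q by auto
            have "path_dist d T (flow (?z r q) (f r q)) (flow (?z r q) (f' r q)) <= limit_lip d \<sigma> * e"
              by (rule limit_path_lipschitz[OF P T less_imp_le[OF e] _ le]) (use e in simp)
            then have "C * path_dist d T (flow (?z r q) (f r q)) (flow (?z r q) (f' r q)) <= C * (limit_lip d \<sigma> * e)"
              using C by (rule mult_left_mono)
            moreover have "\<bar>h (?z r q, f r q) - h (?z r q, f' r q)\<bar> <= C * path_dist d T (flow (?z r q) (f r q)) (flow (?z r q) (f' r q))"
              unfolding h_def fst_conv snd_conv by (intro lip limit_path_cont_paths P)
            ultimately show "\<bar>h (?z r q, f r q) - h (?z r q, f' r q)\<bar> <= \<eta>" using C2e by (simp add: C2_def mult.assoc)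
          qed
        qed
      qed
    qed
    have s1: "((\<lambda>r. (\<integral>q. g (rescale (\<lambda>j. \<gamma> j r) (Z r q)) \<partial>M) - (\<integral>q. h (?z r q, scaled_BM r (W q)) \<partial>M)) \<longlongrightarrow> 0) F"
    proof (rule whp_expectation_diff)
      fix \<eta> :: real assume \<eta>: "0 < \<eta>"
      define e where "e = \<eta> / (C + 1)"
      have e: "0 < e" using \<eta> C by (simp add: e_def)
      have "C * e <= (C + 1) * e" using e by (intro mult_right_mono) auto
      then have Ce: "C * e <= \<eta>" using C by (simp add: e_def)
      show "whp M F (\<lambda>r q. \<bar>g (rescale (\<lambda>j. \<gamma> j r) (Z r q)) - h (?z r q, scaled_BM r (W q))\<bar> <= \<eta>)"
      proof (rule whp_mono[OF close_to_limit_path[OF T e]], rule eventually_mono[OF eventually_unit], intro ballI impI)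
        fix r q assume r: "r \<in> {0<..<1::real}" and q: "q \<in> space M"
          and le: "path_dist d T (rescale (\<lambda>j. \<gamma> j r) (Z r q)) (flow (?z r q) (scaled_BM r (W q))) <= e"
        have "\<bar>g (rescale (\<lambda>j. \<gamma> j r) (Z r q)) - g (flow (?z r q) (scaled_BM r (W q)))\<bar>
            <= C * path_dist d T (rescale (\<lambda>j. \<gamma> j r) (Z r q)) (flow (?z r q) (scaled_BM r (W q)))"
          by (intro lip limit_path_cont_paths scaled_BM_cont_paths W_cont_paths q measurable_path_borel_cont_paths[OF Zm[OF r]])
        also have "... <= C * e" using le C by (rule mult_left_mono)
        finally show "\<bar>g (rescale (\<lambda>j. \<gamma> j r) (Z r q)) - h (?z r q, scaled_BM r (W q))\<bar> <= \<eta>"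
          using Ce by (simp add: h_def)
      qed
    next
      show "\<forall>\<^sub>F r in F. (\<lambda>q. g (rescale (\<lambda>j. \<gamma> j r) (Z r q))) \<in> borel_measurable M \<and> (\<lambda>q. h (?z r q, scaled_BM r (W q))) \<in> borel_measurable M"
        by (rule eventually_mono[OF eventually_unit]) (intro conjI measurable_compose[OF Zm gm] h_meas)
      show "\<forall>\<^sub>F r in F. \<forall>q\<in>space M. \<bar>g (rescale (\<lambda>j. \<gamma> j r) (Z r q))\<bar> <= B \<and> \<bar>h (?z r q, scaled_BM r (W q))\<bar> <= B"
        by (rule eventually_mono[OF eventually_unit])
          (intro ballI conjI B measurable_path_borel_cont_paths[OF Zm] hB scaled_BM_cont_paths W_cont_paths)
    qed
    have s2: "((\<lambda>r. (\<integral>q. h (?z r q, scaled_BM r (W q)) \<partial>M) - (\<integral>q. h (?z r q, ?tB r (W q)) \<partial>M)) \<longlongrightarrow> 0) F"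
    proof (rule whp_expectation_diff[OF h_close])
      show "whp M F (\<lambda>r q. path_dist d T (scaled_BM r (W q)) (?tB r (W q)) <= e)" if "0 < e" for e
        unfolding scaled_BM_def by (rule trunc_close[OF T dir_unit gamma_pos that])
      show "\<forall>\<^sub>F r in F. \<forall>q\<in>space M. scaled_BM r (W q) \<in> cont_paths d \<and> ?tB r (W q) \<in> cont_paths d"
        using t_cont by eventually_elim (simp add: scaled_BM_cont_paths W_cont_paths)
      show "\<forall>\<^sub>F r in F. (\<lambda>q. h (?z r q, scaled_BM r (W q))) \<in> borel_measurable M \<and> (\<lambda>q. h (?z r q, ?tB r (W q))) \<in> borel_measurable M"
        using t_meas eventually_unit by eventually_elim (simp only: h_meas simp_thms)
      show "\<forall>\<^sub>F r in F. \<forall>q\<in>space M. \<bar>h (?z r q, scaled_BM r (W q))\<bar> <= B \<and> \<bar>h (?z r q, ?tB r (W q))\<bar> <= B"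
        using t_cont by eventually_elim (simp add: hB scaled_BM_cont_paths W_cont_paths)
    qed
    \<comment> \<open>Truncated noise and truncated \<open>W\<close> have the same law and both are
      independent of the initial state, so these expectations are equal.\<close>
    have s3: "\<forall>\<^sub>F r in F. (\<integral>q. h (?z r q, ?tB r (W q)) \<partial>M) = (\<integral>q. h (?z r q, ?tW r (W q)) \<partial>M)"
    proof -
      have "\<forall>\<^sub>F r in F. \<forall>i\<in>{..<d}. \<forall>j\<in>{..<d}. i < j --> \<gamma> j r <= 1 * \<gamma> i r"
      proof (intro eventually_ball_finite ballI finite_lessThan)
        fix i j assume "j \<in> {..<d}"
        then show "\<forall>\<^sub>F r in F. i < j --> \<gamma> j r <= 1 * \<gamma> i r"
          using gamma_ratio[of i j 1] by (cases "i < j") auto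
      qed
      then show ?thesis using tBm eventually_unit
      proof eventually_elim
        case (elim r)
        have tB: "?tB r \<in> path_borel d \<rightarrow>\<^sub>M path_borel d" and tW: "?tW r \<in> path_borel d \<rightarrow>\<^sub>M path_borel d" using elim(2) by auto
        have "distr M (path_borel d) (\<lambda>q. ?tB r (W q)) = distr M (path_borel d) (\<lambda>q. ?tW r (W q))"
          by (rule trunc_lincomb_law[OF prob_space_axioms W d T dir_unit gamma_pos[OF _ elim(3)]])
            (use elim(1) in "auto simp: block_start_def")
        then show ?case
          using indep_elements_integral[OF prob_space_axioms ind[OF elim(3) tB] hm hB']
            indep_elements_integral[OF prob_space_axioms ind[OF elim(3) tW] hm hB'] by simp
      qed
    qed
    \<comment> \<open>Undoes the truncation, now for \<open>W\<close> on the fixed clock, whose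
      coordinates are independent from the outset.\<close>
    have s4: "((\<lambda>r. (\<integral>q. h (?z r q, W q) \<partial>M) - (\<integral>q. h (?z r q, ?tW r (W q)) \<partial>M)) \<longlongrightarrow> 0) F"
    proof (rule whp_expectation_diff[OF h_close])
      show "whp M F (\<lambda>r q. path_dist d T (W q) (?tW r (W q)) <= e)" if "0 < e" for e
      proof (rule whp_mono[OF trunc_close[where a = unit_dir and c = "\<lambda>_ _. 1", OF T unit_dir_unit _ that]])
        have "join_path d (\<lambda>j. lincomb_path d (unit_dir j) 1 (W q)) = W q" if "q \<in> space M" for q
          using WW[OF that] by (simp add: lincomb_unit_dir_1 cong: join_path_cong)
        moreover have "join_path d (\<lambda>j. trunc_path T (block_start T r j) (lincomb_path d (unit_dir j) 1 (W q))) = ?tW r (W q)" for r q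
          by (rule join_path_cong) (simp add: lincomb_unit_dir_1)
        ultimately show "\<forall>\<^sub>F r in F. \<forall>q\<in>space M. path_dist d T (join_path d (\<lambda>j. lincomb_path d (unit_dir j) 1 (W q)))
            (join_path d (\<lambda>j. trunc_path T (block_start T r j) (lincomb_path d (unit_dir j) 1 (W q)))) <= e --> path_dist d T (W q) (?tW r (W q)) <= e"
          by (intro always_eventually allI ballI) simp
      qed auto
      show "\<forall>\<^sub>F r in F. \<forall>q\<in>space M. W q \<in> cont_paths d \<and> ?tW r (W q) \<in> cont_paths d"
        using t_cont by eventually_elim (simp add: W_cont_paths)
      show "\<forall>\<^sub>F r in F. (\<lambda>q. h (?z r q, W q)) \<in> borel_measurable M \<and> (\<lambda>q. h (?z r q, ?tW r (W q))) \<in> borel_measurable M"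
        using t_meas eventually_unit by eventually_elim (simp only: h_meas simp_thms)
      show "\<forall>\<^sub>F r in F. \<forall>q\<in>space M. \<bar>h (?z r q, W q)\<bar> <= B \<and> \<bar>h (?z r q, ?tW r (W q))\<bar> <= B"
        using t_cont by eventually_elim (simp add: hB W_cont_paths)
    qed
    have avg_h: "(\<integral>y. h (z, y) \<partial>LP.law) = LP.avg g z" for z by (simp add: LP.avg_def h_def)
    \<comment> \<open>Integrating \<open>W\<close> out leaves a function of the initial state alone;
      uniqueness of the Brownian law allows \<open>V\<close> to replace \<open>W\<close>.\<close>
    have s5: "\<forall>\<^sub>F r in F. (\<integral>q. h (?z r q, W q) \<partial>M) = (\<integral>q. LP.avg g (?z r q) \<partial>M)"
      using eventually_unit
    proof eventually_elim
      case (elim r)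
      have "(\<integral>q. h (?z r q, W q) \<partial>M) = (\<integral>q. (\<integral>y. h (?z r q, y) \<partial>distr M (path_borel d) W) \<partial>M)"
        by (rule indep_elements_integral[OF prob_space_axioms ind[OF elim, of "\<lambda>w. w"] hm hB']) simp_all
      then show ?case
        unfolding BM_law_unique[OF prob_space_axioms W LP.N LP.V] LP.law_def[symmetric] avg_h .
    qed
    have ac: "continuous_map (vec_topology d) euclideanreal (LP.avg g)"
      by (rule continuous_map_vec_lipschitz) (rule LP.avg_lipschitz[OF lip C T B])
    have aB: "\<bar>LP.avg g z\<bar> <= B" if "z \<in> carrier_vec d" for z by (rule LP.avg_bound(1)[OF gm B that])
    have xm: "\<xi> \<in> N \<rightarrow>\<^sub>M vec_borel d" using init_conv by (simp add: converges_weakly_def)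
    \<comment> \<open>\<open>LP.avg g\<close> is bounded and, by the Feller bound, continuous, hence
      an admissible test for the assumed convergence of the initial states.\<close>
    have s6: "((\<lambda>r. \<integral>q. LP.avg g (?z r q) \<partial>M) \<longlongrightarrow> (\<integral>q. LP.avg g (\<xi> q) \<partial>N)) F"
      using init_conv ac aB unfolding converges_weakly_def scaled_init_def topspace_vec_topology by blast
    have "(\<integral>q. LP.avg g (\<xi> q) \<partial>N) = (\<integral>z. LP.avg g z \<partial>distr N' (vec_borel d) \<xi>')"
      unfolding law by (rule integral_distr[symmetric, OF xm LP.avg_measurable[OF gm]])
    also have "... = (\<integral>q. LP.avg g (\<xi>' q) \<partial>N')" by (rule integral_distr[OF LP.xi_measurable LP.avg_measurable[OF gm]])
    also have "... = (\<integral>q. h (\<xi>' q, V q) \<partial>N')"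
      using indep_elements_integral[OF LP.N LP.ind hm hB'] by (simp add: avg_h flip: LP.law_def)
    finally have lim: "(\<integral>q. LP.avg g (\<xi> q) \<partial>N) = (\<integral>q. g (flow (\<xi>' q) (V q)) \<partial>N')" by (simp add: h_def)
    have s56: "((\<lambda>r. \<integral>q. h (?z r q, W q) \<partial>M) \<longlongrightarrow> (\<integral>q. g (flow (\<xi>' q) (V q)) \<partial>N')) F"
      using s6 unfolding lim by (rule tendsto_cong[THEN iffD2, OF s5])
    have s3': "((\<lambda>r. (\<integral>q. h (?z r q, ?tB r (W q)) \<partial>M) - (\<integral>q. h (?z r q, ?tW r (W q)) \<partial>M)) \<longlongrightarrow> 0) F"
      by (rule tendsto_eventually) (use s3 in eventually_elim, simp)
    show "((\<lambda>r. \<integral>q. g (rescale (\<lambda>j. \<gamma> j r) (Z r q)) \<partial>M) \<longlongrightarrow> (\<integral>q. g (flow (\<xi>' q) (V q)) \<partial>N')) F"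
      using tendsto_add[OF tendsto_diff[OF tendsto_add[OF tendsto_add[OF s1 s2] s3'] s4] s56] by simp
  qed
qed

end

section \<open>Construction of the limit and identification of its coefficients\<close>

lemma converges_weakly_cong:
  assumes conv: "converges_weakly T M X N Y F" and eq: "\<forall>\<^sub>F i in F. \<forall>w\<in>space M. X' i w = X i w"
  shows "converges_weakly T M X' N Y F"
proof -
  have "\<forall>\<^sub>F i in F. X i \<in> M \<rightarrow>\<^sub>M borel_of T" using conv by (simp add: converges_weakly_def)
  then have "\<forall>\<^sub>F i in F. X' i \<in> M \<rightarrow>\<^sub>M borel_of T"
    using eq by eventually_elim (simp cong: measurable_cong)
  moreover have "((\<lambda>i. \<integral>w. f (X' i w) \<partial>M) \<longlongrightarrow> (\<integral>w. f (Y w) \<partial>N)) F"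
    if "continuous_map T euclideanreal f \<and> (\<exists>B. \<forall>x\<in>topspace T. \<bar>f x\<bar> <= B)" for f
  proof -
    have "((\<lambda>i. \<integral>w. f (X i w) \<partial>M) \<longlongrightarrow> (\<integral>w. f (Y w) \<partial>N)) F"
      using conv that unfolding converges_weakly_def by blast
    moreover have "\<forall>\<^sub>F i in F. (\<integral>w. f (X' i w) \<partial>M) = (\<integral>w. f (X i w) \<partial>M)"
      using eq by eventually_elim (auto intro!: Bochner_Integration.integral_cong)
    ultimately show ?thesis by (rule tendsto_cong[THEN iffD2, rotated])
  qed
  ultimately show ?thesis using conv by (simp add: converges_weakly_def)
qed

lemma indep_elements_pair:
  assumes A: "prob_space A" and B: "prob_space B"
  shows "indep_elements (A \<Otimes>\<^sub>M B) A fst B snd"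
proof -
  interpret A: prob_space A by fact
  interpret B: prob_space B by fact
  interpret AB: pair_prob_space A B ..
  note P = AB.prob_space_axioms
  have rect: "measure (A \<Otimes>\<^sub>M B) (S \<times> T) = measure A S * measure B T" if "S \<in> sets A" "T \<in> sets B" for S T
    by (simp add: measure_def B.emeasure_pair_measure_Times[OF that] enn2real_mult)
  have pre: "fst -` S \<inter> space (A \<Otimes>\<^sub>M B) = S \<times> space B" "snd -` T \<inter> space (A \<Otimes>\<^sub>M B) = space A \<times> T"
    if "S \<in> sets A" "T \<in> sets B" for S T
    using sets.sets_into_space[OF that(1)] sets.sets_into_space[OF that(2)] by (auto simp: space_pair_measure)
  show ?thesis
    unfolding indep_elements_iff_prob[OF P measurable_fst measurable_snd]
  proof (intro ballI)
    fix S T assume ST: "S \<in> sets A" "T \<in> sets B"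
    have "S \<times> space B \<inter> space A \<times> T = S \<times> T" using sets.sets_into_space[OF ST(1)] sets.sets_into_space[OF ST(2)] by auto
    then show "measure (A \<Otimes>\<^sub>M B) ((fst -` S \<inter> space (A \<Otimes>\<^sub>M B)) \<inter> (snd -` T \<inter> space (A \<Otimes>\<^sub>M B))) =
      measure (A \<Otimes>\<^sub>M B) (fst -` S \<inter> space (A \<Otimes>\<^sub>M B)) * measure (A \<Otimes>\<^sub>M B) (snd -` T \<inter> space (A \<Otimes>\<^sub>M B))"
      using ST by (simp add: pre[OF ST] rect A.prob_space B.prob_space)
  qed
qed

lemma measurable_center: "center d \<in> path_borel d \<rightarrow>\<^sub>M path_borel d"
proof (rule measurable_path_borelI)
  show "center d x \<in> cont_paths d" if "x \<in> space (path_borel d)" for x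
    using that by (intro center_cont_paths) (simp add: topspace_path_topology)
  fix t i assume t: "0 <= (t::real)" and i: "i < d"
  have "(\<lambda>x. x t $ i - x 0 $ i) \<in> borel_measurable (path_borel d)"
    using t i by (intro borel_measurable_diff measurable_path_eval) auto
  then show "(\<lambda>x. center d x t $ i) \<in> borel_measurable (path_borel d)" using t i by (simp add: center_def)
qed

text \<open>The product of the two laws charges paths not starting at 0 and vectors with negative
  components; \<open>center\<close> and the positive part correct the coordinate maps on these null sets.\<close>

lemma independent_copy:
  assumes N: "prob_space N" and xi: "\<xi> \<in> N \<rightarrow>\<^sub>M vec_borel d" and xi_nonneg: "\<And>w j. w \<in> space N ==> j < d ==> 0 <= \<xi> w $ j"
    and M: "prob_space M" and W: "standard_BM M d W"
  obtains N' :: "(real vec \<times> (real => real vec)) measure" and \<xi>' V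
  where "limit_process N' d \<xi>' V" and "distr N' (vec_borel d) \<xi>' = distr N (vec_borel d) \<xi>"
    and "\<And>w j. w \<in> space N' ==> j < d ==> 0 <= \<xi>' w $ j"
proof -
  note Wm = BM_measurable[OF W]
  define A where "A = distr N (vec_borel d) \<xi>"
  define B where "B = distr M (path_borel d) W"
  interpret A: prob_space A unfolding A_def by (rule prob_space.prob_space_distr[OF N xi])
  interpret B: prob_space B unfolding B_def by (rule prob_space.prob_space_distr[OF M Wm])
  interpret AB: pair_prob_space A B ..
  define pp :: "real vec => real vec" where "pp v = Matrix.vec d (\<lambda>j. max 0 (v $ j))" for v
  have ppm: "pp \<in> vec_borel d \<rightarrow>\<^sub>M vec_borel d"
    by (rule measurable_vec_borelI) (auto simp: pp_def intro!: borel_measurable_max measurable_vec_component)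
  have ppA: "pp \<in> A \<rightarrow>\<^sub>M vec_borel d" using ppm by (simp add: A_def)
  have cB: "center d \<in> B \<rightarrow>\<^sub>M path_borel d" using measurable_center by (simp add: B_def)
  let ?x = "\<lambda>p. pp (fst p)" and ?V = "\<lambda>p. center d (snd p)"
  have ind: "indep_elements (A \<Otimes>\<^sub>M B) (vec_borel d) ?x (path_borel d) ?V"
    by (rule indep_elements_compose[OF AB.prob_space_axioms indep_elements_pair[OF A.prob_space_axioms B.prob_space_axioms] ppA cB])
  have fst_law: "distr (A \<Otimes>\<^sub>M B) A fst = A" by (rule B.distr_pair_fst)
  have snd_law: "distr (A \<Otimes>\<^sub>M B) B snd = B"
  proof (rule measure_eqI)
    fix S assume "S \<in> sets (distr (A \<Otimes>\<^sub>M B) B snd)"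
    then have S: "S \<in> sets B" by simp
    have "snd -` S \<inter> space (A \<Otimes>\<^sub>M B) = space A \<times> S" using sets.sets_into_space[OF S] by (auto simp: space_pair_measure)
    then show "emeasure (distr (A \<Otimes>\<^sub>M B) B snd) S = emeasure B S"
      using S by (simp add: emeasure_distr B.emeasure_pair_measure_Times A.emeasure_space_1)
  qed simp
  have x_law: "distr (A \<Otimes>\<^sub>M B) (vec_borel d) ?x = distr N (vec_borel d) \<xi>"
  proof -
    have "distr (A \<Otimes>\<^sub>M B) (vec_borel d) ?x = distr (distr (A \<Otimes>\<^sub>M B) A fst) (vec_borel d) pp"
      by (simp add: distr_distr[OF ppA measurable_fst] comp_def)
    also have "... = distr N (vec_borel d) (\<lambda>w. pp (\<xi> w))"
      unfolding fst_law unfolding A_def by (simp add: distr_distr[OF ppm xi] comp_def)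
    also have "... = distr N (vec_borel d) \<xi>"
    proof (rule distr_cong[OF refl refl])
      fix w assume w: "w \<in> space N"
      have "\<xi> w \<in> carrier_vec d" using measurable_space[OF xi w] by (simp add: topspace_vec_topology)
      then show "pp (\<xi> w) = \<xi> w" using xi_nonneg[OF w] by (intro eq_vecI) (auto simp: pp_def)
    qed
    finally show ?thesis .
  qed
  have V_law: "distr M (path_borel d) W = distr (A \<Otimes>\<^sub>M B) (path_borel d) ?V"
  proof -
    have "distr (A \<Otimes>\<^sub>M B) (path_borel d) ?V = distr (distr (A \<Otimes>\<^sub>M B) B snd) (path_borel d) (center d)"
      by (simp add: distr_distr[OF cB measurable_snd] comp_def)
    also have "... = distr M (path_borel d) (\<lambda>w. center d (W w))"
      unfolding snd_law unfolding B_def by (simp add: distr_distr[OF measurable_center Wm] comp_def)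
    also have "... = distr M (path_borel d) W"
      by (rule distr_cong[OF refl refl]) (simp add: center_eq[OF BM_cont_paths[OF W] BM_0[OF W]])
    finally show ?thesis ..
  qed
  have "standard_BM (A \<Otimes>\<^sub>M B) d ?V"
    by (rule standard_BM_transfer[OF M AB.prob_space_axioms W indep_elements_measurable(2)[OF ind] V_law])
      (auto simp: center_def intro!: eq_vecI)
  then have "limit_process (A \<Otimes>\<^sub>M B) d ?x ?V" using ind AB.prob_space_axioms by (intro limit_process.intro)
  then show ?thesis by (rule that[OF _ x_law]) (simp add: pp_def)
qed

context srbm_family
begin

lemma u_vec_index: "j < d ==> i < d ==> u_vec d R j $ i = (if i < j then elim j j i else if i = j then 1 else 0)"
  by (simp add: u_vec_def w_coeff_elim)

text \<open>With \<open>y = L' u\<close> the quadratic form is the squared length of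
  \<open>y\<close>, and \<open>y\<close> is the row \<open>noise j j\<close> because the entries of
  \<open>u\<close> are the elimination weights of row \<open>j\<close>.\<close>

lemma variance_eq:
  assumes L: "L \<in> carrier_mat d d" and G: "\<Gamma> = L * transpose_mat L" and j: "j < d"
  shows "scalar_prod (u_vec d R j) (\<Gamma> *\<^sub>v u_vec d R j) = (\<sigma> j)\<^sup>2"
proof -
  let ?u = "u_vec d R j"
  have u: "?u \<in> carrier_vec d" by (simp add: u_vec_def)
  have LT: "transpose_mat L \<in> carrier_mat d d" using L by simp
  let ?y = "transpose_mat L *\<^sub>v ?u"
  have y: "?y \<in> carrier_vec d" using LT u by simp
  have yk: "?y $ k = noise j j k" if k: "k < d" for k
  proof -
    have "?y $ k = (\<Sum>i<d. L $$ (i, k) * ?u $ i)"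
      using mult_mat_vec_index[OF LT u k] k L by simp
    also have "... = (\<Sum>i\<in>{..j}. L $$ (i, k) * ?u $ i)"
      using j by (intro sum.mono_neutral_right) (auto simp: u_vec_index[OF j])
    also have "{..j} = insert j {..<j}" by auto
    also have "(\<Sum>i\<in>insert j {..<j}. L $$ (i, k) * ?u $ i) = L $$ (j, k) + (\<Sum>i<j. elim j j i * L $$ (i, k))"
      using j by (simp add: u_vec_index[OF j] mult.commute)
    finally show ?thesis by (simp add: noise_def reduced_def)
  qed
  have "\<Gamma> *\<^sub>v ?u = L *\<^sub>v ?y" unfolding G using L LT u by (rule assoc_mult_mat_vec)
  then have "scalar_prod ?u (\<Gamma> *\<^sub>v ?u) = scalar_prod ?y ?y"
    using transpose_vec_mult_scalar[OF L y u] by simp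
  also have "... = (\<Sum>k<d. (noise j j k)\<^sup>2)"
    unfolding scalar_prod_def carrier_vecD[OF y] atLeast0LessThan by (intro sum.cong refl) (simp only: yk lessThan_iff power2_eq_square)
  finally show ?thesis by (simp add: \<sigma>_def sum_nonneg)
qed

end

text \<open>The space of \<open>\<xi>\<close> need not carry a Brownian motion independent of
  \<open>\<xi>\<close>, so the limit lives on the product of the law of \<open>\<xi>\<close> and
  Wiener measure, with an initial state \<open>\<xi>'\<close> that has the law of
  \<open>\<xi>\<close>.\<close>

theorem theorem2:
  fixes J :: nat
    and \<gamma> :: "nat \<Rightarrow> real \<Rightarrow> real"
    and \<epsilon> :: real
    and \<Gamma> L R :: "real mat"
    and \<theta> \<delta> :: "real \<Rightarrow> real vec"
    and M :: "'w measure"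
    and W :: "'w \<Rightarrow> real \<Rightarrow> real vec"
    and Z0 :: "real \<Rightarrow> 'w \<Rightarrow> real vec"
    and X Y Z :: "real \<Rightarrow> 'w \<Rightarrow> real \<Rightarrow> real vec"
    and N :: "'v measure"
    and \<xi> :: "'v \<Rightarrow> real vec"
  assumes J: "1 \<le> J"
    \<comment> \<open>scale functions\<close>
    and gamma_pos: "\<And>j r. j < J \<Longrightarrow> r \<in> {0<..<1} \<Longrightarrow> 0 < \<gamma> j r"
    and gamma_mono: "\<And>j. j < J \<Longrightarrow> strict_mono_on {0<..<1} (\<gamma> j)"
    and gamma_lim: "\<And>j. j < J \<Longrightarrow> (\<gamma> j \<longlongrightarrow> 0) (at_right 0)"
    and gamma_sep: "\<And>i j. i < j \<Longrightarrow> j < J \<Longrightarrow> ((\<lambda>r. \<gamma> j r / \<gamma> i r) \<longlongrightarrow> 0) (at_right 0)"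
    and eps: "0 < \<epsilon>" "\<epsilon> < 1"
    and gamma_log: "((\<lambda>r. \<gamma> 0 r powr ((2 - \<epsilon>) / (2 + \<epsilon>)) * sqrt (ln (ln (1 / \<gamma> 0 r)))
                            * ln (ln (1 / \<gamma> (J - 1) r))) \<longlongrightarrow> 0) (at_right 0)"
    \<comment> \<open>the SRBM family\<close>
    and Gamma: "positive_definite J \<Gamma>" "cholesky J \<Gamma> L"
    and R: "M_matrix J R"
    and M: "prob_space M"
    and W: "standard_BM M J W"
    and theta_dim: "\<And>r. r \<in> {0<..<1} \<Longrightarrow> \<theta> r \<in> carrier_vec J"
    and Z0_nonneg: "\<And>r \<omega> j. r \<in> {0<..<1} \<Longrightarrow> \<omega> \<in> space M \<Longrightarrow> j < J \<Longrightarrow> 0 \<le> Z0 r \<omega> $ j"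
    and Z0_indep: "\<And>r. r \<in> {0<..<1} \<Longrightarrow> indep_elements M (vec_borel J) (Z0 r) (path_borel J) W"
    and X: "\<And>r \<omega>. r \<in> {0<..<1} \<Longrightarrow> \<omega> \<in> space M \<Longrightarrow>
              X r \<omega> = (\<lambda>t\<in>{0..}. Z0 r \<omega> + t \<cdot>\<^sub>v \<theta> r + L *\<^sub>v W \<omega> t)"
    and Y: "\<And>r \<omega>. r \<in> {0<..<1} \<Longrightarrow> \<omega> \<in> space M \<Longrightarrow> Y r \<omega> = regulator J R (X r \<omega>)"
    and Z: "\<And>r \<omega>. r \<in> {0<..<1} \<Longrightarrow> \<omega> \<in> space M \<Longrightarrow> Z r \<omega> = reflected J R (X r \<omega>)"
    \<comment> \<open>assumption (i)\<close>
    and delta: "\<And>r. r \<in> {0<..<1} \<Longrightarrow> \<delta> r = Matrix.vec J (\<lambda>j. \<gamma> j r)"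
    and theta: "\<And>r. r \<in> {0<..<1} \<Longrightarrow> \<theta> r = - (R *\<^sub>v \<delta> r)"
    \<comment> \<open>assumption (ii)\<close>
    and N: "prob_space N"
    and xi: "\<xi> \<in> N \<rightarrow>\<^sub>M vec_borel J"
    and xi_nonneg: "\<And>\<omega> j. \<omega> \<in> space N \<Longrightarrow> j < J \<Longrightarrow> 0 \<le> \<xi> \<omega> $ j"
    and xi_indep: "prob_space.indep_vars N (\<lambda>_. borel) (\<lambda>j \<omega>. \<xi> \<omega> $ j) {..<J}"
    and init_conv: "converges_weakly (vec_topology J)
                      M (\<lambda>r \<omega>. Matrix.vec J (\<lambda>j. \<gamma> j r * Z0 r \<omega> $ j)) N \<xi> (at_right 0)"
    and init_large: "\<And>j C. 1 \<le> j \<Longrightarrow> j < J \<Longrightarrow>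
              ((\<lambda>r. measure M {\<omega> \<in> space M. C < \<gamma> (j - 1) r * Z0 r \<omega> $ j}) \<longlongrightarrow> 1) (at_right 0)"
  shows "(\<exists>(N' :: (real vec \<times> (real \<Rightarrow> real vec)) measure) \<xi>' Z'.
            prob_space N' \<and>
            \<xi>' \<in> N' \<rightarrow>\<^sub>M vec_borel J \<and> distr N' (vec_borel J) \<xi>' = distr N (vec_borel J) \<xi> \<and>
            diffusion N' J Z' \<and>
            converges_weakly (path_topology J)
              M (\<lambda>r \<omega>. \<lambda>t\<in>{0..}. Matrix.vec J (\<lambda>j. \<gamma> j r * Z r \<omega> (t / (\<gamma> j r)\<^sup>2) $ j))
              N' Z' (at_right 0) \<and>
            prob_space.indep_vars N' (\<lambda>_. path_borel 1) (\<lambda>j \<omega>. coord_path j (Z' \<omega>)) {..<J} \<and>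
            (\<forall>j<J. - (1 - w_coeff R j j) < 0 \<and>
                   SRBM_1d N' (\<lambda>\<omega>. \<xi>' \<omega> $ j)
                     (- (1 - w_coeff R j j))
                     (scalar_prod (u_vec J R j) (\<Gamma> *\<^sub>v u_vec J R j))
                     (\<lambda>\<omega>. coord_path j (Z' \<omega>))))
         \<and> (\<forall>P. substochastic J P \<and> invertible_mat (1\<^sub>m J - P) \<and> R = 1\<^sub>m J - transpose_mat P \<longrightarrow>
                (\<forall>j<J. \<forall>i\<le>j. w_coeff R i j = w_coeff_routing P i j))"
proof -
  have Lc: "L \<in> carrier_mat J J" and GL: "\<Gamma> = L * transpose_mat L" and L_diag: "\<And>j. j < J ==> 0 < L $$ (j, j)"
    using Gamma(2) by (auto simp: cholesky_def)
  have L_tri: "L $$ (i, k) = 0" if "i < k" "k < J" for i k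
  proof -
    have "transpose_mat L $$ (k, i) = 0"
      using Gamma(2) that Lc by (intro upper_triangularD) (auto simp: cholesky_def)
    then show ?thesis using that Lc by simp
  qed
  have "0 < J" using J by simp
  from M_matrix_reflection[OF this R] obtain v where v: "reflection J R v" by blast
  interpret S: srbm_family J R v M L \<gamma> W Z0 N \<xi>
    using v M \<open>0 < J\<close> W N gamma_pos gamma_sep L_tri L_diag Z0_nonneg Z0_indep init_conv init_large
    by (intro srbm_family.intro srbm_family_axioms.intro)
  \<comment> \<open>Writing the drift \<open>- R \<delta>\<close> and the noise entrywise identifies
    the given family with the one fixed in the locale, on \<open>space M\<close> and for
    \<open>r\<close> in the unit interval.\<close>
  have ZS: "Z r \<omega> = S.Z r \<omega>" if r: "r \<in> {0<..<1}" and \<omega>: "\<omega> \<in> space M" for r \<omega>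
  proof -
    have z: "Z0 r \<omega> \<in> carrier_vec J"
      using measurable_space[OF S.Z0_measurable[OF r] \<omega>] by (simp add: topspace_vec_topology)
    have \<delta>: "\<delta> r \<in> carrier_vec J" by (simp add: delta[OF r])
    have "Z0 r \<omega> + t \<cdot>\<^sub>v \<theta> r + L *\<^sub>v W \<omega> t =
        Matrix.vec J (\<lambda>i. Z0 r \<omega> $ i - t * (\<Sum>k<J. R $$ (i, k) * \<gamma> k r) + (\<Sum>k<J. L $$ (i, k) * W \<omega> t $ k))" if t: "t \<in> {0..}" for t
    proof (rule eq_vecI)
      have w: "W \<omega> t \<in> carrier_vec J" using cont_paths_carrier[OF S.W_cont_paths[OF \<omega>]] t by simp
      fix i assume "i < dim_vec (Matrix.vec J (\<lambda>i. Z0 r \<omega> $ i - t * (\<Sum>k<J. R $$ (i, k) * \<gamma> k r) + (\<Sum>k<J. L $$ (i, k) * W \<omega> t $ k)))"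
      then have i: "i < J" by simp
      have "\<theta> r $ i = - (\<Sum>k<J. R $$ (i, k) * \<gamma> k r)"
        using i mult_mat_vec_index[OF S.R_carrier \<delta> i] S.R_carrier by (simp add: theta[OF r] delta[OF r])
      moreover have "(L *\<^sub>v W \<omega> t) $ i = (\<Sum>k<J. L $$ (i, k) * W \<omega> t $ k)" by (rule mult_mat_vec_index[OF Lc w i])
      ultimately show "(Z0 r \<omega> + t \<cdot>\<^sub>v \<theta> r + L *\<^sub>v W \<omega> t) $ i = Matrix.vec J (\<lambda>i. Z0 r \<omega> $ i - t * (\<Sum>k<J. R $$ (i, k) * \<gamma> k r) + (\<Sum>k<J. L $$ (i, k) * W \<omega> t $ k)) $ i"
        using i z w theta_dim[OF r] Lc by simp
    qed (use Lc in simp)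
    then have XS: "X r \<omega> = S.X r \<omega>" unfolding X[OF r \<omega>] S.X_def by (rule restrict_ext)
    show ?thesis
      unfolding Z[OF r \<omega>] XS S.Z_def
      by (rule S.reflected_eq[OF S.X_cont_paths[OF \<omega>]]) (simp add: S.X_0[OF \<omega>] Z0_nonneg[OF r \<omega>])
  qed
  obtain N' :: "(real vec \<times> (real => real vec)) measure" and \<xi>' V
    where LP: "limit_process N' J \<xi>' V" and law: "distr N' (vec_borel J) \<xi>' = distr N (vec_borel J) \<xi>"
      and xi0: "\<And>\<omega> j. \<omega> \<in> space N' ==> j < J ==> 0 <= \<xi>' \<omega> $ j"
    using independent_copy[OF N xi xi_nonneg M W] by metis
  interpret LP: limit_process N' J \<xi>' V S.\<theta> S.\<sigma> by (rule LP)
  have conv: "converges_weakly (path_topology J)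
      M (\<lambda>r \<omega>. \<lambda>t\<in>{0..}. Matrix.vec J (\<lambda>j. \<gamma> j r * Z r \<omega> (t / (\<gamma> j r)\<^sup>2) $ j)) N' LP.Z (at_right 0)"
    unfolding LP.Z_def[abs_def]
  proof (rule converges_weakly_cong[OF S.weak_convergence[OF LP law]])
    show "\<forall>\<^sub>F r in at_right 0. \<forall>\<omega>\<in>space M. (\<lambda>t\<in>{0..}. Matrix.vec J (\<lambda>j. \<gamma> j r * Z r \<omega> (t / (\<gamma> j r)\<^sup>2) $ j)) =
        S.rescale (\<lambda>j. \<gamma> j r) (S.Z r \<omega>)"
      using S.eventually_unit by eventually_elim (simp add: ZS S.rescale_def)
  qed
  have xi'_indep: "prob_space.indep_vars N' (\<lambda>_. borel) (\<lambda>j \<omega>. \<xi>' \<omega> $ j) {..<J}"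
    by (rule indep_vars_transfer[OF N LP.N xi LP.xi_measurable law[symmetric] measurable_vec_component xi_indep]) simp
  have SRBM: "SRBM_1d N' (\<lambda>\<omega>. \<xi>' \<omega> $ j) (- (1 - w_coeff R j j))
      (scalar_prod (u_vec J R j) (\<Gamma> *\<^sub>v u_vec J R j)) (\<lambda>\<omega>. coord_path j (LP.Z \<omega>))" if j: "j < J" for j
  proof -
    have "- (1 - w_coeff R j j) = S.\<theta> j" unfolding S.\<theta>_def S.w_coeff_diag[OF j] ..
    then show ?thesis
      using SRBM_1d_limit_path[where \<sigma> = S.\<sigma> and \<theta> = S.\<theta>, OF LP.N LP.V LP.ind xi0[OF _ j] j S.sigma_pos[OF j]]
      by (simp only: S.variance_eq[OF Lc GL j] LP.Z_def)
  qed
  have "- (1 - w_coeff R j j) < 0" if "j < J" for j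
    using S.schur_diag_pos[OF that] S.w_coeff_diag[OF that] by simp
  moreover have "prob_space.indep_vars N' (\<lambda>_. path_borel 1) (\<lambda>j \<omega>. coord_path j (LP.Z \<omega>)) {..<J}"
    unfolding LP.Z_def by (rule indep_coord_limit_path[OF LP.N LP.V LP.ind xi'_indep])
  moreover have "w_coeff R i j = w_coeff_routing P i j"
    if "substochastic J P" "R = 1\<^sub>m J - transpose_mat P" "j < J" "i <= j" for P i j
    using that by (intro S.w_coeff_routing_eq) (auto simp: substochastic_def)
  ultimately show ?thesis
    using LP.N LP.xi_measurable law LP.diffusion_Z conv SRBM
    by (intro conjI exI[of _ N'] exI[of _ \<xi>'] exI[of _ LP.Z]) blast+
qed

end
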